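(* Let $\mathscr{F}$ be a simple foliation on a smooth manifold $M$, with leaf space $N:=M/\mathscr{F}$ and quotient map $p:M\to N$, and let $L$ be a Dirac structure on $M$. The following conditions are equivalent: (i) $L$ and $\mathrm{Gr}(\mathscr{F})$ concur; (ii) there exists a Dirac structure $R$ on $N$ for which $p:(M,L)\to(N,R)$ is forward Dirac, i.e. $p_!(L)=R$. In that case, $L\circledast\mathrm{Gr}(\mathscr{F})=p^!(R)$.
   Context: Let $\mathbb{T}M=TM\oplus T^*M$ with the pairing $\langle u+\xi,v+\eta\rangle=\xi(v)+\eta(u)$, the Dorfman bracket $[u+\xi,v+\eta]=[u,v]+\mathscr{L}_u\eta-\iota_v\mathrm{d}\xi$, and projections $\mathrm{pr}_T,\mathrm{pr}_{T^*}$. A Dirac structure is a vector subbundle $L\subset\mathbb{T}M$ with $L=L^\perp$ and $[\Gamma(L),\Gamma(L)]\subset\Gamma(L)$. A foliation $\mathscr{F}$ is simple if its leaf space $M/\mathscr{F}$ with the quotient topology has the structure of a smooth manifold for which the quotient map $p:M\to M/\mathscr{F}$ is a (surjective) submersion; the fibres of $p$ are the leaves, hence connected. $\mathrm{Gr}(\mathscr{F})=T\mathscr{F}\oplus(T\mathscr{F})^\circ$. The cotangent product is $L\circledast R=\{a+\mathrm{pr}_T(b)\mid(a,b)\in L\times R\text{ in the same fibre},\ \mathrm{pr}_{T^*}(a)=\mathrm{pr}_{T^*}(b)\}$; Dirac structures concur if their cotangent product is a Dirac structure. For smooth $p:M\to N$: $p_!(L_x)=\{p_*u+\eta\mid \eta\in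 T^*_{p(x)}N,\ u+p^*\eta\in L_x\}\subset\mathbb{T}_{p(x)}N$, and $p_!(L)=R$ means $p_!(L_x)=R_{p(x)}$ for all $x\in M$; $p^!(R)_x=\{u+p^*\eta\mid u\in T_xM,\ \eta\in T^*_{p(x)}N,\ p_*u+\eta\in R_{p(x)}\}$. *)

theory Defs
  imports "HOL-Analysis.Analysis" "HOL-Library.Function_Algebras"
begin

instantiation "fun" :: (type, real_vector) real_vector
begin

definition scaleR_fun :: "real \<Rightarrow> ('a \<Rightarrow> 'b) \<Rightarrow> 'a \<Rightarrow> 'b" where
  "scaleR_fun c f = (\<lambda>x. c *\<^sub>R f x)"

instance
  by standard (auto simp: scaleR_fun_def plus_fun_def fun_eq_iff algebra_simps)

end

text \<open>
  A manifold is modelled on a linear subspace of a Euclidean space type. Since the types of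
  class \<open>euclidean_space\<close> have positive dimension, working with subspaces
  allows every dimension from \<open>0\<close> up to \<open>DIM('e)\<close>,
  where \<open>'e\<close> is arbitrary.
\<close>

record ('a, 'e) manifold =
  mtop :: "'a topology"
  model :: "'e set"
  atlas :: "('a set \<times> ('a \<Rightarrow> 'e)) set"

abbreviation mpoints :: "('a, 'e) manifold \<Rightarrow> 'a set" where
  "mpoints M \<equiv> topspace (mtop M)"

text \<open>
  In the following two definitions, \<open>U\<close> is an open subset of the linear
  subspace \<open>S\<close>. The derivative within \<open>U\<close> is then uniquely
  determined on the directions in \<open>S\<close>, and only these are used.
\<close>

primrec Ck_on ::
  "nat \<Rightarrow> 'e::real_normed_vector set \<Rightarrow> 'e set \<Rightarrow> ('e \<Rightarrow> 'b::real_normed_vector) \<Rightarrow> bool" where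
  "Ck_on 0 S U f \<longleftrightarrow> continuous_on U f"
| "Ck_on (Suc k) S U f \<longleftrightarrow>
     (\<exists>f'. (\<forall>x\<in>U. (f has_derivative f' x) (at x within U)) \<and>
           (\<forall>v\<in>S. Ck_on k S U (\<lambda>x. f' x v)))"

definition Cinf_on ::
  "'e::real_normed_vector set \<Rightarrow> 'e set \<Rightarrow> ('e \<Rightarrow> 'b::real_normed_vector) \<Rightarrow> bool" where
  "Cinf_on S U f \<longleftrightarrow> (\<forall>k. Ck_on k S U f)"

definition second_countable_space :: "'a topology \<Rightarrow> bool" where
  "second_countable_space X \<longleftrightarrow>
     (\<exists>\<B>. countable \<B> \<and> (\<forall>V\<in>\<B>. openin X V) \<and>
          (\<forall>U x. openin X U \<and> x \<in> U \<longrightarrow> (\<exists>V\<in>\<B>. x \<in> V \<and> V \<subseteq> U)))"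

definition top_chart :: "('a, 'e::euclidean_space) manifold \<Rightarrow> 'a set \<Rightarrow> ('a \<Rightarrow> 'e) \<Rightarrow> bool" where
  "top_chart M U \<phi> \<longleftrightarrow>
     openin (mtop M) U \<and>
     openin (top_of_set (model M)) (\<phi> ` U) \<and>
     homeomorphic_map (subtopology (mtop M) U) (top_of_set (\<phi> ` U)) \<phi>"

definition smoothly_compatible ::
  "'e::euclidean_space set \<Rightarrow> 'a set \<Rightarrow> ('a \<Rightarrow> 'e) \<Rightarrow> 'a set \<Rightarrow> ('a \<Rightarrow> 'e) \<Rightarrow> bool" where
  "smoothly_compatible S U \<phi> V \<psi> \<longleftrightarrow>
     Cinf_on S (\<phi> ` (U \<inter> V)) (\<psi> \<circ> inv_into U \<phi>) \<and>
     Cinf_on S (\<psi> ` (U \<inter> V)) (\<phi> \<circ> inv_into V \<psi>)"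

text \<open>
  The field \<open>atlas\<close> need not be maximal; \<open>smooth_chart\<close> is membership in the
  maximal smooth atlas that it generates.
\<close>

definition smooth_chart :: "('a, 'e::euclidean_space) manifold \<Rightarrow> 'a set \<Rightarrow> ('a \<Rightarrow> 'e) \<Rightarrow> bool" where
  "smooth_chart M U \<phi> \<longleftrightarrow>
     top_chart M U \<phi> \<and> (\<forall>(V, \<psi>)\<in>atlas M. smoothly_compatible (model M) U \<phi> V \<psi>)"

definition smooth_manifold :: "('a, 'e::euclidean_space) manifold \<Rightarrow> bool" where
  "smooth_manifold M \<longleftrightarrow>
     Hausdorff_space (mtop M) \<and> second_countable_space (mtop M) \<and>
     subspace (model M) \<and>
     (\<forall>(U, \<phi>)\<in>atlas M. smooth_chart M U \<phi>) \<and>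
     (\<Union>(U, \<phi>)\<in>atlas M. U) = mpoints M"

definition mdim :: "('a, 'e::euclidean_space) manifold \<Rightarrow> nat" where
  "mdim M = dim (model M)"

definition smooth_fun_on :: "('a, 'e::euclidean_space) manifold \<Rightarrow> 'a set \<Rightarrow> ('a \<Rightarrow> real) \<Rightarrow> bool" where
  "smooth_fun_on M W f \<longleftrightarrow>
     (\<forall>(U, \<phi>)\<in>atlas M. Cinf_on (model M) (\<phi> ` (U \<inter> W)) (f \<circ> inv_into U \<phi>))"

definition smooth_funs :: "('a, 'e::euclidean_space) manifold \<Rightarrow> ('a \<Rightarrow> real) set" where
  "smooth_funs M = {f. smooth_fun_on M (mpoints M) f}"

definition smooth_map ::
  "('a, 'e::euclidean_space) manifold \<Rightarrow> ('b, 'f::euclidean_space) manifold \<Rightarrow> ('a \<Rightarrow> 'b) \<Rightarrow> bool" where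
  "smooth_map M N p \<longleftrightarrow>
     continuous_map (mtop M) (mtop N) p \<and>
     (\<forall>(U, \<phi>)\<in>atlas M. \<forall>(V, \<psi>)\<in>atlas N.
        Cinf_on (model M) (\<phi> ` (U \<inter> p -` V)) (\<psi> \<circ> p \<circ> inv_into U \<phi>))"

type_synonym 'a tangent = "('a \<Rightarrow> real) \<Rightarrow> real"
type_synonym 'a cotangent = "'a tangent \<Rightarrow> real"

text \<open>
  Tangent vectors at \<open>x\<close> are the derivations at \<open>x\<close> of the algebra of
  smooth functions, and cotangent vectors are the linear forms on the tangent space. HOL functions
  being total, both are extended by zero outside their domain so that equality is the intended one.
\<close>

definition tangent_space :: "('a, 'e::euclidean_space) manifold \<Rightarrow> 'a \<Rightarrow> 'a tangent set" where
  "tangent_space M x =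
     {v. (\<forall>f\<in>smooth_funs M. \<forall>g\<in>smooth_funs M. v (f + g) = v f + v g) \<and>
         (\<forall>c. \<forall>f\<in>smooth_funs M. v (c *\<^sub>R f) = c * v f) \<and>
         (\<forall>f\<in>smooth_funs M. \<forall>g\<in>smooth_funs M. v (f * g) = f x * v g + g x * v f) \<and>
         (\<forall>f. f \<notin> smooth_funs M \<longrightarrow> v f = 0)}"

definition cotangent_space :: "('a, 'e::euclidean_space) manifold \<Rightarrow> 'a \<Rightarrow> 'a cotangent set" where
  "cotangent_space M x =
     {\<alpha>. (\<forall>u\<in>tangent_space M x. \<forall>v\<in>tangent_space M x. \<alpha> (u + v) = \<alpha> u + \<alpha> v) \<and>
         (\<forall>c. \<forall>u\<in>tangent_space M x. \<alpha> (c *\<^sub>R u) = c * \<alpha> u) \<and>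
         (\<forall>u. u \<notin> tangent_space M x \<longrightarrow> \<alpha> u = 0)}"

definition pushforward :: "('b, 'f::euclidean_space) manifold \<Rightarrow> ('a \<Rightarrow> 'b) \<Rightarrow> 'a tangent \<Rightarrow> 'b tangent" where
  "pushforward N p v = (\<lambda>g. if g \<in> smooth_funs N then v (g \<circ> p) else 0)"

definition pullback ::
  "('a, 'e::euclidean_space) manifold \<Rightarrow> ('b, 'f::euclidean_space) manifold \<Rightarrow>
   ('a \<Rightarrow> 'b) \<Rightarrow> 'a \<Rightarrow> 'b cotangent \<Rightarrow> 'a cotangent" where
  "pullback M N p x \<eta> = (\<lambda>u. if u \<in> tangent_space M x then \<eta> (pushforward N p u) else 0)"

definition immersion ::
  "('a, 'e::euclidean_space) manifold \<Rightarrow> ('b, 'f::euclidean_space) manifold \<Rightarrow> ('a \<Rightarrow> 'b) \<Rightarrow> bool" where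
  "immersion M N p \<longleftrightarrow>
     smooth_map M N p \<and> (\<forall>x\<in>mpoints M. inj_on (pushforward N p) (tangent_space M x))"

definition submersion ::
  "('a, 'e::euclidean_space) manifold \<Rightarrow> ('b, 'f::euclidean_space) manifold \<Rightarrow> ('a \<Rightarrow> 'b) \<Rightarrow> bool" where
  "submersion M N p \<longleftrightarrow>
     smooth_map M N p \<and>
     (\<forall>x\<in>mpoints M. pushforward N p ` tangent_space M x = tangent_space N (p x))"

definition vector_field_on ::
  "('a, 'e::euclidean_space) manifold \<Rightarrow> 'a set \<Rightarrow> ('a \<Rightarrow> 'a tangent) \<Rightarrow> bool" where
  "vector_field_on M W X \<longleftrightarrow>
     (\<forall>x\<in>W. X x \<in> tangent_space M x) \<and>
     (\<forall>f\<in>smooth_funs M. smooth_fun_on M W (\<lambda>x. X x f))"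

definition one_form_on ::
  "('a, 'e::euclidean_space) manifold \<Rightarrow> 'a set \<Rightarrow> ('a \<Rightarrow> 'a cotangent) \<Rightarrow> bool" where
  "one_form_on M W \<alpha> \<longleftrightarrow>
     (\<forall>x\<in>W. \<alpha> x \<in> cotangent_space M x) \<and>
     (\<forall>X. vector_field_on M (mpoints M) X \<longrightarrow> smooth_fun_on M W (\<lambda>x. \<alpha> x (X x)))"

definition lie_bracket ::
  "('a \<Rightarrow> 'a tangent) \<Rightarrow> ('a \<Rightarrow> 'a tangent) \<Rightarrow> 'a \<Rightarrow> 'a tangent" where
  "lie_bracket X Y x = (\<lambda>f. X x (\<lambda>y. Y y f) - Y x (\<lambda>y. X y f))"

definition extend_vector ::
  "('a, 'e::euclidean_space) manifold \<Rightarrow> 'a \<Rightarrow> 'a tangent \<Rightarrow> 'a \<Rightarrow> 'a tangent" where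
  "extend_vector M x v = (SOME X. vector_field_on M (mpoints M) X \<and> X x = v)"

text \<open>
  The invariant formulas
  \<open>d\<xi>(X, Y) = X (\<xi> Y) - Y (\<xi> X) - \<xi> [X, Y]\<close> and
  \<open>(L\<^sub>X \<eta>) Y = X (\<eta> Y) - \<eta> [X, Y]\<close> are tensorial in
  \<open>X, Y\<close>, resp. in \<open>Y\<close>; they are evaluated on tangent vectors
  by means of arbitrary extensions to vector fields.
\<close>

definition ext_deriv ::
  "('a, 'e::euclidean_space) manifold \<Rightarrow> ('a \<Rightarrow> 'a cotangent) \<Rightarrow>
   'a \<Rightarrow> 'a tangent \<Rightarrow> 'a tangent \<Rightarrow> real" where
  "ext_deriv M \<xi> x u v =
     (if u \<in> tangent_space M x \<and> v \<in> tangent_space M x then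
        (let X = extend_vector M x u; Y = extend_vector M x v
         in X x (\<lambda>y. \<xi> y (Y y)) - Y x (\<lambda>y. \<xi> y (X y)) - \<xi> x (lie_bracket X Y x))
      else 0)"

definition lie_deriv ::
  "('a, 'e::euclidean_space) manifold \<Rightarrow> ('a \<Rightarrow> 'a tangent) \<Rightarrow> ('a \<Rightarrow> 'a cotangent) \<Rightarrow>
   'a \<Rightarrow> 'a cotangent" where
  "lie_deriv M X \<eta> x =
     (\<lambda>v. if v \<in> tangent_space M x then
            (let Y = extend_vector M x v
             in X x (\<lambda>y. \<eta> y (Y y)) - \<eta> x (lie_bracket X Y x))
          else 0)"

definition contract ::
  "('a \<Rightarrow> 'a tangent) \<Rightarrow> ('a \<Rightarrow> 'a tangent \<Rightarrow> 'a tangent \<Rightarrow> real) \<Rightarrow> 'a \<Rightarrow> 'a cotangent" where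
  "contract X \<omega> x = \<omega> x (X x)"

type_synonym 'a gtangent = "'a tangent \<times> 'a cotangent"

definition gtangent_space :: "('a, 'e::euclidean_space) manifold \<Rightarrow> 'a \<Rightarrow> 'a gtangent set" where
  "gtangent_space M x = tangent_space M x \<times> cotangent_space M x"

definition pairing :: "'a gtangent \<Rightarrow> 'a gtangent \<Rightarrow> real" where
  "pairing a b = snd a (fst b) + snd b (fst a)"

definition smooth_section_on ::
  "('a, 'e::euclidean_space) manifold \<Rightarrow> 'a set \<Rightarrow> ('a \<Rightarrow> 'a gtangent) \<Rightarrow> bool" where
  "smooth_section_on M W s \<longleftrightarrow> vector_field_on M W (fst \<circ> s) \<and> one_form_on M W (snd \<circ> s)"

definition dorfman_bracket ::
  "('a, 'e::euclidean_space) manifold \<Rightarrow> ('a \<Rightarrow> 'a gtangent) \<Rightarrow> ('a \<Rightarrow> 'a gtangent) \<Rightarrow>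
   'a \<Rightarrow> 'a gtangent" where
  "dorfman_bracket M a b x =
     (let u = fst \<circ> a; \<xi> = snd \<circ> a; v = fst \<circ> b; \<eta> = snd \<circ> b
      in (lie_bracket u v x, lie_deriv M u \<eta> x - contract v (ext_deriv M \<xi>) x))"

definition vector_subbundle ::
  "('a, 'e::euclidean_space) manifold \<Rightarrow> ('a \<Rightarrow> 'a gtangent set) \<Rightarrow> bool" where
  "vector_subbundle M L \<longleftrightarrow>
     (\<forall>x\<in>mpoints M. L x \<subseteq> gtangent_space M x \<and> subspace (L x)) \<and>
     (\<forall>x\<in>mpoints M. \<exists>U (r::nat) e. openin (mtop M) U \<and> x \<in> U \<and>
        (\<forall>i<r. smooth_section_on M U (e i)) \<and>
        (\<forall>y\<in>U. inj_on (\<lambda>i. e i y) {..<r} \<and>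
               independent ((\<lambda>i. e i y) ` {..<r}) \<and>
               span ((\<lambda>i. e i y) ` {..<r}) = L y))"

definition sections ::
  "('a, 'e::euclidean_space) manifold \<Rightarrow> ('a \<Rightarrow> 'a gtangent set) \<Rightarrow> ('a \<Rightarrow> 'a gtangent) set" where
  "sections M L = {s. smooth_section_on M (mpoints M) s \<and> (\<forall>x\<in>mpoints M. s x \<in> L x)}"

definition orthogonal_space ::
  "('a, 'e::euclidean_space) manifold \<Rightarrow> 'a \<Rightarrow> 'a gtangent set \<Rightarrow> 'a gtangent set" where
  "orthogonal_space M x E = {a \<in> gtangent_space M x. \<forall>b\<in>E. pairing a b = 0}"

definition dirac_structure ::
  "('a, 'e::euclidean_space) manifold \<Rightarrow> ('a \<Rightarrow> 'a gtangent set) \<Rightarrow> bool" where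
  "dirac_structure M L \<longleftrightarrow>
     vector_subbundle M L \<and>
     (\<forall>x\<in>mpoints M. L x = orthogonal_space M x (L x)) \<and>
     (\<forall>a\<in>sections M L. \<forall>b\<in>sections M L. dorfman_bracket M a b \<in> sections M L)"

definition cotangent_product ::
  "('a \<Rightarrow> 'a gtangent set) \<Rightarrow> ('a \<Rightarrow> 'a gtangent set) \<Rightarrow> 'a \<Rightarrow> 'a gtangent set" where
  "cotangent_product L R x = {a + (fst b, 0) | a b. a \<in> L x \<and> b \<in> R x \<and> snd a = snd b}"

definition concur ::
  "('a, 'e::euclidean_space) manifold \<Rightarrow> ('a \<Rightarrow> 'a gtangent set) \<Rightarrow> ('a \<Rightarrow> 'a gtangent set) \<Rightarrow> bool" where
  "concur M L R \<longleftrightarrow> dirac_structure M (cotangent_product L R)"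

definition dirac_push ::
  "('a, 'e::euclidean_space) manifold \<Rightarrow> ('b, 'f::euclidean_space) manifold \<Rightarrow>
   ('a \<Rightarrow> 'b) \<Rightarrow> 'a \<Rightarrow> 'a gtangent set \<Rightarrow> 'b gtangent set" where
  "dirac_push M N p x E =
     {(pushforward N p u, \<eta>) | u \<eta>. u \<in> tangent_space M x \<and> \<eta> \<in> cotangent_space N (p x) \<and>
        (u, pullback M N p x \<eta>) \<in> E}"

definition forward_dirac ::
  "('a, 'e::euclidean_space) manifold \<Rightarrow> ('a \<Rightarrow> 'a gtangent set) \<Rightarrow>
   ('b, 'f::euclidean_space) manifold \<Rightarrow> ('b \<Rightarrow> 'b gtangent set) \<Rightarrow> ('a \<Rightarrow> 'b) \<Rightarrow> bool" where
  "forward_dirac M L N R p \<longleftrightarrow> (\<forall>x\<in>mpoints M. dirac_push M N p x (L x) = R (p x))"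

definition dirac_pull ::
  "('a, 'e::euclidean_space) manifold \<Rightarrow> ('b, 'f::euclidean_space) manifold \<Rightarrow>
   ('a \<Rightarrow> 'b) \<Rightarrow> ('b \<Rightarrow> 'b gtangent set) \<Rightarrow> 'a \<Rightarrow> 'a gtangent set" where
  "dirac_pull M N p R x =
     {(u, pullback M N p x \<eta>) | u \<eta>. u \<in> tangent_space M x \<and> \<eta> \<in> cotangent_space N (p x) \<and>
        (pushforward N p u, \<eta>) \<in> R (p x)}"

text \<open>
  A foliation of dimension \<open>k\<close> is given by its set of leaves: a partition of the
  manifold into connected immersed submanifolds of dimension \<open>k\<close> such that flat charts
  exist around every point. A chart is flat if its image is a cube with respect to some orthonormal
  basis \<open>B\<close> of the model space and every leaf meets it in a countable (possibly empty)
  union of slices parallel to the span of some \<open>k\<close>-element subset \<open>B'\<close>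
  of \<open>B\<close>.
\<close>

definition immersed_submanifold ::
  "('a, 'e::euclidean_space) manifold \<Rightarrow> 'a set \<Rightarrow> ('a, 'e) manifold \<Rightarrow> bool" where
  "immersed_submanifold M S Q \<longleftrightarrow>
     smooth_manifold Q \<and> mpoints Q = S \<and> immersion Q M (\<lambda>x. x)"

definition flat_chart ::
  "('a, 'e::euclidean_space) manifold \<Rightarrow> nat \<Rightarrow> 'a set set \<Rightarrow> 'a set \<Rightarrow> ('a \<Rightarrow> 'e) \<Rightarrow> bool" where
  "flat_chart M k \<F> U \<phi> \<longleftrightarrow>
     smooth_chart M U \<phi> \<and>
     (\<exists>B B' lo hi.
        pairwise orthogonal B \<and> (\<forall>b\<in>B. norm b = 1) \<and> span B = model M \<and>
        B' \<subseteq> B \<and> card B' = k \<and>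
        \<phi> ` U = {y \<in> model M. \<forall>b\<in>B. lo b < y \<bullet> b \<and> y \<bullet> b < hi b} \<and>
        (\<forall>S\<in>\<F>. \<exists>C. countable C \<and>
           \<phi> ` (S \<inter> U) = {y \<in> \<phi> ` U. \<exists>c\<in>C. \<forall>b\<in>B - B'. y \<bullet> b = c \<bullet> b}))"

definition foliation_of_dim :: "('a, 'e::euclidean_space) manifold \<Rightarrow> nat \<Rightarrow> 'a set set \<Rightarrow> bool" where
  "foliation_of_dim M k \<F> \<longleftrightarrow>
     \<Union>\<F> = mpoints M \<and> disjoint \<F> \<and> {} \<notin> \<F> \<and>
     (\<forall>S\<in>\<F>. \<exists>Q. immersed_submanifold M S Q \<and> mdim Q = k \<and> connected_space (mtop Q)) \<and>
     (\<forall>x\<in>mpoints M. \<exists>U \<phi>. x \<in> U \<and> flat_chart M k \<F> U \<phi>)"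

definition foliation :: "('a, 'e::euclidean_space) manifold \<Rightarrow> 'a set set \<Rightarrow> bool" where
  "foliation M \<F> \<longleftrightarrow> (\<exists>k. foliation_of_dim M k \<F>)"

definition leaf_map :: "'a set set \<Rightarrow> 'a \<Rightarrow> 'a set" where
  "leaf_map \<F> x = (THE S. S \<in> \<F> \<and> x \<in> S)"

text \<open>
  The tangent space of the leaf through \<open>x\<close>. The immersed submanifold structure
  \<open>Q\<close> on a leaf is unique, so the existential quantifier involves no choice.
\<close>

definition foliation_tangent ::
  "('a, 'e::euclidean_space) manifold \<Rightarrow> 'a set set \<Rightarrow> 'a \<Rightarrow> 'a tangent set" where
  "foliation_tangent M \<F> x =
     {v. \<exists>Q. immersed_submanifold M (leaf_map \<F> x) Q \<and>
             v \<in> pushforward M (\<lambda>y. y) ` tangent_space Q x}"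

definition Gr ::
  "('a, 'e::euclidean_space) manifold \<Rightarrow> 'a set set \<Rightarrow> 'a \<Rightarrow> 'a gtangent set" where
  "Gr M \<F> x = {(u, \<xi>). u \<in> foliation_tangent M \<F> x \<and> \<xi> \<in> cotangent_space M x \<and>
                       (\<forall>w\<in>foliation_tangent M \<F> x. \<xi> w = 0)}"

text \<open>
  The manifold structure \<open>N\<close> on the leaf space is a parameter; it is unique up to
  compatibility of atlases (and the choice of model space) when it exists.
\<close>

definition simple_foliation ::
  "('a, 'e::euclidean_space) manifold \<Rightarrow> 'a set set \<Rightarrow> ('a set, 'f::euclidean_space) manifold \<Rightarrow> bool" where
  "simple_foliation M \<F> N \<longleftrightarrow>
     foliation M \<F> \<and> smooth_manifold N \<and> mpoints N = \<F> \<and>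
     quotient_map (mtop M) (mtop N) (leaf_map \<F>) \<and>
     submersion M N (leaf_map \<F>)"

end

theory Submission
  imports Defs
begin

text \<open>
  Let \<open>p\<close> be the leaf map and \<open>K\<close> the kernel of its differential, which is the tangent
  distribution of the foliation (\<open>foliation_tangent_eq_kernel\<close>). The cotangent product \<open>D\<close> of \<open>L\<close>
  with \<open>Gr M \<F>\<close> consists of the \<open>u + k + \<xi>\<close> with \<open>u + \<xi>\<close> in \<open>L\<close>, \<open>k\<close> in \<open>K\<close> and \<open>\<xi>\<close> vanishing on \<open>K\<close>.
  Two facts follow by linear algebra in a single fibre. Firstly \<open>D\<close> and \<open>L\<close> have the same pushforward
  along \<open>p\<close>, since a pulled back covector vanishes on \<open>K\<close> and \<open>p\<close> kills \<open>k\<close>. Secondly, if \<open>L\<close> is forward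
  related to \<open>R\<close>, then \<open>D\<close> is the pullback of \<open>R\<close>, since the annihilator of \<open>K\<close> is exactly the space
  of pulled back covectors. The equivalence therefore amounts to two statements on a submersion: the
  pullback of a Dirac structure is a Dirac structure (\<open>dirac_structure_pull\<close>), and a Dirac structure
  that contains \<open>K\<close> descends to the base when the fibres are connected (\<open>dirac_structure_descends\<close>).

  Both use the characterization \<open>dirac_structure_iff\<close>: a family of fibres is a Dirac structure if and
  only if each fibre equals its orthogonal, every element of a fibre is a value of a global section,
  and \<open>\<langle>[a, b], c\<rangle> = 0\<close> for all sections \<open>a\<close>, \<open>b\<close>, \<open>c\<close>. This last expression is cyclic and depends on \<open>c\<close>
  only through its value at the point, hence it depends on all three sections only through their
  values (\<open>courant_tensor_cong\<close>). It may thus be computed with sections chosen at will. Locally a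
  section on the base has \<open>p\<close>-related lifts with prescribed vector part at one point, and related
  sections have the same Courant tensor (\<open>courant_tensor_related\<close>). This transports integrability in
  both directions.

  For the descent it remains to see that the pushforward of the fibre \<open>D x\<close> is the same at all points
  of a fibre of \<open>p\<close>. In coordinates in which \<open>p\<close> is affine, the bracket with a vertical coordinate field
  is the derivative of the coefficients. If \<open>\<zeta>\<close> has constant coefficients and lies in \<open>D\<close> at one
  point, its pairings with a local frame of \<open>D\<close> solve, along a vertical coordinate line, a homogeneous
  linear differential equation, because the bracket of a frame section with a vertical coordinate
  field is again a section of \<open>D\<close>. The pairings vanish at the start, hence everywhere, and so \<open>\<zeta>\<close> stays
  in the orthogonal of \<open>D\<close>, that is, in \<open>D\<close> (\<open>push_locally_constant\<close>). The pushforward is thus locally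
  constant on the connected fibre.

  Tangent vectors being derivations, the calculus behind this consists of Hadamard's lemma, by which
  derivations are coordinate vectors, of bump functions, which make the passage from local to global
  objects possible, and of the smooth inverse function theorem, which provides coordinates adapted
  to a submersion.
\<close>

section \<open>Smooth functions on open subsets of a linear subspace\<close>

text \<open>
  The Frechet derivative within an open subset of a subspace is determined only on that subspace.
  This line derivative is a canonical choice there, and it depends only on the germ of \<open>f\<close>.
\<close>

definition dird :: "('e::real_normed_vector \<Rightarrow> 'b::real_normed_vector) \<Rightarrow> 'e \<Rightarrow> 'e \<Rightarrow> 'b" where
  "dird f x v = vector_derivative (\<lambda>t. f (x + t *\<^sub>R v)) (at 0)"

definition open_sub :: "'e::real_normed_vector set \<Rightarrow> 'e set \<Rightarrow> bool" where
  "open_sub S U \<longleftrightarrow> subspace S \<and> openin (top_of_set S) U"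

lemma open_subD: "open_sub S U \<Longrightarrow> subspace S" "open_sub S U \<Longrightarrow> U \<subseteq> S"
  by (auto simp: open_sub_def dest: openin_imp_subset)

lemma open_sub_openin: "open_sub S U \<Longrightarrow> openin (top_of_set U) V \<Longrightarrow> open_sub S V"
  unfolding open_sub_def using openin_trans by blast

lemma open_sub_line:
  assumes "open_sub S U" "x \<in> U" "v \<in> S"
  obtains e where "e > 0" "\<And>t. \<bar>t\<bar> < e \<Longrightarrow> x + t *\<^sub>R v \<in> U"
proof -
  have S: "subspace S" and US: "U \<subseteq> S" using open_subD[OF assms(1)] by auto
  obtain d where d: "d > 0" "ball x d \<inter> S \<subseteq> U"
    using assms unfolding open_sub_def openin_contains_ball by blast
  have nz: "norm v + 1 > 0" using norm_ge_zero[of v] by linarith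
  show thesis
  proof (rule that[of "d / (norm v + 1)"])
    show "d / (norm v + 1) > 0" using d nz by simp
    fix t :: real assume t: "\<bar>t\<bar> < d / (norm v + 1)"
    have "norm (t *\<^sub>R v) \<le> \<bar>t\<bar> * (norm v + 1)" by (simp add: mult_left_mono)
    also have "\<dots> < d" using t nz by (simp add: pos_less_divide_eq)
    finally have "x + t *\<^sub>R v \<in> ball x d" by (simp add: dist_norm)
    moreover have "x + t *\<^sub>R v \<in> S" using S US assms by (auto intro!: subspace_add subspace_scale)
    ultimately show "x + t *\<^sub>R v \<in> U" using d by blast
  qed
qed

lemma has_derivative_line:
  assumes "open_sub S U" "x \<in> U" "v \<in> S" "(f has_derivative f') (at x within U)"
  shows "((\<lambda>t. f (x + t *\<^sub>R v)) has_vector_derivative f' v) (at 0)"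
proof -
  obtain e where e: "e > 0" "\<And>t. \<bar>t\<bar> < e \<Longrightarrow> x + t *\<^sub>R v \<in> U"
    using open_sub_line[OF assms(1-3)] by blast
  let ?T = "ball (0::real) e"
  have 1: "((\<lambda>t. x + t *\<^sub>R v) has_derivative (\<lambda>t. t *\<^sub>R v)) (at 0 within ?T)"
    by (auto intro!: derivative_eq_intros)
  have 2: "(f has_derivative f') (at (x + 0 *\<^sub>R v) within (\<lambda>t. x + t *\<^sub>R v) ` ?T)"
    using assms(4) e(2) by (auto intro!: has_derivative_subset[OF assms(4)])
  have "((\<lambda>t. f (x + t *\<^sub>R v)) has_derivative (\<lambda>t. f' (t *\<^sub>R v))) (at 0 within ?T)"
    by (rule has_derivative_in_compose[OF 1 2])
  moreover have "at (0::real) within ?T = at 0" using e by (intro at_within_open) auto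
  moreover have "f' (t *\<^sub>R v) = t *\<^sub>R f' v" for t
    using assms(4) by (simp add: has_derivative_def bounded_linear.linear linear_scale)
  ultimately show ?thesis by (simp add: has_vector_derivative_def)
qed

lemma dird_eq:
  assumes "open_sub S U" "x \<in> U" "v \<in> S" "(f has_derivative f') (at x within U)"
  shows "dird f x v = f' v"
  unfolding dird_def by (rule vector_derivative_at[OF has_derivative_line[OF assms]])

lemma Ck_on_SucI:
  assumes "\<And>x. x \<in> U \<Longrightarrow> (f has_derivative f' x) (at x within U)" "\<And>v. v \<in> S \<Longrightarrow> Ck_on k S U (\<lambda>x. f' x v)"
  shows "Ck_on (Suc k) S U f"
  using assms by auto

lemma Ck_on_cong:
  assumes "Ck_on k S U f" "\<And>x. x \<in> U \<Longrightarrow> f x = g x"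
  shows "Ck_on k S U g"
  using assms
proof (induction k arbitrary: f g)
  case 0 then show ?case using continuous_on_cong[of U U f g] by simp
next
  case (Suc k)
  then obtain f' where f': "\<forall>x\<in>U. (f has_derivative f' x) (at x within U)" "\<forall>v\<in>S. Ck_on k S U (\<lambda>x. f' x v)"
    by auto
  have "\<forall>x\<in>U. (g has_derivative f' x) (at x within U)"
    using f'(1) Suc.prems(2) by (metis has_derivative_transform)
  then show ?case using f'(2) by auto
qed

lemma Ck_on_mono:
  assumes "Ck_on k S U f" "S' \<subseteq> S" "U' \<subseteq> U"
  shows "Ck_on k S' U' f"
  using assms
proof (induction k arbitrary: f)
  case 0 then show ?case using continuous_on_subset by auto
next
  case (Suc k)
  then obtain f' where f': "\<forall>x\<in>U. (f has_derivative f' x) (at x within U)" "\<forall>v\<in>S. Ck_on k S U (\<lambda>x. f' x v)"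
    by auto
  have "\<forall>x\<in>U'. (f has_derivative f' x) (at x within U')"
    using f'(1) Suc.prems(3) by (meson has_derivative_subset subsetD)
  moreover have "\<forall>v\<in>S'. Ck_on k S' U' (\<lambda>x. f' x v)" using f'(2) Suc.prems Suc.IH by blast
  ultimately show ?case by (intro Ck_on_SucI[where f' = f']) auto
qed

lemma Ck_on_pred: "Ck_on (Suc k) S U f \<Longrightarrow> Ck_on k S U f"
proof (induction k arbitrary: f)
  case 0
  then show ?case
    by (auto simp: continuous_on_eq_continuous_within intro: has_derivative_continuous)
next
  case (Suc k)
  from Suc.prems obtain f' where f': "\<forall>x\<in>U. (f has_derivative f' x) (at x within U)" "\<forall>v\<in>S. Ck_on (Suc k) S U (\<lambda>x. f' x v)"
    by (subst (asm) Ck_on.simps(2)) blast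
  have "\<forall>v\<in>S. Ck_on k S U (\<lambda>x. f' x v)" using f'(2) Suc.IH by blast
  with f'(1) show ?case by auto
qed

lemma Ck_on_le: "Ck_on k S U f \<Longrightarrow> j \<le> k \<Longrightarrow> Ck_on j S U f"
proof (induction k)
  case (Suc k) then show ?case using Ck_on_pred by (metis le_Suc_eq)
qed simp

lemma Ck_on_continuous: "Ck_on k S U f \<Longrightarrow> continuous_on U f"
  using Ck_on_le[of k S U f 0] by simp

text \<open>
  The derivative in the recursive definition of \<open>Ck_on\<close> is existentially quantified. Replacing it by
  the canonical \<open>dird\<close> makes the notion local and shows that directional derivatives of smooth
  functions are smooth.
\<close>

lemma Ck_Suc_dird:
  assumes "open_sub S U"
  shows "Ck_on (Suc k) S U f \<longleftrightarrow>
    (\<forall>x\<in>U. f differentiable (at x within U)) \<and> (\<forall>v\<in>S. Ck_on k S U (\<lambda>x. dird f x v))"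
proof
  assume "Ck_on (Suc k) S U f"
  then obtain f' where f': "\<forall>x\<in>U. (f has_derivative f' x) (at x within U)" "\<forall>v\<in>S. Ck_on k S U (\<lambda>x. f' x v)"
    by auto
  have "Ck_on k S U (\<lambda>x. dird f x v)" if "v \<in> S" for v
  proof (rule Ck_on_cong)
    show "Ck_on k S U (\<lambda>x. f' x v)" using f'(2) that by blast
    show "f' x v = dird f x v" if "x \<in> U" for x
      using dird_eq[OF assms that \<open>v \<in> S\<close>, of f "f' x"] f'(1) that by simp
  qed
  then show "(\<forall>x\<in>U. f differentiable (at x within U)) \<and> (\<forall>v\<in>S. Ck_on k S U (\<lambda>x. dird f x v))"
    using f'(1) unfolding differentiable_def by blast
next
  assume R: "(\<forall>x\<in>U. f differentiable (at x within U)) \<and> (\<forall>v\<in>S. Ck_on k S U (\<lambda>x. dird f x v))"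
  then obtain f' where f': "\<forall>x\<in>U. (f has_derivative f' x) (at x within U)"
    unfolding differentiable_def by metis
  have "Ck_on k S U (\<lambda>x. f' x v)" if "v \<in> S" for v
  proof (rule Ck_on_cong)
    show "Ck_on k S U (\<lambda>x. dird f x v)" using R that by blast
    show "dird f x v = f' x v" if "x \<in> U" for x
      using dird_eq[OF assms that \<open>v \<in> S\<close>, of f "f' x"] f' that by simp
  qed
  then show "Ck_on (Suc k) S U f" using f' by (intro Ck_on_SucI[where f' = f']) auto
qed

lemma at_within_openin_eq:
  assumes "openin (top_of_set U) V" "x \<in> V" shows "at x within V = at x within U"
proof -
  obtain T where "open T" "V = U \<inter> T" using assms(1) openin_open by metis
  then show ?thesis using assms(2) by (intro at_within_nhd[of x T]) auto
qed

lemma Ck_on_local: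
  assumes "open_sub S U" "\<And>x. x \<in> U \<Longrightarrow> \<exists>V. openin (top_of_set U) V \<and> x \<in> V \<and> Ck_on k S V f"
  shows "Ck_on k S U f"
  using assms(2)
proof (induction k arbitrary: f)
  case 0
  have "continuous (at x within U) f" if x: "x \<in> U" for x
  proof -
    obtain V where V: "openin (top_of_set U) V" "x \<in> V" "continuous_on V f" using 0[OF x] by auto
    then have "continuous (at x within V) f" by (simp add: continuous_on_eq_continuous_within)
    then show ?thesis using at_within_openin_eq[OF V(1,2)] by simp
  qed
  then show ?case by (simp add: continuous_on_eq_continuous_within)
next
  case (Suc k)
  have d: "f differentiable (at x within U)" if x: "x \<in> U" for x
  proof -
    obtain V where V: "openin (top_of_set U) V" "x \<in> V" "Ck_on (Suc k) S V f" using Suc.prems[OF x] by auto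
    then have "f differentiable (at x within V)" by (auto simp: differentiable_def)
    then show ?thesis using at_within_openin_eq[OF V(1,2)] by simp
  qed
  have "Ck_on k S U (\<lambda>x. dird f x v)" if v: "v \<in> S" for v
  proof (rule Suc.IH)
    fix x assume x: "x \<in> U"
    obtain V where V: "openin (top_of_set U) V" "x \<in> V" "Ck_on (Suc k) S V f" using Suc.prems[OF x] by auto
    then show "\<exists>V. openin (top_of_set U) V \<and> x \<in> V \<and> Ck_on k S V (\<lambda>x. dird f x v)"
      using Ck_Suc_dird[OF open_sub_openin[OF assms(1) V(1)]] v by blast
  qed
  then show ?case using d Ck_Suc_dird[OF assms(1)] by blast
qed

lemma Ck_on_const: "Ck_on k S U (\<lambda>x. c)"
proof (induction k arbitrary: c)
  case (Suc k)
  show ?case by (rule Ck_on_SucI[where f' = "\<lambda>x v. 0"]) (use Suc in auto)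
qed auto

lemma Ck_on_linear:
  assumes "bounded_linear L" shows "Ck_on k S U L"
proof (cases k)
  case 0 then show ?thesis using assms by (simp add: linear_continuous_on)
next
  case (Suc j)
  show ?thesis unfolding Suc
    by (rule Ck_on_SucI[where f' = "\<lambda>x. L"]) (use assms bounded_linear_imp_has_derivative Ck_on_const in auto)
qed

lemma Ck_on_linear_comp:
  assumes "bounded_linear L" "Ck_on k S U f" shows "Ck_on k S U (\<lambda>x. L (f x))"
  using assms(2)
proof (induction k arbitrary: f)
  case 0 then show ?case using assms(1) bounded_linear.continuous_on by auto
next
  case (Suc k)
  then obtain f' where f': "\<forall>x\<in>U. (f has_derivative f' x) (at x within U)" "\<forall>v\<in>S. Ck_on k S U (\<lambda>x. f' x v)"
    by auto
  have "\<forall>x\<in>U. ((\<lambda>x. L (f x)) has_derivative (\<lambda>v. L (f' x v))) (at x within U)"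
    using f'(1) assms(1) bounded_linear.has_derivative by blast
  moreover have "\<forall>v\<in>S. Ck_on k S U (\<lambda>x. L (f' x v))" using f'(2) Suc.IH by blast
  ultimately show ?case by (intro Ck_on_SucI[where f' = "\<lambda>x v. L (f' x v)"]) auto
qed

lemma Ck_on_add:
  assumes "Ck_on k S U f" "Ck_on k S U g" shows "Ck_on k S U (\<lambda>x. f x + g x)"
  using assms
proof (induction k arbitrary: f g)
  case 0 then show ?case by (auto intro: continuous_on_add)
next
  case (Suc k)
  then obtain f' g' where f': "\<forall>x\<in>U. (f has_derivative f' x) (at x within U)" "\<forall>v\<in>S. Ck_on k S U (\<lambda>x. f' x v)"
    and g': "\<forall>x\<in>U. (g has_derivative g' x) (at x within U)" "\<forall>v\<in>S. Ck_on k S U (\<lambda>x. g' x v)"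
    by auto
  have "\<forall>x\<in>U. ((\<lambda>x. f x + g x) has_derivative (\<lambda>v. f' x v + g' x v)) (at x within U)"
    using f' g' by (auto intro: has_derivative_add)
  moreover have "\<forall>v\<in>S. Ck_on k S U (\<lambda>x. f' x v + g' x v)" using f'(2) g'(2) Suc.IH by blast
  ultimately show ?case by (intro Ck_on_SucI[where f' = "\<lambda>x v. f' x v + g' x v"]) auto
qed

lemma Ck_on_sum:
  assumes "\<And>i. i \<in> I \<Longrightarrow> Ck_on k S U (f i)" shows "Ck_on k S U (\<lambda>x. \<Sum>i\<in>I. f i x)"
  using assms by (induction I rule: infinite_finite_induct) (auto intro: Ck_on_const Ck_on_add)

lemma Ck_on_bilinear:
  assumes "bounded_bilinear pr" "Ck_on k S U f" "Ck_on k S U g"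
  shows "Ck_on k S U (\<lambda>x. pr (f x) (g x))"
  using assms(2,3)
proof (induction k arbitrary: f g)
  case 0 then show ?case using bounded_bilinear.continuous_on[OF assms(1)] by auto
next
  case (Suc k)
  then obtain f' g' where f': "\<forall>x\<in>U. (f has_derivative f' x) (at x within U)" "\<forall>v\<in>S. Ck_on k S U (\<lambda>x. f' x v)"
    and g': "\<forall>x\<in>U. (g has_derivative g' x) (at x within U)" "\<forall>v\<in>S. Ck_on k S U (\<lambda>x. g' x v)"
    by auto
  have "\<forall>x\<in>U. ((\<lambda>x. pr (f x) (g x)) has_derivative (\<lambda>v. pr (f x) (g' x v) + pr (f' x v) (g x))) (at x within U)"
    using f' g' bounded_bilinear.FDERIV[OF assms(1)] by blast
  moreover have "\<forall>v\<in>S. Ck_on k S U (\<lambda>x. pr (f x) (g' x v) + pr (f' x v) (g x))"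
    using f'(2) g'(2) by (intro ballI Ck_on_add Suc.IH Ck_on_pred[OF Suc.prems(1)] Ck_on_pred[OF Suc.prems(2)]) auto
  ultimately show ?case
    by (intro Ck_on_SucI[where f' = "\<lambda>x v. pr (f x) (g' x v) + pr (f' x v) (g x)"]) auto
qed

lemmas Ck_on_mult = Ck_on_bilinear[OF bounded_bilinear_mult]
lemmas Ck_on_scaleR = Ck_on_bilinear[OF bounded_bilinear_scaleR]
lemmas Ck_on_inner = Ck_on_bilinear[OF bounded_bilinear_inner]

lemma Ck_on_uminus: "Ck_on k S U f \<Longrightarrow> Ck_on k S U (\<lambda>x. - f x)"
  using Ck_on_linear_comp[OF bounded_linear_minus[OF bounded_linear_ident]] by blast

lemma Ck_on_diff: "Ck_on k S U f \<Longrightarrow> Ck_on k S U g \<Longrightarrow> Ck_on k S U (\<lambda>x. f x - g x)"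
  using Ck_on_add[of k S U f "\<lambda>x. - g x"] Ck_on_uminus by fastforce

lemma Ck_on_inverse:
  fixes f :: "'e::real_normed_vector \<Rightarrow> real"
  assumes "Ck_on k S U f" "\<And>x. x \<in> U \<Longrightarrow> f x \<noteq> 0"
  shows "Ck_on k S U (\<lambda>x. inverse (f x))"
  using assms(1)
proof (induction k)
  case 0 then show ?case using assms(2) by (auto intro: continuous_on_inverse)
next
  case (Suc k)
  then obtain f' where f': "\<forall>x\<in>U. (f has_derivative f' x) (at x within U)" "\<forall>v\<in>S. Ck_on k S U (\<lambda>x. f' x v)"
    by auto
  have I: "Ck_on k S U (\<lambda>x. inverse (f x))" using Suc Ck_on_pred by blast
  have "\<forall>x\<in>U. ((\<lambda>x. inverse (f x)) has_derivative (\<lambda>v. - (inverse (f x) * f' x v * inverse (f x)))) (at x within U)"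
    by (intro ballI has_derivative_inverse) (use f'(1) assms(2) in auto)
  moreover have "\<forall>v\<in>S. Ck_on k S U (\<lambda>x. - (inverse (f x) * f' x v * inverse (f x)))"
    using f'(2) I by (intro ballI Ck_on_uminus Ck_on_mult) auto
  ultimately show ?case
    by (intro Ck_on_SucI[where f' = "\<lambda>x v. - (inverse (f x) * f' x v * inverse (f x))"]) auto
qed

lemma orthonormal_expansion:
  fixes B :: "'e::euclidean_space set"
  assumes "pairwise orthogonal B" "\<And>b. b \<in> B \<Longrightarrow> norm b = 1" "finite B" "x \<in> span B"
  shows "(\<Sum>b\<in>B. (x \<bullet> b) *\<^sub>R b) = x"
proof -
  have "linear (\<lambda>x. \<Sum>b\<in>B. (x \<bullet> b) *\<^sub>R b)"
    by (intro bounded_linear.linear bounded_linear_intros)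
  moreover have "(\<Sum>b\<in>B. (y \<bullet> b) *\<^sub>R b) = y" if "y \<in> B" for y
  proof -
    have "(\<Sum>b\<in>B. (y \<bullet> b) *\<^sub>R b) = (\<Sum>b\<in>B. if b = y then y else 0)"
    proof (rule sum.cong)
      fix b assume "b \<in> B"
      then show "(y \<bullet> b) *\<^sub>R b = (if b = y then y else 0)"
        using assms(1) assms(2)[of y] that by (auto simp: pairwise_def orthogonal_def dot_square_norm)
    qed simp
    also have "\<dots> = y" using that assms(3) by simp
    finally show ?thesis .
  qed
  ultimately show ?thesis
    using linear_eq_on_span[of "\<lambda>x. \<Sum>b\<in>B. (x \<bullet> b) *\<^sub>R b" "\<lambda>x. x" B x] linear_id assms(4) by (simp add: id_def)
qed

text \<open>
  An orthonormal basis of a subspace; sums over it express linear maps on \<open>S\<close> and the derivatives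
  in the directions of \<open>S\<close>.
\<close>

definition onb :: "'e::euclidean_space set \<Rightarrow> 'e set" where
  "onb S = (SOME B. B \<subseteq> S \<and> pairwise orthogonal B \<and> (\<forall>b\<in>B. norm b = 1) \<and> finite B \<and> span B = S)"

lemma onb:
  assumes "subspace S"
  shows "onb S \<subseteq> S" "pairwise orthogonal (onb S)" "\<And>b. b \<in> onb S \<Longrightarrow> norm b = 1" "finite (onb S)" "span (onb S) = S"
proof -
  have "\<exists>B. B \<subseteq> S \<and> pairwise orthogonal B \<and> (\<forall>b\<in>B. norm b = 1) \<and> finite B \<and> span B = S"
    using orthonormal_basis_subspace[OF assms] independent_imp_finite by metis
  from someI_ex[OF this] show "onb S \<subseteq> S" "pairwise orthogonal (onb S)" "\<And>b. b \<in> onb S \<Longrightarrow> norm b = 1" "finite (onb S)" "span (onb S) = S"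
    unfolding onb_def by blast+
qed

lemma onb_expand: "subspace S \<Longrightarrow> x \<in> S \<Longrightarrow> (\<Sum>b\<in>onb S. (x \<bullet> b) *\<^sub>R b) = x"
  using orthonormal_expansion[of "onb S" x] onb[of S] by auto

lemma onb_inner: "subspace S \<Longrightarrow> b \<in> onb S \<Longrightarrow> c \<in> onb S \<Longrightarrow> b \<bullet> c = (if b = c then 1 else 0)"
  using onb(2,3)[of S] by (auto simp: pairwise_def orthogonal_def dot_square_norm)

text \<open>Difference quotients of a map into a subspace lie in that subspace, which is closed.\<close>

lemma derivative_in_subspace:
  fixes f :: "'e::real_normed_vector \<Rightarrow> 'f::euclidean_space"
  assumes "open_sub S U" "x \<in> U" "v \<in> S" "(f has_derivative f') (at x within U)" "f ` U \<subseteq> S'" "subspace S'"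
  shows "f' v \<in> S'"
proof -
  define L where "L y = y - (\<Sum>b\<in>onb S'. (y \<bullet> b) *\<^sub>R b)" for y
  have L: "bounded_linear L" unfolding L_def
    by (intro bounded_linear_intros)
  have "((\<lambda>x. L (f x)) has_derivative (\<lambda>v. L (f' v))) (at x within U)"
    using assms(4) L bounded_linear.has_derivative by blast
  then have 1: "dird (\<lambda>x. L (f x)) x v = L (f' v)" by (rule dird_eq[OF assms(1-3)])
  have 0: "L (f y) = 0" if "y \<in> U" for y
    using onb_expand[OF assms(6)] assms(5) that unfolding L_def by auto
  have "((\<lambda>x. L (f x)) has_derivative (\<lambda>v. 0)) (at x within U)"
    by (rule has_derivative_transform[of x U _ "\<lambda>x. 0"]) (use 0 assms(2) in auto)
  then have "dird (\<lambda>x. L (f x)) x v = 0" by (rule dird_eq[OF assms(1-3)])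
  then have "f' v = (\<Sum>b\<in>onb S'. (f' v \<bullet> b) *\<^sub>R b)" using 1 unfolding L_def by simp
  also have "\<dots> \<in> S'" using onb(1)[OF assms(6)] assms(6) by (auto intro!: subspace_sum subspace_scale)
  finally show ?thesis .
qed

text \<open>
  The chain rule and induction. The derivative of \<open>g\<close> is controlled only in the directions of \<open>S'\<close>, so
  the derivative of the inner function is first expanded in a basis of \<open>S'\<close>.
\<close>

lemma Ck_on_compose:
  fixes f :: "'e::real_normed_vector \<Rightarrow> 'f::euclidean_space" and g :: "'f \<Rightarrow> 'b::real_normed_vector"
  assumes U: "open_sub S U" and V: "open_sub S' V" and fV: "f ` U \<subseteq> V" and "Ck_on k S U f" "Ck_on k S' V g"
  shows "Ck_on k S U (\<lambda>x. g (f x))"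
  using assms(4,5)
proof (induction k arbitrary: g)
  case 0
  then show ?case using continuous_on_compose2[of V g U f] fV by simp
next
  case (Suc k)
  from Suc.prems(1) obtain f' where "\<forall>x\<in>U. (f has_derivative f' x) (at x within U)" "\<forall>v\<in>S. Ck_on k S U (\<lambda>x. f' x v)"
    by auto
  then have f': "\<And>x. x\<in>U \<Longrightarrow> (f has_derivative f' x) (at x within U)" "\<And>v. v\<in>S \<Longrightarrow> Ck_on k S U (\<lambda>x. f' x v)"
    by auto
  from Suc.prems(2) obtain g' where "\<forall>x\<in>V. (g has_derivative g' x) (at x within V)" "\<forall>v\<in>S'. Ck_on k S' V (\<lambda>x. g' x v)"
    by auto
  then have g': "\<And>x. x\<in>V \<Longrightarrow> (g has_derivative g' x) (at x within V)" "\<And>v. v\<in>S' \<Longrightarrow> Ck_on k S' V (\<lambda>x. g' x v)"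
    by auto
  have S': "subspace S'" and VS': "V \<subseteq> S'" using open_subD[OF V] by auto
  show ?case
  proof (rule Ck_on_SucI)
    fix x assume x: "x \<in> U"
    then have fx: "f x \<in> V" using fV by auto
    have "(g has_derivative g' (f x)) (at (f x) within f ` U)"
      using g'(1)[OF fx] fV by (rule has_derivative_subset)
    then show "((\<lambda>x. g (f x)) has_derivative (\<lambda>v. g' (f x) (f' x v))) (at x within U)"
      by (rule has_derivative_in_compose[OF f'(1)[OF x]])
  next
    fix v assume v: "v \<in> S"
    have fk: "Ck_on k S U f" using Suc.prems(1) by (rule Ck_on_pred)
    show "Ck_on k S U (\<lambda>x. g' (f x) (f' x v))"
    proof (rule Ck_on_cong)
      show "Ck_on k S U (\<lambda>x. \<Sum>b\<in>onb S'. (f' x v \<bullet> b) *\<^sub>R g' (f x) b)"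
      proof (intro Ck_on_sum Ck_on_scaleR)
        fix b assume b: "b \<in> onb S'"
        show "Ck_on k S U (\<lambda>x. f' x v \<bullet> b)"
          by (rule Ck_on_linear_comp[OF bounded_linear_inner_left f'(2)[OF v]])
        show "Ck_on k S U (\<lambda>x. g' (f x) b)"
          by (rule Suc.IH[OF fk]) (use g'(2) b onb(1)[OF S'] in auto)
      qed
      fix x assume x: "x \<in> U"
      then have fx: "f x \<in> V" using fV by auto
      have lin: "linear (g' (f x))" using g'(1)[OF fx] has_derivative_linear by blast
      have "f' x v \<in> S'"
        by (rule derivative_in_subspace[OF U x v f'(1)[OF x]]) (use fV VS' S' in auto)
      then have "g' (f x) (f' x v) = g' (f x) (\<Sum>b\<in>onb S'. (f' x v \<bullet> b) *\<^sub>R b)"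
        using onb_expand[OF S'] by simp
      then show "(\<Sum>b\<in>onb S'. (f' x v \<bullet> b) *\<^sub>R g' (f x) b) = g' (f x) (f' x v)"
        using lin by (simp add: linear_sum linear_scale)
    qed
  qed
qed

lemma Cinf_on_cong: "Cinf_on S U f \<Longrightarrow> (\<And>x. x \<in> U \<Longrightarrow> f x = g x) \<Longrightarrow> Cinf_on S U g"
  unfolding Cinf_on_def by (auto intro: Ck_on_cong[of _ S U f g])
lemma Cinf_on_mono: "Cinf_on S U f \<Longrightarrow> S' \<subseteq> S \<Longrightarrow> U' \<subseteq> U \<Longrightarrow> Cinf_on S' U' f"
  unfolding Cinf_on_def using Ck_on_mono by blast
lemma Cinf_on_continuous: "Cinf_on S U f \<Longrightarrow> continuous_on U f"
  unfolding Cinf_on_def using Ck_on_continuous by blast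
lemma Cinf_on_local:
  assumes "open_sub S U" "\<And>x. x \<in> U \<Longrightarrow> \<exists>V. openin (top_of_set U) V \<and> x \<in> V \<and> Cinf_on S V f"
  shows "Cinf_on S U f"
  unfolding Cinf_on_def
proof (rule allI, rule Ck_on_local[OF assms(1)])
  fix k x assume "x \<in> U"
  then show "\<exists>V. openin (top_of_set U) V \<and> x \<in> V \<and> Ck_on k S V f"
    using assms(2)[of x] by (auto simp: Cinf_on_def)
qed
lemma Cinf_on_const: "Cinf_on S U (\<lambda>x. c)"
  by (simp add: Cinf_on_def Ck_on_const)
lemma Cinf_on_linear: "bounded_linear L \<Longrightarrow> Cinf_on S U L"
  by (simp add: Cinf_on_def Ck_on_linear)
lemma Cinf_on_ident: "Cinf_on S U (\<lambda>x. x)"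
  by (rule Cinf_on_linear) (rule bounded_linear_ident)
lemma Cinf_on_linear_comp: "bounded_linear L \<Longrightarrow> Cinf_on S U f \<Longrightarrow> Cinf_on S U (\<lambda>x. L (f x))"
  by (simp add: Cinf_on_def Ck_on_linear_comp)
lemma Cinf_on_add: "Cinf_on S U f \<Longrightarrow> Cinf_on S U g \<Longrightarrow> Cinf_on S U (\<lambda>x. f x + g x)"
  by (simp add: Cinf_on_def Ck_on_add)
lemma Cinf_on_diff: "Cinf_on S U f \<Longrightarrow> Cinf_on S U g \<Longrightarrow> Cinf_on S U (\<lambda>x. f x - g x)"
  by (simp add: Cinf_on_def Ck_on_diff)
lemma Cinf_on_sum: "(\<And>i. i \<in> I \<Longrightarrow> Cinf_on S U (f i)) \<Longrightarrow> Cinf_on S U (\<lambda>x. \<Sum>i\<in>I. f i x)"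
  by (simp add: Cinf_on_def Ck_on_sum)
lemma Cinf_on_mult:
  fixes f g :: "'e::real_normed_vector \<Rightarrow> real"
  shows "Cinf_on S U f \<Longrightarrow> Cinf_on S U g \<Longrightarrow> Cinf_on S U (\<lambda>x. f x * g x)"
  by (simp add: Cinf_on_def Ck_on_mult)
lemma Cinf_on_inner: "Cinf_on S U f \<Longrightarrow> Cinf_on S U g \<Longrightarrow> Cinf_on S U (\<lambda>x. f x \<bullet> g x)"
  by (simp add: Cinf_on_def Ck_on_inner)
lemma Cinf_on_inverse:
  fixes f :: "'e::real_normed_vector \<Rightarrow> real"
  shows "Cinf_on S U f \<Longrightarrow> (\<And>x. x \<in> U \<Longrightarrow> f x \<noteq> 0) \<Longrightarrow> Cinf_on S U (\<lambda>x. inverse (f x))"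
  by (simp add: Cinf_on_def Ck_on_inverse)
lemma Cinf_on_compose:
  fixes f :: "'e::real_normed_vector \<Rightarrow> 'f::euclidean_space" and g :: "'f \<Rightarrow> 'b::real_normed_vector"
  assumes "open_sub S U" "open_sub S' V" "f ` U \<subseteq> V" "Cinf_on S U f" "Cinf_on S' V g"
  shows "Cinf_on S U (\<lambda>x. g (f x))"
  using Ck_on_compose[OF assms(1-3), of _ g] assms(4,5) by (simp add: Cinf_on_def)
lemma Cinf_on_dird:
  assumes "open_sub S U" "Cinf_on S U f" "v \<in> S"
  shows "Cinf_on S U (\<lambda>x. dird f x v)"
  unfolding Cinf_on_def
proof
  fix k
  have "Ck_on (Suc k) S U f" using assms(2) unfolding Cinf_on_def by blast
  then show "Ck_on k S U (\<lambda>x. dird f x v)" using Ck_Suc_dird[OF assms(1)] assms(3) by blast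
qed

lemma has_derivative_dird:
  fixes f :: "'e::euclidean_space \<Rightarrow> 'b::real_normed_vector"
  assumes U: "open_sub S U" and x: "x \<in> U" and f: "Cinf_on S U f"
  shows "(f has_derivative (\<lambda>v. \<Sum>b\<in>onb S. (v \<bullet> b) *\<^sub>R dird f x b)) (at x within U)"
proof -
  have S: "subspace S" and US: "U \<subseteq> S" using open_subD[OF U] by auto
  have "Ck_on (Suc 0) S U f" using f unfolding Cinf_on_def by blast
  then obtain f' where f': "(f has_derivative f') (at x within U)" using x unfolding Ck_on.simps(2) by blast
  define P where "P v = (\<Sum>b\<in>onb S. (v \<bullet> b) *\<^sub>R b)" for v
  have bP: "bounded_linear P" unfolding P_def by (intro bounded_linear_intros)
  have PU: "P y = y" if "y \<in> U" for y using onb_expand[OF S] US that unfolding P_def by auto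
  have "(P has_derivative P) (at x within U)" using bP by (rule bounded_linear_imp_has_derivative)
  moreover have "P ` U = U" using PU by auto
  ultimately have "((\<lambda>y. f (P y)) has_derivative (\<lambda>v. f' (P v))) (at x within U)"
    by (intro has_derivative_in_compose[of P P x U f f']) (simp_all only: PU[OF x] f')
  then have "(f has_derivative (\<lambda>v. f' (P v))) (at x within U)"
    by (rule has_derivative_transform[OF x, rotated]) (use PU in auto)
  moreover have "f' (P v) = (\<Sum>b\<in>onb S. (v \<bullet> b) *\<^sub>R dird f x b)" for v
  proof -
    have "dird f x b = f' b" if "b \<in> onb S" for b
      using dird_eq[OF U x _ f'] onb(1)[OF S] that by blast
    then show ?thesis using has_derivative_linear[OF f'] unfolding P_def by (simp add: linear_sum linear_scale)
  qed
  ultimately show ?thesis by simp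
qed

lemma dird_expand:
  fixes f :: "'e::euclidean_space \<Rightarrow> 'b::real_normed_vector"
  assumes "open_sub S U" "x \<in> U" "Cinf_on S U f" "v \<in> S"
  shows "dird f x v = (\<Sum>b\<in>onb S. (v \<bullet> b) *\<^sub>R dird f x b)"
  by (rule dird_eq[OF assms(1,2,4) has_derivative_dird[OF assms(1-3)]])

lemma has_vector_derivative_dird:
  fixes f :: "'e::euclidean_space \<Rightarrow> 'b::real_normed_vector"
  assumes "open_sub S U" "x \<in> U" "Cinf_on S U f" "v \<in> S"
  shows "((\<lambda>t. f (x + t *\<^sub>R v)) has_vector_derivative dird f x v) (at 0)"
  using has_derivative_line[OF assms(1,2,4) has_derivative_dird[OF assms(1-3)]] dird_expand[OF assms] by simp

lemma dird_compose:
  fixes f :: "'e::euclidean_space \<Rightarrow> 'f::euclidean_space" and g :: "'f \<Rightarrow> 'b::real_normed_vector"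
  assumes U: "open_sub S U" and V: "open_sub S' V" and fV: "f ` U \<subseteq> V" and f: "Cinf_on S U f" and g: "Cinf_on S' V g"
    and x: "x \<in> U" and v: "v \<in> S"
  shows "dird (\<lambda>x. g (f x)) x v = dird g (f x) (dird f x v)" "dird f x v \<in> S'"
proof -
  have fx: "f x \<in> V" using fV x by auto
  note df = has_derivative_dird[OF U x f] and dg = has_derivative_dird[OF V fx g]
  show inS: "dird f x v \<in> S'"
    unfolding dird_expand[OF U x f v]
    by (rule derivative_in_subspace[OF U x v df]) (use fV open_subD[OF V] in auto)
  have "((\<lambda>x. g (f x)) has_derivative (\<lambda>v. \<Sum>b\<in>onb S'. ((\<Sum>b\<in>onb S. (v \<bullet> b) *\<^sub>R dird f x b) \<bullet> b) *\<^sub>R dird g (f x) b)) (at x within U)"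
    by (rule has_derivative_in_compose[OF df has_derivative_subset[OF dg fV]])
  from dird_eq[OF U x v this]
  show "dird (\<lambda>x. g (f x)) x v = dird g (f x) (dird f x v)"
    by (simp only: dird_expand[OF U x f v, symmetric] dird_expand[OF V fx g inS, symmetric])
qed

lemma dird_linear:
  assumes "bounded_linear L" shows "dird L x v = L v"
  unfolding dird_def
proof (rule vector_derivative_at)
  interpret bounded_linear L by fact
  show "((\<lambda>t. L (x + t *\<^sub>R v)) has_vector_derivative L v) (at 0)"
    unfolding has_vector_derivative_def add scaleR
    by (rule has_derivative_eq_rhs, rule has_derivative_add, rule has_derivative_const,
        rule has_derivative_scaleR_left, rule has_derivative_ident) simp
qed

lemma dird_cong:
  assumes "open_sub S U" "x \<in> U" "v \<in> S" "\<And>y. y \<in> U \<Longrightarrow> f y = g y"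
  shows "dird f x v = dird g x v"
proof -
  obtain e where e: "e > 0" "\<And>t. \<bar>t\<bar> < e \<Longrightarrow> x + t *\<^sub>R v \<in> U"
    using open_sub_line[OF assms(1-3)] by blast
  have "eventually (\<lambda>t. t \<in> ball (0::real) e) (nhds 0)" using e(1) by (intro eventually_nhds_in_open) auto
  then have "eventually (\<lambda>t. f (x + t *\<^sub>R v) = g (x + t *\<^sub>R v)) (nhds 0)"
    by eventually_elim (use e(2) assms(4) in auto)
  then show ?thesis unfolding dird_def by (intro vector_derivative_cong_eq) auto
qed

section \<open>Hadamard's lemma\<close>

lemma convex_combination_line:
  assumes "convex U" "z \<in> U" "y \<in> U" "t \<in> {0..1::real}"
  shows "z + t *\<^sub>R (y - z) \<in> U"
proof -
  have "z + t *\<^sub>R (y - z) = (1 - t) *\<^sub>R z + t *\<^sub>R y" by (simp add: algebra_simps)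
  then show ?thesis using assms convexD[OF assms(1-3), of "1 - t" t] by simp
qed

text \<open>
  Differentiation under the integral sign. The inner derivative contributes a factor \<open>t\<close>, so with the
  weights \<open>t ^ j\<close> the partial derivatives are integrals of the same kind and smoothness follows by
  induction.
\<close>

lemma has_derivative_segment_average:
  fixes f :: "'e::euclidean_space \<Rightarrow> real"
  assumes U: "open_sub S U" "convex U" and z: "z \<in> U" and f: "Cinf_on S U f" and x0: "x0 \<in> U"
  shows "((\<lambda>y. integral {0..1} (\<lambda>t. t ^ j * f (z + t *\<^sub>R (y - z)))) has_derivative
    (\<lambda>v. \<Sum>b\<in>onb S. (v \<bullet> b) * integral {0..1} (\<lambda>t. t ^ Suc j * dird f (z + t *\<^sub>R (x0 - z)) b))) (at x0 within U)"
proof -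
  have S: "subspace S" using open_subD[OF U(1)] by auto
  have B: "finite (onb S)" "onb S \<subseteq> S" using onb[OF S] by auto
  define F where "F y t = t ^ j * f (z + t *\<^sub>R (y - z))" for y t
  define c where "c b y t = t ^ Suc j * dird f (z + t *\<^sub>R (y - z)) b" for b y and t :: real
  define F' where "F' y t = (\<Sum>b\<in>onb S. c b y t *\<^sub>R blinfun_inner_left b)" for y t
  have mem: "z + t *\<^sub>R (y - z) \<in> U" if "y \<in> U" "t \<in> {0..1}" for y t
    using convex_combination_line[OF U(2) z] that by blast
  have cc: "continuous_on (U \<times> {0..1}) (\<lambda>(y, t). c b y t)" if "b \<in> onb S" for b
  proof -
    have "continuous_on U (\<lambda>x. dird f x b)"
      using Cinf_on_continuous[OF Cinf_on_dird[OF U(1) f]] that B by blast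
    then have "continuous_on (U \<times> {0..1}) (\<lambda>p. dird f (z + snd p *\<^sub>R (fst p - z)) b)"
      by (rule continuous_on_compose2) (auto intro!: continuous_intros mem)
    then show ?thesis unfolding c_def case_prod_unfold by (intro continuous_intros)
  qed
  have cF': "continuous_on (U \<times> {0..1}) (\<lambda>(y, t). F' y t)"
    unfolding F'_def case_prod_unfold
    by (intro continuous_on_sum continuous_on_scaleR continuous_on_const) (use cc in \<open>simp add: case_prod_unfold\<close>)
  have dF: "((\<lambda>y. F y t) has_derivative blinfun_apply (F' y t)) (at y within U)" if y: "y \<in> U" and t: "t \<in> {0..1}" for y t
  proof -
    have 1: "((\<lambda>y. z + t *\<^sub>R (y - z)) has_derivative (\<lambda>v. t *\<^sub>R v)) (at y within U)"
      by (auto intro!: derivative_eq_intros)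
    have "(f has_derivative (\<lambda>v. \<Sum>b\<in>onb S. (v \<bullet> b) *\<^sub>R dird f (z + t *\<^sub>R (y - z)) b)) (at (z + t *\<^sub>R (y - z)) within (\<lambda>y. z + t *\<^sub>R (y - z)) ` U)"
      by (rule has_derivative_subset[OF has_derivative_dird[OF U(1) mem[OF y t] f]]) (use mem t in auto)
    from has_derivative_mult_right[OF has_derivative_in_compose[OF 1 this], of "t ^ j"]
    have "((\<lambda>y. F y t) has_derivative (\<lambda>v. t ^ j * (\<Sum>b\<in>onb S. ((t *\<^sub>R v) \<bullet> b) *\<^sub>R dird f (z + t *\<^sub>R (y - z)) b))) (at y within U)"
      unfolding F_def .
    then show ?thesis
      by (rule has_derivative_eq_rhs)
        (auto simp: fun_eq_iff F'_def c_def blinfun.sum_left blinfun.scaleR_left sum_distrib_left inner_commute mult_ac intro!: sum.cong)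
  qed
  have iF: "F y integrable_on cbox 0 1" if y: "y \<in> U" for y
  proof -
    have "continuous_on {0..1} (F y)"
      unfolding F_def using Cinf_on_continuous[OF f]
      by (auto intro!: continuous_intros continuous_on_compose2[of U f] mem y)
    then show ?thesis by (simp add: integrable_continuous_interval)
  qed
  have ic: "c b x0 integrable_on {0..1}" if "b \<in> onb S" for b
  proof -
    have "continuous_on {0..1} (\<lambda>t. case (x0, t) of (y, t) \<Rightarrow> c b y t)"
      by (rule continuous_on_compose2[OF cc[OF that]]) (use x0 in \<open>auto intro!: continuous_intros\<close>)
    then show ?thesis by (intro integrable_continuous_interval) (simp add: eta_contract_eq)
  qed
  have iF': "F' x0 integrable_on {0..1}"
    unfolding F'_def using ic by (intro integrable_sum B integrable_on_scaleR_left) auto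
  have "((\<lambda>y. integral (cbox 0 1) (F y)) has_derivative blinfun_apply (integral (cbox 0 1) (F' x0))) (at x0 within U)"
    by (rule leibniz_rule[where fx = F']) (use dF iF cF' x0 U(2) in auto)
  then have "((\<lambda>y. integral {0..1} (\<lambda>t. t ^ j * f (z + t *\<^sub>R (y - z)))) has_derivative
      blinfun_apply (integral (cbox 0 1) (F' x0))) (at x0 within U)"
    unfolding F_def[abs_def] by simp
  then show ?thesis
  proof (rule has_derivative_eq_rhs)
    show "blinfun_apply (integral (cbox 0 1) (F' x0)) = (\<lambda>v. \<Sum>b\<in>onb S. (v \<bullet> b) * integral {0..1} (\<lambda>t. t ^ Suc j * dird f (z + t *\<^sub>R (x0 - z)) b))"
    proof
      fix v
      have "blinfun_apply (integral {0..1} (F' x0)) v = integral {0..1} (\<lambda>t. F' x0 t v)"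
        using iF' by (simp add: blinfun_apply_integral)
      also have "\<dots> = integral {0..1} (\<lambda>t. \<Sum>b\<in>onb S. (v \<bullet> b) * c b x0 t)"
        by (auto simp: F'_def blinfun.sum_left blinfun.scaleR_left inner_commute mult_ac)
      also have "\<dots> = (\<Sum>b\<in>onb S. integral {0..1} (\<lambda>t. (v \<bullet> b) * c b x0 t))"
        by (rule integral_sum[OF B(1)]) (use ic in \<open>auto intro: integrable_on_mult_right\<close>)
      finally show "blinfun_apply (integral (cbox 0 1) (F' x0)) v = (\<Sum>b\<in>onb S. (v \<bullet> b) * integral {0..1} (\<lambda>t. t ^ Suc j * dird f (z + t *\<^sub>R (x0 - z)) b))"
        by (simp add: c_def)
    qed
  qed
qed

lemma Ck_on_segment_average:
  fixes f :: "'e::euclidean_space \<Rightarrow> real"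
  assumes U: "open_sub S U" "convex U" and z: "z \<in> U" and f: "Cinf_on S U f"
  shows "Ck_on k S U (\<lambda>y. integral {0..1} (\<lambda>t. t ^ j * f (z + t *\<^sub>R (y - z))))"
  using f
proof (induction k arbitrary: f j)
  case 0
  then show ?case
    using has_derivative_continuous[OF has_derivative_segment_average[OF U z 0]]
    by (simp add: continuous_on_eq_continuous_within)
next
  case (Suc k)
  have B: "onb S \<subseteq> S" using onb open_subD[OF U(1)] by auto
  show ?case
    by (rule Ck_on_SucI[OF has_derivative_segment_average[OF U z Suc.prems]])
      (use B in \<open>auto intro!: Ck_on_sum Ck_on_mult Ck_on_const Suc.IH Cinf_on_dird[OF U(1) Suc.prems] simp del: power_Suc\<close>)
qed

text \<open>
  Integrate the derivative of \<open>f\<close> along the segment from \<open>z\<close> to \<open>y\<close>. The coefficients are the averages of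
  the partial derivatives over the segment.
\<close>

lemma Hadamard:
  fixes f :: "'e::euclidean_space \<Rightarrow> real"
  assumes U: "open_sub S U" "convex U" and z: "z \<in> U" and f: "Cinf_on S U f"
  obtains g where "\<And>b. b \<in> onb S \<Longrightarrow> Cinf_on S U (g b)"
    "\<And>y. y \<in> U \<Longrightarrow> f y = f z + (\<Sum>b\<in>onb S. ((y - z) \<bullet> b) * g b y)"
    "\<And>b. b \<in> onb S \<Longrightarrow> g b z = dird f z b"
proof -
  have S: "subspace S" and US: "U \<subseteq> S" using open_subD[OF U(1)] by auto
  have B: "finite (onb S)" "onb S \<subseteq> S" using onb[OF S] by auto
  define g where "g b y = integral {0..1} (\<lambda>t. t ^ 0 * dird f (z + t *\<^sub>R (y - z)) b)" for b y
  have mem: "z + t *\<^sub>R (y - z) \<in> U" if "y \<in> U" "t \<in> {0..1}" for y t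
    using convex_combination_line[OF U(2) z] that by blast
  show thesis
  proof (rule that)
    show "Cinf_on S U (g b)" if "b \<in> onb S" for b
      unfolding Cinf_on_def g_def
      using Ck_on_segment_average[OF U z Cinf_on_dird[OF U(1) f]] that B by blast
    show "g b z = dird f z b" for b by (simp add: g_def)
  next
    fix y assume y: "y \<in> U"
    have cd: "continuous_on {0..1} (\<lambda>t. dird f (z + t *\<^sub>R (y - z)) b)" if "b \<in> onb S" for b
      by (rule continuous_on_compose2[OF Cinf_on_continuous[OF Cinf_on_dird[OF U(1) f]]])
        (use that B mem y in \<open>auto intro!: continuous_intros\<close>)
    have "((\<lambda>t. \<Sum>b\<in>onb S. ((y - z) \<bullet> b) * dird f (z + t *\<^sub>R (y - z)) b) has_integral
        (f (z + 1 *\<^sub>R (y - z)) - f (z + 0 *\<^sub>R (y - z)))) {0..1}"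
    proof (rule fundamental_theorem_of_calculus)
      fix t :: real assume t: "t \<in> {0..1}"
      have 1: "((\<lambda>t. z + t *\<^sub>R (y - z)) has_derivative (\<lambda>s. s *\<^sub>R (y - z))) (at t within {0..1})"
        by (auto intro!: derivative_eq_intros)
      have 2: "(f has_derivative (\<lambda>v. \<Sum>b\<in>onb S. (v \<bullet> b) *\<^sub>R dird f (z + t *\<^sub>R (y - z)) b)) (at (z + t *\<^sub>R (y - z)) within (\<lambda>t. z + t *\<^sub>R (y - z)) ` {0..1})"
        by (rule has_derivative_subset[OF has_derivative_dird[OF U(1) mem[OF y t] f]]) (use mem y in auto)
      show "((\<lambda>t. f (z + t *\<^sub>R (y - z))) has_vector_derivative (\<Sum>b\<in>onb S. ((y - z) \<bullet> b) * dird f (z + t *\<^sub>R (y - z)) b)) (at t within {0..1})"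
        unfolding has_vector_derivative_def
        by (rule has_derivative_eq_rhs[OF has_derivative_in_compose[OF 1 2]])
          (auto simp: fun_eq_iff sum_distrib_left mult_ac)
    qed simp
    then have "f y - f z = integral {0..1} (\<lambda>t. \<Sum>b\<in>onb S. ((y - z) \<bullet> b) * dird f (z + t *\<^sub>R (y - z)) b)"
      by (simp add: integral_unique)
    also have "\<dots> = (\<Sum>b\<in>onb S. integral {0..1} (\<lambda>t. ((y - z) \<bullet> b) * dird f (z + t *\<^sub>R (y - z)) b))"
      by (rule integral_sum[OF B(1)]) (use cd in \<open>auto intro!: integrable_continuous_interval continuous_intros\<close>)
    finally show "f y = f z + (\<Sum>b\<in>onb S. ((y - z) \<bullet> b) * g b y)"
      by (simp add: g_def)
  qed
qed

section \<open>Cutoff functions\<close>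

text \<open>
  The derivatives of \<open>exp (-1/t)\<close>, extended by zero, are combinations of these functions. Hence the
  family is closed under differentiation, and smoothness of its members is an induction.
\<close>

definition flat_exp :: "nat \<Rightarrow> real \<Rightarrow> real" where
  "flat_exp n t = (if t > 0 then exp (- inverse t) * inverse t ^ n else 0)"

lemma flat_exp_tendsto: "(flat_exp n \<longlongrightarrow> 0) (at 0)"
proof -
  have "((\<lambda>u. u ^ n / exp u) \<longlongrightarrow> (0::real)) at_top" by (rule tendsto_power_div_exp_0)
  then have "((\<lambda>t. inverse t ^ n / exp (inverse t)) \<longlongrightarrow> (0::real)) (at_right 0)"
    by (rule filterlim_compose) (rule filterlim_inverse_at_top_right)
  then have r: "(flat_exp n \<longlongrightarrow> 0) (at_right 0)"
  proof (rule Lim_transform_eventually)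
    show "eventually (\<lambda>t. inverse t ^ n / exp (inverse t) = flat_exp n t) (at_right 0)"
      unfolding eventually_at_filter by (rule always_eventually) (auto simp: flat_exp_def exp_minus divide_inverse)
  qed
  have l: "(flat_exp n \<longlongrightarrow> 0) (at_left 0)"
    by (rule Lim_transform_eventually[OF tendsto_const])
      (auto simp: eventually_at_filter flat_exp_def intro!: always_eventually)
  show ?thesis using r l by (simp add: filterlim_at_split)
qed

lemma DERIV_flat_exp: "DERIV (flat_exp n) t :> flat_exp (n + 2) t - real n * flat_exp (n + 1) t"
proof (cases "t = 0")
  case True
  have "((\<lambda>h. flat_exp n h / h) \<longlongrightarrow> 0) (at 0)"
  proof (rule Lim_transform_eventually[OF flat_exp_tendsto[of "Suc n"]])
    show "eventually (\<lambda>h. flat_exp (Suc n) h = flat_exp n h / h) (at 0)"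
      unfolding eventually_at_filter by (rule always_eventually) (auto simp: flat_exp_def divide_inverse)
  qed
  then show ?thesis using True by (simp add: DERIV_def flat_exp_def)
next
  case False
  show ?thesis
  proof (cases "t > 0")
    case True
    have e: "eventually (\<lambda>x. x \<in> {0<..}) (nhds t)" using True by (intro eventually_nhds_in_open) auto
    have 1: "DERIV (\<lambda>t. exp (- inverse t)) t :> exp (- inverse t) * inverse t ^ 2"
      using True by (auto intro!: derivative_eq_intros simp: power2_eq_square)
    have 2: "DERIV (\<lambda>t. inverse t ^ n) t :> - (real n * inverse t ^ (n + 1))"
    proof (rule DERIV_cong[OF DERIV_power[OF DERIV_inverse]])
      show "real n * (- (inverse t ^ Suc (Suc 0)) * inverse t ^ (n - Suc 0)) = - (real n * inverse t ^ (n + 1))"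
        by (cases n) simp_all
    qed (use True in simp)
    have "DERIV (\<lambda>t. exp (- inverse t) * inverse t ^ n) t :> flat_exp (n + 2) t - real n * flat_exp (n + 1) t"
      by (rule DERIV_cong[OF DERIV_mult[OF 1 2]])
        (use True in \<open>simp add: flat_exp_def power_add power2_eq_square algebra_simps\<close>)
    moreover have "eventually (\<lambda>x. flat_exp n x = exp (- inverse x) * inverse x ^ n) (nhds t)"
      using e by eventually_elim (auto simp: flat_exp_def)
    ultimately show ?thesis using DERIV_cong_ev[of t t "flat_exp n"] by simp
  next
    case F: False
    have e: "eventually (\<lambda>x. x \<in> {..<0}) (nhds t)" using F False by (intro eventually_nhds_in_open) auto
    have "DERIV (\<lambda>t. 0) t :> flat_exp (n + 2) t - real n * flat_exp (n + 1) t"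
      using F by (simp add: flat_exp_def)
    moreover have "eventually (\<lambda>x. flat_exp n x = 0) (nhds t)"
      using e by eventually_elim (auto simp: flat_exp_def)
    ultimately show ?thesis using DERIV_cong_ev[of t t "flat_exp n" "\<lambda>t. 0"] by simp
  qed
qed

lemma Ck_on_flat_exp: "Ck_on k S U (flat_exp n)"
proof (induction k arbitrary: n)
  case 0
  show ?case by (auto intro!: DERIV_continuous_on[OF DERIV_subset[OF DERIV_flat_exp]])
next
  case (Suc k)
  show ?case
  proof (rule Ck_on_SucI)
    fix x
    show "(flat_exp n has_derivative (\<lambda>v. (flat_exp (n + 2) x - real n * flat_exp (n + 1) x) * v)) (at x within U)"
      using DERIV_subset[OF DERIV_flat_exp[of n x], of U] by (simp add: has_field_derivative_def)
    fix v
    show "Ck_on k S U (\<lambda>x. (flat_exp (n + 2) x - real n * flat_exp (n + 1) x) * v)"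
      by (intro Ck_on_mult Ck_on_diff Ck_on_const Suc)
  qed
qed

text \<open>
  The numerator vanishes for \<open>t \<ge> 2\<close>, and the second term of the denominator for \<open>t \<le> 1\<close>.
\<close>

definition cutoff :: "real \<Rightarrow> real" where
  "cutoff t = flat_exp 0 (2 - t) * inverse (flat_exp 0 (2 - t) + flat_exp 0 (t - 1))"

lemma cutoff_denominator: "flat_exp 0 (2 - t) + flat_exp 0 (t - 1) > 0"
  by (auto simp: flat_exp_def intro: add_pos_pos)

lemma cutoff_1: "t \<le> 1 \<Longrightarrow> cutoff t = 1" and cutoff_0: "t \<ge> 2 \<Longrightarrow> cutoff t = 0"
  using cutoff_denominator[of t] by (auto simp: cutoff_def flat_exp_def)

lemma Cinf_on_cutoff: "Cinf_on S U cutoff"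
proof -
  have U: "open_sub UNIV (UNIV::real set)" by (simp add: open_sub_def)
  have f: "Cinf_on UNIV UNIV (flat_exp 0)" using Ck_on_flat_exp by (simp add: Cinf_on_def)
  have "Cinf_on UNIV UNIV (\<lambda>t. flat_exp 0 (2 - t))" "Cinf_on UNIV UNIV (\<lambda>t. flat_exp 0 (t - 1))"
    by (rule Cinf_on_compose[OF U U _ _ f]; auto intro!: Cinf_on_diff Cinf_on_const Cinf_on_ident)+
  then have "Cinf_on UNIV UNIV cutoff" unfolding cutoff_def
    using cutoff_denominator by (intro Cinf_on_mult Cinf_on_inverse Cinf_on_add) (auto simp: less_imp_neq[symmetric])
  then show ?thesis by (rule Cinf_on_mono) auto
qed

text \<open>The squared distance is used because, unlike the norm, it is smooth at the centre.\<close>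

lemma Cinf_on_bump:
  assumes "open_sub S U"
  shows "Cinf_on S U (\<lambda>y. cutoff (((y - z) \<bullet> (y - z)) / r\<^sup>2))"
proof (rule Cinf_on_compose[OF assms _ _ _ Cinf_on_cutoff])
  show "open_sub UNIV (UNIV::real set)" by (simp add: open_sub_def)
  show "Cinf_on S U (\<lambda>y. ((y - z) \<bullet> (y - z)) / r\<^sup>2)"
    unfolding divide_inverse
    by (intro Cinf_on_mult Cinf_on_inner Cinf_on_diff Cinf_on_const Cinf_on_ident)
qed simp

section \<open>The smooth inverse function theorem and the local form of a submersion\<close>

text \<open>
  Where one factor of a product vanishes, its derivative requires only continuity of the other. This
  gives the derivative of an inverse operator before the inverse is known to be differentiable.
\<close>

lemma has_derivative_vanishing_scaleR:
  fixes f :: "'e::real_normed_vector \<Rightarrow> real" and g :: "'e \<Rightarrow> 'b::real_normed_vector"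
  assumes f: "(f has_derivative f') (at x within U)" "f x = 0" and g: "(g \<longlongrightarrow> g x) (at x within U)"
  shows "((\<lambda>y. f y *\<^sub>R g y) has_derivative (\<lambda>v. f' v *\<^sub>R g x)) (at x within U)"
proof -
  have bl: "bounded_linear f'" using f(1) has_derivative_bounded_linear by blast
  then obtain K where K: "\<And>v. norm (f' v) \<le> norm v * K" using bounded_linear.bounded by blast
  define e where "e y = norm (f y - f' (y - x)) / norm (y - x)" for y
  have e: "(e \<longlongrightarrow> 0) (at x within U)"
    using f unfolding has_derivative_iff_norm e_def by simp
  have n: "((\<lambda>y. (e y + K) * norm (g y - g x)) \<longlongrightarrow> (0 + K) * norm (g x - g x)) (at x within U)"
    by (intro tendsto_intros e g)
  have le: "norm (norm (f y *\<^sub>R (g y - g x)) / norm (y - x)) \<le> (e y + K) * norm (g y - g x)" if "y \<noteq> x" for y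
  proof -
    have p: "norm (y - x) > 0" using that by simp
    have "\<bar>f y\<bar> \<le> norm (f y - f' (y - x)) + norm (f' (y - x))"
      using norm_triangle_ineq[of "f y - f' (y - x)" "f' (y - x)"] by simp
    also have "\<dots> \<le> norm (f y - f' (y - x)) + norm (y - x) * K" using K by auto
    also have "\<dots> = (e y + K) * norm (y - x)" using p by (simp add: e_def algebra_simps)
    finally have "\<bar>f y\<bar> / norm (y - x) \<le> e y + K" using p by (simp add: pos_divide_le_eq)
    then have "\<bar>f y\<bar> / norm (y - x) * norm (g y - g x) \<le> (e y + K) * norm (g y - g x)"
      by (rule mult_right_mono) simp
    then show ?thesis by simp
  qed
  have "((\<lambda>y. norm (f y *\<^sub>R (g y - g x)) / norm (y - x)) \<longlongrightarrow> 0) (at x within U)"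
  proof (rule Lim_null_comparison[OF _ n[simplified]])
    show "eventually (\<lambda>y. norm (norm (f y *\<^sub>R (g y - g x)) / norm (y - x)) \<le> (e y + K) * norm (g y - g x)) (at x within U)"
      unfolding eventually_at_filter by (rule always_eventually) (use le in blast)
  qed
  then have h: "((\<lambda>y. f y *\<^sub>R (g y - g x)) has_derivative (\<lambda>v. 0)) (at x within U)"
    using f(2) by (simp add: has_derivative_iff_norm)
  have "((\<lambda>y. f y *\<^sub>R g x + f y *\<^sub>R (g y - g x)) has_derivative (\<lambda>v. f' v *\<^sub>R g x + 0)) (at x within U)"
    by (intro has_derivative_add h has_derivative_scaleR_left f)
  then show ?thesis by (simp add: algebra_simps)
qed

lemma linear_onb_expand:
  fixes A :: "'e::euclidean_space \<Rightarrow> 'b::real_vector"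
  assumes "linear A" shows "A u = (\<Sum>c\<in>onb UNIV. (u \<bullet> c) *\<^sub>R A c)"
proof -
  have "A u = A (\<Sum>c\<in>onb UNIV. (u \<bullet> c) *\<^sub>R c)" using onb_expand[of UNIV u] by simp
  then show ?thesis using assms by (simp add: linear_sum linear_scale)
qed

text \<open>
  An invertible operator is bounded below by some \<open>c > 0\<close>, and nearby operators are then bounded below
  by \<open>c / 2\<close>. With \<open>u = inv (A x) w - inv (A x0) w\<close> this bounds \<open>u\<close> by \<open>A x u\<close>, which is
  \<open>(A x0 - A x) (inv (A x0) w)\<close> and tends to zero.
\<close>

lemma continuous_inverse_operator:
  fixes A :: "'x::real_normed_vector \<Rightarrow> 'e::euclidean_space \<Rightarrow> 'e"
  assumes lin: "\<And>x. x \<in> U \<Longrightarrow> linear (A x)" and bij: "\<And>x. x \<in> U \<Longrightarrow> bij (A x)"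
    and cont: "\<And>v. continuous_on U (\<lambda>x. A x v)"
  shows "continuous_on U (\<lambda>x. inv (A x) w)"
  unfolding continuous_on
proof
  fix x0 assume x0: "x0 \<in> U"
  obtain c where c: "c > 0" "\<And>u. norm (A x0 u) \<ge> c * norm u"
    using linear_inj_bounded_below_pos[OF lin[OF x0] bij_is_inj[OF bij[OF x0]]] by blast
  define d where "d x = (\<Sum>b\<in>onb UNIV. norm (A x b - A x0 b))" for x
  have d: "norm (A x u - A x0 u) \<le> norm u * d x" if "x \<in> U" for x u
  proof -
    have "A x u - A x0 u = (\<Sum>b\<in>onb UNIV. (u \<bullet> b) *\<^sub>R (A x b - A x0 b))"
      using linear_onb_expand[OF lin[OF that], of u] linear_onb_expand[OF lin[OF x0], of u]
      by (simp add: scaleR_diff_right sum_subtractf)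
    also have "norm \<dots> \<le> (\<Sum>b\<in>onb UNIV. norm u * norm (A x b - A x0 b))"
    proof (rule order_trans[OF norm_sum sum_mono])
      fix b :: 'e assume "b \<in> onb UNIV"
      then have "\<bar>u \<bullet> b\<bar> \<le> norm u" using Cauchy_Schwarz_ineq2[of u b] onb(3)[of UNIV b] by simp
      then show "norm ((u \<bullet> b) *\<^sub>R (A x b - A x0 b)) \<le> norm u * norm (A x b - A x0 b)"
        by (simp add: mult_right_mono)
    qed
    finally show ?thesis by (simp add: d_def sum_distrib_left)
  qed
  have dl: "(d \<longlongrightarrow> (\<Sum>b\<in>onb (UNIV::'e set). norm (A x0 b - A x0 b))) (at x0 within U)"
    unfolding d_def using cont x0 by (intro tendsto_intros) (auto simp: continuous_on)
  then have "eventually (\<lambda>x. d x < c / 2) (at x0 within U)" using c by (intro order_tendstoD(2)[OF dl]) auto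
  then have ev: "eventually (\<lambda>x. norm (inv (A x) w - inv (A x0) w) \<le> 2 / c * norm (A x0 (inv (A x0) w) - A x (inv (A x0) w))) (at x0 within U)"
  proof (rule eventually_mp[rotated])
    show "eventually (\<lambda>x. d x < c / 2 \<longrightarrow> norm (inv (A x) w - inv (A x0) w) \<le> 2 / c * norm (A x0 (inv (A x0) w) - A x (inv (A x0) w))) (at x0 within U)"
      unfolding eventually_at_filter
    proof (rule always_eventually, intro allI impI)
      fix x assume x: "x \<in> U" and dx: "d x < c / 2"
      let ?u = "inv (A x) w - inv (A x0) w"
      have s: "A x (inv (A x) w) = w" "A x0 (inv (A x0) w) = w"
        using bij[OF x] bij[OF x0] by (simp_all add: bij_is_surj surj_f_inv_f)
      have "norm ?u * d x \<le> norm ?u * (c / 2)" using dx by (intro mult_left_mono) auto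
      then have "c / 2 * norm ?u \<le> norm (A x0 ?u) - norm (A x ?u - A x0 ?u)"
        using c(2)[of ?u] d[OF x, of ?u] by (simp add: algebra_simps)
      also have "\<dots> \<le> norm (A x ?u)" using norm_triangle_ineq2[of "A x0 ?u" "A x0 ?u - A x ?u"]
        by (simp add: norm_minus_commute)
      also have "A x ?u = A x0 (inv (A x0) w) - A x (inv (A x0) w)"
        using s lin[OF x] by (simp add: linear_diff)
      finally show "norm ?u \<le> 2 / c * norm (A x0 (inv (A x0) w) - A x (inv (A x0) w))"
        using c(1) by (simp add: field_simps)
    qed
  qed
  have "((\<lambda>x. A x (inv (A x0) w)) \<longlongrightarrow> A x0 (inv (A x0) w)) (at x0 within U)"
    using cont x0 unfolding continuous_on by blast
  then have "((\<lambda>x. 2 / c * norm (A x0 (inv (A x0) w) - A x (inv (A x0) w))) \<longlongrightarrow> 2 / c * norm (A x0 (inv (A x0) w) - A x0 (inv (A x0) w))) (at x0 within U)"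
    by (intro tendsto_intros)
  then have "((\<lambda>x. inv (A x) w - inv (A x0) w) \<longlongrightarrow> 0) (at x0 within U)"
    by (intro Lim_null_comparison[OF ev]) simp
  then show "((\<lambda>x. inv (A x) w) \<longlongrightarrow> inv (A x0) w) (at x0 within U)" by (rule LIM_zero_cancel)
qed

text \<open>
  Write \<open>B x = inv (A x)\<close>. The identity \<open>B y w = u - B y (A y u - w)\<close> for \<open>u = B x w\<close> expresses \<open>B\<close> by a
  product whose second factor vanishes at \<open>x\<close>. Its derivative is \<open>- B A' B\<close>, and the induction
  proceeds because this involves \<open>B\<close> only with one order of differentiability less.
\<close>

lemma Ck_on_inverse_operator:
  fixes A :: "'x::real_normed_vector \<Rightarrow> 'e::euclidean_space \<Rightarrow> 'e"
  assumes lin: "\<And>x. x \<in> U \<Longrightarrow> linear (A x)" and bij: "\<And>x. x \<in> U \<Longrightarrow> bij (A x)"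
    and "\<And>v. Ck_on k S U (\<lambda>x. A x v)"
  shows "Ck_on k S U (\<lambda>x. inv (A x) w)"
  using assms(3)
proof (induction k arbitrary: w)
  case 0
  then have "continuous_on U (\<lambda>x. A x v)" for v by simp
  from continuous_inverse_operator[OF lin bij this] show ?case by simp
next
  case (Suc k)
  let ?B = "\<lambda>x. inv (A x)"
  have s: "A x (?B x w) = w" and i: "?B x (A x w) = w" if "x \<in> U" for x w
    using bij[OF that] by (simp_all add: bij_is_surj surj_f_inv_f bij_is_inj inv_f_f)
  have linB: "linear (?B x)" if "x \<in> U" for x
    by (rule inj_linear_imp_inv_linear[OF lin[OF that] bij_is_inj[OF bij[OF that]]])
  have cA: "continuous_on U (\<lambda>x. A x v)" for v using Ck_on_continuous[OF Suc.prems] .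
  have cB: "continuous_on U (\<lambda>x. ?B x v)" for v by (rule continuous_inverse_operator[OF lin bij cA])
  have IH: "Ck_on k S U (\<lambda>x. ?B x v)" for v by (rule Suc.IH[OF Ck_on_pred[OF Suc.prems]])
  have "\<forall>c. \<exists>a'. (\<forall>x\<in>U. ((\<lambda>x. A x c) has_derivative a' x) (at x within U)) \<and> (\<forall>v\<in>S. Ck_on k S U (\<lambda>x. a' x v))"
    using Suc.prems by simp
  then obtain a' where a': "\<And>c x. x \<in> U \<Longrightarrow> ((\<lambda>x. A x c) has_derivative a' c x) (at x within U)"
     "\<And>c v. v \<in> S \<Longrightarrow> Ck_on k S U (\<lambda>x. a' c x v)" by metis
  define D where "D x v = - (\<Sum>b\<in>onb UNIV. ((\<Sum>c\<in>onb UNIV. (?B x w \<bullet> c) *\<^sub>R a' c x v) \<bullet> b) *\<^sub>R ?B x b)" for x v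
  show ?case
  proof (rule Ck_on_SucI)
    fix x assume x: "x \<in> U"
    define u where "u = ?B x w"
    define q where "q y = (\<Sum>c\<in>onb UNIV. (u \<bullet> c) *\<^sub>R (A y c - A x c))" for y
    have q: "q y = A y u - w" if "y \<in> U" for y
    proof -
      have "A x u = w" using s[OF x] by (simp add: u_def)
      then show ?thesis unfolding q_def using linear_onb_expand[OF lin[OF that], of u] linear_onb_expand[OF lin[OF x], of u]
        by (simp add: scaleR_diff_right sum_subtractf)
    qed
    have dq: "(q has_derivative (\<lambda>v. \<Sum>c\<in>onb UNIV. (u \<bullet> c) *\<^sub>R (a' c x v - 0))) (at x within U)"
      unfolding q_def by (intro has_derivative_sum has_derivative_scaleR_right has_derivative_diff a' x has_derivative_const)
    have "((\<lambda>y. u - (\<Sum>b\<in>onb UNIV. (q y \<bullet> b) *\<^sub>R ?B y b)) has_derivative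
       (\<lambda>v. 0 - (\<Sum>b\<in>onb UNIV. ((\<Sum>c\<in>onb UNIV. (u \<bullet> c) *\<^sub>R (a' c x v - 0)) \<bullet> b) *\<^sub>R ?B x b))) (at x within U)"
      by (intro has_derivative_diff has_derivative_const has_derivative_sum has_derivative_vanishing_scaleR has_derivative_inner_left dq)
        (use cB x in \<open>auto simp: q_def continuous_on\<close>)
    then show "((\<lambda>x. ?B x w) has_derivative D x) (at x within U)"
    proof (rule has_derivative_transform[OF x, rotated, THEN has_derivative_eq_rhs])
      show "(\<lambda>v. 0 - (\<Sum>b\<in>onb UNIV. ((\<Sum>c\<in>onb UNIV. (u \<bullet> c) *\<^sub>R (a' c x v - 0)) \<bullet> b) *\<^sub>R ?B x b)) = D x"
        by (simp add: D_def u_def fun_eq_iff)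
      fix y assume y: "y \<in> U"
      have "(\<Sum>b\<in>onb UNIV. (q y \<bullet> b) *\<^sub>R ?B y b) = ?B y (q y)"
        using linear_onb_expand[OF linB[OF y], of "q y"] by simp
      also have "\<dots> = u - ?B y w" using i[OF y] linB[OF y] q[OF y] by (simp add: linear_diff)
      finally show "?B y w = u - (\<Sum>b\<in>onb UNIV. (q y \<bullet> b) *\<^sub>R ?B y b)" by simp
    qed
  next
    fix v assume v: "v \<in> S"
    show "Ck_on k S U (\<lambda>x. D x v)"
      unfolding D_def
      by (intro Ck_on_uminus Ck_on_sum Ck_on_scaleR IH Ck_on_linear_comp[OF bounded_linear_inner_left] a'(2)[OF v])
  qed
qed

text \<open>
  The derivative of \<open>H\<close> is the inverse operator of the derivative of \<open>G\<close>, evaluated at \<open>H\<close> itself. Hence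
  each order of differentiability of \<open>H\<close> gives the next.
\<close>

lemma Cinf_on_inverse_function:
  fixes G :: "'e::euclidean_space \<Rightarrow> 'e"
  assumes U: "open U" and V: "open V" and G: "Cinf_on UNIV U G"
    and H: "\<And>y. y \<in> V \<Longrightarrow> H y \<in> U"
    and dH: "\<And>y. y \<in> V \<Longrightarrow> (H has_derivative inv (dird G (H y))) (at y)"
    and bij: "\<And>y. y \<in> V \<Longrightarrow> bij (dird G (H y))"
  shows "Cinf_on UNIV V H"
proof -
  have oU: "open_sub UNIV U" and oV: "open_sub UNIV V" using U V by (simp_all add: open_sub_def)
  have lin: "linear (dird G x)" if "x \<in> U" for x
  proof -
    have "dird G x = (\<lambda>v. \<Sum>b\<in>onb UNIV. (v \<bullet> b) *\<^sub>R dird G x b)"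
      using dird_expand[OF oU that G] by blast
    then show ?thesis using has_derivative_linear[OF has_derivative_dird[OF oU that G]] by simp
  qed
  have "Ck_on k UNIV V H" for k
  proof (induction k)
    case 0
    show ?case
      using has_derivative_continuous[OF dH] continuous_at_imp_continuous_at_within
      by (auto simp: continuous_on_eq_continuous_within)
  next
    case (Suc k)
    show ?case
    proof (rule Ck_on_SucI)
      show "(H has_derivative inv (dird G (H y))) (at y within V)" if "y \<in> V" for y
        using dH[OF that] by (rule has_derivative_at_withinI)
      fix v
      have "Ck_on k UNIV V (\<lambda>y. dird G (H y) v)" for v
      proof (rule Ck_on_compose[OF oV oU _ Suc])
        show "Ck_on k UNIV U (\<lambda>x. dird G x v)" using Cinf_on_dird[OF oU G] by (simp add: Cinf_on_def)
      qed (use H in auto)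
      then show "Ck_on k UNIV V (\<lambda>y. inv (dird G (H y)) v)"
        by (intro Ck_on_inverse_operator lin H bij) auto
    qed
  qed
  then show ?thesis by (simp add: Cinf_on_def)
qed

lemma smooth_local_inverse:
  fixes G :: "'e::euclidean_space \<Rightarrow> 'e"
  assumes U: "open U" and z0: "z0 \<in> U" and G: "Cinf_on UNIV U G" and id: "\<And>v. dird G z0 v = v"
  obtains U' V H where "open U'" "U' \<subseteq> U" "z0 \<in> U'" "open V" "homeomorphism U' V G H" "Cinf_on UNIV V H"
proof -
  have oU: "open_sub UNIV U" using U by (simp add: open_sub_def)
  define f' where "f' z = Blinfun (dird G z)" for z
  have dG: "(G has_derivative dird G z) (at z)" if "z \<in> U" for z
  proof -
    have "dird G z = (\<lambda>v. \<Sum>b\<in>onb UNIV. (v \<bullet> b) *\<^sub>R dird G z b)"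
      using dird_expand[OF oU that G] by blast
    then show ?thesis using has_derivative_dird[OF oU that G] at_within_open[OF that U] by simp
  qed
  have f': "blinfun_apply (f' z) = dird G z" if "z \<in> U" for z
    unfolding f'_def by (rule bounded_linear_Blinfun_apply[OF has_derivative_bounded_linear[OF dG[OF that]]])
  have "continuous_on U f'"
  proof (rule continuous_on_blinfun_componentwise)
    fix i :: 'e assume "i \<in> Basis"
    have "continuous_on U (\<lambda>z. dird G z i)"
      by (rule Cinf_on_continuous[OF Cinf_on_dird[OF oU G]]) simp
    then show "continuous_on U (\<lambda>z. blinfun_apply (f' z) i)"
      by (rule continuous_on_eq) (simp add: f')
  qed
  moreover have "id_blinfun o\<^sub>L f' z0 = id_blinfun"
    by (rule blinfun_eqI) (simp add: f'[OF z0] id)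
  ultimately obtain U' V H g' where H: "open U'" "U' \<subseteq> U" "z0 \<in> U'" "open V" "homeomorphism U' V G H"
    "\<And>y. y \<in> V \<Longrightarrow> (H has_derivative (g' y)) (at y)"
    "\<And>y. y \<in> V \<Longrightarrow> g' y = inv (blinfun_apply (f'(H y)))"
    "\<And>y. y \<in> V \<Longrightarrow> bij (blinfun_apply (f'(H y)))"
    using inverse_function_theorem[OF U _ _ z0, of G f' id_blinfun] dG f' by metis
  have HU: "H y \<in> U" if "y \<in> V" for y using H(2,5) that by (auto simp: homeomorphism_def)
  have "Cinf_on UNIV V H"
    by (rule Cinf_on_inverse_function[OF U H(4) G HU]) (use H(6-8) f' HU in auto)
  then show thesis using that H by blast
qed

text \<open>
  Let \<open>l\<close> be a linear right inverse of \<open>L = dP z0\<close>. The map \<open>G z = z + l (P z - P z0 - L (z - z0))\<close> has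
  the identity as derivative at \<open>z0\<close>, so it is a local change of coordinates, and applying \<open>L\<close> shows
  that \<open>P\<close> is affine in the new coordinate. As \<open>G\<close> differs from the identity by elements of \<open>S\<close>, it
  preserves \<open>S\<close>. Composing with the orthogonal projection onto \<open>S\<close> extends \<open>P\<close> to an open set of the
  whole space, where the inverse function theorem applies.
\<close>

lemma submersion_normal_form:
  fixes P :: "'e::euclidean_space \<Rightarrow> 'f::euclidean_space"
  assumes O: "open_sub S \<Omega>" and S': "subspace S'" and P: "Cinf_on S \<Omega> P" and z0: "z0 \<in> \<Omega>"
    and PS: "P ` \<Omega> \<subseteq> S'" and onto: "dird P z0 ` S = S'"
  obtains L l G H \<Omega>1 \<Omega>2 where "bounded_linear L" "bounded_linear l" "\<And>v. v \<in> S \<Longrightarrow> L v = dird P z0 v" "L ` S = S'" "l ` S' \<subseteq> S"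
    "\<And>w. w \<in> S' \<Longrightarrow> L (l w) = w"
    "open_sub S \<Omega>1" "z0 \<in> \<Omega>1" "\<Omega>1 \<subseteq> \<Omega>" "open_sub S \<Omega>2" "G ` \<Omega>1 = \<Omega>2" "H ` \<Omega>2 = \<Omega>1"
    "\<And>z. z \<in> \<Omega>1 \<Longrightarrow> H (G z) = z" "\<And>y. y \<in> \<Omega>2 \<Longrightarrow> G (H y) = y"
    "Cinf_on S \<Omega>1 G" "Cinf_on S \<Omega>2 H" "G z0 = z0" "\<And>z. z \<in> \<Omega>1 \<Longrightarrow> P z = P z0 + L (G z - z0)"
proof -
  have S: "subspace S" and OS: "\<Omega> \<subseteq> S" using open_subD[OF O] by auto
  define L where "L v = (\<Sum>b\<in>onb S. (v \<bullet> b) *\<^sub>R dird P z0 b)" for v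
  have L: "bounded_linear L" unfolding L_def by (intro bounded_linear_intros)
  then have linL: "linear L" by (rule bounded_linear.linear)
  have Ld: "L v = dird P z0 v" if "v \<in> S" for v
    using dird_expand[OF O z0 P that] by (simp add: L_def)
  have LS: "L ` S = S'" using Ld onto by auto
  have "\<forall>b\<in>onb S'. \<exists>s\<in>S. L s = b" using LS onb(1)[OF S'] by (auto simp: image_iff)
  then obtain s where s: "\<And>b. b \<in> onb S' \<Longrightarrow> s b \<in> S" "\<And>b. b \<in> onb S' \<Longrightarrow> L (s b) = b" by metis
  define l where "l w = (\<Sum>b\<in>onb S'. (w \<bullet> b) *\<^sub>R s b)" for w
  have l: "bounded_linear l" unfolding l_def by (intro bounded_linear_intros)
  then have linl: "linear l" by (rule bounded_linear.linear)
  have lS: "l w \<in> S" for w unfolding l_def using s(1) S by (auto intro!: subspace_sum subspace_scale)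
  have Ll: "L (l w) = w" if "w \<in> S'" for w
    using onb_expand[OF S' that] linL s(2) by (simp add: l_def linear_sum linear_scale)
  \<comment> \<open>The orthogonal projection onto \<open>S\<close>.\<close>
  define pr where "pr z = (\<Sum>b\<in>onb S. (z \<bullet> b) *\<^sub>R b)" for z
  have pr: "bounded_linear pr" unfolding pr_def by (intro bounded_linear_intros)
  have prS: "pr z \<in> S" for z unfolding pr_def using S onb(1)[OF S] by (auto intro!: subspace_sum subspace_scale)
  have prid: "pr z = z" if "z \<in> S" for z using onb_expand[OF S that] by (simp add: pr_def)
  obtain T where T: "open T" "\<Omega> = S \<inter> T" using O unfolding open_sub_def openin_open by blast
  define U where "U = pr -` T"
  have U: "open U" unfolding U_def using T(1) linear_continuous_on[OF pr, of UNIV] by (simp add: open_vimage)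
  have oU: "open_sub UNIV U" using U by (simp add: open_sub_def)
  have prU: "pr ` U \<subseteq> \<Omega>" using T(2) prS by (auto simp: U_def)
  have z0S: "z0 \<in> S" using z0 OS by auto
  have z0U: "z0 \<in> U" using z0 T(2) prid[OF z0S] by (simp add: U_def)
  define G where "G z = z + l (P (pr z) - P z0 - L (z - z0))" for z
  have Ppr: "Cinf_on UNIV U (\<lambda>z. P (pr z))"
    by (rule Cinf_on_compose[OF oU O prU Cinf_on_linear[OF pr] P])
  have G: "Cinf_on UNIV U G"
    unfolding G_def
    by (intro Cinf_on_add Cinf_on_ident Cinf_on_linear_comp[OF l] Cinf_on_diff Cinf_on_const Cinf_on_linear_comp[OF L] Ppr)
  have "(P has_derivative L) (at (pr z0) within pr ` U)"
    using has_derivative_subset[OF has_derivative_dird[OF O z0 P] prU] prid[OF z0S] by (simp add: L_def[abs_def])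
  then have dP: "((\<lambda>z. P (pr z)) has_derivative (\<lambda>v. L (pr v))) (at z0 within U)"
    by (rule has_derivative_in_compose[OF bounded_linear_imp_has_derivative[OF pr]])
  have Lpr: "L (pr v) = L v" for v
  proof -
    have "pr v \<bullet> b = v \<bullet> b" if "b \<in> onb S" for b
    proof -
      have "pr v \<bullet> b = (\<Sum>c\<in>onb S. if c = b then v \<bullet> c else 0)"
        unfolding pr_def inner_sum_left by (rule sum.cong) (use onb_inner[OF S _ that] in auto)
      then show ?thesis using that onb(4)[OF S] by simp
    qed
    then show ?thesis by (simp add: L_def)
  qed
  have dG: "(G has_derivative (\<lambda>v. v + l (L (pr v) - 0 - L (v - 0)))) (at z0 within U)"
    unfolding G_def
    by (intro has_derivative_add has_derivative_ident bounded_linear.has_derivative[OF l] bounded_linear.has_derivative[OF L] has_derivative_diff dP has_derivative_const)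
  have id: "dird G z0 v = v" for v
    using dird_eq[OF oU z0U _ dG, of v] Lpr linl by (simp add: linear_0)
  obtain U' V H where H: "open U'" "U' \<subseteq> U" "z0 \<in> U'" "open V" "homeomorphism U' V G H" "Cinf_on UNIV V H"
    using smooth_local_inverse[OF U z0U G id] by blast
  have GS: "G z \<in> S \<longleftrightarrow> z \<in> S" for z
    using S lS unfolding G_def by (metis add_diff_cancel_right' subspace_add subspace_diff)
  have hom: "\<And>z. z \<in> U' \<Longrightarrow> G z \<in> V \<and> H (G z) = z" "\<And>y. y \<in> V \<Longrightarrow> H y \<in> U' \<and> G (H y) = y"
    using H(5) by (auto simp: homeomorphism_def)
  show thesis
  proof (rule that[of L l "S \<inter> U'" "S \<inter> V" G H])
    show "open_sub S (S \<inter> U')" "open_sub S (S \<inter> V)" using S H by (auto simp: open_sub_def openin_open)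
    show "S \<inter> U' \<subseteq> \<Omega>" using H(2) T prid by (auto simp: U_def)
    show "G ` (S \<inter> U') = S \<inter> V" using hom GS by (force simp: image_iff)
    show "H ` (S \<inter> V) = S \<inter> U'" using hom GS by (force simp: image_iff)
    show "Cinf_on S (S \<inter> U') G" by (rule Cinf_on_mono[OF G]) (use H in auto)
    show "Cinf_on S (S \<inter> V) H" by (rule Cinf_on_mono[OF H(6)]) auto
    show "G z0 = z0" using prid[OF z0S] linl linL by (simp add: G_def linear_0)
    fix z assume z: "z \<in> S \<inter> U'"
    then have zO: "z \<in> \<Omega>" and zS: "z \<in> S" using H(2) T prid by (auto simp: U_def)
    have "P z - P z0 - L (z - z0) \<in> S'"
      using PS zO z0 LS zS z0S S S' by (intro subspace_diff[OF S']) (auto intro: subspace_diff)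
    then have "L (G z - z0) = L (z - z0) + (P z - P z0 - L (z - z0))"
      using Ll linL prid[OF zS] by (simp add: G_def linear_add linear_diff)
    then show "P z = P z0 + L (G z - z0)" by simp
  qed (use L l Ld LS lS Ll z0S H(3) hom in auto)
qed

section \<open>Smooth functions and coordinate systems on a manifold\<close>

lemma smooth_manifoldD:
  assumes "smooth_manifold M"
  shows "Hausdorff_space (mtop M)" "subspace (model M)"
    "\<And>U \<phi>. (U, \<phi>) \<in> atlas M \<Longrightarrow> smooth_chart M U \<phi>" "\<And>U \<phi>. (U, \<phi>) \<in> atlas M \<Longrightarrow> top_chart M U \<phi>"
    "\<And>x. x \<in> mpoints M \<Longrightarrow> \<exists>U \<phi>. (U, \<phi>) \<in> atlas M \<and> x \<in> U"
  using assms unfolding smooth_manifold_def smooth_chart_def by blast+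

lemma top_chartD:
  assumes "top_chart M U \<phi>"
  shows "openin (mtop M) U" "U \<subseteq> mpoints M" "inj_on \<phi> U"
    "\<And>y. y \<in> U \<Longrightarrow> inv_into U \<phi> (\<phi> y) = y"
    "continuous_map (subtopology (mtop M) U) (top_of_set (\<phi> ` U)) \<phi>"
    "continuous_map (top_of_set (\<phi> ` U)) (subtopology (mtop M) U) (inv_into U \<phi>)"
proof -
  have h: "homeomorphic_map (subtopology (mtop M) U) (top_of_set (\<phi> ` U)) \<phi>" and o: "openin (mtop M) U"
    using assms by (auto simp: top_chart_def)
  show "openin (mtop M) U" by fact
  show U: "U \<subseteq> mpoints M" using o openin_subset by blast
  show inj: "inj_on \<phi> U"
    using h U by (simp add: homeomorphic_map_def Int_absorb1)
  then show "\<And>y. y \<in> U \<Longrightarrow> inv_into U \<phi> (\<phi> y) = y" by simp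
  show "continuous_map (subtopology (mtop M) U) (top_of_set (\<phi> ` U)) \<phi>"
    using h homeomorphic_imp_continuous_map by blast
  obtain g where g: "homeomorphic_maps (subtopology (mtop M) U) (top_of_set (\<phi> ` U)) \<phi> g"
    using h homeomorphic_map_maps by blast
  then have "continuous_map (top_of_set (\<phi> ` U)) (subtopology (mtop M) U) g"
    by (simp add: homeomorphic_maps_def)
  then show "continuous_map (top_of_set (\<phi> ` U)) (subtopology (mtop M) U) (inv_into U \<phi>)"
  proof (rule continuous_map_eq)
    fix z assume "z \<in> topspace (top_of_set (\<phi> ` U))"
    then obtain y where y: "y \<in> U" "z = \<phi> y" by auto
    then show "g z = inv_into U \<phi> z" using g U inj by (auto simp: homeomorphic_maps_def)
  qed
qed

lemma top_chart_open_sub: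
  assumes "subspace (model M)" "top_chart M U \<phi>" "openin (mtop M) X" "X \<subseteq> U"
  shows "open_sub (model M) (\<phi> ` X)"
proof -
  have h: "homeomorphic_map (subtopology (mtop M) U) (top_of_set (\<phi> ` U)) \<phi>"
    and o: "openin (top_of_set (model M)) (\<phi> ` U)" using assms(2) by (auto simp: top_chart_def)
  have "openin (subtopology (mtop M) U) X" using assms(3,4) by (simp add: openin_subset_topspace_eq openin_subtopology_Int2 inf.absorb_iff2 openin_subtopology) blast
  then have "openin (top_of_set (\<phi> ` U)) (\<phi> ` X)"
    using homeomorphic_imp_open_map[OF h] by (simp add: open_map_def)
  then show ?thesis using o assms(1) openin_trans unfolding open_sub_def by blast
qed

lemma top_chart_vimage_open:
  assumes "top_chart M U \<phi>" "openin (top_of_set (model M)) X"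
  shows "openin (mtop M) {y \<in> U. \<phi> y \<in> X}"
proof -
  have "openin (top_of_set (\<phi> ` U)) (\<phi> ` U \<inter> X)"
  proof -
    have s: "\<phi> ` U \<subseteq> model M" using assms(1) openin_imp_subset unfolding top_chart_def by blast
    obtain T where T: "open T" "X = model M \<inter> T" using assms(2) by (auto simp: openin_open)
    then have "\<phi> ` U \<inter> X = \<phi> ` U \<inter> T" using s by auto
    then show ?thesis using T by (auto simp: openin_open)
  qed
  then have "openin (subtopology (mtop M) U) {y \<in> topspace (subtopology (mtop M) U). \<phi> y \<in> \<phi> ` U \<inter> X}"
    using top_chartD(5)[OF assms(1)] openin_continuous_map_preimage by blast
  moreover have "{y \<in> topspace (subtopology (mtop M) U). \<phi> y \<in> \<phi> ` U \<inter> X} = {y \<in> U. \<phi> y \<in> X}"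
    using top_chartD(2)[OF assms(1)] by auto
  ultimately show ?thesis using openin_trans_full top_chartD(1)[OF assms(1)] by fastforce
qed

lemma smooth_fun_on_atlas:
  assumes "smooth_fun_on M W f" "(U, \<phi>) \<in> atlas M"
  shows "Cinf_on (model M) (\<phi> ` (U \<inter> W)) (\<lambda>z. f (inv_into U \<phi> z))"
  using assms by (auto simp: smooth_fun_on_def o_def)

lemma smooth_fun_onI:
  assumes "\<And>U \<phi>. (U, \<phi>) \<in> atlas M \<Longrightarrow> Cinf_on (model M) (\<phi> ` (U \<inter> W)) (\<lambda>z. f (inv_into U \<phi> z))"
  shows "smooth_fun_on M W f"
  using assms by (auto simp: smooth_fun_on_def o_def)

lemma smooth_fun_on_cong:
  assumes m: "smooth_manifold M" and "smooth_fun_on M W f" "\<And>x. x \<in> W \<Longrightarrow> f x = g x"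
  shows "smooth_fun_on M W g"
proof (rule smooth_fun_onI)
  fix U \<phi> assume a: "(U, \<phi>) \<in> atlas M"
  show "Cinf_on (model M) (\<phi> ` (U \<inter> W)) (\<lambda>z. g (inv_into U \<phi> z))"
    by (rule Cinf_on_cong[OF smooth_fun_on_atlas[OF assms(2) a]])
      (use top_chartD(4)[OF smooth_manifoldD(4)[OF m a]] assms(3) in auto)
qed

lemma smooth_fun_on_mono: "smooth_fun_on M W f \<Longrightarrow> W' \<subseteq> W \<Longrightarrow> smooth_fun_on M W' f"
  by (rule smooth_fun_onI, rule Cinf_on_mono[OF smooth_fun_on_atlas]) auto

lemma smooth_fun_on_const: "smooth_fun_on M W (\<lambda>x. c)"
  by (rule smooth_fun_onI, rule Cinf_on_const)
lemma smooth_fun_on_add: "smooth_fun_on M W f \<Longrightarrow> smooth_fun_on M W g \<Longrightarrow> smooth_fun_on M W (\<lambda>x. f x + g x)"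
  by (rule smooth_fun_onI) (intro Cinf_on_add smooth_fun_on_atlas)
lemma smooth_fun_on_diff: "smooth_fun_on M W f \<Longrightarrow> smooth_fun_on M W g \<Longrightarrow> smooth_fun_on M W (\<lambda>x. f x - g x)"
  by (rule smooth_fun_onI) (intro Cinf_on_diff smooth_fun_on_atlas)
lemma smooth_fun_on_mult: "smooth_fun_on M W f \<Longrightarrow> smooth_fun_on M W g \<Longrightarrow> smooth_fun_on M W (\<lambda>x. f x * g x)"
  by (rule smooth_fun_onI) (intro Cinf_on_mult smooth_fun_on_atlas)
lemma smooth_fun_on_sum: "(\<And>i. i \<in> I \<Longrightarrow> smooth_fun_on M W (f i)) \<Longrightarrow> smooth_fun_on M W (\<lambda>x. \<Sum>i\<in>I. f i x)"
  by (rule smooth_fun_onI) (intro Cinf_on_sum smooth_fun_on_atlas)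

lemma smooth_fun_on_local:
  assumes m: "smooth_manifold M" and W: "openin (mtop M) W"
    and loc: "\<And>x. x \<in> W \<Longrightarrow> \<exists>W'. openin (mtop M) W' \<and> x \<in> W' \<and> smooth_fun_on M W' f"
  shows "smooth_fun_on M W f"
proof (rule smooth_fun_onI)
  fix U \<phi> assume a: "(U, \<phi>) \<in> atlas M"
  note t = smooth_manifoldD(4)[OF m a]
  have oU: "openin (mtop M) U" using top_chartD[OF t] by blast
  show "Cinf_on (model M) (\<phi> ` (U \<inter> W)) (\<lambda>z. f (inv_into U \<phi> z))"
  proof (rule Cinf_on_local)
    show o: "open_sub (model M) (\<phi> ` (U \<inter> W))"
      by (rule top_chart_open_sub[OF smooth_manifoldD(2)[OF m] t]) (use oU W in auto)
    fix z assume "z \<in> \<phi> ` (U \<inter> W)"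
    then obtain y where y: "y \<in> U" "y \<in> W" "z = \<phi> y" by auto
    obtain W' where W': "openin (mtop M) W'" "y \<in> W'" "smooth_fun_on M W' f" using loc[OF y(2)] by blast
    have "open_sub (model M) (\<phi> ` (U \<inter> W \<inter> W'))"
      by (rule top_chart_open_sub[OF smooth_manifoldD(2)[OF m] t]) (use oU W W' in auto)
    then have "openin (top_of_set (\<phi> ` (U \<inter> W))) (\<phi> ` (U \<inter> W \<inter> W'))"
      using o unfolding open_sub_def by (meson Int_lower1 image_mono openin_subset_trans openin_imp_subset)
    moreover have "Cinf_on (model M) (\<phi> ` (U \<inter> W \<inter> W')) (\<lambda>z. f (inv_into U \<phi> z))"
      by (rule Cinf_on_mono[OF smooth_fun_on_atlas[OF W'(3) a]]) auto
    ultimately show "\<exists>V. openin (top_of_set (\<phi> ` (U \<inter> W))) V \<and> z \<in> V \<and> Cinf_on (model M) V (\<lambda>z. f (inv_into U \<phi> z))"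
      using y W'(2) by blast
  qed
qed

text \<open>
  A coordinate system is characterized by what smoothness means in it. It need not belong to the
  atlas, so that coordinates can be changed without enlarging the atlas.
\<close>

definition coord :: "('a, 'e::euclidean_space) manifold \<Rightarrow> 'a set \<Rightarrow> ('a \<Rightarrow> 'e) \<Rightarrow> bool" where
  "coord M W \<kappa> \<longleftrightarrow> top_chart M W \<kappa> \<and>
     (\<forall>W' f. openin (mtop M) W' \<and> W' \<subseteq> W \<longrightarrow>
       (smooth_fun_on M W' f \<longleftrightarrow> Cinf_on (model M) (\<kappa> ` W') (\<lambda>z. f (inv_into W \<kappa> z))))"

lemma coordD:
  assumes "coord M W \<kappa>"
  shows "top_chart M W \<kappa>"
   "\<And>W' f. openin (mtop M) W' \<Longrightarrow> W' \<subseteq> W \<Longrightarrow> smooth_fun_on M W' f \<longleftrightarrow> Cinf_on (model M) (\<kappa> ` W') (\<lambda>z. f (inv_into W \<kappa> z))"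
  using assms unfolding coord_def by blast+

lemma smooth_chart_coord:
  assumes m: "smooth_manifold M" and c: "smooth_chart M W \<kappa>"
  shows "coord M W \<kappa>"
proof -
  have t: "top_chart M W \<kappa>" using c by (simp add: smooth_chart_def)
  note S = smooth_manifoldD(2)[OF m] and tc = top_chartD[OF t]
  show ?thesis unfolding coord_def
  proof (intro conjI t allI impI, elim conjE)
    fix W' f assume W': "openin (mtop M) W'" "W' \<subseteq> W"
    show "smooth_fun_on M W' f \<longleftrightarrow> Cinf_on (model M) (\<kappa> ` W') (\<lambda>z. f (inv_into W \<kappa> z))"
    proof
      assume f: "smooth_fun_on M W' f"
      show "Cinf_on (model M) (\<kappa> ` W') (\<lambda>z. f (inv_into W \<kappa> z))"
      proof (rule Cinf_on_local)
        show o: "open_sub (model M) (\<kappa> ` W')" by (rule top_chart_open_sub[OF S t W'])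
        fix z assume "z \<in> \<kappa> ` W'"
        then obtain y where y: "y \<in> W'" "z = \<kappa> y" by auto
        obtain V \<psi> where V: "(V, \<psi>) \<in> atlas M" "y \<in> V"
          using smooth_manifoldD(5)[OF m, of y] y W' tc(2) by blast
        note t' = smooth_manifoldD(4)[OF m V(1)]
        note tc' = top_chartD[OF t']
        have o': "open_sub (model M) (\<kappa> ` (V \<inter> W'))"
          by (rule top_chart_open_sub[OF S t]) (use tc' W' in auto)
        then have "openin (top_of_set (\<kappa> ` W')) (\<kappa> ` (V \<inter> W'))"
          using o unfolding open_sub_def by (meson Int_lower2 image_mono openin_subset_trans openin_imp_subset)
        moreover have "Cinf_on (model M) (\<kappa> ` (V \<inter> W')) (\<lambda>z. f (inv_into W \<kappa> z))"
        proof (rule Cinf_on_cong)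
          show "Cinf_on (model M) (\<kappa> ` (V \<inter> W')) (\<lambda>z. f (inv_into V \<psi> (\<psi> (inv_into W \<kappa> z))))"
          proof (rule Cinf_on_compose[OF o', where f = "\<lambda>z. \<psi> (inv_into W \<kappa> z)" and g = "\<lambda>z. f (inv_into V \<psi> z)"])
            show "open_sub (model M) (\<psi> ` (V \<inter> W'))"
              by (rule top_chart_open_sub[OF S t']) (use tc' W' in auto)
            show "Cinf_on (model M) (\<psi> ` (V \<inter> W')) (\<lambda>z. f (inv_into V \<psi> z))"
              by (rule smooth_fun_on_atlas[OF f V(1)])
            have "Cinf_on (model M) (\<kappa> ` (W \<inter> V)) (\<psi> \<circ> inv_into W \<kappa>)"
              using c V(1) by (auto simp: smooth_chart_def smoothly_compatible_def)
            then show "Cinf_on (model M) (\<kappa> ` (V \<inter> W')) (\<lambda>z. \<psi> (inv_into W \<kappa> z))"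
              unfolding o_def by (rule Cinf_on_mono) (use W' in auto)
            show "(\<lambda>z. \<psi> (inv_into W \<kappa> z)) ` \<kappa> ` (V \<inter> W') \<subseteq> \<psi> ` (V \<inter> W')"
              using tc(4) W' by auto
          qed
        qed (use tc(4) tc'(4) W' in auto)
        ultimately show "\<exists>V. openin (top_of_set (\<kappa> ` W')) V \<and> z \<in> V \<and> Cinf_on (model M) V (\<lambda>z. f (inv_into W \<kappa> z))"
          using y V(2) by blast
      qed
    next
      assume f: "Cinf_on (model M) (\<kappa> ` W') (\<lambda>z. f (inv_into W \<kappa> z))"
      show "smooth_fun_on M W' f"
      proof (rule smooth_fun_onI)
        fix V \<psi> assume V: "(V, \<psi>) \<in> atlas M"
        note t' = smooth_manifoldD(4)[OF m V(1)]
        note tc' = top_chartD[OF t']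
        show "Cinf_on (model M) (\<psi> ` (V \<inter> W')) (\<lambda>z. f (inv_into V \<psi> z))"
        proof (rule Cinf_on_cong)
          show "Cinf_on (model M) (\<psi> ` (V \<inter> W')) (\<lambda>z. f (inv_into W \<kappa> (\<kappa> (inv_into V \<psi> z))))"
          proof (rule Cinf_on_compose[OF _ _ _ _ f, where f = "\<lambda>z. \<kappa> (inv_into V \<psi> z)"])
            show "open_sub (model M) (\<psi> ` (V \<inter> W'))"
              by (rule top_chart_open_sub[OF S t']) (use tc' W' in auto)
            show "open_sub (model M) (\<kappa> ` W')" by (rule top_chart_open_sub[OF S t W'])
            have "Cinf_on (model M) (\<psi> ` (W \<inter> V)) (\<kappa> \<circ> inv_into V \<psi>)"
              using c V(1) by (auto simp: smooth_chart_def smoothly_compatible_def)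
            then show "Cinf_on (model M) (\<psi> ` (V \<inter> W')) (\<lambda>z. \<kappa> (inv_into V \<psi> z))"
              unfolding o_def by (rule Cinf_on_mono) (use W' in auto)
            show "(\<lambda>z. \<kappa> (inv_into V \<psi> z)) ` \<psi> ` (V \<inter> W') \<subseteq> \<kappa> ` W'"
              using tc'(4) by auto
          qed
        qed (use tc(4) tc'(4) W' in auto)
      qed
    qed
  qed
qed

lemma coord_exists:
  assumes "smooth_manifold M" "x \<in> mpoints M"
  obtains W \<kappa> where "(W, \<kappa>) \<in> atlas M" "coord M W \<kappa>" "x \<in> W"
  using smooth_manifoldD(3,5)[OF assms(1)] smooth_chart_coord[OF assms(1)] assms(2) by metis

text \<open>
  A cutoff function of the distance in a chart. The image of a closed ball is compact, and it is closed
  in the manifold because the topology is Hausdorff; therefore the extension by zero is smooth.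
\<close>

lemma bump:
  assumes m: "smooth_manifold M" and O: "openin (mtop M) O'" and x: "x \<in> O'"
  obtains \<beta> C W where "\<beta> \<in> smooth_funs M" "closedin (mtop M) C" "C \<subseteq> O'" "\<And>y. y \<notin> C \<Longrightarrow> \<beta> y = 0"
    "openin (mtop M) W" "x \<in> W" "W \<subseteq> C" "\<And>y. y \<in> W \<Longrightarrow> \<beta> y = 1"
proof -
  have xM: "x \<in> mpoints M" using O x openin_subset by blast
  obtain U \<phi> where c: "coord M U \<phi>" "x \<in> U" using coord_exists[OF m xM] by blast
  note t = coordD(1)[OF c(1)]
  note tc = top_chartD[OF t]
  note S = smooth_manifoldD(2)[OF m]
  have oi: "openin (mtop M) (U \<inter> O')" using tc(1) O by blast
  have "open_sub (model M) (\<phi> ` (U \<inter> O'))" by (rule top_chart_open_sub[OF S t oi]) auto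
  then obtain e where e: "e > 0" "ball (\<phi> x) e \<inter> model M \<subseteq> \<phi> ` (U \<inter> O')" 
    unfolding open_sub_def openin_contains_ball using c(2) x by blast
  have US: "\<phi> ` U \<subseteq> model M" using t openin_imp_subset unfolding top_chart_def by blast
  \<comment> \<open>The cutoff function below vanishes at distance \<open>sqrt 2 * r\<close> and beyond, inside the ball of radius \<open>3/2 * r < e\<close>.\<close>
  define r where "r = e / 2"
  have r: "r > 0" using e by (simp add: r_def)
  define \<beta> where "\<beta> y = (if y \<in> U then cutoff (((\<phi> y - \<phi> x) \<bullet> (\<phi> y - \<phi> x)) / r\<^sup>2) else 0)" for y
  define K where "K = cball (\<phi> x) (3/2 * r) \<inter> model M"
  have KO: "K \<subseteq> \<phi> ` (U \<inter> O')" using e r unfolding K_def r_def by force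
  define C where "C = inv_into U \<phi> ` K"
  have C_iff: "y \<in> C \<longleftrightarrow> y \<in> U \<and> norm (\<phi> y - \<phi> x) \<le> 3/2 * r" for y
  proof
    assume "y \<in> C"
    then obtain z where z: "z \<in> K" "y = inv_into U \<phi> z" unfolding C_def by auto
    then obtain w where w: "w \<in> U" "z = \<phi> w" using KO by auto
    then show "y \<in> U \<and> norm (\<phi> y - \<phi> x) \<le> 3/2 * r" using z tc(4) by (auto simp: K_def dist_norm norm_minus_commute)
  next
    assume "y \<in> U \<and> norm (\<phi> y - \<phi> x) \<le> 3/2 * r"
    then show "y \<in> C" unfolding C_def using tc(4)[of y] US
      by (intro image_eqI[of _ _ "\<phi> y"]) (auto simp: K_def dist_norm norm_minus_commute)
  qed
  have CO: "C \<subseteq> O'" unfolding C_def using KO tc(4) by (fastforce simp: image_subset_iff)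
  have "compact K" unfolding K_def by (intro compact_Int_closed compact_cball closed_subspace S)
  then have "compactin (top_of_set (\<phi> ` U)) K" using KO by (auto simp: compactin_subtopology)
  then have "compactin (subtopology (mtop M) U) C"
    unfolding C_def using tc(6) image_compactin by blast
  then have cC: "closedin (mtop M) C"
    using compactin_imp_closedin[OF smooth_manifoldD(1)[OF m]] by (simp add: compactin_subtopology)
  have b0: "\<beta> y = 0" if "y \<notin> C" for y
  proof (cases "y \<in> U")
    case True
    then have "3/2 * r < norm (\<phi> y - \<phi> x)" using that C_iff by auto
    then have "(3/2 * r)\<^sup>2 \<le> (norm (\<phi> y - \<phi> x))\<^sup>2" using r by (intro power_mono) auto
    moreover have "(3/2 * r)\<^sup>2 = 9/4 * r\<^sup>2" by (simp add: power2_eq_square)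
    ultimately have le: "2 * r\<^sup>2 \<le> (norm (\<phi> y - \<phi> x))\<^sup>2" using zero_le_power2[of r] by linarith
    then have "2 \<le> ((\<phi> y - \<phi> x) \<bullet> (\<phi> y - \<phi> x)) / r\<^sup>2"
      using r le by (simp add: dot_square_norm pos_le_divide_eq)
    then show ?thesis by (simp add: \<beta>_def cutoff_0)
  qed (simp add: \<beta>_def)
  have oMC: "openin (mtop M) (mpoints M - C)" using cC by blast
  have sU: "smooth_fun_on M U \<beta>"
    unfolding coordD(2)[OF c(1) tc(1) order_refl]
    by (rule Cinf_on_cong[OF Cinf_on_bump[OF top_chart_open_sub[OF S t tc(1) order_refl], of "\<phi> x" r]])
      (use tc(4) in \<open>auto simp: \<beta>_def\<close>)
  have s0: "smooth_fun_on M (mpoints M - C) \<beta>"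
    by (rule smooth_fun_on_cong[OF m smooth_fun_on_const[of _ _ 0]]) (use b0 in auto)
  have "smooth_fun_on M (mpoints M) \<beta>"
  proof (rule smooth_fun_on_local[OF m])
    fix y assume "y \<in> mpoints M"
    then have "y \<in> U \<or> y \<in> mpoints M - C" using C_iff by blast
    then show "\<exists>W'. openin (mtop M) W' \<and> y \<in> W' \<and> smooth_fun_on M W' \<beta>"
      using sU s0 tc(1) oMC by blast
  qed simp
  then have sm: "\<beta> \<in> smooth_funs M" by (simp add: smooth_funs_def)
  define W where "W = {y \<in> U. \<phi> y \<in> ball (\<phi> x) r \<inter> model M}"
  have oW: "openin (mtop M) W" unfolding W_def
    by (rule top_chart_vimage_open[OF t]) (auto simp: openin_open Int_commute)
  show thesis
  proof (rule that[OF sm cC CO b0 oW])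
    show "x \<in> W" using c(2) US r by (auto simp: W_def)
    show "W \<subseteq> C" using r by (auto simp: W_def C_iff dist_norm norm_minus_commute)
    fix y assume y: "y \<in> W"
    then have "norm (\<phi> y - \<phi> x) \<le> r" "y \<in> U" by (auto simp: W_def dist_norm norm_minus_commute)
    then have "(norm (\<phi> y - \<phi> x))\<^sup>2 \<le> r\<^sup>2" by (intro power_mono) auto
    then have "((\<phi> y - \<phi> x) \<bullet> (\<phi> y - \<phi> x)) / r\<^sup>2 \<le> 1" using r by (simp add: dot_square_norm)
    then show "\<beta> y = 1" using \<open>y \<in> U\<close> by (simp add: \<beta>_def cutoff_1)
  qed
qed

lemma smooth_fun_extend_by_zero:
  assumes m: "smooth_manifold M" and O: "openin (mtop M) O'" and C: "closedin (mtop M) C" "C \<subseteq> O'"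
    and f: "smooth_fun_on M O' f" and f0: "\<And>y. y \<in> mpoints M \<Longrightarrow> y \<notin> C \<Longrightarrow> f y = 0"
  shows "f \<in> smooth_funs M"
proof -
  have s0: "smooth_fun_on M (mpoints M - C) f"
    by (rule smooth_fun_on_cong[OF m smooth_fun_on_const[of _ _ 0]]) (use f0 in auto)
  have "smooth_fun_on M (mpoints M) f"
  proof (rule smooth_fun_on_local[OF m])
    fix y assume "y \<in> mpoints M"
    then have "y \<in> O' \<or> y \<in> mpoints M - C" using C by blast
    then show "\<exists>W'. openin (mtop M) W' \<and> y \<in> W' \<and> smooth_fun_on M W' f"
      using f s0 O C by blast
  qed simp
  then show ?thesis by (simp add: smooth_funs_def)
qed

section \<open>Tangent and cotangent spaces in coordinates\<close>

lemma smooth_funsD: "f \<in> smooth_funs M \<Longrightarrow> W \<subseteq> mpoints M \<Longrightarrow> smooth_fun_on M W f"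
  unfolding smooth_funs_def using smooth_fun_on_mono by blast

lemma smooth_funs_const: "(\<lambda>x. c) \<in> smooth_funs M"
  and smooth_funs_add: "f \<in> smooth_funs M \<Longrightarrow> g \<in> smooth_funs M \<Longrightarrow> (\<lambda>x. f x + g x) \<in> smooth_funs M"
  and smooth_funs_diff: "f \<in> smooth_funs M \<Longrightarrow> g \<in> smooth_funs M \<Longrightarrow> (\<lambda>x. f x - g x) \<in> smooth_funs M"
  and smooth_funs_mult: "f \<in> smooth_funs M \<Longrightarrow> g \<in> smooth_funs M \<Longrightarrow> (\<lambda>x. f x * g x) \<in> smooth_funs M"
  by (simp_all add: smooth_funs_def smooth_fun_on_const smooth_fun_on_add smooth_fun_on_diff smooth_fun_on_mult)

lemma smooth_funs_sum: "(\<And>i. i \<in> I \<Longrightarrow> f i \<in> smooth_funs M) \<Longrightarrow> (\<lambda>x. \<Sum>i\<in>I. f i x) \<in> smooth_funs M"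
  by (simp add: smooth_funs_def smooth_fun_on_sum)

lemma tangent_add:
  assumes "v \<in> tangent_space M x" "f \<in> smooth_funs M" "g \<in> smooth_funs M"
  shows "v (\<lambda>y. f y + g y) = v f + v g"
  using assms by (simp add: tangent_space_def plus_fun_def)

lemma tangent_cmult:
  assumes "v \<in> tangent_space M x" "f \<in> smooth_funs M"
  shows "v (\<lambda>y. c * f y) = c * v f"
  using assms by (simp add: tangent_space_def scaleR_fun_def)

lemma tangent_mult:
  assumes "v \<in> tangent_space M x" "f \<in> smooth_funs M" "g \<in> smooth_funs M"
  shows "v (\<lambda>y. f y * g y) = f x * v g + g x * v f"
  using assms by (simp add: tangent_space_def times_fun_def)

lemma tangent_nonsmooth: "v \<in> tangent_space M x \<Longrightarrow> f \<notin> smooth_funs M \<Longrightarrow> v f = 0"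
  by (simp add: tangent_space_def)

lemma tangent_const:
  assumes "v \<in> tangent_space M x" shows "v (\<lambda>y. c) = 0"
proof -
  have "v (\<lambda>y. 1 * 1) = 1 * v (\<lambda>y. 1) + 1 * v (\<lambda>y. 1)"
    by (rule tangent_mult[OF assms smooth_funs_const smooth_funs_const])
  then have "v (\<lambda>y. 1) = 0" by simp
  then show ?thesis using tangent_cmult[OF assms smooth_funs_const[of 1], of c] by simp
qed

lemma tangent_diff:
  assumes "v \<in> tangent_space M x" "f \<in> smooth_funs M" "g \<in> smooth_funs M"
  shows "v (\<lambda>y. f y - g y) = v f - v g"
  using tangent_add[OF assms(1,2) smooth_funs_mult[OF smooth_funs_const[of "-1"] assms(3)]]
    tangent_cmult[OF assms(1,3), of "-1"] by simp

lemma tangent_sum: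
  assumes "v \<in> tangent_space M x" "\<And>i. i \<in> I \<Longrightarrow> f i \<in> smooth_funs M"
  shows "v (\<lambda>y. \<Sum>i\<in>I. f i y) = (\<Sum>i\<in>I. v (f i))"
  using assms(2)
proof (induction I rule: infinite_finite_induct)
  case (insert i I)
  then show ?case using tangent_add[OF assms(1), of "f i" "\<lambda>y. \<Sum>i\<in>I. f i y"] by (simp add: smooth_funs_sum)
qed (simp_all add: tangent_const[OF assms(1)])

text \<open>A derivation at a point only sees germs: multiply by a bump function.\<close>

lemma tangent_local:
  assumes m: "smooth_manifold M" and v: "v \<in> tangent_space M x"
    and W: "openin (mtop M) W" "x \<in> W" and f: "f \<in> smooth_funs M" and g: "g \<in> smooth_funs M"
    and eq: "\<And>y. y \<in> W \<Longrightarrow> f y = g y"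
  shows "v f = v g"
proof -
  obtain \<beta> C W' where b: "\<beta> \<in> smooth_funs M" "C \<subseteq> W" "\<And>y. y \<notin> C \<Longrightarrow> \<beta> y = 0" "x \<in> W'" "\<And>y. y \<in> W' \<Longrightarrow> \<beta> y = 1"
    using bump[OF m W] by metis
  have "(\<lambda>y. \<beta> y * (f y - g y)) = (\<lambda>y. 0)" using b eq by (auto simp: fun_eq_iff)
  then have "v (\<lambda>y. \<beta> y * (f y - g y)) = 0" using tangent_const[OF v] by simp
  moreover have "v (\<lambda>y. \<beta> y * (f y - g y)) = \<beta> x * v (\<lambda>y. f y - g y) + (f x - g x) * v \<beta>"
    by (rule tangent_mult[OF v b(1) smooth_funs_diff[OF f g]])
  ultimately show ?thesis using b(4,5) eq[OF W(2)] tangent_diff[OF v f g] by simp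
qed

lemma fun_plus_apply: "(f + g) x = f x + g x" by (simp add: plus_fun_def)
lemma fun_scaleR_apply: "(c *\<^sub>R f) x = c *\<^sub>R f x" by (simp add: scaleR_fun_def)
lemma fun_sum_apply: "(\<Sum>i\<in>I. f i) x = (\<Sum>i\<in>I. f i x)"
  by (induction I rule: infinite_finite_induct) (auto simp: plus_fun_def zero_fun_def)

lemma subspace_tangent_space: "subspace (tangent_space M x)"
  by (rule subspaceI) (auto simp: tangent_space_def plus_fun_def zero_fun_def scaleR_fun_def algebra_simps)

lemma subspace_cotangent_space: "subspace (cotangent_space M x)"
  by (rule subspaceI) (auto simp: cotangent_space_def plus_fun_def zero_fun_def scaleR_fun_def algebra_simps)

lemma subspace_gtangent_space: "subspace (gtangent_space M x)"
  unfolding gtangent_space_def by (intro subspace_Times subspace_tangent_space subspace_cotangent_space)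

lemma cotangent_add: "\<alpha> \<in> cotangent_space M x \<Longrightarrow> u \<in> tangent_space M x \<Longrightarrow> v \<in> tangent_space M x \<Longrightarrow> \<alpha> (u + v) = \<alpha> u + \<alpha> v"
  and cotangent_scale: "\<alpha> \<in> cotangent_space M x \<Longrightarrow> u \<in> tangent_space M x \<Longrightarrow> \<alpha> (c *\<^sub>R u) = c * \<alpha> u"
  by (auto simp: cotangent_space_def)

lemma cotangent_0: "\<alpha> \<in> cotangent_space M x \<Longrightarrow> \<alpha> 0 = 0"
  using cotangent_scale[of \<alpha> M x 0 0] subspace_0[OF subspace_tangent_space, of M x] by simp

lemma cotangent_diff: "\<alpha> \<in> cotangent_space M x \<Longrightarrow> u \<in> tangent_space M x \<Longrightarrow> v \<in> tangent_space M x \<Longrightarrow> \<alpha> (u - v) = \<alpha> u - \<alpha> v"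
  using cotangent_add[of \<alpha> M x u "(-1) *\<^sub>R v"] cotangent_scale[of \<alpha> M x v "-1"] subspace_scale[OF subspace_tangent_space, of v M x "-1"]
  by simp

lemma cotangent_sum:
  assumes "\<alpha> \<in> cotangent_space M x" "\<And>i. i \<in> I \<Longrightarrow> v i \<in> tangent_space M x"
  shows "\<alpha> (\<Sum>i\<in>I. c i *\<^sub>R v i) = (\<Sum>i\<in>I. c i * \<alpha> (v i))"
  using assms(2)
proof (induction I rule: infinite_finite_induct)
  case (insert i I)
  have "(\<Sum>i\<in>I. c i *\<^sub>R v i) \<in> tangent_space M x"
    using insert by (intro subspace_sum subspace_scale subspace_tangent_space) auto
  moreover have "c i *\<^sub>R v i \<in> tangent_space M x"
    using insert by (intro subspace_scale subspace_tangent_space) auto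
  ultimately have A: "\<alpha> (c i *\<^sub>R v i + (\<Sum>i\<in>I. c i *\<^sub>R v i)) = c i * \<alpha> (v i) + \<alpha> (\<Sum>i\<in>I. c i *\<^sub>R v i)"
    using cotangent_add[OF assms(1)] cotangent_scale[OF assms(1), of "v i" "c i"] insert by simp
  have IH: "\<alpha> (\<Sum>i\<in>I. c i *\<^sub>R v i) = (\<Sum>i\<in>I. c i * \<alpha> (v i))" using insert by simp
  show ?case unfolding sum.insert[OF insert(1,2)] A IH by (rule refl)
qed (simp_all add: cotangent_0[OF assms(1)])

lemma cotangent_eqI:
  assumes "\<alpha> \<in> cotangent_space M x" "\<beta> \<in> cotangent_space M x" "\<And>v. v \<in> tangent_space M x \<Longrightarrow> \<alpha> v = \<beta> v"
  shows "\<alpha> = \<beta>"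
proof
  fix v show "\<alpha> v = \<beta> v" using assms by (cases "v \<in> tangent_space M x") (auto simp: cotangent_space_def)
qed

lemma tangent_eqI:
  assumes "u \<in> tangent_space M x" "v \<in> tangent_space M x" "\<And>f. f \<in> smooth_funs M \<Longrightarrow> u f = v f"
  shows "u = v"
proof
  fix f show "u f = v f" using assms by (cases "f \<in> smooth_funs M") (auto simp: tangent_space_def)
qed

lemma vector_field_onD:
  assumes "vector_field_on M W X"
  shows "\<And>x. x \<in> W \<Longrightarrow> X x \<in> tangent_space M x" "\<And>f. f \<in> smooth_funs M \<Longrightarrow> smooth_fun_on M W (\<lambda>x. X x f)"
  using assms by (auto simp: vector_field_on_def)

lemma vector_field_smooth_funs:
  "vector_field_on M (mpoints M) X \<Longrightarrow> f \<in> smooth_funs M \<Longrightarrow> (\<lambda>x. X x f) \<in> smooth_funs M"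
  by (simp add: vector_field_on_def smooth_funs_def)

lemma one_form_onD:
  assumes "one_form_on M W \<alpha>"
  shows "\<And>x. x \<in> W \<Longrightarrow> \<alpha> x \<in> cotangent_space M x"
    "\<And>X. vector_field_on M (mpoints M) X \<Longrightarrow> smooth_fun_on M W (\<lambda>x. \<alpha> x (X x))"
  using assms by (auto simp: one_form_on_def)

lemma one_form_smooth_funs:
  "one_form_on M (mpoints M) \<alpha> \<Longrightarrow> vector_field_on M (mpoints M) X \<Longrightarrow> (\<lambda>x. \<alpha> x (X x)) \<in> smooth_funs M"
  by (simp add: one_form_on_def smooth_funs_def)

lemma vector_field_on_add:
  assumes "vector_field_on M W X" "vector_field_on M W Y" shows "vector_field_on M W (\<lambda>x. X x + Y x)"
  using assms by (auto simp: vector_field_on_def fun_plus_apply intro: subspace_add[OF subspace_tangent_space] smooth_fun_on_add)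

lemma vector_field_on_scale:
  assumes "smooth_fun_on M W f" "vector_field_on M W X" shows "vector_field_on M W (\<lambda>x. f x *\<^sub>R X x)"
  using assms by (auto simp: vector_field_on_def fun_scaleR_apply intro: subspace_scale[OF subspace_tangent_space] smooth_fun_on_mult)

lemma vector_field_on_0: "vector_field_on M W (\<lambda>x. 0)"
  by (auto simp: vector_field_on_def zero_fun_def subspace_0[OF subspace_tangent_space, unfolded zero_fun_def] smooth_fun_on_const)

lemma vector_field_on_sum:
  assumes "\<And>i. i \<in> I \<Longrightarrow> vector_field_on M W (X i)" shows "vector_field_on M W (\<lambda>x. \<Sum>i\<in>I. X i x)"
  using assms by (induction I rule: infinite_finite_induct) (auto intro: vector_field_on_0 vector_field_on_add)

lemma one_form_on_add:
  assumes "one_form_on M W \<alpha>" "one_form_on M W \<beta>" shows "one_form_on M W (\<lambda>x. \<alpha> x + \<beta> x)"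
  using assms by (auto simp: one_form_on_def fun_plus_apply intro: subspace_add[OF subspace_cotangent_space] smooth_fun_on_add)

lemma one_form_on_scale:
  assumes "smooth_fun_on M W f" "one_form_on M W \<alpha>" shows "one_form_on M W (\<lambda>x. f x *\<^sub>R \<alpha> x)"
  using assms by (auto simp: one_form_on_def fun_scaleR_apply intro: subspace_scale[OF subspace_cotangent_space] smooth_fun_on_mult)

lemma one_form_on_0: "one_form_on M W (\<lambda>x. 0)"
  by (auto simp: one_form_on_def zero_fun_def subspace_0[OF subspace_cotangent_space, unfolded zero_fun_def] smooth_fun_on_const)

lemma one_form_on_sum:
  assumes "\<And>i. i \<in> I \<Longrightarrow> one_form_on M W (X i)" shows "one_form_on M W (\<lambda>x. \<Sum>i\<in>I. X i x)"
  using assms by (induction I rule: infinite_finite_induct) (auto intro: one_form_on_0 one_form_on_add)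

lemma vector_field_on_mono: "vector_field_on M W X \<Longrightarrow> W' \<subseteq> W \<Longrightarrow> vector_field_on M W' X"
  unfolding vector_field_on_def using smooth_fun_on_mono by blast
lemma one_form_on_mono: "one_form_on M W X \<Longrightarrow> W' \<subseteq> W \<Longrightarrow> one_form_on M W' X"
  unfolding one_form_on_def using smooth_fun_on_mono by blast

text \<open>
  A local object times a bump function, continued by zero: the passage from local to global functions,
  fields, forms and sections.
\<close>

definition cut_off :: "'a set \<Rightarrow> ('a \<Rightarrow> real) \<Rightarrow> ('a \<Rightarrow> 'v::real_vector) \<Rightarrow> 'a \<Rightarrow> 'v" where
  "cut_off W \<beta> X y = (if y \<in> W then \<beta> y *\<^sub>R X y else 0)"

lemma smooth_cut:
  assumes m: "smooth_manifold M" and W: "openin (mtop M) W" and C: "closedin (mtop M) C" "C \<subseteq> W"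
    and b: "\<beta> \<in> smooth_funs M" "\<And>y. y \<notin> C \<Longrightarrow> \<beta> y = 0"
    and f: "smooth_fun_on M W f"
  shows "cut_off W \<beta> f \<in> smooth_funs M"
proof (rule smooth_fun_extend_by_zero[OF m W C])
  show "smooth_fun_on M W (cut_off W \<beta> f)"
    by (rule smooth_fun_on_cong[OF m smooth_fun_on_mult[OF smooth_funsD[OF b(1)] f]])
      (use W openin_subset in \<open>auto simp: cut_off_def\<close>)
qed (use b(2) in \<open>simp add: cut_off_def\<close>)

lemma vector_field_cut:
  assumes m: "smooth_manifold M" and W: "openin (mtop M) W" and C: "closedin (mtop M) C" "C \<subseteq> W"
    and b: "\<beta> \<in> smooth_funs M" "\<And>y. y \<notin> C \<Longrightarrow> \<beta> y = 0"
    and X: "vector_field_on M W X"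
  shows "vector_field_on M (mpoints M) (cut_off W \<beta> X)"
  unfolding vector_field_on_def
proof (intro conjI ballI)
  show "cut_off W \<beta> X x \<in> tangent_space M x" for x
    using vector_field_onD(1)[OF X] subspace_scale[OF subspace_tangent_space, of _ M x] subspace_0[OF subspace_tangent_space, of M x]
    by (auto simp: cut_off_def)
  fix f assume f: "f \<in> smooth_funs M"
  have "(\<lambda>x. cut_off W \<beta> X x f) = cut_off W \<beta> (\<lambda>x. X x f)"
    by (auto simp: fun_eq_iff cut_off_def scaleR_fun_def)
  then show "smooth_fun_on M (mpoints M) (\<lambda>x. cut_off W \<beta> X x f)"
    using smooth_cut[OF m W C b vector_field_onD(2)[OF X f]] by (simp add: smooth_funs_def)
qed

lemma one_form_cut:
  assumes m: "smooth_manifold M" and W: "openin (mtop M) W" and C: "closedin (mtop M) C" "C \<subseteq> W"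
    and b: "\<beta> \<in> smooth_funs M" "\<And>y. y \<notin> C \<Longrightarrow> \<beta> y = 0"
    and X: "one_form_on M W \<alpha>"
  shows "one_form_on M (mpoints M) (cut_off W \<beta> \<alpha>)"
  unfolding one_form_on_def
proof (intro conjI ballI allI impI)
  show "cut_off W \<beta> \<alpha> x \<in> cotangent_space M x" for x
    using one_form_onD(1)[OF X] subspace_scale[OF subspace_cotangent_space, of _ M x] subspace_0[OF subspace_cotangent_space, of M x]
    by (auto simp: cut_off_def)
  fix Y assume f: "vector_field_on M (mpoints M) Y"
  have "(\<lambda>x. cut_off W \<beta> \<alpha> x (Y x)) = cut_off W \<beta> (\<lambda>x. \<alpha> x (Y x))"
    by (auto simp: fun_eq_iff cut_off_def scaleR_fun_def)
  then show "smooth_fun_on M (mpoints M) (\<lambda>x. cut_off W \<beta> \<alpha> x (Y x))"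
    using smooth_cut[OF m W C b one_form_onD(2)[OF X f]] by (simp add: smooth_funs_def)
qed

text \<open>
  The tangent vector with coordinates \<open>s\<close>. The value zero on other functions makes it an element of
  the tangent space, which consists of functions extended in this way.
\<close>

definition cvec :: "('a, 'e::euclidean_space) manifold \<Rightarrow> 'a set \<Rightarrow> ('a \<Rightarrow> 'e) \<Rightarrow> 'a \<Rightarrow> 'e \<Rightarrow> 'a tangent" where
  "cvec M W \<kappa> x s = (\<lambda>f. if f \<in> smooth_funs M then dird (\<lambda>z. f (inv_into W \<kappa> z)) (\<kappa> x) s else 0)"

lemma coord_rep:
  assumes "coord M W \<kappa>" "f \<in> smooth_funs M"
  shows "Cinf_on (model M) (\<kappa> ` W) (\<lambda>z. f (inv_into W \<kappa> z))"
  using coordD(2)[OF assms(1) top_chartD(1)[OF coordD(1)[OF assms(1)]] order_refl, of f]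
    smooth_funsD[OF assms(2) top_chartD(2)[OF coordD(1)[OF assms(1)]]] by blast

lemma coord_open_sub:
  assumes "smooth_manifold M" "coord M W \<kappa>" "openin (mtop M) X" "X \<subseteq> W"
  shows "open_sub (model M) (\<kappa> ` X)"
  by (rule top_chart_open_sub[OF smooth_manifoldD(2)[OF assms(1)] coordD(1)[OF assms(2)] assms(3,4)])

lemma coord_simps:
  assumes "coord M W \<kappa>"
  shows "openin (mtop M) W" "W \<subseteq> mpoints M" "\<And>y. y \<in> W \<Longrightarrow> inv_into W \<kappa> (\<kappa> y) = y" "inj_on \<kappa> W"
  using top_chartD[OF coordD(1)[OF assms]] by auto

lemma cvec_has_derivative:
  assumes "smooth_manifold M" "coord M W \<kappa>" "x \<in> W" "s \<in> model M" "f \<in> smooth_funs M"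
  shows "((\<lambda>t. f (inv_into W \<kappa> (\<kappa> x + t *\<^sub>R s))) has_vector_derivative cvec M W \<kappa> x s f) (at 0)"
  using has_vector_derivative_dird[OF coord_open_sub[OF assms(1,2) coord_simps(1)[OF assms(2)] order_refl] _ coord_rep[OF assms(2,5)] assms(4), of "\<kappa> x"] assms(3,5)
  by (simp add: cvec_def)

lemma cvec_tangent:
  assumes m: "smooth_manifold M" and c: "coord M W \<kappa>" and x: "x \<in> W" and s: "s \<in> model M"
  shows "cvec M W \<kappa> x s \<in> tangent_space M x"
  unfolding tangent_space_def
proof (intro CollectI conjI ballI allI impI)
  note d = cvec_has_derivative[OF m c x s]
  have ix: "inv_into W \<kappa> (\<kappa> x) = x" using coord_simps(3)[OF c x] .
  fix f assume f: "f \<in> smooth_funs M"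
  show "cvec M W \<kappa> x s (a *\<^sub>R f) = a * cvec M W \<kappa> x s f" for a
  proof -
    have af: "a *\<^sub>R f \<in> smooth_funs M" using smooth_funs_mult[OF smooth_funs_const[of a] f] by (simp add: scaleR_fun_def)
    have "((\<lambda>t. a *\<^sub>R f (inv_into W \<kappa> (\<kappa> x + t *\<^sub>R s))) has_vector_derivative a *\<^sub>R cvec M W \<kappa> x s f) (at 0)"
      using bounded_linear.has_vector_derivative[OF bounded_linear_scaleR_right d[OF f]] .
    from vector_derivative_unique_at[OF this d[OF af, unfolded fun_scaleR_apply]] show ?thesis by (simp add: scaleR_fun_def)
  qed
  fix g assume g: "g \<in> smooth_funs M"
  have fg: "f + g \<in> smooth_funs M" "f * g \<in> smooth_funs M"
    using smooth_funs_add[OF f g] smooth_funs_mult[OF f g] by (simp_all add: plus_fun_def times_fun_def)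
  show "cvec M W \<kappa> x s (f + g) = cvec M W \<kappa> x s f + cvec M W \<kappa> x s g"
    using vector_derivative_unique_at[OF d[OF fg(1), unfolded fun_plus_apply] has_vector_derivative_add[OF d[OF f] d[OF g]]]
    by (simp add: plus_fun_def)
  show "cvec M W \<kappa> x s (f * g) = f x * cvec M W \<kappa> x s g + g x * cvec M W \<kappa> x s f"
    using vector_derivative_unique_at[OF d[OF fg(2), unfolded times_fun_def] has_vector_derivative_mult[OF d[OF f] d[OF g]]]
    by (simp add: ix mult.commute times_fun_def)
qed (simp add: cvec_def)

lemma cvec_expand:
  assumes m: "smooth_manifold M" and c: "coord M W \<kappa>" and x: "x \<in> W" and s: "s \<in> model M"
  shows "cvec M W \<kappa> x s = (\<Sum>b\<in>onb (model M). (s \<bullet> b) *\<^sub>R cvec M W \<kappa> x b)"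
proof
  fix f
  show "cvec M W \<kappa> x s f = (\<Sum>b\<in>onb (model M). (s \<bullet> b) *\<^sub>R cvec M W \<kappa> x b) f"
  proof (cases "f \<in> smooth_funs M")
    case True
    then show ?thesis
      using dird_expand[OF coord_open_sub[OF m c coord_simps(1)[OF c] order_refl] _ coord_rep[OF c True] s, of "\<kappa> x"] x
      by (simp add: fun_sum_apply fun_scaleR_apply cvec_def)
  qed (simp add: fun_sum_apply fun_scaleR_apply cvec_def)
qed

lemma cvec_linear:
  assumes m: "smooth_manifold M" and c: "coord M W \<kappa>" and x: "x \<in> W" and s: "s \<in> model M" and t: "t \<in> model M"
  shows "cvec M W \<kappa> x (s + t) = cvec M W \<kappa> x s + cvec M W \<kappa> x t"
    "cvec M W \<kappa> x (a *\<^sub>R s) = a *\<^sub>R cvec M W \<kappa> x s"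
proof -
  note S = smooth_manifoldD(2)[OF m]
  show "cvec M W \<kappa> x (s + t) = cvec M W \<kappa> x s + cvec M W \<kappa> x t"
    unfolding cvec_expand[OF m c x s] cvec_expand[OF m c x t] cvec_expand[OF m c x subspace_add[OF S s t]]
    by (simp add: inner_add_left scaleR_add_left sum.distrib)
  show "cvec M W \<kappa> x (a *\<^sub>R s) = a *\<^sub>R cvec M W \<kappa> x s"
    unfolding cvec_expand[OF m c x s] cvec_expand[OF m c x subspace_scale[OF S s]]
    by (simp add: scaleR_sum_right)
qed

lemma vector_field_cvec:
  assumes m: "smooth_manifold M" and c: "coord M W \<kappa>" and s: "s \<in> model M"
  shows "vector_field_on M W (\<lambda>x. cvec M W \<kappa> x s)"
  unfolding vector_field_on_def
proof (intro conjI ballI)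
  show "cvec M W \<kappa> x s \<in> tangent_space M x" if "x \<in> W" for x by (rule cvec_tangent[OF m c that s])
  fix f assume f: "f \<in> smooth_funs M"
  show "smooth_fun_on M W (\<lambda>x. cvec M W \<kappa> x s f)"
    unfolding coordD(2)[OF c coord_simps(1)[OF c] order_refl]
    by (rule Cinf_on_cong[OF Cinf_on_dird[OF coord_open_sub[OF m c coord_simps(1)[OF c] order_refl] coord_rep[OF c f] s]])
      (use coord_simps(3)[OF c] f in \<open>auto simp: cvec_def\<close>)
qed

text \<open>
  Globally defined vector fields \<open>E s\<close> and functions \<open>q s\<close> that agree on \<open>W1\<close> with the coordinate fields and
  the coordinate functions of \<open>\<kappa>\<close>. With them all computations can use global fields and functions only,
  on which tangent vectors and brackets are defined.
\<close>

definition cframe :: "('a, 'e::euclidean_space) manifold \<Rightarrow> 'a set \<Rightarrow> ('a \<Rightarrow> 'e) \<Rightarrow> 'a set \<Rightarrow>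
    ('e \<Rightarrow> 'a \<Rightarrow> 'a tangent) \<Rightarrow> ('e \<Rightarrow> 'a \<Rightarrow> real) \<Rightarrow> bool" where
  "cframe M W \<kappa> W1 E q \<longleftrightarrow> coord M W \<kappa> \<and> openin (mtop M) W1 \<and> W1 \<subseteq> W \<and>
    (\<forall>s\<in>model M. vector_field_on M (mpoints M) (E s) \<and> q s \<in> smooth_funs M \<and>
       (\<forall>y\<in>W1. E s y = cvec M W \<kappa> y s \<and> q s y = \<kappa> y \<bullet> s))"

lemma cframeD:
  assumes "cframe M W \<kappa> W1 E q"
  shows "coord M W \<kappa>" "openin (mtop M) W1" "W1 \<subseteq> W" "W1 \<subseteq> mpoints M"
    "\<And>s. s \<in> model M \<Longrightarrow> vector_field_on M (mpoints M) (E s)"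
    "\<And>s. s \<in> model M \<Longrightarrow> q s \<in> smooth_funs M"
    "\<And>s y. s \<in> model M \<Longrightarrow> y \<in> W1 \<Longrightarrow> E s y = cvec M W \<kappa> y s"
    "\<And>s y. s \<in> model M \<Longrightarrow> y \<in> W1 \<Longrightarrow> q s y = \<kappa> y \<bullet> s"
    "\<And>s y. s \<in> model M \<Longrightarrow> y \<in> W1 \<Longrightarrow> E s y \<in> tangent_space M y"
  using assms openin_subset[of "mtop M" W1] unfolding cframe_def vector_field_on_def by (blast+)

text \<open>
  Coordinate fields and functions are multiplied by a bump function that is one near the point.
\<close>

lemma cframe_exists:
  assumes m: "smooth_manifold M" and c: "coord M W \<kappa>" and O: "openin (mtop M) O'" "x \<in> O'" "O' \<subseteq> W"
  obtains W1 E q where "cframe M W \<kappa> W1 E q" "x \<in> W1" "W1 \<subseteq> O'"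
proof -
  note cs = coord_simps[OF c]
  obtain \<beta> C W1 where b: "\<beta> \<in> smooth_funs M" "closedin (mtop M) C" "C \<subseteq> O'" "\<And>y. y \<notin> C \<Longrightarrow> \<beta> y = 0"
    "openin (mtop M) W1" "x \<in> W1" "W1 \<subseteq> C" "\<And>y. y \<in> W1 \<Longrightarrow> \<beta> y = 1"
    using bump[OF m O(1,2)] by metis
  have CW: "C \<subseteq> W" using b(3) O(3) by blast
  define E where "E s = cut_off W \<beta> (\<lambda>y. cvec M W \<kappa> y s)" for s
  define q where "q s = cut_off W \<beta> (\<lambda>y. \<kappa> y \<bullet> s)" for s
  have sk: "smooth_fun_on M W (\<lambda>y. \<kappa> y \<bullet> s)" for s
    unfolding coordD(2)[OF c cs(1) order_refl]
    by (rule Cinf_on_cong[OF Cinf_on_linear[OF bounded_linear_inner_left[of s]]]) (use cs(3) in auto)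
  have "cframe M W \<kappa> W1 E q"
    unfolding cframe_def
    using c b(5) b(7) CW vector_field_cut[OF m cs(1) b(2) CW b(1,4) vector_field_cvec[OF m c]]
      smooth_cut[OF m cs(1) b(2) CW b(1,4) sk] b(8)
    by (auto simp: E_def q_def cut_off_def)
  then show thesis using that b(3,6,7) by blast
qed

lemma cframe_exists':
  assumes m: "smooth_manifold M" and x: "x \<in> mpoints M"
  obtains W \<kappa> W1 E q where "cframe M W \<kappa> W1 E q" "x \<in> W1"
  using coord_exists[OF m x] cframe_exists[OF m] coord_simps(1) by (metis order_refl)

lemma cframe_dual:
  assumes m: "smooth_manifold M" and F: "cframe M W \<kappa> W1 E q" and y: "y \<in> W1" and s: "s \<in> model M" and t: "t \<in> model M"
  shows "E s y (q t) = s \<bullet> t"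
proof -
  note d = cframeD[OF F]
  note o = coord_open_sub[OF m d(1,2,3)]
  have "E s y (q t) = dird (\<lambda>z. q t (inv_into W \<kappa> z)) (\<kappa> y) s"
    using d(6)[OF t] d(7)[OF s y] by (simp add: cvec_def)
  also have "\<dots> = dird (\<lambda>z. z \<bullet> t) (\<kappa> y) s"
    by (rule dird_cong[OF o _ s]) (use y d(3) d(8)[OF t] coord_simps(3)[OF d(1)] in auto)
  also have "\<dots> = s \<bullet> t" by (rule dird_linear[OF bounded_linear_inner_left])
  finally show ?thesis .
qed

text \<open>Every derivation is a combination of coordinate derivations, by Hadamard's lemma.\<close>

lemma cframe_tangent_expand:
  assumes m: "smooth_manifold M" and F: "cframe M W \<kappa> W1 E q" and y: "y \<in> W1" and v: "v \<in> tangent_space M y"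
  shows "v = (\<Sum>b\<in>onb (model M). v (q b) *\<^sub>R E b y)"
proof (rule tangent_eqI[OF v])
  note d = cframeD[OF F]
  note o = coord_open_sub[OF m d(1,2,3)]
  note S = smooth_manifoldD(2)[OF m]
  note cs = coord_simps[OF d(1)]
  have B: "b \<in> model M" if "b \<in> onb (model M)" for b using onb(1)[OF S] that by blast
  show "(\<Sum>b\<in>onb (model M). v (q b) *\<^sub>R E b y) \<in> tangent_space M y"
    using d(9) B y by (intro subspace_sum subspace_scale subspace_tangent_space) auto
  fix f assume f: "f \<in> smooth_funs M"
  let ?f = "\<lambda>z. f (inv_into W \<kappa> z)"
  obtain e where e: "e > 0" "ball (\<kappa> y) e \<inter> model M \<subseteq> \<kappa> ` W1"
    using o y unfolding open_sub_def openin_contains_ball by blast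
  define \<Omega> where "\<Omega> = ball (\<kappa> y) e \<inter> model M"
  have o\<Omega>: "open_sub (model M) \<Omega>" using S by (auto simp: open_sub_def \<Omega>_def openin_open Int_commute)
  have c\<Omega>: "convex \<Omega>" unfolding \<Omega>_def by (intro convex_Int convex_ball subspace_imp_convex S)
  have yS: "\<kappa> y \<in> model M" using open_subD(2)[OF o] y by blast
  have y\<Omega>: "\<kappa> y \<in> \<Omega>" using e yS by (simp add: \<Omega>_def)
  have f\<Omega>: "Cinf_on (model M) \<Omega> ?f"
    by (rule Cinf_on_mono[OF coord_rep[OF d(1) f]]) (use e d(3) in \<open>auto simp: \<Omega>_def\<close>)
  obtain g where g: "\<And>b. b \<in> onb (model M) \<Longrightarrow> Cinf_on (model M) \<Omega> (g b)"
    "\<And>z. z \<in> \<Omega> \<Longrightarrow> ?f z = ?f (\<kappa> y) + (\<Sum>b\<in>onb (model M). ((z - \<kappa> y) \<bullet> b) * g b z)"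
    "\<And>b. b \<in> onb (model M) \<Longrightarrow> g b (\<kappa> y) = dird ?f (\<kappa> y) b"
    using Hadamard[OF o\<Omega> c\<Omega> y\<Omega> f\<Omega>] by blast
  define X where "X = {x \<in> W. \<kappa> x \<in> \<Omega>}"
  have oX: "openin (mtop M) X" unfolding X_def
    by (rule top_chart_vimage_open[OF coordD(1)[OF d(1)]]) (use o\<Omega> in \<open>simp add: open_sub_def\<close>)
  have XW1: "X \<subseteq> W1"
    using e(2) d(3) cs(4) by (auto simp: X_def \<Omega>_def inj_on_def) (metis (no_types, lifting) IntI imageE mem_ball subsetD)
  have yX: "y \<in> X" using y\<Omega> y d(3) by (auto simp: X_def)
  have \<kappa>X: "\<kappa> ` X = \<Omega>" using e(2) d(3) by (fastforce simp: X_def \<Omega>_def)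
  obtain \<beta> C W2 where b: "\<beta> \<in> smooth_funs M" "closedin (mtop M) C" "C \<subseteq> X" "\<And>y. y \<notin> C \<Longrightarrow> \<beta> y = 0"
    "openin (mtop M) W2" "y \<in> W2" "W2 \<subseteq> C" "\<And>y. y \<in> W2 \<Longrightarrow> \<beta> y = 1"
    using bump[OF m oX yX] by metis
  define G where "G b = cut_off X \<beta> (\<lambda>x. g b (\<kappa> x))" for b
  define h where "h b x = q b x - \<kappa> y \<bullet> b" for b x
  have G: "G b \<in> smooth_funs M" if "b \<in> onb (model M)" for b
    unfolding G_def
  proof (rule smooth_cut[OF m oX b(2,3,1,4)])
    have XW: "X \<subseteq> W" by (auto simp: X_def)
    show "smooth_fun_on M X (\<lambda>x. g b (\<kappa> x))"
      unfolding coordD(2)[OF d(1) oX XW] \<kappa>X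
      by (rule Cinf_on_cong[OF g(1)[OF that]]) (use \<kappa>X XW cs(3) in auto)
  qed
  have h: "h b \<in> smooth_funs M" "v (h b) = v (q b)" "h b y = 0" if "b \<in> onb (model M)" for b
    using smooth_funs_diff[OF d(6)[OF B[OF that]] smooth_funs_const] tangent_diff[OF v d(6)[OF B[OF that]] smooth_funs_const]
      tangent_const[OF v] d(8)[OF B[OF that] y] unfolding h_def[abs_def] by simp_all
  have Gy: "G b y = dird ?f (\<kappa> y) b" if "b \<in> onb (model M)" for b
    using yX b(6,8) g(3)[OF that] by (simp add: G_def cut_off_def)
  have "v f = v (\<lambda>x. f y + (\<Sum>b\<in>onb (model M). h b x * G b x))"
  proof (rule tangent_local[OF m v b(5,6) f])
    show "(\<lambda>x. f y + (\<Sum>b\<in>onb (model M). h b x * G b x)) \<in> smooth_funs M"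
      using h(1) G by (intro smooth_funs_add smooth_funs_const smooth_funs_sum smooth_funs_mult)
    fix x assume x: "x \<in> W2"
    then have xX: "x \<in> X" and xW: "x \<in> W" and x1: "x \<in> W1" using b(3,7) d(3) XW1 by blast+
    have "\<kappa> x \<in> \<Omega>" using xX by (simp add: X_def)
    from g(2)[OF this] have "f x = f y + (\<Sum>b\<in>onb (model M). ((\<kappa> x - \<kappa> y) \<bullet> b) * g b (\<kappa> x))"
      using cs(3) xW y d(3) by auto
    also have "(\<Sum>b\<in>onb (model M). ((\<kappa> x - \<kappa> y) \<bullet> b) * g b (\<kappa> x)) = (\<Sum>b\<in>onb (model M). h b x * G b x)"
      by (rule sum.cong) (use d(8)[OF B x1] b(8)[OF x] xX in \<open>auto simp: h_def G_def cut_off_def inner_diff_left\<close>)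
    finally show "f x = f y + (\<Sum>b\<in>onb (model M). h b x * G b x)" .
  qed
  also have "\<dots> = v (\<lambda>x. f y) + v (\<lambda>x. \<Sum>b\<in>onb (model M). h b x * G b x)"
    using h(1) G by (intro tangent_add[OF v] smooth_funs_const smooth_funs_sum smooth_funs_mult)
  also have "\<dots> = (\<Sum>b\<in>onb (model M). v (\<lambda>x. h b x * G b x))"
    using h(1) G by (simp add: tangent_const[OF v] tangent_sum[OF v] smooth_funs_mult)
  also have "\<dots> = (\<Sum>b\<in>onb (model M). v (q b) * E b y f)"
  proof (rule sum.cong)
    fix b assume b: "b \<in> onb (model M)"
    show "v (\<lambda>x. h b x * G b x) = v (q b) * E b y f"
      using tangent_mult[OF v h(1)[OF b] G[OF b]] h[OF b] Gy[OF b] d(7)[OF B[OF b] y] f by (simp add: cvec_def)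
  qed simp
  finally show "v f = (\<Sum>b\<in>onb (model M). v (q b) *\<^sub>R E b y) f" by (simp add: fun_sum_apply fun_scaleR_apply)
qed

section \<open>Lie derivatives, the exterior derivative and the Dorfman bracket\<close>

lemma vector_field_on_diff:
  assumes "vector_field_on M W X" "vector_field_on M W Y" shows "vector_field_on M W (\<lambda>x. X x - Y x)"
proof -
  have "vector_field_on M W (\<lambda>x. X x + (-1) *\<^sub>R Y x)"
    by (intro vector_field_on_add vector_field_on_scale smooth_fun_on_const assms)
  then show ?thesis by simp
qed

lemma cframe_basis: "smooth_manifold M \<Longrightarrow> b \<in> onb (model M) \<Longrightarrow> b \<in> model M"
  using onb(1)[OF smooth_manifoldD(2)] by blast

lemma cframe_cotangent_expand:
  assumes m: "smooth_manifold M" and F: "cframe M W \<kappa> W1 E q" and y: "y \<in> W1"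
    and v: "v \<in> tangent_space M y" and \<alpha>: "\<alpha> \<in> cotangent_space M y"
  shows "\<alpha> v = (\<Sum>b\<in>onb (model M). v (q b) * \<alpha> (E b y))"
proof -
  have "\<alpha> v = \<alpha> (\<Sum>b\<in>onb (model M). v (q b) *\<^sub>R E b y)"
    using cframe_tangent_expand[OF m F y v] by simp
  also have "\<dots> = (\<Sum>b\<in>onb (model M). v (q b) * \<alpha> (E b y))"
    by (rule cotangent_sum[OF \<alpha>]) (use cframeD(9)[OF F _ y] cframe_basis[OF m] in blast)
  finally show ?thesis .
qed

definition dform :: "('a, 'e::euclidean_space) manifold \<Rightarrow> ('a \<Rightarrow> real) \<Rightarrow> 'a \<Rightarrow> 'a cotangent" where
  "dform M f y = (\<lambda>v. if v \<in> tangent_space M y then v f else 0)"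

lemma dform_cotangent: "dform M f y \<in> cotangent_space M y"
  unfolding cotangent_space_def dform_def
  using subspace_add[OF subspace_tangent_space, of _ M y] subspace_scale[OF subspace_tangent_space, of _ M y]
  by (auto simp: plus_fun_def scaleR_fun_def)

lemma one_form_dform:
  assumes m: "smooth_manifold M" and "f \<in> smooth_funs M" "W \<subseteq> mpoints M" shows "one_form_on M W (dform M f)"
  unfolding one_form_on_def
proof (intro conjI ballI allI impI dform_cotangent)
  fix X assume X: "vector_field_on M (mpoints M) X"
  show "smooth_fun_on M W (\<lambda>x. dform M f x (X x))"
    by (rule smooth_fun_on_cong[OF m smooth_funsD[OF vector_field_smooth_funs[OF X assms(2)] assms(3)]])
      (use vector_field_onD(1)[OF X] assms(3) in \<open>auto simp: dform_def\<close>)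
qed

text \<open>
  The Leibniz rule is the usual cancellation of the mixed terms. A function that is not smooth is
  mapped to zero by both fields, at all points of the manifold, and hence also by the bracket.
\<close>

lemma lie_bracket_tangent:
  assumes m: "smooth_manifold M" and X: "vector_field_on M (mpoints M) X" and Y: "vector_field_on M (mpoints M) Y"
    and x: "x \<in> mpoints M"
  shows "lie_bracket X Y x \<in> tangent_space M x"
  unfolding tangent_space_def
proof (intro CollectI conjI ballI allI impI)
  note vX = vector_field_onD(1)[OF X] and vY = vector_field_onD(1)[OF Y]
  note sX = vector_field_smooth_funs[OF X] and sY = vector_field_smooth_funs[OF Y]
  have cong: "v f = v g" if "v \<in> tangent_space M x" "f \<in> smooth_funs M" "\<And>y. y \<in> mpoints M \<Longrightarrow> g y = f y" for v f g
  proof -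
    have "smooth_fun_on M (mpoints M) g"
      by (rule smooth_fun_on_cong[OF m, of _ f]) (use that in \<open>auto simp: smooth_funs_def\<close>)
    then show ?thesis
      using tangent_local[OF m that(1) openin_topspace x that(2), of g] that(3) by (simp add: smooth_funs_def)
  qed
  fix f :: "'a \<Rightarrow> real"
  show "lie_bracket X Y x f = 0" if f: "f \<notin> smooth_funs M"
  proof -
    have "X x (\<lambda>y. 0) = X x (\<lambda>y. Y y f)"
      by (rule cong[OF vX[OF x] smooth_funs_const]) (use tangent_nonsmooth[OF vY f] in auto)
    moreover have "Y x (\<lambda>y. 0) = Y x (\<lambda>y. X y f)"
      by (rule cong[OF vY[OF x] smooth_funs_const]) (use tangent_nonsmooth[OF vX f] in auto)
    ultimately show ?thesis
      using tangent_const[OF vX[OF x], of 0] tangent_const[OF vY[OF x], of 0] by (simp add: lie_bracket_def)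
  qed
  assume f: "f \<in> smooth_funs M"
  show "lie_bracket X Y x (c *\<^sub>R f) = c * lie_bracket X Y x f" for c
  proof -
    have cf: "(\<lambda>y. c * f y) = c *\<^sub>R f" by (simp add: scaleR_fun_def)
    have "X x (\<lambda>y. c * Y y f) = X x (\<lambda>y. Y y (c *\<^sub>R f))"
      by (rule cong[OF vX[OF x] smooth_funs_mult[OF smooth_funs_const sY[OF f]]]) (use tangent_cmult[OF vY f, of _ c] cf in auto)
    moreover have "Y x (\<lambda>y. c * X y f) = Y x (\<lambda>y. X y (c *\<^sub>R f))"
      by (rule cong[OF vY[OF x] smooth_funs_mult[OF smooth_funs_const sX[OF f]]]) (use tangent_cmult[OF vX f, of _ c] cf in auto)
    ultimately show ?thesis
      using tangent_cmult[OF vX[OF x] sY[OF f], of c] tangent_cmult[OF vY[OF x] sX[OF f], of c]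
      by (simp add: lie_bracket_def algebra_simps)
  qed
  fix g assume g: "g \<in> smooth_funs M"
  show "lie_bracket X Y x (f + g) = lie_bracket X Y x f + lie_bracket X Y x g"
  proof -
    have cf: "(\<lambda>y. f y + g y) = f + g" by (simp add: plus_fun_def)
    have "X x (\<lambda>y. Y y f + Y y g) = X x (\<lambda>y. Y y (f + g))"
      by (rule cong[OF vX[OF x] smooth_funs_add[OF sY[OF f] sY[OF g]]]) (use tangent_add[OF vY f g] cf in auto)
    moreover have "Y x (\<lambda>y. X y f + X y g) = Y x (\<lambda>y. X y (f + g))"
      by (rule cong[OF vY[OF x] smooth_funs_add[OF sX[OF f] sX[OF g]]]) (use tangent_add[OF vX f g] cf in auto)
    ultimately show ?thesis
      using tangent_add[OF vX[OF x] sY[OF f] sY[OF g]] tangent_add[OF vY[OF x] sX[OF f] sX[OF g]]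
      by (simp add: lie_bracket_def)
  qed
  show "lie_bracket X Y x (f * g) = f x * lie_bracket X Y x g + g x * lie_bracket X Y x f"
  proof -
    have cf: "(\<lambda>y. f y * g y) = f * g" by (simp add: times_fun_def)
    have "X x (\<lambda>y. f y * Y y g + g y * Y y f) = X x (\<lambda>y. Y y (f * g))"
      by (rule cong[OF vX[OF x] smooth_funs_add[OF smooth_funs_mult[OF f sY[OF g]] smooth_funs_mult[OF g sY[OF f]]]])
        (use tangent_mult[OF vY f g] cf in auto)
    moreover have "Y x (\<lambda>y. f y * X y g + g y * X y f) = Y x (\<lambda>y. X y (f * g))"
      by (rule cong[OF vY[OF x] smooth_funs_add[OF smooth_funs_mult[OF f sX[OF g]] smooth_funs_mult[OF g sX[OF f]]]])
        (use tangent_mult[OF vX f g] cf in auto)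
    moreover have "X x (\<lambda>y. f y * Y y g + g y * Y y f) = f x * X x (\<lambda>y. Y y g) + Y x g * X x f + (g x * X x (\<lambda>y. Y y f) + Y x f * X x g)"
      using f g sY by (simp add: tangent_add[OF vX[OF x]] tangent_mult[OF vX[OF x]] smooth_funs_mult)
    moreover have "Y x (\<lambda>y. f y * X y g + g y * X y f) = f x * Y x (\<lambda>y. X y g) + X x g * Y x f + (g x * Y x (\<lambda>y. X y f) + X x f * Y x g)"
      using f g sX by (simp add: tangent_add[OF vY[OF x]] tangent_mult[OF vY[OF x]] smooth_funs_mult)
    ultimately show ?thesis by (simp add: lie_bracket_def algebra_simps)
  qed
qed

lemma lie_bracket_vector_field:
  assumes m: "smooth_manifold M" and X: "vector_field_on M (mpoints M) X" and Y: "vector_field_on M (mpoints M) Y"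
  shows "vector_field_on M (mpoints M) (lie_bracket X Y)"
  unfolding vector_field_on_def
proof (intro conjI ballI lie_bracket_tangent[OF m X Y])
  fix f assume f: "f \<in> smooth_funs M"
  show "smooth_fun_on M (mpoints M) (\<lambda>x. lie_bracket X Y x f)"
    using smooth_funs_diff[OF vector_field_smooth_funs[OF X vector_field_smooth_funs[OF Y f]] vector_field_smooth_funs[OF Y vector_field_smooth_funs[OF X f]]]
    by (simp add: lie_bracket_def smooth_funs_def)
qed

lemma lie_bracket_antisym: "lie_bracket X Y x = - lie_bracket Y X x"
  by (auto simp: lie_bracket_def fun_eq_iff)

lemma lie_bracket_add:
  assumes X: "vector_field_on M (mpoints M) X" and Y: "vector_field_on M (mpoints M) Y" and Z: "vector_field_on M (mpoints M) Z"
    and m: "smooth_manifold M" and x: "x \<in> mpoints M"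
  shows "lie_bracket X (\<lambda>y. Y y + Z y) x = lie_bracket X Y x + lie_bracket X Z x"
proof (rule tangent_eqI[OF lie_bracket_tangent[OF m X vector_field_on_add[OF Y Z] x]])
  show "lie_bracket X Y x + lie_bracket X Z x \<in> tangent_space M x"
    by (intro subspace_add subspace_tangent_space lie_bracket_tangent[OF m] X Y Z x)
  fix f assume f: "f \<in> smooth_funs M"
  show "lie_bracket X (\<lambda>y. Y y + Z y) x f = (lie_bracket X Y x + lie_bracket X Z x) f"
    using tangent_add[OF vector_field_onD(1)[OF X x] vector_field_smooth_funs[OF Y f] vector_field_smooth_funs[OF Z f]]
    by (simp add: lie_bracket_def)
qed

lemma lie_bracket_cmult:
  assumes X: "vector_field_on M (mpoints M) X" and Y: "vector_field_on M (mpoints M) Y"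
    and m: "smooth_manifold M" and x: "x \<in> mpoints M"
  shows "lie_bracket X (\<lambda>y. c *\<^sub>R Y y) x = c *\<^sub>R lie_bracket X Y x"
proof (rule tangent_eqI[OF lie_bracket_tangent[OF m X vector_field_on_scale[OF smooth_fun_on_const Y] x]])
  show "c *\<^sub>R lie_bracket X Y x \<in> tangent_space M x"
    by (intro subspace_scale subspace_tangent_space lie_bracket_tangent[OF m] X Y x)
  fix f assume f: "f \<in> smooth_funs M"
  show "lie_bracket X (\<lambda>y. c *\<^sub>R Y y) x f = (c *\<^sub>R lie_bracket X Y x) f"
    using tangent_cmult[OF vector_field_onD(1)[OF X x] vector_field_smooth_funs[OF Y f], of c]
    by (simp add: lie_bracket_def fun_scaleR_apply algebra_simps)
qed

text \<open>
  The pairing of the Lie derivative of \<open>\<eta>\<close> along \<open>X\<close> with a field \<open>Y\<close>. Fields as arguments avoid the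
  arbitrary extensions that occur in \<open>lie_deriv\<close>.
\<close>

definition lie_form :: "('a \<Rightarrow> 'a tangent) \<Rightarrow> ('a \<Rightarrow> 'a cotangent) \<Rightarrow> ('a \<Rightarrow> 'a tangent) \<Rightarrow> 'a \<Rightarrow> real" where
  "lie_form X \<eta> Y x = X x (\<lambda>y. \<eta> y (Y y)) - \<eta> x (lie_bracket X Y x)"

text \<open>
  Tensoriality in \<open>Y\<close>: with \<open>Y\<close> written locally as a combination of coordinate fields whose coefficients
  vanish at \<open>x\<close>, the derivatives of the coefficients in the two terms of \<open>lie_form\<close> cancel.
\<close>

lemma lie_form_vanishing:
  assumes m: "smooth_manifold M" and X: "vector_field_on M (mpoints M) X" and Y: "vector_field_on M (mpoints M) Y"
    and \<eta>: "one_form_on M (mpoints M) \<eta>" and x: "x \<in> mpoints M" and Y0: "Y x = 0"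
  shows "lie_form X \<eta> Y x = 0"
proof -
  obtain W \<kappa> W1 E q where F: "cframe M W \<kappa> W1 E q" "x \<in> W1" using cframe_exists'[OF m x] by metis
  note d = cframeD[OF F(1)]
  note B = cframe_basis[OF m]
  note vX = vector_field_onD(1)[OF X x] and vY = vector_field_onD(1)[OF Y]
  let ?B = "onb (model M)"
  have sY: "(\<lambda>y. Y y (q b)) \<in> smooth_funs M" if "b \<in> ?B" for b using vector_field_smooth_funs[OF Y d(6)[OF B[OF that]]] .
  have sE: "(\<lambda>y. \<eta> y (E b y)) \<in> smooth_funs M" if "b \<in> ?B" for b using one_form_smooth_funs[OF \<eta> d(5)[OF B[OF that]]] .
  have "X x (\<lambda>y. \<eta> y (Y y)) = X x (\<lambda>y. \<Sum>b\<in>?B. Y y (q b) * \<eta> y (E b y))"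
  proof (rule tangent_local[OF m vX d(2) F(2) one_form_smooth_funs[OF \<eta> Y]])
    show "(\<lambda>y. \<Sum>b\<in>?B. Y y (q b) * \<eta> y (E b y)) \<in> smooth_funs M"
      by (intro smooth_funs_sum smooth_funs_mult sY sE)
    show "\<eta> y (Y y) = (\<Sum>b\<in>?B. Y y (q b) * \<eta> y (E b y))" if y: "y \<in> W1" for y
      by (rule cframe_cotangent_expand[OF m F(1) y vY one_form_onD(1)[OF \<eta>]]) (use d(4) y in auto)
  qed
  also have "\<dots> = (\<Sum>b\<in>?B. X x (\<lambda>y. Y y (q b) * \<eta> y (E b y)))"
    by (rule tangent_sum[OF vX]) (intro smooth_funs_mult sY sE)
  also have "\<dots> = (\<Sum>b\<in>?B. lie_bracket X Y x (q b) * \<eta> x (E b x))"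
    by (rule sum.cong) (simp_all add: tangent_mult[OF vX sY sE] Y0 lie_bracket_def)
  also have "\<dots> = \<eta> x (lie_bracket X Y x)"
    using cframe_cotangent_expand[OF m F lie_bracket_tangent[OF m X Y x] one_form_onD(1)[OF \<eta> x]] by simp
  finally show ?thesis by (simp add: lie_form_def)
qed

lemma lie_form_add:
  assumes m: "smooth_manifold M" and X: "vector_field_on M (mpoints M) X" and Y: "vector_field_on M (mpoints M) Y"
    and Z: "vector_field_on M (mpoints M) Z" and \<eta>: "one_form_on M (mpoints M) \<eta>" and x: "x \<in> mpoints M"
  shows "lie_form X \<eta> (\<lambda>y. Y y + Z y) x = lie_form X \<eta> Y x + lie_form X \<eta> Z x"
proof -
  note vX = vector_field_onD(1)[OF X x]
  note sY = one_form_smooth_funs[OF \<eta> Y] and sZ = one_form_smooth_funs[OF \<eta> Z]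
  have "X x (\<lambda>y. \<eta> y (Y y + Z y)) = X x (\<lambda>y. \<eta> y (Y y) + \<eta> y (Z y))"
    by (rule tangent_local[OF m vX openin_topspace x one_form_smooth_funs[OF \<eta> vector_field_on_add[OF Y Z]] smooth_funs_add[OF sY sZ]])
      (rule cotangent_add[OF one_form_onD(1)[OF \<eta>] vector_field_onD(1)[OF Y] vector_field_onD(1)[OF Z]])
  then show ?thesis
    using lie_bracket_add[OF X Y Z m x] tangent_add[OF vX sY sZ]
      cotangent_add[OF one_form_onD(1)[OF \<eta> x] lie_bracket_tangent[OF m X Y x] lie_bracket_tangent[OF m X Z x]]
    by (simp only: lie_form_def)
qed

lemma lie_form_cmult:
  assumes m: "smooth_manifold M" and X: "vector_field_on M (mpoints M) X" and Y: "vector_field_on M (mpoints M) Y"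
    and \<eta>: "one_form_on M (mpoints M) \<eta>" and x: "x \<in> mpoints M"
  shows "lie_form X \<eta> (\<lambda>y. c *\<^sub>R Y y) x = c * lie_form X \<eta> Y x"
proof -
  note vX = vector_field_onD(1)[OF X x]
  note sY = one_form_smooth_funs[OF \<eta> Y]
  have "X x (\<lambda>y. \<eta> y (c *\<^sub>R Y y)) = X x (\<lambda>y. c * \<eta> y (Y y))"
    by (rule tangent_local[OF m vX openin_topspace x one_form_smooth_funs[OF \<eta> vector_field_on_scale[OF smooth_fun_on_const Y]] smooth_funs_mult[OF smooth_funs_const sY]])
      (rule cotangent_scale[OF one_form_onD(1)[OF \<eta>] vector_field_onD(1)[OF Y]])
  then show ?thesis
    using lie_bracket_cmult[OF X Y m x, of c] tangent_cmult[OF vX sY, of c]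
      cotangent_scale[OF one_form_onD(1)[OF \<eta> x] lie_bracket_tangent[OF m X Y x], of c]
    by (simp only: lie_form_def right_diff_distrib)
qed

lemma lie_form_cong:
  assumes m: "smooth_manifold M" and X: "vector_field_on M (mpoints M) X" and Y: "vector_field_on M (mpoints M) Y"
    and Z: "vector_field_on M (mpoints M) Z" and \<eta>: "one_form_on M (mpoints M) \<eta>" and x: "x \<in> mpoints M" and eq: "Y x = Z x"
  shows "lie_form X \<eta> Y x = lie_form X \<eta> Z x"
proof -
  have D: "vector_field_on M (mpoints M) (\<lambda>y. Y y - Z y)" by (rule vector_field_on_diff[OF Y Z])
  have "lie_form X \<eta> (\<lambda>y. Z y + (Y y - Z y)) x = lie_form X \<eta> Z x + lie_form X \<eta> (\<lambda>y. Y y - Z y) x"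
    by (rule lie_form_add[OF m X Z D \<eta> x])
  moreover have "lie_form X \<eta> (\<lambda>y. Y y - Z y) x = 0"
    by (rule lie_form_vanishing[OF m X D \<eta> x]) (simp add: eq)
  ultimately show ?thesis by simp
qed

text \<open>
  The arbitrary choice in the definition is one between fields that exist: a coordinate field has any
  prescribed value at the point.
\<close>

lemma extend_vector:
  assumes m: "smooth_manifold M" and x: "x \<in> mpoints M" and v: "v \<in> tangent_space M x"
  shows "vector_field_on M (mpoints M) (extend_vector M x v)" "extend_vector M x v x = v"
proof -
  obtain W \<kappa> W1 E q where F: "cframe M W \<kappa> W1 E q" "x \<in> W1" using cframe_exists'[OF m x] by metis
  have "vector_field_on M (mpoints M) (\<lambda>y. \<Sum>b\<in>onb (model M). v (q b) *\<^sub>R E b y)"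
    by (intro vector_field_on_sum vector_field_on_scale smooth_fun_on_const cframeD(5)[OF F(1)] cframe_basis[OF m])
  moreover have "(\<Sum>b\<in>onb (model M). v (q b) *\<^sub>R E b x) = v"
    using cframe_tangent_expand[OF m F v] by simp
  ultimately have "\<exists>X. vector_field_on M (mpoints M) X \<and> X x = v" by blast
  from someI_ex[OF this]
  show "vector_field_on M (mpoints M) (extend_vector M x v)" "extend_vector M x v x = v"
    unfolding extend_vector_def by blast+
qed

lemma lie_deriv_eq:
  assumes m: "smooth_manifold M" and X: "vector_field_on M (mpoints M) X" and Y: "vector_field_on M (mpoints M) Y"
    and \<eta>: "one_form_on M (mpoints M) \<eta>" and x: "x \<in> mpoints M"
  shows "lie_deriv M X \<eta> x (Y x) = lie_form X \<eta> Y x"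
proof -
  note v = vector_field_onD(1)[OF Y x]
  have "lie_deriv M X \<eta> x (Y x) = lie_form X \<eta> (extend_vector M x (Y x)) x"
    using v by (simp add: lie_deriv_def lie_form_def Let_def)
  also have "\<dots> = lie_form X \<eta> Y x"
    by (rule lie_form_cong[OF m X extend_vector(1)[OF m x v] Y \<eta> x extend_vector(2)[OF m x v]])
  finally show ?thesis .
qed

text \<open>
  The exterior derivative by Cartan's formula: the Lie derivative of \<open>\<xi>\<close> along \<open>X\<close>, minus the differential
  of the function \<open>\<xi> X\<close>.
\<close>

definition d_form :: "('a \<Rightarrow> 'a cotangent) \<Rightarrow> ('a \<Rightarrow> 'a tangent) \<Rightarrow> ('a \<Rightarrow> 'a tangent) \<Rightarrow> 'a \<Rightarrow> real" where
  "d_form \<xi> X Y x = lie_form X \<xi> Y x - Y x (\<lambda>y. \<xi> y (X y))"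

lemma d_form_antisym:
  assumes m: "smooth_manifold M" and X: "vector_field_on M (mpoints M) X" and Y: "vector_field_on M (mpoints M) Y"
    and \<xi>: "one_form_on M (mpoints M) \<xi>" and x: "x \<in> mpoints M"
  shows "d_form \<xi> X Y x = - d_form \<xi> Y X x"
proof -
  have "\<xi> x (lie_bracket X Y x) = - \<xi> x (lie_bracket Y X x)"
    using lie_bracket_antisym[of X Y x] cotangent_scale[OF one_form_onD(1)[OF \<xi> x] lie_bracket_tangent[OF m Y X x], of "-1"] by simp
  then show ?thesis by (simp add: d_form_def lie_form_def)
qed

text \<open>
  Tensoriality in \<open>Y\<close> is that of \<open>lie_form\<close>, and antisymmetry transfers it to \<open>X\<close>.
\<close>

lemma d_form_cong:
  assumes m: "smooth_manifold M" and X: "vector_field_on M (mpoints M) X" and Y: "vector_field_on M (mpoints M) Y"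
    and X': "vector_field_on M (mpoints M) X'" and Y': "vector_field_on M (mpoints M) Y'"
    and \<xi>: "one_form_on M (mpoints M) \<xi>" and x: "x \<in> mpoints M" and eq: "X x = X' x" "Y x = Y' x"
  shows "d_form \<xi> X Y x = d_form \<xi> X' Y' x"
proof -
  have 1: "d_form \<xi> X Y x = d_form \<xi> X Y' x"
    using lie_form_cong[OF m X Y Y' \<xi> x eq(2)] eq(2) by (simp add: d_form_def)
  have 2: "d_form \<xi> Y' X x = d_form \<xi> Y' X' x"
    using lie_form_cong[OF m Y' X X' \<xi> x eq(1)] eq(1) by (simp add: d_form_def)
  show ?thesis
    using 1 2 d_form_antisym[OF m X Y' \<xi> x] d_form_antisym[OF m X' Y' \<xi> x] by simp
qed

lemma ext_deriv_eq:
  assumes m: "smooth_manifold M" and X: "vector_field_on M (mpoints M) X" and Y: "vector_field_on M (mpoints M) Y"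
    and \<xi>: "one_form_on M (mpoints M) \<xi>" and x: "x \<in> mpoints M"
  shows "ext_deriv M \<xi> x (X x) (Y x) = d_form \<xi> X Y x"
proof -
  note v = vector_field_onD(1)[OF Y x] and u = vector_field_onD(1)[OF X x]
  note eu = extend_vector[OF m x u] and ev = extend_vector[OF m x v]
  have "ext_deriv M \<xi> x (X x) (Y x) = d_form \<xi> (extend_vector M x (X x)) (extend_vector M x (Y x)) x"
    using u v by (simp add: ext_deriv_def d_form_def lie_form_def Let_def)
  also have "\<dots> = d_form \<xi> X Y x"
    by (rule d_form_cong[OF m eu(1) ev(1) X Y \<xi> x eu(2) ev(2)])
  finally show ?thesis .
qed

text \<open>The covector part of the Dorfman bracket, paired with a field.\<close>

definition dorfman_form :: "('a \<Rightarrow> 'a gtangent) \<Rightarrow> ('a \<Rightarrow> 'a gtangent) \<Rightarrow> ('a \<Rightarrow> 'a tangent) \<Rightarrow> 'a \<Rightarrow> real" where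
  "dorfman_form a b Y x = lie_form (fst \<circ> a) (snd \<circ> b) Y x - d_form (snd \<circ> a) (fst \<circ> b) Y x"

lemma smooth_sectionD:
  assumes "smooth_section_on M W a"
  shows "vector_field_on M W (fst \<circ> a)" "one_form_on M W (snd \<circ> a)" "\<And>x. x \<in> W \<Longrightarrow> a x \<in> gtangent_space M x"
  using assms by (auto simp: smooth_section_on_def gtangent_space_def vector_field_on_def one_form_on_def mem_Times_iff)

lemma dorfman_bracket_form:
  assumes m: "smooth_manifold M" and a: "smooth_section_on M (mpoints M) a" and b: "smooth_section_on M (mpoints M) b"
    and Y: "vector_field_on M (mpoints M) Y" and x: "x \<in> mpoints M"
  shows "snd (dorfman_bracket M a b x) (Y x) = dorfman_form a b Y x"
  using lie_deriv_eq[OF m smooth_sectionD(1)[OF a] Y smooth_sectionD(2)[OF b] x]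
    ext_deriv_eq[OF m smooth_sectionD(1)[OF b] Y smooth_sectionD(2)[OF a] x]
  by (simp add: dorfman_bracket_def Let_def dorfman_form_def contract_def)

lemma dorfman_bracket_smooth:
  assumes m: "smooth_manifold M" and a: "smooth_section_on M (mpoints M) a" and b: "smooth_section_on M (mpoints M) b"
  shows "smooth_section_on M (mpoints M) (dorfman_bracket M a b)"
  unfolding smooth_section_on_def
proof
  note A = smooth_sectionD[OF a] and B = smooth_sectionD[OF b]
  have "fst \<circ> dorfman_bracket M a b = lie_bracket (fst \<circ> a) (fst \<circ> b)"
    by (auto simp: dorfman_bracket_def Let_def)
  then show "vector_field_on M (mpoints M) (fst \<circ> dorfman_bracket M a b)"
    using lie_bracket_vector_field[OF m A(1) B(1)] by simp
  note form = dorfman_bracket_form[OF m a b]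
  have d_add: "dorfman_form a b (\<lambda>y. Y y + Z y) x = dorfman_form a b Y x + dorfman_form a b Z x"
    if Y: "vector_field_on M (mpoints M) Y" and Z: "vector_field_on M (mpoints M) Z" and x: "x \<in> mpoints M" for Y Z x
    using lie_form_add[OF m A(1) Y Z B(2) x] lie_form_add[OF m B(1) Y Z A(2) x]
    by (simp add: dorfman_form_def d_form_def)
  have d_cm: "dorfman_form a b (\<lambda>y. c *\<^sub>R Y y) x = c * dorfman_form a b Y x"
    if Y: "vector_field_on M (mpoints M) Y" and x: "x \<in> mpoints M" for Y x c
    using lie_form_cmult[OF m A(1) Y B(2) x, of c] lie_form_cmult[OF m B(1) Y A(2) x, of c]
    by (simp add: dorfman_form_def d_form_def fun_scaleR_apply algebra_simps)
  show "one_form_on M (mpoints M) (snd \<circ> dorfman_bracket M a b)"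
    unfolding one_form_on_def
  proof (intro conjI ballI allI impI)
    fix x assume x: "x \<in> mpoints M"
    show "(snd \<circ> dorfman_bracket M a b) x \<in> cotangent_space M x"
      unfolding cotangent_space_def
    proof (intro CollectI conjI ballI allI impI)
      fix u assume u: "u \<in> tangent_space M x"
      note U = extend_vector[OF m x u]
      show "(snd \<circ> dorfman_bracket M a b) x (c *\<^sub>R u) = c * (snd \<circ> dorfman_bracket M a b) x u" for c
        using form[OF vector_field_on_scale[OF smooth_fun_on_const[of _ _ c] U(1)] x] form[OF U(1) x] d_cm[OF U(1) x, of c] U(2)
        by simp
      fix v assume v: "v \<in> tangent_space M x"
      note V = extend_vector[OF m x v]
      show "(snd \<circ> dorfman_bracket M a b) x (u + v) = (snd \<circ> dorfman_bracket M a b) x u + (snd \<circ> dorfman_bracket M a b) x v"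
        using form[OF vector_field_on_add[OF U(1) V(1)] x] form[OF U(1) x] form[OF V(1) x] d_add[OF U(1) V(1) x] U(2) V(2)
        by simp
    next
      fix u assume "u \<notin> tangent_space M x"
      then show "(snd \<circ> dorfman_bracket M a b) x u = 0"
        by (simp add: dorfman_bracket_def Let_def lie_deriv_def contract_def ext_deriv_def)
    qed
  next
    fix Y assume Y: "vector_field_on M (mpoints M) Y"
    have lf: "(\<lambda>x. lie_form X \<eta> Y x) \<in> smooth_funs M" if X: "vector_field_on M (mpoints M) X" and \<eta>: "one_form_on M (mpoints M) \<eta>" for X \<eta>
      unfolding lie_form_def
      by (intro smooth_funs_diff vector_field_smooth_funs[OF X] one_form_smooth_funs[OF \<eta>] Y lie_bracket_vector_field[OF m X Y])
    have "(\<lambda>x. dorfman_form a b Y x) \<in> smooth_funs M"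
      unfolding dorfman_form_def d_form_def
      by (intro smooth_funs_diff lf A B vector_field_smooth_funs[OF Y] one_form_smooth_funs[OF A(2)])
    then show "smooth_fun_on M (mpoints M) (\<lambda>x. (snd \<circ> dorfman_bracket M a b) x (Y x))"
      unfolding smooth_funs_def mem_Collect_eq
      by (rule smooth_fun_on_cong[OF m]) (simp add: form[OF Y])
  qed
qed

text \<open>
  The value of \<open>\<langle>[a, b], c\<rangle>\<close> for sections that are pairwise orthogonal, in a form that is visibly
  invariant under cyclic permutation of \<open>a\<close>, \<open>b\<close> and \<open>c\<close>.
\<close>

definition courant_tensor :: "('a \<Rightarrow> 'a gtangent) \<Rightarrow> ('a \<Rightarrow> 'a gtangent) \<Rightarrow> ('a \<Rightarrow> 'a gtangent) \<Rightarrow> 'a \<Rightarrow> real" where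
  "courant_tensor a b c x =
     fst (a x) (\<lambda>y. snd (b y) (fst (c y))) + fst (b x) (\<lambda>y. snd (c y) (fst (a y))) + fst (c x) (\<lambda>y. snd (a y) (fst (b y)))
     + snd (c x) (lie_bracket (fst \<circ> a) (fst \<circ> b) x) + snd (a x) (lie_bracket (fst \<circ> b) (fst \<circ> c) x)
     + snd (b x) (lie_bracket (fst \<circ> c) (fst \<circ> a) x)"

lemma courant_tensor_cyclic: "courant_tensor a b c x = courant_tensor b c a x"
  by (simp add: courant_tensor_def)

text \<open>
  By \<open>\<langle>a, c\<rangle> = 0\<close> the derivative along \<open>fst b\<close> of \<open>snd a\<close> on \<open>fst c\<close> is minus that of \<open>snd c\<close> on \<open>fst a\<close>. This
  turns the invariant formulas for the bracket into the cyclic expression.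
\<close>

lemma pairing_dorfman:
  assumes m: "smooth_manifold M" and a: "smooth_section_on M (mpoints M) a" and b: "smooth_section_on M (mpoints M) b"
    and c: "smooth_section_on M (mpoints M) c" and x: "x \<in> mpoints M"
    and iso: "\<And>y. y \<in> mpoints M \<Longrightarrow> pairing (a y) (c y) = 0"
  shows "pairing (dorfman_bracket M a b x) (c x) = courant_tensor a b c x"
proof -
  note A = smooth_sectionD[OF a] and B = smooth_sectionD[OF b] and C = smooth_sectionD[OF c]
  have ac: "(\<lambda>y. snd (a y) (fst (c y))) \<in> smooth_funs M" "(\<lambda>y. snd (c y) (fst (a y))) \<in> smooth_funs M"
    using one_form_smooth_funs[OF A(2) C(1)] one_form_smooth_funs[OF C(2) A(1)] by (simp_all add: o_def)
  have vb: "fst (b x) \<in> tangent_space M x" using vector_field_onD(1)[OF B(1) x] by simp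
  have "fst (b x) (\<lambda>y. snd (a y) (fst (c y)) + snd (c y) (fst (a y))) = fst (b x) (\<lambda>y. 0)"
    by (rule tangent_local[OF m vb openin_topspace x smooth_funs_add[OF ac] smooth_funs_const]) (use iso in \<open>simp add: pairing_def\<close>)
  then have 1: "fst (b x) (\<lambda>y. snd (a y) (fst (c y))) = - fst (b x) (\<lambda>y. snd (c y) (fst (a y)))"
    using tangent_add[OF vb ac] tangent_const[OF vb, of 0] by simp
  have "snd (b x) (lie_bracket (fst \<circ> a) (fst \<circ> c) x) = - snd (b x) (lie_bracket (fst \<circ> c) (fst \<circ> a) x)"
    using lie_bracket_antisym[of "fst \<circ> a" "fst \<circ> c" x]
      cotangent_scale[OF one_form_onD(1)[OF B(2) x] lie_bracket_tangent[OF m C(1) A(1) x], of "-1"] by simp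
  then show ?thesis
    using dorfman_bracket_form[OF m a b C(1) x] 1
    by (simp add: pairing_def courant_tensor_def dorfman_form_def d_form_def lie_form_def o_def dorfman_bracket_def Let_def)
qed

section \<open>Dirac structures through global sections\<close>

text \<open>
  Linear independence is an open condition. The quantitative form bounds the coefficients uniformly, and
  with them the coefficients of the differential equation in \<open>push_locally_constant\<close>.
\<close>

lemma independent_nearby:
  fixes e :: "'i \<Rightarrow> 'z::metric_space \<Rightarrow> 'v::euclidean_space"
  assumes I: "finite I" and inj: "inj_on (\<lambda>i. e i z0) I" and ind: "independent ((\<lambda>i. e i z0) ` I)"
    and cont: "\<And>i. i \<in> I \<Longrightarrow> continuous_on Z (e i)" and z0: "z0 \<in> Z"
  obtains \<delta> N :: real where "\<delta> > 0" "N > 0"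
    "\<And>z c. z \<in> Z \<Longrightarrow> dist z z0 < \<delta> \<Longrightarrow> (\<Sum>i\<in>I. \<bar>c i\<bar>) \<le> N * norm (\<Sum>i\<in>I. c i *\<^sub>R e i z)"
proof -
  have "\<exists>g. linear g \<and> (\<forall>j\<in>I. g (e j z0) = (if j = i then 1 else 0 :: real))" if "i \<in> I" for i
  proof -
    obtain g where g: "linear g" "\<And>x. x \<in> (\<lambda>i. e i z0) ` I \<Longrightarrow> g x = (if x = e i z0 then 1 else 0 :: real)"
      using linear_independent_extend[OF ind, of "\<lambda>x. if x = e i z0 then 1 else 0 :: real"] by blast
    have "g (e j z0) = (if j = i then 1 else 0)" if "j \<in> I" for j
      using g(2)[of "e j z0"] inj that \<open>i \<in> I\<close> by (auto simp: inj_on_def)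
    then show ?thesis using g(1) by blast
  qed
  then obtain g where g: "\<And>i. i \<in> I \<Longrightarrow> linear (g i)" "\<And>i j. i \<in> I \<Longrightarrow> j \<in> I \<Longrightarrow> g i (e j z0) = (if j = i then 1 else 0 :: real)"
    by metis
  have "\<exists>K. \<forall>x. \<bar>g i x\<bar> \<le> K * norm x" if "i \<in> I" for i
    using linear_bounded[OF g(1)[OF that]] by simp
  then obtain K where K: "\<And>i x. i \<in> I \<Longrightarrow> \<bar>g i x\<bar> \<le> K i * norm x" by metis
  define N where "N = (\<Sum>i\<in>I. \<bar>K i\<bar>) + 1"
  have Npos: "N > 0" unfolding N_def using sum_nonneg[of I "\<lambda>i. \<bar>K i\<bar>"] by linarith
  have base: "(\<Sum>i\<in>I. \<bar>c i\<bar>) \<le> N * norm (\<Sum>i\<in>I. c i *\<^sub>R e i z0)" for c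
  proof -
    let ?w = "\<Sum>j\<in>I. c j *\<^sub>R e j z0"
    have "\<bar>c i\<bar> \<le> \<bar>K i\<bar> * norm ?w" if "i \<in> I" for i
    proof -
      have "g i ?w = (\<Sum>j\<in>I. c j * g i (e j z0))" using g(1)[OF that] by (simp add: linear_sum linear_scale)
      also have "\<dots> = (\<Sum>j\<in>I. if j = i then c j else 0)" by (rule sum.cong) (use g(2)[OF that] in auto)
      also have "\<dots> = c i" using I that by simp
      finally have "\<bar>c i\<bar> \<le> K i * norm ?w" using K[OF that, of ?w] by simp
      also have "\<dots> \<le> \<bar>K i\<bar> * norm ?w" by (intro mult_right_mono) auto
      finally show ?thesis .
    qed
    then have "(\<Sum>i\<in>I. \<bar>c i\<bar>) \<le> (\<Sum>i\<in>I. \<bar>K i\<bar>) * norm ?w" by (simp add: sum_mono sum_distrib_right)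
    also have "\<dots> \<le> N * norm ?w" unfolding N_def by (intro mult_right_mono) auto
    finally show ?thesis .
  qed
  define \<epsilon> where "\<epsilon> = 1 / (2 * N)"
  have \<epsilon>: "\<epsilon> > 0" using Npos by (simp add: \<epsilon>_def)
  have "\<exists>\<delta>>0. \<forall>z\<in>Z. dist z z0 < \<delta> \<longrightarrow> dist (e i z) (e i z0) < \<epsilon>" if "i \<in> I" for i
    using cont[OF that] z0 \<epsilon> unfolding continuous_on_iff by blast
  then obtain \<delta> where \<delta>: "\<And>i. i \<in> I \<Longrightarrow> \<delta> i > 0" "\<And>i z. i \<in> I \<Longrightarrow> z \<in> Z \<Longrightarrow> dist z z0 < \<delta> i \<Longrightarrow> dist (e i z) (e i z0) < \<epsilon>"
    by metis
  define d where "d = Min (insert 1 (\<delta> ` I))"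
  have d: "d > 0" "\<And>i. i \<in> I \<Longrightarrow> d \<le> \<delta> i" using I \<delta>(1) by (auto simp: d_def)
  show thesis
  proof (rule that[of d "2 * N"])
    show "d > 0" "2 * N > 0" using d Npos by auto
    fix z c assume z: "z \<in> Z" "dist z z0 < d"
    have "norm ((\<Sum>i\<in>I. c i *\<^sub>R e i z0) - (\<Sum>i\<in>I. c i *\<^sub>R e i z)) \<le> (\<Sum>i\<in>I. \<bar>c i\<bar> * \<epsilon>)"
      unfolding sum_subtractf[symmetric] scaleR_diff_right[symmetric]
    proof (rule sum_norm_le)
      fix i assume i: "i \<in> I"
      have "norm (e i z0 - e i z) \<le> \<epsilon>" using \<delta>(2)[OF i z(1)] z(2) d(2)[OF i] by (simp add: dist_norm norm_minus_commute)
      then show "norm (c i *\<^sub>R (e i z0 - e i z)) \<le> \<bar>c i\<bar> * \<epsilon>" by (simp add: mult_left_mono)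
    qed
    then have "norm (\<Sum>i\<in>I. c i *\<^sub>R e i z0) \<le> norm (\<Sum>i\<in>I. c i *\<^sub>R e i z) + (\<Sum>i\<in>I. \<bar>c i\<bar>) * \<epsilon>"
      using norm_triangle_sub[of "\<Sum>i\<in>I. c i *\<^sub>R e i z0" "\<Sum>i\<in>I. c i *\<^sub>R e i z"] by (simp add: sum_distrib_right)
    then have "N * norm (\<Sum>i\<in>I. c i *\<^sub>R e i z0) \<le> N * (norm (\<Sum>i\<in>I. c i *\<^sub>R e i z) + (\<Sum>i\<in>I. \<bar>c i\<bar>) * \<epsilon>)"
      using Npos by (intro mult_left_mono) auto
    then have "(\<Sum>i\<in>I. \<bar>c i\<bar>) \<le> N * norm (\<Sum>i\<in>I. c i *\<^sub>R e i z) + (\<Sum>i\<in>I. \<bar>c i\<bar>) / 2"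
      using base[of c] Npos by (simp add: algebra_simps \<epsilon>_def)
    then show "(\<Sum>i\<in>I. \<bar>c i\<bar>) \<le> 2 * N * norm (\<Sum>i\<in>I. c i *\<^sub>R e i z)" by simp
  qed
qed

text \<open>
  The coordinates of an element of the generalized tangent bundle, in which all fibres over \<open>W1\<close> become
  the same space \<open>model M \<times> model M\<close>.
\<close>

definition gcoord :: "('a, 'e::euclidean_space) manifold \<Rightarrow> ('e \<Rightarrow> 'a \<Rightarrow> 'a tangent) \<Rightarrow> ('e \<Rightarrow> 'a \<Rightarrow> real) \<Rightarrow>
    'a \<Rightarrow> 'a gtangent \<Rightarrow> 'e \<times> 'e" where
  "gcoord M E q y d = ((\<Sum>b\<in>onb (model M). fst d (q b) *\<^sub>R b), (\<Sum>b\<in>onb (model M). snd d (E b y) *\<^sub>R b))"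

lemma linear_gcoord: "linear (gcoord M E q y)"
  by (rule linearI) (simp_all add: gcoord_def fun_plus_apply fun_scaleR_apply scaleR_add_left sum.distrib scaleR_sum_right)

lemma onb_inner_sum:
  assumes "subspace S" "c \<in> onb S" shows "(\<Sum>b\<in>onb S. x b *\<^sub>R b) \<bullet> c = x c"
proof -
  have "(\<Sum>b\<in>onb S. x b *\<^sub>R b) \<bullet> c = (\<Sum>b\<in>onb S. if b = c then x b else 0)"
    unfolding inner_sum_left by (rule sum.cong) (use onb_inner[OF assms(1) _ assms(2)] in auto)
  then show ?thesis using assms(2) onb(4)[OF assms(1)] by simp
qed

lemma onb_inner_sums:
  assumes "subspace S" shows "(\<Sum>b\<in>onb S. x b *\<^sub>R b) \<bullet> (\<Sum>b\<in>onb S. y b *\<^sub>R b) = (\<Sum>b\<in>onb S. x b * y b)"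
  unfolding inner_sum_right by (rule sum.cong) (use onb_inner_sum[OF assms] in auto)

lemma gcoord_pairing:
  assumes m: "smooth_manifold M" and F: "cframe M W \<kappa> W1 E q" and y: "y \<in> W1"
    and d: "d \<in> gtangent_space M y" and d': "d' \<in> gtangent_space M y"
  shows "pairing d d' = fst (gcoord M E q y d) \<bullet> snd (gcoord M E q y d') + fst (gcoord M E q y d') \<bullet> snd (gcoord M E q y d)"
  using cframe_cotangent_expand[OF m F y, of "fst d" "snd d'"] cframe_cotangent_expand[OF m F y, of "fst d'" "snd d"] d d'
  by (simp add: gcoord_def onb_inner_sums[OF smooth_manifoldD(2)[OF m]] pairing_def gtangent_space_def mem_Times_iff)

lemma gcoord_in: "smooth_manifold M \<Longrightarrow> gcoord M E q y d \<in> model M \<times> model M"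
  using smooth_manifoldD(2)[of M] onb(1)[OF smooth_manifoldD(2)[of M]]
  by (auto simp: gcoord_def intro!: subspace_sum subspace_scale)

lemma gcoord_inj:
  assumes m: "smooth_manifold M" and F: "cframe M W \<kappa> W1 E q" and y: "y \<in> W1"
    and d: "d \<in> gtangent_space M y" and d': "d' \<in> gtangent_space M y" and eq: "gcoord M E q y d = gcoord M E q y d'"
  shows "d = d'"
proof -
  note S = smooth_manifoldD(2)[OF m]
  have 1: "fst d (q b) = fst d' (q b)" "snd d (E b y) = snd d' (E b y)" if "b \<in> onb (model M)" for b
    using eq onb_inner_sum[OF S that, of "\<lambda>b. fst d (q b)"] onb_inner_sum[OF S that, of "\<lambda>b. fst d' (q b)"]
      onb_inner_sum[OF S that, of "\<lambda>b. snd d (E b y)"] onb_inner_sum[OF S that, of "\<lambda>b. snd d' (E b y)"]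
    by (auto simp: gcoord_def)
  have D: "fst d \<in> tangent_space M y" "snd d \<in> cotangent_space M y" "fst d' \<in> tangent_space M y" "snd d' \<in> cotangent_space M y"
    using d d' by (auto simp: gtangent_space_def)
  have "fst d = fst d'"
    using cframe_tangent_expand[OF m F y D(1)] cframe_tangent_expand[OF m F y D(3)] 1(1) by (metis (no_types, lifting) sum.cong)
  moreover have "snd d = snd d'"
  proof (rule cotangent_eqI[OF D(2,4)])
    fix v assume v: "v \<in> tangent_space M y"
    show "snd d v = snd d' v"
      unfolding cframe_cotangent_expand[OF m F y v D(2)] cframe_cotangent_expand[OF m F y v D(4)]
      by (rule sum.cong) (use 1(2) in auto)
  qed
  ultimately show ?thesis by (simp add: prod_eq_iff)
qed

lemma gcoord_surj:
  assumes m: "smooth_manifold M" and F: "cframe M W \<kappa> W1 E q" and y: "y \<in> W1" and p: "p \<in> model M \<times> model M"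
  obtains d where "d \<in> gtangent_space M y" "gcoord M E q y d = p"
proof
  note S = smooth_manifoldD(2)[OF m]
  let ?B = "onb (model M)"
  note B = cframe_basis[OF m]
  define v where "v = (\<Sum>b\<in>?B. (fst p \<bullet> b) *\<^sub>R E b y)"
  define \<alpha> where "\<alpha> = (\<Sum>b\<in>?B. (snd p \<bullet> b) *\<^sub>R dform M (q b) y)"
  have E: "E b y \<in> tangent_space M y" if "b \<in> ?B" for b by (rule cframeD(9)[OF F B[OF that] y])
  have dual: "E b y (q c) = (if b = c then 1 else 0)" if "b \<in> ?B" "c \<in> ?B" for b c
    using cframe_dual[OF m F y B[OF that(1)] B[OF that(2)]] onb_inner[OF S that] by simp
  show "(v, \<alpha>) \<in> gtangent_space M y"
    unfolding gtangent_space_def v_def \<alpha>_def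
    by (intro SigmaI subspace_sum subspace_scale subspace_tangent_space subspace_cotangent_space dform_cotangent E)
  have "v (q c) = fst p \<bullet> c" if c: "c \<in> ?B" for c
  proof -
    have "v (q c) = (\<Sum>b\<in>?B. if b = c then fst p \<bullet> b else 0)"
      unfolding v_def fun_sum_apply fun_scaleR_apply by (rule sum.cong) (use dual[OF _ c] in auto)
    then show ?thesis using c onb(4)[OF S] by simp
  qed
  moreover have "\<alpha> (E c y) = snd p \<bullet> c" if c: "c \<in> ?B" for c
  proof -
    have "\<alpha> (E c y) = (\<Sum>b\<in>?B. if b = c then snd p \<bullet> b else 0)"
      unfolding \<alpha>_def fun_sum_apply fun_scaleR_apply by (rule sum.cong) (use dual[OF c] E[OF c] in \<open>auto simp: dform_def\<close>)
    then show ?thesis using c onb(4)[OF S] by simp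
  qed
  ultimately show "gcoord M E q y (v, \<alpha>) = p"
    using onb_expand[OF S, of "fst p"] onb_expand[OF S, of "snd p"] p
    by (auto simp: gcoord_def prod_eq_iff cong: sum.cong)
qed

lemma subspace_orthogonal_space:
  assumes "A \<subseteq> gtangent_space M x" shows "subspace (orthogonal_space M x A)"
proof -
  have A: "fst b \<in> tangent_space M x" "snd b \<in> cotangent_space M x" if "b \<in> A" for b
    using assms that by (auto simp: gtangent_space_def)
  note g = subspace_gtangent_space[of M x]
  have "pairing (a + a') b = pairing a b + pairing a' b" "pairing (c *\<^sub>R a) b = c * pairing a b"
    if "a \<in> gtangent_space M x" "a' \<in> gtangent_space M x" "b \<in> A" for a a' b c
    using that A[OF that(3)] cotangent_add[OF A(2)[OF that(3)], of "fst a" "fst a'"] cotangent_scale[OF A(2)[OF that(3)], of "fst a" c]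
    by (auto simp: pairing_def fun_plus_apply fun_scaleR_apply gtangent_space_def mem_Times_iff algebra_simps)
  moreover have "pairing 0 b = 0" if "b \<in> A" for b
    using cotangent_0[OF A(2)[OF that]] by (simp add: pairing_def zero_fun_def)
  ultimately show ?thesis
    unfolding subspace_def orthogonal_space_def using g by (auto simp: subspace_def)
qed

definition lagrangian_family :: "('a, 'e::euclidean_space) manifold \<Rightarrow> ('a \<Rightarrow> 'a gtangent set) \<Rightarrow> bool" where
  "lagrangian_family M D \<longleftrightarrow> (\<forall>x\<in>mpoints M. D x = orthogonal_space M x (D x))"

lemma lagrangian_familyD:
  assumes "lagrangian_family M D" "x \<in> mpoints M"
  shows "D x \<subseteq> gtangent_space M x" "subspace (D x)"
    "\<And>a b. a \<in> D x \<Longrightarrow> b \<in> D x \<Longrightarrow> pairing a b = 0"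
    "\<And>a. a \<in> gtangent_space M x \<Longrightarrow> (\<And>b. b \<in> D x \<Longrightarrow> pairing a b = 0) \<Longrightarrow> a \<in> D x"
proof -
  have D: "D x = orthogonal_space M x (D x)" using assms by (simp add: lagrangian_family_def)
  show g: "D x \<subseteq> gtangent_space M x" by (subst D) (auto simp: orthogonal_space_def)
  show "subspace (D x)" by (subst D) (rule subspace_orthogonal_space[OF g])
  show "pairing a b = 0" if "a \<in> D x" "b \<in> D x" for a b using D that by (auto simp: orthogonal_space_def)
  show "a \<in> D x" if "a \<in> gtangent_space M x" "\<And>b. b \<in> D x \<Longrightarrow> pairing a b = 0" for a
    by (subst D) (use that in \<open>auto simp: orthogonal_space_def\<close>)
qed

text \<open>
  In coordinates the pairing is the inner product after exchanging the two components. A Lagrangian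
  subspace is thus the orthogonal complement of its image under the exchange, which has the same
  dimension.
\<close>

lemma lagrangian_dim:
  assumes m: "smooth_manifold M" and D: "lagrangian_family M D" and F: "cframe M W \<kappa> W1 E q" and y: "y \<in> W1"
  shows "dim (gcoord M E q y ` D y) = dim (model M)" "subspace (gcoord M E q y ` D y)"
proof -
  have yM: "y \<in> mpoints M" using cframeD(4)[OF F] y by blast
  note DD = lagrangian_familyD[OF D yM] and S = smooth_manifoldD(2)[OF m]
  let ?g = "gcoord M E q y"
  let ?A = "?g ` D y" and ?SS = "model M \<times> model M"
  show sA: "subspace ?A" by (rule linear_subspace_image[OF linear_gcoord DD(2)])
  have AS: "?A \<subseteq> ?SS" using gcoord_in[OF m] by blast
  \<comment> \<open>Exchanging the components turns the pairing into the inner product.\<close>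
  define sw :: "'b \<times> 'b \<Rightarrow> 'b \<times> 'b" where "sw = (\<lambda>p. (snd p, fst p))"
  have lsw: "linear sw" unfolding sw_def by (rule linearI) auto
  have isw: "inj sw" unfolding sw_def by (auto simp: inj_def prod_eq_iff)
  have swA: "subspace (sw ` ?A)" by (rule linear_subspace_image[OF lsw sA])
  have swS: "sw ` ?A \<subseteq> ?SS" using AS by (auto simp: sw_def)
  have SS: "subspace ?SS" by (intro subspace_Times S)
  have in_sw: "sw (?g b) \<bullet> ?g a = pairing b a" if "a \<in> gtangent_space M y" "b \<in> gtangent_space M y" for a b
    using gcoord_pairing[OF m F y that(2,1)] by (simp add: sw_def inner_prod_def inner_commute)
  have "{p \<in> ?SS. \<forall>x\<in>sw ` ?A. orthogonal x p} = ?A"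
  proof (intro equalityI subsetI)
    fix p assume p: "p \<in> {p \<in> ?SS. \<forall>x\<in>sw ` ?A. orthogonal x p}"
    then obtain a where a: "a \<in> gtangent_space M y" "?g a = p" using gcoord_surj[OF m F y] by blast
    have "a \<in> D y"
    proof (rule DD(4)[OF a(1)])
      fix b assume b: "b \<in> D y"
      have "orthogonal (sw (?g b)) (?g a)" using p a(2) b by simp
      moreover have bg: "b \<in> gtangent_space M y" using DD(1) b by blast
      ultimately have "pairing b a = 0" using in_sw[OF a(1) bg] unfolding orthogonal_def by simp
      then show "pairing a b = 0" by (simp add: pairing_def)
    qed
    then show "p \<in> ?A" using a by blast
  next
    fix p assume "p \<in> ?A"
    then obtain a where a: "a \<in> D y" "p = ?g a" by blast
    have "orthogonal (sw (?g b)) p" if b: "b \<in> D y" for b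
    proof -
      have ab: "a \<in> gtangent_space M y" "b \<in> gtangent_space M y" using DD(1) a(1) b by blast+
      show ?thesis unfolding orthogonal_def a(2) in_sw[OF ab] by (rule DD(3)[OF b a(1)])
    qed
    then show "p \<in> {p \<in> ?SS. \<forall>x\<in>sw ` ?A. orthogonal x p}" using AS \<open>p \<in> ?A\<close> by auto
  qed
  then have "dim ?A + dim (sw ` ?A) = dim ?SS"
    using dim_subspace_orthogonal_to_vectors[OF swA SS swS] by simp
  moreover have "dim (sw ` ?A) = dim ?A"
    by (rule dim_image_eq[OF lsw]) (use isw in \<open>auto intro: inj_on_subset\<close>)
  moreover have "dim ?SS = dim (model M) + dim (model M)" by (rule dim_Times[OF S S])
  ultimately show "dim ?A = dim (model M)" by simp
qed

text \<open>
  For a Lagrangian family this replaces local frames: it speaks of one element at a time and of global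
  sections only.
\<close>

definition has_sections :: "('a, 'e::euclidean_space) manifold \<Rightarrow> ('a \<Rightarrow> 'a gtangent set) \<Rightarrow> bool" where
  "has_sections M D \<longleftrightarrow> (\<forall>x\<in>mpoints M. \<forall>d\<in>D x. \<exists>a\<in>sections M D. a x = d)"

lemma sectionsD:
  assumes "a \<in> sections M D"
  shows "smooth_section_on M (mpoints M) a" "\<And>x. x \<in> mpoints M \<Longrightarrow> a x \<in> D x"
  using assms by (auto simp: sections_def)

lemma continuous_gcoord_section:
  assumes m: "smooth_manifold M" and F: "cframe M W \<kappa> W1 E q" and a: "smooth_section_on M (mpoints M) a"
  shows "continuous_on (\<kappa> ` W1) (\<lambda>z. gcoord M E q (inv_into W \<kappa> z) (a (inv_into W \<kappa> z)))"
proof -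
  note d = cframeD[OF F] and A = smooth_sectionD[OF a]
  have c: "continuous_on (\<kappa> ` W1) (\<lambda>z. f (inv_into W \<kappa> z))" if f: "f \<in> smooth_funs M" for f
    by (rule continuous_on_subset[OF Cinf_on_continuous[OF coord_rep[OF d(1) f]]]) (use d(3) in blast)
  have "continuous_on (\<kappa> ` W1) (\<lambda>z. fst (a (inv_into W \<kappa> z)) (q b))" if "b \<in> onb (model M)" for b
    using c[OF vector_field_smooth_funs[OF A(1) d(6)[OF cframe_basis[OF m that]]]] by (simp add: o_def)
  moreover have "continuous_on (\<kappa> ` W1) (\<lambda>z. snd (a (inv_into W \<kappa> z)) (E b (inv_into W \<kappa> z)))" if "b \<in> onb (model M)" for b
    using c[OF one_form_smooth_funs[OF A(2) d(5)[OF cframe_basis[OF m that]]]] by (simp add: o_def)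
  ultimately show ?thesis
    unfolding gcoord_def by (intro continuous_on_Pair continuous_on_sum continuous_on_scaleR continuous_on_const)
qed

text \<open>
  Sections through the elements of a basis of \<open>D x\<close> remain independent nearby. They span since the
  dimension of a Lagrangian subspace is always that of the manifold.
\<close>

lemma lagrangian_frame:
  assumes m: "smooth_manifold M" and D: "lagrangian_family M D" and ext: "has_sections M D"
    and F: "cframe M W \<kappa> W1 E q" and x: "x \<in> W1"
  obtains e \<delta> N where "\<And>i. i < dim (model M) \<Longrightarrow> e i \<in> sections M D" "\<delta> > 0" "N > 0"
    "\<And>y c. y \<in> W1 \<Longrightarrow> dist (\<kappa> y) (\<kappa> x) < \<delta> \<Longrightarrow>
      (\<Sum>i<dim (model M). \<bar>c i\<bar>) \<le> N * norm (gcoord M E q y (\<Sum>i<dim (model M). c i *\<^sub>R e i y))"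
    "\<And>y d. y \<in> W1 \<Longrightarrow> dist (\<kappa> y) (\<kappa> x) < \<delta> \<Longrightarrow> d \<in> D y \<Longrightarrow> \<exists>c. d = (\<Sum>i<dim (model M). c i *\<^sub>R e i y)"
proof -
  note fd = cframeD[OF F]
  have xM: "x \<in> mpoints M" using fd(4) x by blast
  let ?r = "dim (model M)" and ?g = "gcoord M E q"
  obtain B where B: "B \<subseteq> ?g x ` D x" "independent B" "card B = ?r" "finite B"
    using basis_exists[of "?g x ` D x"] lagrangian_dim(1)[OF m D F x] independent_imp_finite by metis
  obtain h where h: "bij_betw h {..<?r} B" using ex_bij_betw_nat_finite[OF B(4)] B(3) by (auto simp: lessThan_atLeast0)
  have "\<exists>e\<in>sections M D. ?g x (e x) = h i" if "i < ?r" for i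
  proof -
    have "h i \<in> ?g x ` D x" using h that B(1) by (auto simp: bij_betw_def)
    then obtain d where d: "d \<in> D x" "?g x d = h i" by auto
    then show ?thesis using ext xM unfolding has_sections_def by metis
  qed
  then obtain e where e: "\<And>i. i < ?r \<Longrightarrow> e i \<in> sections M D" "\<And>i. i < ?r \<Longrightarrow> ?g x (e i x) = h i" by metis
  define e' where "e' i z = ?g (inv_into W \<kappa> z) (e i (inv_into W \<kappa> z))" for i z
  have inv: "inv_into W \<kappa> (\<kappa> y) = y" if "y \<in> W1" for y using coord_simps(3)[OF fd(1)] fd(3) that by blast
  have e'x: "e' i (\<kappa> x) = h i" if "i < ?r" for i using e(2)[OF that] inv[OF x] by (simp add: e'_def)
  obtain \<delta> N where dN: "\<delta> > 0" "N > 0" "\<And>z c. z \<in> \<kappa> ` W1 \<Longrightarrow> dist z (\<kappa> x) < \<delta> \<Longrightarrow> (\<Sum>i<?r. \<bar>c i\<bar>) \<le> N * norm (\<Sum>i<?r. c i *\<^sub>R e' i z)"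
  proof (rule independent_nearby[of "{..<?r}" e' "\<kappa> x" "\<kappa> ` W1"])
    show "inj_on (\<lambda>i. e' i (\<kappa> x)) {..<?r}" using h e'x by (auto simp: bij_betw_def inj_on_def)
    have "(\<lambda>i. e' i (\<kappa> x)) ` {..<?r} = B" using h e'x by (auto simp: bij_betw_def)
    then show "independent ((\<lambda>i. e' i (\<kappa> x)) ` {..<?r})" using B by simp
    show "continuous_on (\<kappa> ` W1) (e' i)" if "i \<in> {..<?r}" for i
      using continuous_gcoord_section[OF m F sectionsD(1)[OF e(1)]] that by (simp add: e'_def[abs_def])
  qed (use x in auto)
  show thesis
  proof (rule that[OF e(1) dN(1,2)])
    fix y assume y: "y \<in> W1" and dist: "dist (\<kappa> y) (\<kappa> x) < \<delta>"
    have yM: "y \<in> mpoints M" using fd(4) y by blast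
    note DD = lagrangian_familyD[OF D yM]
    have lin: "?g y (\<Sum>i<?r. c i *\<^sub>R e i y) = (\<Sum>i<?r. c i *\<^sub>R e' i (\<kappa> y))" for c
      using linear_gcoord[of M E q y] by (simp add: linear_sum linear_scale e'_def inv[OF y])
    show est: "(\<Sum>i<?r. \<bar>c i\<bar>) \<le> N * norm (?g y (\<Sum>i<?r. c i *\<^sub>R e i y))" for c
      unfolding lin by (rule dN(3)) (use y dist in auto)
    have zero: "c i = 0" if "(\<Sum>i<?r. c i *\<^sub>R e' i (\<kappa> y)) = 0" "i < ?r" for c i
    proof -
      have "(\<Sum>i<?r. \<bar>c i\<bar>) \<le> 0" using est[of c] that(1) by (simp add: lin)
      then have "(\<Sum>i<?r. \<bar>c i\<bar>) = 0" by (intro antisym sum_nonneg) simp_all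
      then show ?thesis using that(2) by (simp add: sum_nonneg_eq_0_iff)
    qed
    have inj: "inj_on (\<lambda>i. e' i (\<kappa> y)) {..<?r}"
    proof (rule inj_onI, rule ccontr)
      fix i j assume ij: "i \<in> {..<?r}" "j \<in> {..<?r}" "e' i (\<kappa> y) = e' j (\<kappa> y)" "i \<noteq> j"
      have "(\<Sum>k<?r. ((if k = i then 1 else 0) - (if k = j then 1 else 0)) *\<^sub>R e' k (\<kappa> y)) = 0"
        using ij by (simp add: scaleR_diff_left sum_subtractf if_distrib[of "\<lambda>c. c *\<^sub>R _"] sum.delta cong: if_cong)
      from zero[OF this, of i] ij show False by simp
    qed
    let ?V = "(\<lambda>i. e' i (\<kappa> y)) ` {..<?r}"
    have ind: "independent ?V"
    proof (rule independent_if_scalars_zero)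
      fix f v assume f: "(\<Sum>v\<in>?V. f v *\<^sub>R v) = 0" "v \<in> ?V"
      then have "(\<Sum>i<?r. f (e' i (\<kappa> y)) *\<^sub>R e' i (\<kappa> y)) = 0" by (simp add: sum.reindex[OF inj])
      from zero[OF this] f(2) show "f v = 0" by auto
    qed simp
    have sub: "?V \<subseteq> ?g y ` D y" using sectionsD(2)[OF e(1) yM] inv[OF y] by (auto simp: e'_def)
    have "?g y ` D y \<subseteq> span ?V"
      by (rule card_ge_dim_independent[OF sub ind]) (simp add: lagrangian_dim(1)[OF m D F y] card_image[OF inj])
    fix d assume d: "d \<in> D y"
    then have "?g y d \<in> span ?V" using \<open>?g y ` D y \<subseteq> span ?V\<close> by blast
    then obtain f where f: "?g y d = (\<Sum>v\<in>?V. f v *\<^sub>R v)" by (auto simp: span_finite)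
    then have "?g y d = ?g y (\<Sum>i<?r. f (e' i (\<kappa> y)) *\<^sub>R e i y)" by (simp add: sum.reindex[OF inj] lin)
    then have "d = (\<Sum>i<?r. f (e' i (\<kappa> y)) *\<^sub>R e i y)"
    proof (rule gcoord_inj[OF m F y, rotated 2])
      show "d \<in> gtangent_space M y" using d DD(1) by blast
      show "(\<Sum>i<?r. f (e' i (\<kappa> y)) *\<^sub>R e i y) \<in> gtangent_space M y"
        using sectionsD(2)[OF e(1) yM] DD(1) by (intro subspace_sum subspace_scale subspace_gtangent_space) auto
    qed
    then show "\<exists>c. d = (\<Sum>i<?r. c i *\<^sub>R e i y)" by (rule exI[of _ "\<lambda>i. f (e' i (\<kappa> y))"])
  qed
qed

lemma lagrangian_subbundle:
  assumes m: "smooth_manifold M" and D: "lagrangian_family M D" and ext: "has_sections M D"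
  shows "vector_subbundle M D"
  unfolding vector_subbundle_def
proof (intro conjI ballI)
  fix x assume x: "x \<in> mpoints M"
  show "D x \<subseteq> gtangent_space M x" "subspace (D x)" using lagrangian_familyD[OF D x] by auto
  obtain W \<kappa> W1 E q where F: "cframe M W \<kappa> W1 E q" "x \<in> W1" using cframe_exists'[OF m x] by metis
  note fd = cframeD[OF F(1)]
  let ?r = "dim (model M)"
  show "\<exists>U (r::nat) e. openin (mtop M) U \<and> x \<in> U \<and> (\<forall>i<r. smooth_section_on M U (e i)) \<and>
        (\<forall>y\<in>U. inj_on (\<lambda>i. e i y) {..<r} \<and> independent ((\<lambda>i. e i y) ` {..<r}) \<and> span ((\<lambda>i. e i y) ` {..<r}) = D y)"
  proof (rule lagrangian_frame[OF m D ext F])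
  fix e \<delta> N
  assume e: "\<And>i. i < ?r \<Longrightarrow> e i \<in> sections M D" "\<delta> > 0" "N > 0"
    "\<And>y c. y \<in> W1 \<Longrightarrow> dist (\<kappa> y) (\<kappa> x) < \<delta> \<Longrightarrow>
      (\<Sum>i<?r. \<bar>c i\<bar>) \<le> N * norm (gcoord M E q y (\<Sum>i<?r. c i *\<^sub>R e i y))"
    "\<And>y d. y \<in> W1 \<Longrightarrow> dist (\<kappa> y) (\<kappa> x) < \<delta> \<Longrightarrow> d \<in> D y \<Longrightarrow> \<exists>c. d = (\<Sum>i<?r. c i *\<^sub>R e i y)"
  define U where "U = {y \<in> W. \<kappa> y \<in> model M \<inter> ball (\<kappa> x) \<delta>} \<inter> W1"
  have kS: "\<kappa> y \<in> model M" if "y \<in> W1" for y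
    using open_subD(2)[OF coord_open_sub[OF m fd(1,2,3)]] that by blast
  have U: "y \<in> U \<longleftrightarrow> y \<in> W1 \<and> dist (\<kappa> y) (\<kappa> x) < \<delta>" for y
    using fd(3) kS by (auto simp: U_def dist_commute)
  have "openin (mtop M) {y \<in> W. \<kappa> y \<in> model M \<inter> ball (\<kappa> x) \<delta>}"
    by (rule top_chart_vimage_open[OF coordD(1)[OF fd(1)]]) (auto simp: openin_open)
  then have oU: "openin (mtop M) U" unfolding U_def using fd(2) by (rule openin_Int)
  have main: "inj_on (\<lambda>i. e i y) {..<?r} \<and> independent ((\<lambda>i. e i y) ` {..<?r}) \<and> span ((\<lambda>i. e i y) ` {..<?r}) = D y"
    if "y \<in> U" for y
  proof -
    have y: "y \<in> W1" "dist (\<kappa> y) (\<kappa> x) < \<delta>" "y \<in> mpoints M" using that U fd(4) by auto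
    have zero: "c i = 0" if "(\<Sum>i<?r. c i *\<^sub>R e i y) = 0" "i < ?r" for c i
    proof -
      have "(\<Sum>i<?r. \<bar>c i\<bar>) \<le> 0" using e(4)[OF y(1,2), of c] linear_0[OF linear_gcoord[of M E q y]] unfolding that(1) by simp
      then have "(\<Sum>i<?r. \<bar>c i\<bar>) = 0" by (intro antisym sum_nonneg) simp_all
      then show ?thesis using that(2) by (simp add: sum_nonneg_eq_0_iff)
    qed
    have inj: "inj_on (\<lambda>i. e i y) {..<?r}"
    proof (rule inj_onI, rule ccontr)
      fix i j assume ij: "i \<in> {..<?r}" "j \<in> {..<?r}" "e i y = e j y" "i \<noteq> j"
      have "(\<Sum>k<?r. ((if k = i then 1 else 0) - (if k = j then 1 else 0)) *\<^sub>R e k y) = 0"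
        using ij by (simp add: scaleR_diff_left sum_subtractf if_distrib[of "\<lambda>c. c *\<^sub>R _"] sum.delta cong: if_cong)
      from zero[OF this, of i] ij show False by simp
    qed
    have ind: "independent ((\<lambda>i. e i y) ` {..<?r})"
    proof (rule independent_if_scalars_zero)
      fix f v assume f: "(\<Sum>v\<in>(\<lambda>i. e i y) ` {..<?r}. f v *\<^sub>R v) = 0" "v \<in> (\<lambda>i. e i y) ` {..<?r}"
      then have "(\<Sum>i<?r. f (e i y) *\<^sub>R e i y) = 0" by (simp add: sum.reindex[OF inj])
      from zero[OF this] f(2) show "f v = 0" by auto
    qed simp
    have "span ((\<lambda>i. e i y) ` {..<?r}) \<subseteq> D y"
      by (rule span_minimal) (use sectionsD(2)[OF e(1) y(3)] lagrangian_familyD(2)[OF D y(3)] in auto)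
    moreover have "D y \<subseteq> span ((\<lambda>i. e i y) ` {..<?r})"
    proof
      fix d assume "d \<in> D y"
      then obtain c where c: "d = (\<Sum>i<?r. c i *\<^sub>R e i y)" using e(5)[OF y(1,2)] by blast
      show "d \<in> span ((\<lambda>i. e i y) ` {..<?r})"
        unfolding c by (rule span_sum, rule span_scale, rule span_base) simp
    qed
    ultimately show ?thesis using inj ind by blast
  qed
  show ?thesis
  proof (intro exI conjI ballI allI impI)
    show "openin (mtop M) U" "x \<in> U" using oU U F(2) e(2) by auto
    show "smooth_section_on M U (e i)" if "i < ?r" for i
      using sectionsD(1)[OF e(1)[OF that]] openin_subset[OF oU] vector_field_on_mono one_form_on_mono
      unfolding smooth_section_on_def by metis
  qed (use main in auto)
  qed
qed

lemma smooth_section_cut: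
  assumes m: "smooth_manifold M" and W: "openin (mtop M) W" and C: "closedin (mtop M) C" "C \<subseteq> W"
    and b: "\<beta> \<in> smooth_funs M" "\<And>y. y \<notin> C \<Longrightarrow> \<beta> y = 0"
    and a: "smooth_section_on M W a"
  shows "smooth_section_on M (mpoints M) (cut_off W \<beta> a)"
proof -
  have "fst \<circ> cut_off W \<beta> a = cut_off W \<beta> (fst \<circ> a)" "snd \<circ> cut_off W \<beta> a = cut_off W \<beta> (snd \<circ> a)"
    by (auto simp: cut_off_def fun_eq_iff)
  then show ?thesis
    using vector_field_cut[OF m W C b] one_form_cut[OF m W C b] a by (simp add: smooth_section_on_def)
qed

text \<open>
  Multiplication by a bump function does not leave the subspaces \<open>D y\<close>, and zero belongs to all of them.
\<close>

lemma extend_section: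
  assumes m: "smooth_manifold M" and W: "openin (mtop M) W" "x \<in> W" and a: "smooth_section_on M W a"
    and D: "\<And>y. y \<in> W \<Longrightarrow> a y \<in> D y" and sub: "\<And>y. y \<in> mpoints M \<Longrightarrow> subspace (D y)"
  obtains a' W' where "a' \<in> sections M D" "openin (mtop M) W'" "x \<in> W'" "W' \<subseteq> W" "\<And>y. y \<in> W' \<Longrightarrow> a' y = a y"
proof -
  obtain \<beta> C W' where b: "\<beta> \<in> smooth_funs M" "closedin (mtop M) C" "C \<subseteq> W" "\<And>y. y \<notin> C \<Longrightarrow> \<beta> y = 0"
    "openin (mtop M) W'" "x \<in> W'" "W' \<subseteq> C" "\<And>y. y \<in> W' \<Longrightarrow> \<beta> y = 1"
    using bump[OF m W] by metis
  show thesis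
  proof (rule that[of "cut_off W \<beta> a" W'])
    show "cut_off W \<beta> a \<in> sections M D"
      unfolding sections_def using smooth_section_cut[OF m W(1) b(2,3,1,4) a] D sub
      by (auto simp: cut_off_def subspace_scale subspace_0)
  qed (use b in \<open>auto simp: cut_off_def\<close>)
qed

lemma subbundle_has_sections:
  assumes m: "smooth_manifold M" and D: "vector_subbundle M D"
  shows "has_sections M D"
  unfolding has_sections_def
proof (intro ballI)
  fix x d assume x: "x \<in> mpoints M" and d: "d \<in> D x"
  obtain U r e where U: "openin (mtop M) U" "x \<in> U" "\<And>i. i < (r::nat) \<Longrightarrow> smooth_section_on M U (e i)"
    "\<And>y. y \<in> U \<Longrightarrow> inj_on (\<lambda>i. e i y) {..<r}" "\<And>y. y \<in> U \<Longrightarrow> span ((\<lambda>i. e i y) ` {..<r}) = D y"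
    using D x unfolding vector_subbundle_def by metis
  have "d \<in> span ((\<lambda>i. e i x) ` {..<r})" using d U(2,5) by simp
  then obtain f where f: "d = (\<Sum>v\<in>(\<lambda>i. e i x) ` {..<r}. f v *\<^sub>R v)" by (auto simp: span_finite)
  define c where "c i = f (e i x)" for i
  have dc: "d = (\<Sum>i<r. c i *\<^sub>R e i x)" unfolding f c_def by (simp add: sum.reindex[OF U(4)[OF U(2)]])
  define a where "a y = (\<Sum>i<r. c i *\<^sub>R e i y)" for y
  have "smooth_section_on M U a"
  proof -
    have "fst \<circ> a = (\<lambda>y. \<Sum>i<r. c i *\<^sub>R (fst \<circ> e i) y)" "snd \<circ> a = (\<lambda>y. \<Sum>i<r. c i *\<^sub>R (snd \<circ> e i) y)"
      by (auto simp: a_def fst_sum snd_sum)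
    moreover have "vector_field_on M U (\<lambda>y. \<Sum>i<r. c i *\<^sub>R (fst \<circ> e i) y)" "one_form_on M U (\<lambda>y. \<Sum>i<r. c i *\<^sub>R (snd \<circ> e i) y)"
      by (intro vector_field_on_sum one_form_on_sum vector_field_on_scale one_form_on_scale smooth_fun_on_const smooth_sectionD(1,2)[OF U(3)]; simp)+
    ultimately show ?thesis unfolding smooth_section_on_def by (simp only:)
  qed
  moreover have "a y \<in> D y" if "y \<in> U" for y
    unfolding a_def U(5)[OF that, symmetric] by (intro span_sum span_scale span_base) auto
  ultimately obtain a' W' where "a' \<in> sections M D" "x \<in> W'" "\<And>y. y \<in> W' \<Longrightarrow> a' y = a y"
    using extend_section[OF m U(1,2), of a D] D unfolding vector_subbundle_def by metis
  then show "\<exists>a\<in>sections M D. a x = d" using dc by (auto simp: a_def)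
qed

text \<open>
  For sections \<open>a\<close> and \<open>b\<close> the bracket is a section of \<open>D\<close> if and only if it is orthogonal to \<open>D\<close>, because
  \<open>D\<close> is its own orthogonal, and orthogonality can be tested on values of sections \<open>c\<close>. Local frames are obtained from
  global sections through a basis of one fibre.
\<close>

theorem dirac_structure_iff:
  assumes m: "smooth_manifold M"
  shows "dirac_structure M D \<longleftrightarrow> lagrangian_family M D \<and> has_sections M D \<and>
     (\<forall>a\<in>sections M D. \<forall>b\<in>sections M D. \<forall>c\<in>sections M D. \<forall>x\<in>mpoints M. courant_tensor a b c x = 0)"
proof
  assume D: "dirac_structure M D"
  have l: "lagrangian_family M D" using D by (simp add: dirac_structure_def lagrangian_family_def)
  have "courant_tensor a b c x = 0" if "a \<in> sections M D" "b \<in> sections M D" "c \<in> sections M D" "x \<in> mpoints M" for a b c x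
  proof -
    have "pairing (dorfman_bracket M a b x) (c x) = 0"
      using D that lagrangian_familyD(3)[OF l that(4)] unfolding dirac_structure_def sections_def by blast
    then show ?thesis
      using pairing_dorfman[OF m sectionsD(1)[OF that(1)] sectionsD(1)[OF that(2)] sectionsD(1)[OF that(3)] that(4)]
        lagrangian_familyD(3)[OF l _ sectionsD(2)[OF that(1)] sectionsD(2)[OF that(3)]] by simp
  qed
  then show "lagrangian_family M D \<and> has_sections M D \<and>
     (\<forall>a\<in>sections M D. \<forall>b\<in>sections M D. \<forall>c\<in>sections M D. \<forall>x\<in>mpoints M. courant_tensor a b c x = 0)"
    using l subbundle_has_sections[OF m] D by (simp add: dirac_structure_def)
next
  assume R: "lagrangian_family M D \<and> has_sections M D \<and>
     (\<forall>a\<in>sections M D. \<forall>b\<in>sections M D. \<forall>c\<in>sections M D. \<forall>x\<in>mpoints M. courant_tensor a b c x = 0)"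
  then have l: "lagrangian_family M D" and s: "has_sections M D" by auto
  have "dorfman_bracket M a b \<in> sections M D" if a: "a \<in> sections M D" and b: "b \<in> sections M D" for a b
  proof -
    note sm = dorfman_bracket_smooth[OF m sectionsD(1)[OF a] sectionsD(1)[OF b]]
    have "dorfman_bracket M a b x \<in> D x" if x: "x \<in> mpoints M" for x
    proof (rule lagrangian_familyD(4)[OF l x smooth_sectionD(3)[OF sm x]])
      fix d assume "d \<in> D x"
      then obtain c where c: "c \<in> sections M D" "c x = d" using s x unfolding has_sections_def by blast
      have "pairing (dorfman_bracket M a b x) (c x) = courant_tensor a b c x"
        by (rule pairing_dorfman[OF m sectionsD(1)[OF a] sectionsD(1)[OF b] sectionsD(1)[OF c(1)] x])
          (rule lagrangian_familyD(3)[OF l _ sectionsD(2)[OF a] sectionsD(2)[OF c(1)]])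
      then show "pairing (dorfman_bracket M a b x) d = 0" using R a b c x by auto
    qed
    then show ?thesis using sm by (simp add: sections_def)
  qed
  then show "dirac_structure M D"
    using l lagrangian_subbundle[OF m l s] by (simp add: dirac_structure_def lagrangian_family_def)
qed

text \<open>
  As a pairing with \<open>c\<close> the expression depends only on the value of \<open>c\<close>. Cyclic permutation brings each
  of the three sections into the last position.
\<close>

lemma courant_tensor_cong:
  assumes m: "smooth_manifold M" and D: "lagrangian_family M D" and x: "x \<in> mpoints M"
    and a: "a \<in> sections M D" and b: "b \<in> sections M D" and c: "c \<in> sections M D"
    and a': "a' \<in> sections M D" and b': "b' \<in> sections M D" and c': "c' \<in> sections M D"
    and eq: "a x = a' x" "b x = b' x" "c x = c' x"
  shows "courant_tensor a b c x = courant_tensor a' b' c' x"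
proof -
  have 1: "courant_tensor a b c x = pairing (dorfman_bracket M a b x) (c x)" if "a \<in> sections M D" "b \<in> sections M D" "c \<in> sections M D" for a b c
    by (rule pairing_dorfman[OF m sectionsD(1)[OF that(1)] sectionsD(1)[OF that(2)] sectionsD(1)[OF that(3)] x, symmetric])
      (rule lagrangian_familyD(3)[OF D _ sectionsD(2)[OF that(1)] sectionsD(2)[OF that(3)]])
  have "courant_tensor a b c x = courant_tensor a b c' x" using 1 a b c c' eq by simp
  also have "\<dots> = courant_tensor b c' a x" by (rule courant_tensor_cyclic)
  also have "\<dots> = courant_tensor b c' a' x" using 1 a b c' a' eq by simp
  also have "\<dots> = courant_tensor c' a' b x" by (rule courant_tensor_cyclic)
  also have "\<dots> = courant_tensor c' a' b' x" using 1 b' b c' a' eq by simp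
  also have "\<dots> = courant_tensor a' b' c' x" by (rule courant_tensor_cyclic)
  finally show ?thesis .
qed

section \<open>Submersions in adapted coordinates\<close>

lemma cvec_surj:
  assumes m: "smooth_manifold M" and c: "coord M W \<kappa>" and x: "x \<in> W" and v: "v \<in> tangent_space M x"
  obtains s where "s \<in> model M" "v = cvec M W \<kappa> x s"
proof -
  note S = smooth_manifoldD(2)[OF m]
  obtain W1 E q where F: "cframe M W \<kappa> W1 E q" "x \<in> W1"
    using cframe_exists[OF m c coord_simps(1)[OF c] x order_refl] by metis
  define s where "s = (\<Sum>b\<in>onb (model M). v (q b) *\<^sub>R b)"
  have s: "s \<in> model M" unfolding s_def by (intro subspace_sum subspace_scale S cframe_basis[OF m])
  have "v = (\<Sum>b\<in>onb (model M). v (q b) *\<^sub>R E b x)" by (rule cframe_tangent_expand[OF m F v])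
  also have "\<dots> = (\<Sum>b\<in>onb (model M). (s \<bullet> b) *\<^sub>R cvec M W \<kappa> x b)"
    by (rule sum.cong) (use onb_inner_sum[OF S, of _ "\<lambda>b. v (q b)"] cframeD(7)[OF F(1) cframe_basis[OF m] F(2)] in \<open>auto simp: s_def\<close>)
  also have "\<dots> = cvec M W \<kappa> x s" by (rule cvec_expand[OF m c x s, symmetric])
  finally show thesis using that s by blast
qed

lemma cvec_inj:
  assumes m: "smooth_manifold M" and c: "coord M W \<kappa>" and x: "x \<in> W" and s: "s \<in> model M" "t \<in> model M"
    and eq: "cvec M W \<kappa> x s = cvec M W \<kappa> x t"
  shows "s = t"
proof -
  note S = smooth_manifoldD(2)[OF m]
  obtain W1 E q where F: "cframe M W \<kappa> W1 E q" "x \<in> W1"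
    using cframe_exists[OF m c coord_simps(1)[OF c] x order_refl] by metis
  have "s \<bullet> b = t \<bullet> b" if "b \<in> onb (model M)" for b
    using cframe_dual[OF m F s(1) cframe_basis[OF m that]] cframe_dual[OF m F s(2) cframe_basis[OF m that]]
      cframeD(7)[OF F(1) s(1) F(2)] cframeD(7)[OF F(1) s(2) F(2)] eq by simp
  then show ?thesis using onb_expand[OF S s(1)] onb_expand[OF S s(2)] by (metis (no_types, lifting) sum.cong)
qed

lemma coord_change:
  assumes m: "smooth_manifold M" and c: "coord M U \<phi>" and O1: "open_sub (model M) \<Omega>1" "\<Omega>1 \<subseteq> \<phi> ` U"
    and O2: "open_sub (model M) \<Omega>2" and G: "G ` \<Omega>1 = \<Omega>2" "Cinf_on (model M) \<Omega>1 G"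
    and H: "H ` \<Omega>2 = \<Omega>1" "Cinf_on (model M) \<Omega>2 H"
    and inv: "\<And>z. z \<in> \<Omega>1 \<Longrightarrow> H (G z) = z" "\<And>z. z \<in> \<Omega>2 \<Longrightarrow> G (H z) = z"
  shows "coord M {y \<in> U. \<phi> y \<in> \<Omega>1} (\<lambda>y. G (\<phi> y))" (is "coord M ?W ?\<kappa>")
proof -
  note t = coordD(1)[OF c]
  note tc = top_chartD[OF t] and S = smooth_manifoldD(2)[OF m]
  have oW: "openin (mtop M) ?W" by (rule top_chart_vimage_open[OF t]) (use O1 in \<open>simp add: open_sub_def\<close>)
  have WU: "?W \<subseteq> U" by blast
  have WM: "?W \<subseteq> mpoints M" using tc(2) by blast
  have pW: "\<phi> ` ?W = \<Omega>1" using O1(2) by auto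
  have kW: "?\<kappa> ` ?W = \<Omega>2" using pW G(1) by (auto simp: image_image[symmetric])
  have invW: "inv_into U \<phi> z \<in> ?W" "\<phi> (inv_into U \<phi> z) = z" if "z \<in> \<Omega>1" for z
    using that O1(2) tc(4) by auto
  have hm: "homeomorphic_maps (subtopology (mtop M) ?W) (top_of_set \<Omega>2) ?\<kappa> (\<lambda>z. inv_into U \<phi> (H z))"
    unfolding homeomorphic_maps_def
  proof (intro conjI ballI)
    have "continuous_map (subtopology (mtop M) ?W) (top_of_set (\<phi> ` U)) \<phi>"
      using continuous_map_from_subtopology_mono[OF tc(5) WU] .
    then have "continuous_map (subtopology (mtop M) ?W) (top_of_set \<Omega>1) \<phi>"
      by (auto simp: continuous_map_in_subtopology)
    moreover have "continuous_map (top_of_set \<Omega>1) (top_of_set \<Omega>2) G"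
      using Cinf_on_continuous[OF G(2)] G(1) by (auto simp: continuous_map_in_subtopology)
    ultimately show "continuous_map (subtopology (mtop M) ?W) (top_of_set \<Omega>2) ?\<kappa>"
      using continuous_map_compose[of _ _ \<phi> _ G] by (simp add: o_def)
    have "continuous_map (top_of_set \<Omega>1) (subtopology (mtop M) U) (inv_into U \<phi>)"
      using continuous_map_from_subtopology_mono[OF tc(6) O1(2)] .
    then have "continuous_map (top_of_set \<Omega>1) (subtopology (mtop M) ?W) (inv_into U \<phi>)"
      using invW(1) by (auto simp: continuous_map_in_subtopology)
    note c2 = this
    have c1: "continuous_map (top_of_set \<Omega>2) (top_of_set \<Omega>1) H"
      using Cinf_on_continuous[OF H(2)] H(1) by (auto simp: continuous_map_in_subtopology)
    show "continuous_map (top_of_set \<Omega>2) (subtopology (mtop M) ?W) (\<lambda>z. inv_into U \<phi> (H z))"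
      using continuous_map_compose[OF c1 c2] by (simp only: o_def)
    show "inv_into U \<phi> (H (?\<kappa> y)) = y" if "y \<in> topspace (subtopology (mtop M) ?W)" for y
      using that inv(1) tc(4) by auto
    show "?\<kappa> (inv_into U \<phi> (H z)) = z" if "z \<in> topspace (top_of_set \<Omega>2)" for z
      using that inv(2) H(1) invW(2)[of "H z"] by auto
  qed
  then have hom: "homeomorphic_map (subtopology (mtop M) ?W) (top_of_set (?\<kappa> ` ?W)) ?\<kappa>"
    unfolding kW by (rule homeomorphic_maps_imp_map)
  have T: "top_chart M ?W ?\<kappa>"
    unfolding top_chart_def using oW hom O2 kW by (simp add: open_sub_def)
  have iW: "inv_into ?W ?\<kappa> (?\<kappa> y) = y" if "y \<in> ?W" for y using top_chartD(4)[OF T that] .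
  show ?thesis unfolding coord_def
  proof (intro conjI T allI impI, elim conjE)
    fix W' f assume W': "openin (mtop M) W'" "W' \<subseteq> ?W"
    have W'U: "W' \<subseteq> U" using W'(2) by blast
    note o1 = top_chart_open_sub[OF S t W'(1) W'U] and o2 = top_chart_open_sub[OF S T W']
    have s1: "\<phi> ` W' \<subseteq> \<Omega>1" and s2: "?\<kappa> ` W' \<subseteq> \<Omega>2" using W'(2) kW by auto
    show "smooth_fun_on M W' f \<longleftrightarrow> Cinf_on (model M) (?\<kappa> ` W') (\<lambda>z. f (inv_into ?W ?\<kappa> z))"
      unfolding coordD(2)[OF c W'(1) W'U]
    proof
      assume f: "Cinf_on (model M) (\<phi> ` W') (\<lambda>z. f (inv_into U \<phi> z))"
      show "Cinf_on (model M) (?\<kappa> ` W') (\<lambda>z. f (inv_into ?W ?\<kappa> z))"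
      proof (rule Cinf_on_cong)
        show "Cinf_on (model M) (?\<kappa> ` W') (\<lambda>z. f (inv_into U \<phi> (H z)))"
          by (rule Cinf_on_compose[OF o2 o1 _ _ f]) (use Cinf_on_mono[OF H(2) order_refl s2] inv(1) s1 in auto)
        show "f (inv_into U \<phi> (H z)) = f (inv_into ?W ?\<kappa> z)" if "z \<in> ?\<kappa> ` W'" for z
          using that iW W'(2) inv(1) tc(4) by auto
      qed
    next
      assume f: "Cinf_on (model M) (?\<kappa> ` W') (\<lambda>z. f (inv_into ?W ?\<kappa> z))"
      show "Cinf_on (model M) (\<phi> ` W') (\<lambda>z. f (inv_into U \<phi> z))"
      proof (rule Cinf_on_cong)
        show "Cinf_on (model M) (\<phi> ` W') (\<lambda>z. f (inv_into ?W ?\<kappa> (G z)))"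
          by (rule Cinf_on_compose[OF o1 o2 _ _ f]) (use Cinf_on_mono[OF G(2) order_refl s1] in auto)
        show "f (inv_into ?W ?\<kappa> (G z)) = f (inv_into U \<phi> z)" if "z \<in> \<phi> ` W'" for z
          using that iW W'(2) tc(4) by auto
      qed
    qed
  qed
qed

lemma smooth_map_in: "smooth_map M N p \<Longrightarrow> x \<in> mpoints M \<Longrightarrow> p x \<in> mpoints N"
  unfolding smooth_map_def using continuous_map_image_subset_topspace by blast

lemma smooth_map_vimage_open:
  assumes "smooth_map M N p" "openin (mtop N) V"
  shows "openin (mtop M) {x \<in> mpoints M. p x \<in> V}"
  using assms openin_continuous_map_preimage unfolding smooth_map_def by blast

lemma smooth_map_compose:
  assumes m: "smooth_manifold M" and n: "smooth_manifold N" and p: "smooth_map M N p" and g: "g \<in> smooth_funs N"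
  shows "(\<lambda>x. g (p x)) \<in> smooth_funs M"
  unfolding smooth_funs_def mem_Collect_eq
proof (rule smooth_fun_on_local[OF m openin_topspace])
  fix x assume x: "x \<in> mpoints M"
  obtain U \<phi> where U: "(U, \<phi>) \<in> atlas M" "coord M U \<phi>" "x \<in> U" using coord_exists[OF m x] by metis
  obtain V \<psi> where V: "(V, \<psi>) \<in> atlas N" "coord N V \<psi>" "p x \<in> V" using coord_exists[OF n smooth_map_in[OF p x]] by metis
  note cU = coord_simps[OF U(2)] and cV = coord_simps[OF V(2)]
  define W where "W = U \<inter> p -` V"
  have "W = U \<inter> {x \<in> mpoints M. p x \<in> V}" using cU(2) by (auto simp: W_def)
  then have oW: "openin (mtop M) W" using smooth_map_vimage_open[OF p cV(1)] cU(1) by auto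
  have P: "Cinf_on (model M) (\<phi> ` W) (\<lambda>z. \<psi> (p (inv_into U \<phi> z)))"
    using p U(1) V(1) unfolding smooth_map_def W_def by (auto simp: o_def)
  have WU: "W \<subseteq> U" by (auto simp: W_def)
  have "smooth_fun_on M W (\<lambda>x. g (p x))"
    unfolding coordD(2)[OF U(2) oW WU]
  proof (rule Cinf_on_cong)
    show "Cinf_on (model M) (\<phi> ` W) (\<lambda>z. g (inv_into V \<psi> (\<psi> (p (inv_into U \<phi> z)))))"
      by (rule Cinf_on_compose[OF coord_open_sub[OF m U(2) oW WU] coord_open_sub[OF n V(2) cV(1) order_refl] _ P coord_rep[OF V(2) g]])
        (use cU(3) in \<open>auto simp: W_def\<close>)
  qed (use cU(3) cV(3) in \<open>auto simp: W_def\<close>)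
  then show "\<exists>W'. openin (mtop M) W' \<and> x \<in> W' \<and> smooth_fun_on M W' (\<lambda>x. g (p x))"
    using oW U(3) V(3) by (auto simp: W_def)
qed

lemma pushforward_apply: "g \<in> smooth_funs N \<Longrightarrow> pushforward N p v g = v (\<lambda>x. g (p x))"
  by (simp add: pushforward_def o_def)

lemma pushforward_tangent:
  assumes m: "smooth_manifold M" and n: "smooth_manifold N" and p: "smooth_map M N p" and v: "v \<in> tangent_space M x"
  shows "pushforward N p v \<in> tangent_space N (p x)"
proof -
  note c = smooth_map_compose[OF m n p]
  have "f + g \<in> smooth_funs N" "f * g \<in> smooth_funs N" if "f \<in> smooth_funs N" "g \<in> smooth_funs N" for f g
    using smooth_funs_add[OF that] smooth_funs_mult[OF that] by (simp_all add: plus_fun_def times_fun_def)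
  moreover have "a *\<^sub>R f \<in> smooth_funs N" if "f \<in> smooth_funs N" for a f
    using smooth_funs_mult[OF smooth_funs_const[of a] that] by (simp add: scaleR_fun_def)
  ultimately show ?thesis
    using tangent_add[OF v c c] tangent_cmult[OF v c] tangent_mult[OF v c c]
    by (simp add: tangent_space_def[of N] pushforward_def o_def plus_fun_def times_fun_def scaleR_fun_def)
qed

lemma pushforward_linear:
  "pushforward N p (u + v) = pushforward N p u + pushforward N p v"
  "pushforward N p (c *\<^sub>R u) = c *\<^sub>R pushforward N p u"
  "pushforward N p 0 = 0"
  "pushforward N p (u - v) = pushforward N p u - pushforward N p v"
  by (auto simp: pushforward_def fun_eq_iff fun_plus_apply fun_scaleR_apply zero_fun_def)

lemma pushforward_sum: "pushforward N p (\<Sum>i\<in>I. c i *\<^sub>R v i) = (\<Sum>i\<in>I. c i *\<^sub>R pushforward N p (v i))"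
proof (induction I rule: infinite_finite_induct)
  case (insert i I)
  show ?case unfolding sum.insert[OF insert(1,2)] pushforward_linear(1,2) insert(3) by (rule refl)
next
  case (infinite A)
  show ?case unfolding sum.infinite[OF infinite] pushforward_linear(3) by (rule refl)
next
  case empty
  show ?case unfolding sum.empty pushforward_linear(3) by (rule refl)
qed

lemma pullback_apply: "u \<in> tangent_space M x \<Longrightarrow> pullback M N p x \<eta> u = \<eta> (pushforward N p u)"
  by (simp add: pullback_def)

lemma pullback_cotangent:
  assumes m: "smooth_manifold M" and n: "smooth_manifold N" and p: "smooth_map M N p"
    and \<eta>: "\<eta> \<in> cotangent_space N (p x)"
  shows "pullback M N p x \<eta> \<in> cotangent_space M x"
  unfolding cotangent_space_def
proof (intro CollectI conjI ballI allI impI)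
  note t = pushforward_tangent[OF m n p]
  fix u assume u: "u \<in> tangent_space M x"
  show "pullback M N p x \<eta> (c *\<^sub>R u) = c * pullback M N p x \<eta> u" for c
    by (simp only: pullback_apply[OF u] pullback_apply[OF subspace_scale[OF subspace_tangent_space u]]
        pushforward_linear(2) cotangent_scale[OF \<eta> t[OF u]])
  fix v assume v: "v \<in> tangent_space M x"
  show "pullback M N p x \<eta> (u + v) = pullback M N p x \<eta> u + pullback M N p x \<eta> v"
    by (simp only: pullback_apply[OF u] pullback_apply[OF v] pullback_apply[OF subspace_add[OF subspace_tangent_space u v]]
        pushforward_linear(1) cotangent_add[OF \<eta> t[OF u] t[OF v]])
qed (simp add: pullback_def)

lemma pushforward_cvec:
  assumes m: "smooth_manifold M" and n: "smooth_manifold N" and p: "smooth_map M N p"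
    and c: "coord M W \<kappa>" and d: "coord N V \<psi>" and W': "openin (mtop M) W'" "W' \<subseteq> W" "p ` W' \<subseteq> V"
    and P: "Cinf_on (model M) (\<kappa> ` W') (\<lambda>z. \<psi> (p (inv_into W \<kappa> z)))"
    and x: "x \<in> W'" and s: "s \<in> model M"
  shows "pushforward N p (cvec M W \<kappa> x s) = cvec N V \<psi> (p x) (dird (\<lambda>z. \<psi> (p (inv_into W \<kappa> z))) (\<kappa> x) s)"
    "dird (\<lambda>z. \<psi> (p (inv_into W \<kappa> z))) (\<kappa> x) s \<in> model N"
proof -
  note cs = coord_simps[OF c] and ds = coord_simps[OF d]
  note o1 = coord_open_sub[OF m c W'(1,2)] and o2 = coord_open_sub[OF n d ds(1) order_refl]
  have im: "(\<lambda>z. \<psi> (p (inv_into W \<kappa> z))) ` \<kappa> ` W' \<subseteq> \<psi> ` V" using W' cs(3) by force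
  have kx: "\<kappa> x \<in> \<kappa> ` W'" using x by blast
  show "dird (\<lambda>z. \<psi> (p (inv_into W \<kappa> z))) (\<kappa> x) s \<in> model N"
    by (rule dird_compose(2)[OF o1 o2 im P Cinf_on_ident kx s])
  show "pushforward N p (cvec M W \<kappa> x s) = cvec N V \<psi> (p x) (dird (\<lambda>z. \<psi> (p (inv_into W \<kappa> z))) (\<kappa> x) s)"
  proof
    fix g
    show "pushforward N p (cvec M W \<kappa> x s) g = cvec N V \<psi> (p x) (dird (\<lambda>z. \<psi> (p (inv_into W \<kappa> z))) (\<kappa> x) s) g"
    proof (cases "g \<in> smooth_funs N")
      case True
      have "pushforward N p (cvec M W \<kappa> x s) g = dird (\<lambda>z. g (p (inv_into W \<kappa> z))) (\<kappa> x) s"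
        using smooth_map_compose[OF m n p True] True by (simp add: pushforward_apply cvec_def)
      also have "\<dots> = dird (\<lambda>z. g (inv_into V \<psi> (\<psi> (p (inv_into W \<kappa> z))))) (\<kappa> x) s"
        by (rule dird_cong[OF o1 kx s]) (use cs(3) ds(3) W' in force)
      also have "\<dots> = dird (\<lambda>z. g (inv_into V \<psi> z)) (\<psi> (p (inv_into W \<kappa> (\<kappa> x)))) (dird (\<lambda>z. \<psi> (p (inv_into W \<kappa> z))) (\<kappa> x) s)"
        by (rule dird_compose(1)[OF o1 o2 im P coord_rep[OF d True] kx s])
      also have "inv_into W \<kappa> (\<kappa> x) = x" using cs(3) W'(2) x by blast
      finally show ?thesis using True by (simp add: cvec_def)
    qed (simp add: pushforward_def cvec_def)
  qed
qed

text \<open>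
  Coordinates on \<open>M\<close> and \<open>N\<close> in which \<open>p\<close> is the restriction of an affine map with linear part \<open>L\<close>, together
  with coordinate frames and a linear right inverse \<open>l\<close> of \<open>L\<close>, by which coordinate directions of \<open>N\<close>
  are lifted.
\<close>

definition adapted where
  "adapted M N p W \<kappa> W1 E q V \<psi> V1 E' q' L l c \<longleftrightarrow>
     cframe M W \<kappa> W1 E q \<and> cframe N V \<psi> V1 E' q' \<and> p ` W1 \<subseteq> V1 \<and>
     bounded_linear L \<and> bounded_linear l \<and> L ` model M = model N \<and> l ` model N \<subseteq> model M \<and>
     (\<forall>w\<in>model N. L (l w) = w) \<and> (\<forall>y\<in>W1. \<psi> (p y) = c + L (\<kappa> y)) \<and>
     (\<forall>y\<in>W1. \<forall>s\<in>model M. pushforward N p (E s y) = E' (L s) (p y))"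

lemma adapted_exists:
  fixes M :: "('a, 'e::euclidean_space) manifold" and N :: "('b, 'f::euclidean_space) manifold"
  assumes m: "smooth_manifold M" and n: "smooth_manifold N" and sub: "submersion M N p" and x0: "x0 \<in> mpoints M"
  shows "\<exists>W \<kappa> W1 E q V \<psi> V1 E' q' L l c. adapted M N p W \<kappa> W1 E q V \<psi> V1 E' q' L l c \<and> x0 \<in> W1"
proof -
  have p: "smooth_map M N p" using sub by (simp add: submersion_def)
  note pM = smooth_map_in[OF p]
  obtain U \<phi> where U: "(U, \<phi>) \<in> atlas M" "coord M U \<phi>" "x0 \<in> U" using coord_exists[OF m x0] by metis
  obtain V \<psi> where V: "(V, \<psi>) \<in> atlas N" "coord N V \<psi>" "p x0 \<in> V" using coord_exists[OF n pM[OF x0]] by metis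
  note cU = coord_simps[OF U(2)] and cV = coord_simps[OF V(2)]
  note SN = smooth_manifoldD(2)[OF n]
  define U' where "U' = U \<inter> p -` V"
  have "U' = U \<inter> {x \<in> mpoints M. p x \<in> V}" using cU(2) by (auto simp: U'_def)
  then have oU': "openin (mtop M) U'" using smooth_map_vimage_open[OF p cV(1)] cU(1) by auto
  have U'U: "U' \<subseteq> U" and pU': "p ` U' \<subseteq> V" by (auto simp: U'_def)
  define P where "P z = \<psi> (p (inv_into U \<phi> z))" for z
  have P: "Cinf_on (model M) (\<phi> ` U') P"
    using p U(1) V(1) unfolding smooth_map_def U'_def P_def[abs_def] by (auto simp: o_def)
  note oO = coord_open_sub[OF m U(2) oU' U'U]
  note oN = coord_open_sub[OF n V(2) cV(1) order_refl]
  have x0U': "x0 \<in> U'" using U V by (auto simp: U'_def)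
  have PS: "P ` \<phi> ` U' \<subseteq> model N" using open_subD(2)[OF oN] pU' cU(3) U'U by (force simp: P_def)
  note push = pushforward_cvec[OF m n p U(2) V(2) oU' U'U pU' P[unfolded P_def[abs_def]] x0U', folded P_def[abs_def]]
  have onto: "dird P (\<phi> x0) ` model M = model N"
  proof (intro equalityI subsetI)
    show "w \<in> model N" if "w \<in> dird P (\<phi> x0) ` model M" for w using push(2) that by blast
    fix w assume w: "w \<in> model N"
    have "cvec N V \<psi> (p x0) w \<in> pushforward N p ` tangent_space M x0"
      using sub x0 cvec_tangent[OF n V(2,3) w] by (simp add: submersion_def)
    then obtain v where v: "v \<in> tangent_space M x0" "cvec N V \<psi> (p x0) w = pushforward N p v" by blast
    obtain s where s: "s \<in> model M" "v = cvec M U \<phi> x0 s" using cvec_surj[OF m U(2,3) v(1)] by blast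
    have "w = dird P (\<phi> x0) s"
      by (rule cvec_inj[OF n V(2,3) w push(2)[OF s(1)]]) (use v s push(1)[OF s(1)] in simp)
    then show "w \<in> dird P (\<phi> x0) ` model M" using s(1) by blast
  qed
  have z0: "\<phi> x0 \<in> \<phi> ` U'" using x0U' by blast
  show ?thesis
  proof (rule submersion_normal_form[OF oO SN P z0 PS onto])
    fix L l G H \<Omega>1 \<Omega>2
    assume L: "bounded_linear L" "bounded_linear l" and "\<And>v. v \<in> model M \<Longrightarrow> L v = dird P (\<phi> x0) v"
      and LS: "L ` model M = model N" "l ` model N \<subseteq> model M" "\<And>w. w \<in> model N \<Longrightarrow> L (l w) = w"
      and O1: "open_sub (model M) \<Omega>1" "\<phi> x0 \<in> \<Omega>1" "\<Omega>1 \<subseteq> \<phi> ` U'" and O2: "open_sub (model M) \<Omega>2"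
      and GH: "G ` \<Omega>1 = \<Omega>2" "H ` \<Omega>2 = \<Omega>1" "\<And>z. z \<in> \<Omega>1 \<Longrightarrow> H (G z) = z" "\<And>y. y \<in> \<Omega>2 \<Longrightarrow> G (H y) = y"
        "Cinf_on (model M) \<Omega>1 G" "Cinf_on (model M) \<Omega>2 H"
      and "G (\<phi> x0) = \<phi> x0" and PL: "\<And>z. z \<in> \<Omega>1 \<Longrightarrow> P z = P (\<phi> x0) + L (G z - \<phi> x0)"
    have linL: "linear L" using L(1) bounded_linear.linear by blast
    define W where "W = {y \<in> U. \<phi> y \<in> \<Omega>1}"
    define \<kappa> where "\<kappa> y = G (\<phi> y)" for y
    have c: "coord M W \<kappa>"
      unfolding W_def \<kappa>_def[abs_def]
      by (rule coord_change[OF m U(2) O1(1) _ O2 GH(1) GH(5) GH(2) GH(6) GH(3,4)]) (use O1(3) U'U in auto)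
    note cs = coord_simps[OF c]
    have WU': "W \<subseteq> U'"
    proof
      fix y assume y: "y \<in> W"
      then obtain y' where y': "y' \<in> U'" "\<phi> y = \<phi> y'" using O1(3) by (auto simp: W_def)
      then show "y \<in> U'" using y U'U cU(4) by (auto simp: W_def inj_on_def)
    qed
    have x0W: "x0 \<in> W" using U(3) O1(2) by (simp add: W_def)
    define cc where "cc = P (\<phi> x0) - L (\<phi> x0)"
    have form: "\<psi> (p y) = cc + L (\<kappa> y)" if "y \<in> W" for y
      using PL[of "\<phi> y"] that cU(3)[of y] linL by (auto simp: W_def P_def \<kappa>_def cc_def linear_diff)
    obtain V1 E' q' where F': "cframe N V \<psi> V1 E' q'" "p x0 \<in> V1"
      using cframe_exists[OF n V(2) cV(1) V(3) order_refl] by metis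
    define O' where "O' = W \<inter> {x \<in> mpoints M. p x \<in> V1}"
    have oO': "openin (mtop M) O'" unfolding O'_def
      using cs(1) smooth_map_vimage_open[OF p cframeD(2)[OF F'(1)]] by (rule openin_Int)
    have x0O': "x0 \<in> O'" using x0W x0 F'(2) by (simp add: O'_def)
    have O'W: "O' \<subseteq> W" by (auto simp: O'_def)
    obtain W1 E q where F: "cframe M W \<kappa> W1 E q" "x0 \<in> W1" "W1 \<subseteq> O'"
      using cframe_exists[OF m c oO' x0O' O'W] by metis
    have pW1: "p ` W1 \<subseteq> V1" using F(3) by (auto simp: O'_def)
    note fd = cframeD[OF F(1)] and fd' = cframeD[OF F'(1)]
    have pW1V: "p ` W1 \<subseteq> V" using pW1 fd'(3) by blast
    note o1 = coord_open_sub[OF m c fd(2,3)]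
    have eq: "\<psi> (p (inv_into W \<kappa> z)) = cc + L z" if "z \<in> \<kappa> ` W1" for z
      using that form fd(3) cs(3) by auto
    have PC: "Cinf_on (model M) (\<kappa> ` W1) (\<lambda>z. \<psi> (p (inv_into W \<kappa> z)))"
      by (rule Cinf_on_cong[OF Cinf_on_add[OF Cinf_on_const[of _ _ cc] Cinf_on_linear[OF L(1)]]]) (use eq in auto)
    have "pushforward N p (E s y) = E' (L s) (p y)" if y: "y \<in> W1" and s: "s \<in> model M" for y s
    proof -
      have ky: "\<kappa> y \<in> \<kappa> ` W1" using y by blast
      have "dird (\<lambda>z. \<psi> (p (inv_into W \<kappa> z))) (\<kappa> y) s = dird (\<lambda>z. cc + L z) (\<kappa> y) s"
        by (rule dird_cong[OF o1 ky s]) (rule eq)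
      also have "\<dots> = L s"
        by (rule dird_eq[OF o1 ky s]) (auto intro!: derivative_eq_intros bounded_linear.has_derivative[OF L(1)])
      finally have d: "dird (\<lambda>z. \<psi> (p (inv_into W \<kappa> z))) (\<kappa> y) s = L s" .
      have Ls: "L s \<in> model N" using LS(1) s by blast
      show ?thesis
        using pushforward_cvec(1)[OF m n p c V(2) fd(2,3) pW1V PC y s] d fd(7)[OF s y] fd'(7)[OF Ls, of "p y"] pW1 y by auto
    qed
    then have ad: "adapted M N p W \<kappa> W1 E q V \<psi> V1 E' q' L l cc"
      unfolding adapted_def by (intro conjI ballI F(1) F'(1) pW1 L LS form subsetD[OF fd(3)])
    show ?thesis
      by (rule exI[of _ W], rule exI[of _ \<kappa>], rule exI[of _ W1], rule exI[of _ E], rule exI[of _ q], rule exI[of _ V],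
          rule exI[of _ \<psi>], rule exI[of _ V1], rule exI[of _ E'], rule exI[of _ q'], rule exI[of _ L], rule exI[of _ l],
          rule exI[of _ cc], rule conjI[OF ad F(2)])
  qed
qed

lemma adaptedD:
  assumes "adapted M N p W \<kappa> W1 E q V \<psi> V1 E' q' L l c"
  shows "cframe M W \<kappa> W1 E q" "cframe N V \<psi> V1 E' q'" "\<And>y. y \<in> W1 \<Longrightarrow> p y \<in> V1"
     "bounded_linear L" "bounded_linear l" "linear L" "linear l" "L ` model M = model N"
     "\<And>s. s \<in> model M \<Longrightarrow> L s \<in> model N" "\<And>w. w \<in> model N \<Longrightarrow> l w \<in> model M"
     "\<And>w. w \<in> model N \<Longrightarrow> L (l w) = w" "\<And>y. y \<in> W1 \<Longrightarrow> \<psi> (p y) = c + L (\<kappa> y)"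
     "\<And>y s. y \<in> W1 \<Longrightarrow> s \<in> model M \<Longrightarrow> pushforward N p (E s y) = E' (L s) (p y)"
proof -
  note a = assms[unfolded adapted_def]
  show "cframe M W \<kappa> W1 E q" "cframe N V \<psi> V1 E' q'" "bounded_linear L" "bounded_linear l" "L ` model M = model N"
    using a by simp_all
  then show "linear L" "linear l" "\<And>s. s \<in> model M \<Longrightarrow> L s \<in> model N" by (simp_all add: bounded_linear.linear) blast
  show "\<And>y. y \<in> W1 \<Longrightarrow> p y \<in> V1" "\<And>w. w \<in> model N \<Longrightarrow> l w \<in> model M" using a by blast+
  show "\<And>w. w \<in> model N \<Longrightarrow> L (l w) = w" "\<And>y. y \<in> W1 \<Longrightarrow> \<psi> (p y) = c + L (\<kappa> y)"
     "\<And>y s. y \<in> W1 \<Longrightarrow> s \<in> model M \<Longrightarrow> pushforward N p (E s y) = E' (L s) (p y)"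
    using a by simp_all
qed

section \<open>Related sections and the pullback of a Dirac structure\<close>

lemma cvec_0: "smooth_manifold M \<Longrightarrow> coord M W \<kappa> \<Longrightarrow> x \<in> W \<Longrightarrow> cvec M W \<kappa> x 0 = 0"
  using cvec_linear(2)[of M W \<kappa> x 0 0 0] subspace_0[OF smooth_manifoldD(2)[of M]] by simp

lemma cframe_surj:
  assumes "smooth_manifold M" "cframe M W \<kappa> W1 E q" "y \<in> W1" "v \<in> tangent_space M y"
  obtains s where "s \<in> model M" "v = E s y"
  using cvec_surj[OF assms(1) cframeD(1)[OF assms(2)] _ assms(4)] cframeD(3,7)[OF assms(2)] assms(3) by (metis subsetD)

text \<open>
  The vertical coordinate directions are the kernel of \<open>L\<close>, the same at all points of \<open>W1\<close>.
\<close>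

lemma vertical:
  assumes n: "smooth_manifold N" and A: "adapted M N p W \<kappa> W1 E q V \<psi> V1 E' q' L l c"
    and y: "y \<in> W1" and s: "s \<in> model M"
  shows "pushforward N p (E s y) = 0 \<longleftrightarrow> L s = 0"
proof -
  note a = adaptedD[OF A]
  note d = cframeD[OF a(2)]
  have py: "p y \<in> V1" "p y \<in> V" using a(3)[OF y] d(3) by auto
  have e: "pushforward N p (E s y) = cvec N V \<psi> (p y) (L s)"
    using a(13)[OF y s] d(7)[OF a(9)[OF s] py(1)] by simp
  show ?thesis
    unfolding e using cvec_inj[OF n d(1) py(2) a(9)[OF s] subspace_0[OF smooth_manifoldD(2)[OF n]]] cvec_0[OF n d(1) py(2)] by auto
qed

text \<open>
  The components of \<open>u'\<close> are lifted along \<open>l\<close>. A vertical field with constant coefficients is added to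
  obtain the prescribed value at \<open>x\<close>.
\<close>

lemma lift_vector_field:
  assumes m: "smooth_manifold M" and n: "smooth_manifold N" and p: "smooth_map M N p"
    and A: "adapted M N p W \<kappa> W1 E q V \<psi> V1 E' q' L l c"
    and u': "vector_field_on N (mpoints N) u'" and x: "x \<in> W1" and u0: "u0 \<in> tangent_space M x"
    and pu0: "pushforward N p u0 = u' (p x)"
  obtains u where "vector_field_on M (mpoints M) u" "u x = u0" "\<And>y. y \<in> W1 \<Longrightarrow> pushforward N p (u y) = u' (p y)"
proof -
  note a = adaptedD[OF A]
  note d = cframeD[OF a(1)] and d' = cframeD[OF a(2)]
  note B = cframe_basis[OF n]
  define w where "w y = (\<Sum>b\<in>onb (model N). u' (p y) (q' b) *\<^sub>R E (l b) y)" for y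
  have sm: "(\<lambda>y. u' (p y) (q' b)) \<in> smooth_funs M" if "b \<in> onb (model N)" for b
    by (rule smooth_map_compose[OF m n p vector_field_smooth_funs[OF u' d'(6)[OF B[OF that]]]])
  have w: "vector_field_on M (mpoints M) w"
    unfolding w_def
    by (intro vector_field_on_sum vector_field_on_scale smooth_funsD[OF sm] d(5) a(10) B) auto
  have pw: "pushforward N p (w y) = u' (p y)" if y: "y \<in> W1" for y
  proof -
    have "pushforward N p (w y) = (\<Sum>b\<in>onb (model N). u' (p y) (q' b) *\<^sub>R E' b (p y))"
      unfolding w_def pushforward_sum
      by (rule sum.cong) (use a(13)[OF y a(10)[OF B]] a(11)[OF B] in auto)
    also have "\<dots> = u' (p y)"
      by (rule cframe_tangent_expand[OF n a(2) a(3)[OF y], symmetric])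
        (use vector_field_onD(1)[OF u'] d'(4) a(3)[OF y] in blast)
    finally show ?thesis .
  qed
  have xM: "x \<in> mpoints M" using x d(4) by blast
  have "u0 - w x \<in> tangent_space M x"
    by (intro subspace_diff subspace_tangent_space u0 vector_field_onD(1)[OF w xM])
  then obtain t where t: "t \<in> model M" "u0 - w x = E t x" using cframe_surj[OF m a(1) x] by metis
  have "pushforward N p (E t x) = 0"
    unfolding t(2)[symmetric] pushforward_linear(4) pw[OF x] pu0 by (rule diff_self)
  then have Lt: "L t = 0" using vertical[OF n A x t(1)] by blast
  show thesis
  proof (rule that[of "\<lambda>y. w y + E t y"])
    show "vector_field_on M (mpoints M) (\<lambda>y. w y + E t y)" by (rule vector_field_on_add[OF w d(5)[OF t(1)]])
    show "w x + E t x = u0" unfolding t(2)[symmetric] by simp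
    fix y assume y: "y \<in> W1"
    show "pushforward N p (w y + E t y) = u' (p y)"
      using vertical[OF n A y t(1)] Lt unfolding pushforward_linear(1) pw[OF y] by simp
  qed
qed

lemma pullback_one_form:
  assumes m: "smooth_manifold M" and n: "smooth_manifold N" and p: "smooth_map M N p"
    and \<eta>: "one_form_on N (mpoints N) \<eta>"
  shows "one_form_on M (mpoints M) (\<lambda>x. pullback M N p x (\<eta> (p x)))"
  unfolding one_form_on_def
proof (intro conjI ballI allI impI)
  note pM = smooth_map_in[OF p]
  show "pullback M N p x (\<eta> (p x)) \<in> cotangent_space M x" if "x \<in> mpoints M" for x
    by (rule pullback_cotangent[OF m n p one_form_onD(1)[OF \<eta> pM[OF that]]])
  fix X assume X: "vector_field_on M (mpoints M) X"
  show "smooth_fun_on M (mpoints M) (\<lambda>x. pullback M N p x (\<eta> (p x)) (X x))"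
  proof (rule smooth_fun_on_local[OF m openin_topspace])
    fix x assume x: "x \<in> mpoints M"
    obtain V \<psi> V1 E' q' where F: "cframe N V \<psi> V1 E' q'" "p x \<in> V1" using cframe_exists'[OF n pM[OF x]] by metis
    note d = cframeD[OF F(1)] and B = cframe_basis[OF n]
    let ?O = "{x \<in> mpoints M. p x \<in> V1}"
    have o: "openin (mtop M) ?O" by (rule smooth_map_vimage_open[OF p d(2)])
    have "(\<lambda>x. \<Sum>b\<in>onb (model N). X x (\<lambda>y. q' b (p y)) * \<eta> (p x) (E' b (p x))) \<in> smooth_funs M"
      by (intro smooth_funs_sum smooth_funs_mult vector_field_smooth_funs[OF X] smooth_map_compose[OF m n p]
          smooth_map_compose[OF m n p one_form_smooth_funs[OF \<eta>]] d(5,6) B)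
    then have "smooth_fun_on M ?O (\<lambda>x. \<Sum>b\<in>onb (model N). X x (\<lambda>y. q' b (p y)) * \<eta> (p x) (E' b (p x)))"
      by (rule smooth_funsD) auto
    then have "smooth_fun_on M ?O (\<lambda>x. pullback M N p x (\<eta> (p x)) (X x))"
    proof (rule smooth_fun_on_cong[OF m])
      fix y assume y: "y \<in> ?O"
      then have yM: "y \<in> mpoints M" and py: "p y \<in> V1" by auto
      note t = vector_field_onD(1)[OF X yM]
      show "(\<Sum>b\<in>onb (model N). X y (\<lambda>y. q' b (p y)) * \<eta> (p y) (E' b (p y))) = pullback M N p y (\<eta> (p y)) (X y)"
        unfolding pullback_apply[OF t]
          cframe_cotangent_expand[OF n F(1) py pushforward_tangent[OF m n p t] one_form_onD(1)[OF \<eta> pM[OF yM]]]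
        by (rule sum.cong) (use pushforward_apply[OF d(6)[OF B], of _ p "X y"] in auto)
    qed
    then show "\<exists>W'. openin (mtop M) W' \<and> x \<in> W' \<and> smooth_fun_on M W' (\<lambda>x. pullback M N p x (\<eta> (p x)) (X x))"
      using o x F(2) by blast
  qed
qed

text \<open>
  \<open>p\<close>-relatedness of sections. Pulled back forms are evaluated on related fields as on the base, so that
  pairings of related sections correspond to each other.
\<close>

definition related_at :: "('a, 'e::euclidean_space) manifold \<Rightarrow> ('b, 'f::euclidean_space) manifold \<Rightarrow> ('a \<Rightarrow> 'b) \<Rightarrow>
    ('a \<Rightarrow> 'a gtangent) \<Rightarrow> ('b \<Rightarrow> 'b gtangent) \<Rightarrow> 'a \<Rightarrow> bool" where
  "related_at M N p a a' y \<longleftrightarrow> pushforward N p (fst (a y)) = fst (a' (p y)) \<and> snd (a y) = pullback M N p y (snd (a' (p y)))"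

lemma derivative_related:
  assumes m: "smooth_manifold M" and n: "smooth_manifold N" and p: "smooth_map M N p"
    and v: "v \<in> tangent_space M x" "pushforward N p v = v'" and W: "openin (mtop M) W" "x \<in> W"
    and f: "f \<in> smooth_funs M" and g: "g \<in> smooth_funs N" and eq: "\<And>y. y \<in> W \<Longrightarrow> f y = g (p y)"
  shows "v f = v' g"
proof -
  have "v f = v (\<lambda>y. g (p y))" by (rule tangent_local[OF m v(1) W f smooth_map_compose[OF m n p g] eq])
  then show ?thesis using pushforward_apply[OF g, of p v] v(2) by simp
qed

lemma lie_bracket_related:
  assumes m: "smooth_manifold M" and n: "smooth_manifold N" and p: "smooth_map M N p"
    and X: "vector_field_on M (mpoints M) X" and Y: "vector_field_on M (mpoints M) Y"
    and X': "vector_field_on N (mpoints N) X'" and Y': "vector_field_on N (mpoints N) Y'"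
    and W: "openin (mtop M) W" "x \<in> W"
    and rX: "\<And>y. y \<in> W \<Longrightarrow> pushforward N p (X y) = X' (p y)" and rY: "\<And>y. y \<in> W \<Longrightarrow> pushforward N p (Y y) = Y' (p y)"
  shows "pushforward N p (lie_bracket X Y x) = lie_bracket X' Y' (p x)"
proof -
  have x: "x \<in> mpoints M" using W openin_subset by blast
  note px = smooth_map_in[OF p x]
  show ?thesis
  proof (rule tangent_eqI[OF pushforward_tangent[OF m n p lie_bracket_tangent[OF m X Y x]] lie_bracket_tangent[OF n X' Y' px]])
    fix g assume g: "g \<in> smooth_funs N"
    note gp = smooth_map_compose[OF m n p g]
    have "X x (\<lambda>y. Y y (\<lambda>z. g (p z))) = X' (p x) (\<lambda>y. Y' y g)"
      by (rule derivative_related[OF m n p vector_field_onD(1)[OF X x] rX[OF W(2)] W vector_field_smooth_funs[OF Y gp] vector_field_smooth_funs[OF Y' g]])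
        (use rY pushforward_apply[OF g, of p] in metis)
    moreover have "Y x (\<lambda>y. X y (\<lambda>z. g (p z))) = Y' (p x) (\<lambda>y. X' y g)"
      by (rule derivative_related[OF m n p vector_field_onD(1)[OF Y x] rY[OF W(2)] W vector_field_smooth_funs[OF X gp] vector_field_smooth_funs[OF X' g]])
        (use rX pushforward_apply[OF g, of p] in metis)
    ultimately show "pushforward N p (lie_bracket X Y x) g = lie_bracket X' Y' (p x) g"
      unfolding pushforward_apply[OF g] lie_bracket_def by simp
  qed
qed

text \<open>
  All constituents of the tensor are natural: related vector fields have related brackets, and pairings
  of related sections are functions on \<open>N\<close> composed with \<open>p\<close>.
\<close>

lemma courant_tensor_related:
  assumes m: "smooth_manifold M" and n: "smooth_manifold N" and p: "smooth_map M N p"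
    and s: "smooth_section_on M (mpoints M) a" "smooth_section_on M (mpoints M) b" "smooth_section_on M (mpoints M) c"
    and s': "smooth_section_on N (mpoints N) a'" "smooth_section_on N (mpoints N) b'" "smooth_section_on N (mpoints N) c'"
    and W: "openin (mtop M) W" "x \<in> W"
    and r: "\<And>y. y \<in> W \<Longrightarrow> related_at M N p a a' y" "\<And>y. y \<in> W \<Longrightarrow> related_at M N p b b' y" "\<And>y. y \<in> W \<Longrightarrow> related_at M N p c c' y"
  shows "courant_tensor a b c x = courant_tensor a' b' c' (p x)"
proof -
  have WM: "W \<subseteq> mpoints M" using W openin_subset by blast
  have x: "x \<in> mpoints M" using W WM by blast
  have D: "fst (a x) (\<lambda>y. snd (b y) (fst (c y))) = fst (a' (p x)) (\<lambda>y. snd (b' y) (fst (c' y)))"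
    if sa: "smooth_section_on M (mpoints M) a" and sb: "smooth_section_on M (mpoints M) b" and sc: "smooth_section_on M (mpoints M) c"
    and sb': "smooth_section_on N (mpoints N) b'" and sc': "smooth_section_on N (mpoints N) c'"
    and ra: "\<And>y. y \<in> W \<Longrightarrow> related_at M N p a a' y" and rb: "\<And>y. y \<in> W \<Longrightarrow> related_at M N p b b' y"
    and rc: "\<And>y. y \<in> W \<Longrightarrow> related_at M N p c c' y" for a b c a' b' c'
  proof (rule derivative_related[OF m n p _ _ W, where f = "\<lambda>y. snd (b y) (fst (c y))" and g = "\<lambda>y. snd (b' y) (fst (c' y))"])
    show "fst (a x) \<in> tangent_space M x" using vector_field_onD(1)[OF smooth_sectionD(1)[OF sa] x] by simp
    show "pushforward N p (fst (a x)) = fst (a' (p x))" using ra[OF W(2)] by (simp add: related_at_def)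
    show "(\<lambda>y. snd (b y) (fst (c y))) \<in> smooth_funs M"
      using one_form_smooth_funs[OF smooth_sectionD(2)[OF sb] smooth_sectionD(1)[OF sc]] by (simp add: o_def)
    show "(\<lambda>y. snd (b' y) (fst (c' y))) \<in> smooth_funs N"
      using one_form_smooth_funs[OF smooth_sectionD(2)[OF sb'] smooth_sectionD(1)[OF sc']] by (simp add: o_def)
    fix y assume y: "y \<in> W"
    have t: "fst (c y) \<in> tangent_space M y" using vector_field_onD(1)[OF smooth_sectionD(1)[OF sc]] y WM by auto
    show "snd (b y) (fst (c y)) = snd (b' (p y)) (fst (c' (p y)))"
      using rb[OF y] rc[OF y] pullback_apply[OF t, of N p "snd (b' (p y))"] by (simp add: related_at_def)
  qed
  have B: "snd (c x) (lie_bracket (fst \<circ> a) (fst \<circ> b) x) = snd (c' (p x)) (lie_bracket (fst \<circ> a') (fst \<circ> b') (p x))"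
    if sa: "smooth_section_on M (mpoints M) a" and sb: "smooth_section_on M (mpoints M) b"
    and sa': "smooth_section_on N (mpoints N) a'" and sb': "smooth_section_on N (mpoints N) b'"
    and ra: "\<And>y. y \<in> W \<Longrightarrow> related_at M N p a a' y" and rb: "\<And>y. y \<in> W \<Longrightarrow> related_at M N p b b' y"
    and rc: "\<And>y. y \<in> W \<Longrightarrow> related_at M N p c c' y" for a b c a' b' c'
  proof -
    note S = smooth_sectionD(1)[OF sa] smooth_sectionD(1)[OF sb] smooth_sectionD(1)[OF sa'] smooth_sectionD(1)[OF sb']
    have "pushforward N p (lie_bracket (fst \<circ> a) (fst \<circ> b) x) = lie_bracket (fst \<circ> a') (fst \<circ> b') (p x)"
      by (rule lie_bracket_related[OF m n p S W]) (use ra rb in \<open>auto simp: related_at_def\<close>)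
    moreover have "snd (c x) = pullback M N p x (snd (c' (p x)))" using rc[OF W(2)] by (simp add: related_at_def)
    ultimately show ?thesis using pullback_apply[OF lie_bracket_tangent[OF m S(1,2) x], of N p "snd (c' (p x))"] by simp
  qed
  have
    "fst (a x) (\<lambda>y. snd (b y) (fst (c y))) = fst (a' (p x)) (\<lambda>y. snd (b' y) (fst (c' y)))"
    "snd (b x) (lie_bracket (fst \<circ> c) (fst \<circ> a) x) = snd (b' (p x)) (lie_bracket (fst \<circ> c') (fst \<circ> a') (p x))"
    by (rule D[OF s(1,2,3) s'(2,3)]; fact r) (rule B[OF s(3,1) s'(3,1)]; fact r)
  moreover have
    "fst (b x) (\<lambda>y. snd (c y) (fst (a y))) = fst (b' (p x)) (\<lambda>y. snd (c' y) (fst (a' y)))"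
    "snd (c x) (lie_bracket (fst \<circ> a) (fst \<circ> b) x) = snd (c' (p x)) (lie_bracket (fst \<circ> a') (fst \<circ> b') (p x))"
    by (rule D[OF s(2,3,1) s'(3,1)]; fact r) (rule B[OF s(1,2) s'(1,2)]; fact r)
  moreover have
    "fst (c x) (\<lambda>y. snd (a y) (fst (b y))) = fst (c' (p x)) (\<lambda>y. snd (a' y) (fst (b' y)))"
    "snd (a x) (lie_bracket (fst \<circ> b) (fst \<circ> c) x) = snd (a' (p x)) (lie_bracket (fst \<circ> b') (fst \<circ> c') (p x))"
    by (rule D[OF s(3,1,2) s'(1,2)]; fact r) (rule B[OF s(2,3) s'(2,3)]; fact r)
  ultimately show ?thesis unfolding courant_tensor_def by simp
qed

lemma pullback_linear:
  "pullback M N p x (\<eta> + \<theta>) = pullback M N p x \<eta> + pullback M N p x \<theta>"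
  "pullback M N p x (k *\<^sub>R \<eta>) = k *\<^sub>R pullback M N p x \<eta>"
  "pullback M N p x 0 = 0"
  by (auto simp: pullback_def fun_eq_iff fun_plus_apply fun_scaleR_apply zero_fun_def)

lemma pullback_inj:
  assumes sub: "submersion M N p" and x: "x \<in> mpoints M" and \<eta>: "\<eta> \<in> cotangent_space N (p x)" and \<theta>: "\<theta> \<in> cotangent_space N (p x)"
    and eq: "pullback M N p x \<eta> = pullback M N p x \<theta>"
  shows "\<eta> = \<theta>"
proof (rule cotangent_eqI[OF \<eta> \<theta>])
  fix w assume "w \<in> tangent_space N (p x)"
  then obtain u where u: "u \<in> tangent_space M x" "w = pushforward N p u" using sub x by (auto simp: submersion_def)
  then show "\<eta> w = \<theta> w" using eq pullback_apply[OF u(1), of N p \<eta>] pullback_apply[OF u(1), of N p \<theta>] by simp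
qed

text \<open>
  Since \<open>p\<close> is a submersion, a covector that vanishes on the kernel factors through the tangent space of
  the base.
\<close>

lemma annihilator_pullback:
  assumes sub: "submersion M N p" and x: "x \<in> mpoints M" and \<xi>: "\<xi> \<in> cotangent_space M x"
    and ann: "\<And>k. k \<in> tangent_space M x \<Longrightarrow> pushforward N p k = 0 \<Longrightarrow> \<xi> k = 0"
  obtains \<eta> where "\<eta> \<in> cotangent_space N (p x)" "\<xi> = pullback M N p x \<eta>"
proof -
  note T = subspace_tangent_space[of M x] and T' = subspace_tangent_space[of N "p x"]
  have onto: "pushforward N p ` tangent_space M x = tangent_space N (p x)" using sub x by (simp add: submersion_def)
  define h where "h w = (SOME u. u \<in> tangent_space M x \<and> pushforward N p u = w)" for w
  have h: "h w \<in> tangent_space M x" "pushforward N p (h w) = w" if "w \<in> tangent_space N (p x)" for w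
  proof -
    have "\<exists>u. u \<in> tangent_space M x \<and> pushforward N p u = w" using that unfolding onto[symmetric] by auto
    from someI_ex[OF this] show "h w \<in> tangent_space M x" "pushforward N p (h w) = w" unfolding h_def by blast+
  qed
  have ind: "\<xi> u = \<xi> v" if "u \<in> tangent_space M x" "v \<in> tangent_space M x" "pushforward N p u = pushforward N p v" for u v
    using ann[OF subspace_diff[OF T that(1,2)]] that(3) cotangent_diff[OF \<xi> that(1,2)] unfolding pushforward_linear(4) by simp
  define \<eta> where "\<eta> w = (if w \<in> tangent_space N (p x) then \<xi> (h w) else 0)" for w
  have val: "\<eta> (pushforward N p u) = \<xi> u" if u: "u \<in> tangent_space M x" for u
  proof -
    have w: "pushforward N p u \<in> tangent_space N (p x)" unfolding onto[symmetric] using u by (rule imageI)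
    show ?thesis using ind[OF h(1)[OF w] u h(2)[OF w]] w by (simp add: \<eta>_def)
  qed
  show thesis
  proof (rule that[of \<eta>])
    show "\<eta> \<in> cotangent_space N (p x)"
      unfolding cotangent_space_def
    proof (intro CollectI conjI ballI allI impI)
      fix u assume u: "u \<in> tangent_space N (p x)"
      show "\<eta> (k *\<^sub>R u) = k * \<eta> u" for k
        using val[OF subspace_scale[OF T h(1)[OF u]], of k] val[OF h(1)[OF u]] cotangent_scale[OF \<xi> h(1)[OF u]] h(2)[OF u]
        unfolding pushforward_linear(2) by simp
      fix v assume v: "v \<in> tangent_space N (p x)"
      show "\<eta> (u + v) = \<eta> u + \<eta> v"
        using val[OF subspace_add[OF T h(1)[OF u] h(1)[OF v]]] val[OF h(1)[OF u]] val[OF h(1)[OF v]]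
          cotangent_add[OF \<xi> h(1)[OF u] h(1)[OF v]] h(2)[OF u] h(2)[OF v]
        unfolding pushforward_linear(1) by simp
    qed (simp add: \<eta>_def)
    show "\<xi> = pullback M N p x \<eta>"
    proof
      fix u show "\<xi> u = pullback M N p x \<eta> u"
        using \<xi> val by (cases "u \<in> tangent_space M x") (auto simp: pullback_def cotangent_space_def)
    qed
  qed
qed

lemma subspace_dirac_pull:
  assumes m: "smooth_manifold M" and n: "smooth_manifold N" and p: "smooth_map M N p"
    and R: "subspace (R (p x))" "R (p x) \<subseteq> gtangent_space N (p x)"
  shows "subspace (dirac_pull M N p R x)"
proof (rule subspaceI)
  show "0 \<in> dirac_pull M N p R x"
    using subspace_0[OF subspace_tangent_space[of M x]] subspace_0[OF subspace_cotangent_space[of N "p x"]] subspace_0[OF R(1)]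
    unfolding dirac_pull_def
    by (intro CollectI exI[of _ 0]) (simp only: zero_prod_def pullback_linear pushforward_linear simp_thms)
next
  fix a b assume a: "a \<in> dirac_pull M N p R x" and b: "b \<in> dirac_pull M N p R x"
  obtain u \<eta> where u: "a = (u, pullback M N p x \<eta>)" "u \<in> tangent_space M x" "\<eta> \<in> cotangent_space N (p x)" "(pushforward N p u, \<eta>) \<in> R (p x)"
    using a unfolding dirac_pull_def by blast
  obtain v \<theta> where v: "b = (v, pullback M N p x \<theta>)" "v \<in> tangent_space M x" "\<theta> \<in> cotangent_space N (p x)" "(pushforward N p v, \<theta>) \<in> R (p x)"
    using b unfolding dirac_pull_def by blast
  have 1: "a + b = (u + v, pullback M N p x (\<eta> + \<theta>))" unfolding u(1) v(1) pullback_linear by simp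
  have 2: "(pushforward N p (u + v), \<eta> + \<theta>) \<in> R (p x)"
    using subspace_add[OF R(1) u(4) v(4)] unfolding pushforward_linear by simp
  show "a + b \<in> dirac_pull M N p R x"
    unfolding dirac_pull_def
    using 1 2 subspace_add[OF subspace_tangent_space u(2) v(2)] subspace_add[OF subspace_cotangent_space u(3) v(3)] by blast
  fix k
  have 3: "k *\<^sub>R a = (k *\<^sub>R u, pullback M N p x (k *\<^sub>R \<eta>))" unfolding u(1) pullback_linear by simp
  have 4: "(pushforward N p (k *\<^sub>R u), k *\<^sub>R \<eta>) \<in> R (p x)"
    using subspace_scale[OF R(1) u(4), of k] unfolding pushforward_linear by simp
  show "k *\<^sub>R a \<in> dirac_pull M N p R x"
    unfolding dirac_pull_def
    using 3 4 subspace_scale[OF subspace_tangent_space u(2), of k] subspace_scale[OF subspace_cotangent_space u(3), of k] by blast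
qed

text \<open>
  The vector part is lifted and the form is pulled back on a coordinate neighbourhood; a bump function
  makes the result a global section.
\<close>

lemma lift_section:
  assumes m: "smooth_manifold M" and n: "smooth_manifold N" and sub: "submersion M N p"
    and R: "\<And>y. y \<in> mpoints N \<Longrightarrow> subspace (R y)" "\<And>y. y \<in> mpoints N \<Longrightarrow> R y \<subseteq> gtangent_space N y"
    and a': "a' \<in> sections N R" and x: "x \<in> mpoints M" and u0: "u0 \<in> tangent_space M x" "pushforward N p u0 = fst (a' (p x))"
  obtains a W where "a \<in> sections M (dirac_pull M N p R)" "openin (mtop M) W" "x \<in> W" "fst (a x) = u0"
    "\<And>y. y \<in> W \<Longrightarrow> related_at M N p a a' y"
proof -
  have p: "smooth_map M N p" using sub by (simp add: submersion_def)
  note pM = smooth_map_in[OF p]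
  obtain W \<kappa> W1 E q V \<psi> V1 E' q' L l c where A: "adapted M N p W \<kappa> W1 E q V \<psi> V1 E' q' L l c" "x \<in> W1"
    using adapted_exists[OF m n sub x] by (elim exE conjE)
  note ad = adaptedD[OF A(1)]
  note d = cframeD[OF ad(1)]
  note S' = smooth_sectionD[OF sectionsD(1)[OF a']]
  obtain u where u: "vector_field_on M (mpoints M) u" "u x = u0" "\<And>y. y \<in> W1 \<Longrightarrow> pushforward N p (u y) = (fst \<circ> a') (p y)"
    using lift_vector_field[OF m n p A(1) S'(1) A(2) u0(1)] u0(2) by (metis comp_apply)
  define s where "s y = (u y, pullback M N p y (snd (a' (p y))))" for y
  have "smooth_section_on M (mpoints M) s"
    using u(1) pullback_one_form[OF m n p S'(2)] by (simp add: smooth_section_on_def s_def[abs_def] o_def)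
  then have sW: "smooth_section_on M W1 s"
    unfolding smooth_section_on_def using vector_field_on_mono[OF _ d(4)] one_form_on_mono[OF _ d(4)] by blast
  have sD: "s y \<in> dirac_pull M N p R y" if y: "y \<in> W1" for y
  proof -
    have yM: "y \<in> mpoints M" using d(4) y by blast
    have "(pushforward N p (u y), snd (a' (p y))) \<in> R (p y)" using u(3)[OF y] sectionsD(2)[OF a' pM[OF yM]] by simp
    moreover have "snd (a' (p y)) \<in> cotangent_space N (p y)" using one_form_onD(1)[OF S'(2) pM[OF yM]] by simp
    ultimately show ?thesis unfolding dirac_pull_def s_def using vector_field_onD(1)[OF u(1) yM] by blast
  qed
  have sub': "subspace (dirac_pull M N p R y)" if "y \<in> mpoints M" for y
    by (rule subspace_dirac_pull[where R = R and x = y, OF m n p R(1)[OF pM[OF that]] R(2)[OF pM[OF that]]])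
  obtain a W' where a: "a \<in> sections M (dirac_pull M N p R)" "openin (mtop M) W'" "x \<in> W'" "W' \<subseteq> W1" "\<And>y. y \<in> W' \<Longrightarrow> a y = s y"
    using extend_section[OF m d(2) A(2) sW, of "dirac_pull M N p R"] sD sub' by metis
  show thesis
  proof (rule that[OF a(1,2,3)])
    show "fst (a x) = u0" using a(3,5) u(2) by (simp add: s_def)
    show "related_at M N p a a' y" if "y \<in> W'" for y
      using a(4,5) u(3) that by (auto simp: related_at_def s_def)
  qed
qed

text \<open>
  The Lagrangian property is linear algebra: an element orthogonal to the pullback annihilates the
  kernel, so its covector comes from the base. Elements extend to sections that are related to sections
  of \<open>R\<close>, and the Courant tensor may be computed with these.
\<close>

theorem dirac_structure_pull:
  assumes m: "smooth_manifold M" and n: "smooth_manifold N" and sub: "submersion M N p" and R: "dirac_structure N R"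
  shows "dirac_structure M (dirac_pull M N p R)"
proof -
  let ?D = "dirac_pull M N p R"
  have p: "smooth_map M N p" using sub by (simp add: submersion_def)
  note pM = smooth_map_in[OF p]
  have lR: "lagrangian_family N R" and sR: "has_sections N R"
    and cR: "\<And>a b c y. a \<in> sections N R \<Longrightarrow> b \<in> sections N R \<Longrightarrow> c \<in> sections N R \<Longrightarrow> y \<in> mpoints N \<Longrightarrow> courant_tensor a b c y = 0"
    using R unfolding dirac_structure_iff[OF n] by blast+
  note RR = lagrangian_familyD[OF lR]
  have lD: "lagrangian_family M ?D"
    unfolding lagrangian_family_def
  proof (intro ballI equalityI subsetI)
    fix x d assume x: "x \<in> mpoints M" and d: "d \<in> ?D x"
    then obtain u \<eta> where u: "d = (u, pullback M N p x \<eta>)" "u \<in> tangent_space M x" "\<eta> \<in> cotangent_space N (p x)" "(pushforward N p u, \<eta>) \<in> R (p x)"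
      unfolding dirac_pull_def by blast
    have "pairing d e = 0" if e: "e \<in> ?D x" for e
    proof -
      obtain v \<theta> where v: "e = (v, pullback M N p x \<theta>)" "v \<in> tangent_space M x" "\<theta> \<in> cotangent_space N (p x)" "(pushforward N p v, \<theta>) \<in> R (p x)"
        using e unfolding dirac_pull_def by blast
      show ?thesis using RR(3)[OF pM[OF x] u(4) v(4)] pullback_apply[OF u(2), of N p \<theta>] pullback_apply[OF v(2), of N p \<eta>]
        by (simp add: pairing_def u(1) v(1))
    qed
    then show "d \<in> orthogonal_space M x (?D x)"
      using u pullback_cotangent[OF m n p u(3)] by (simp add: orthogonal_space_def gtangent_space_def)
  next
    fix x d assume x: "x \<in> mpoints M" and d: "d \<in> orthogonal_space M x (?D x)"
    obtain u \<xi> where u: "d = (u, \<xi>)" "u \<in> tangent_space M x" "\<xi> \<in> cotangent_space M x"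
      using d by (auto simp: orthogonal_space_def gtangent_space_def)
    have orth: "pairing (u, \<xi>) e = 0" if "e \<in> ?D x" for e using d that u(1) by (simp add: orthogonal_space_def)
    have ann: "\<xi> k = 0" if k: "k \<in> tangent_space M x" "pushforward N p k = 0" for k
    proof -
      have "(k, pullback M N p x 0) \<in> ?D x"
        unfolding dirac_pull_def
        using k subspace_0[OF subspace_cotangent_space[of N "p x"]] subspace_0[OF RR(2)[OF pM[OF x]]] by (auto simp: zero_prod_def)
      from orth[OF this] show ?thesis unfolding pullback_linear pairing_def by (simp add: zero_fun_def)
    qed
    obtain \<eta> where \<eta>: "\<eta> \<in> cotangent_space N (p x)" "\<xi> = pullback M N p x \<eta>"
      using annihilator_pullback[OF sub x u(3) ann] by blast
    have "(pushforward N p u, \<eta>) \<in> R (p x)"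
    proof (rule RR(4)[OF pM[OF x]])
      show "(pushforward N p u, \<eta>) \<in> gtangent_space N (p x)"
        using pushforward_tangent[OF m n p u(2)] \<eta>(1) by (simp add: gtangent_space_def)
      fix r assume r: "r \<in> R (p x)"
      then have rg: "fst r \<in> tangent_space N (p x)" "snd r \<in> cotangent_space N (p x)"
        using RR(1)[OF pM[OF x]] by (auto simp: gtangent_space_def)
      then obtain v where v: "v \<in> tangent_space M x" "fst r = pushforward N p v" using sub x by (auto simp: submersion_def)
      have "(v, pullback M N p x (snd r)) \<in> ?D x"
        unfolding dirac_pull_def using v rg r by (auto simp: v(2)[symmetric])
      from orth[OF this] show "pairing (pushforward N p u, \<eta>) r = 0"
        using pullback_apply[OF u(2), of N p "snd r"] pullback_apply[OF v(1), of N p \<eta>] v(2) by (simp add: pairing_def \<eta>(2))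
    qed
    then show "d \<in> ?D x" unfolding dirac_pull_def u(1) \<eta>(2) using u(2) \<eta>(1) by blast
  qed
  have lift: "\<exists>a a' W. a \<in> sections M ?D \<and> a' \<in> sections N R \<and> openin (mtop M) W \<and> x \<in> W \<and> a x = d \<and> (\<forall>y\<in>W. related_at M N p a a' y)"
    if x: "x \<in> mpoints M" and d: "d \<in> ?D x" for x d
  proof -
    obtain u \<eta> where u: "d = (u, pullback M N p x \<eta>)" "u \<in> tangent_space M x" "\<eta> \<in> cotangent_space N (p x)" "(pushforward N p u, \<eta>) \<in> R (p x)"
      using d unfolding dirac_pull_def by blast
    obtain a' where a': "a' \<in> sections N R" "a' (p x) = (pushforward N p u, \<eta>)"
      using sR pM[OF x] u(4) unfolding has_sections_def by blast
    obtain a W where a: "a \<in> sections M ?D" "openin (mtop M) W" "x \<in> W" "fst (a x) = u" "\<And>y. y \<in> W \<Longrightarrow> related_at M N p a a' y"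
      using lift_section[OF m n sub RR(2,1) a'(1) x u(2)] a'(2) by (metis fst_conv)
    have "a x = d" using a(4) a(5)[OF a(3)] a'(2) by (simp add: related_at_def u(1) prod_eq_iff)
    then show ?thesis using a a'(1) by blast
  qed
  have sD: "has_sections M ?D" unfolding has_sections_def using lift by blast
  have "courant_tensor a b c x = 0" if s: "a \<in> sections M ?D" "b \<in> sections M ?D" "c \<in> sections M ?D" and x: "x \<in> mpoints M" for a b c x
  proof -
    obtain a1 a' Wa where a: "a1 \<in> sections M ?D" "a' \<in> sections N R" "openin (mtop M) Wa" "x \<in> Wa" "a1 x = a x" "\<forall>y\<in>Wa. related_at M N p a1 a' y"
      using lift[OF x sectionsD(2)[OF s(1) x]] by blast
    obtain b1 b' Wb where b: "b1 \<in> sections M ?D" "b' \<in> sections N R" "openin (mtop M) Wb" "x \<in> Wb" "b1 x = b x" "\<forall>y\<in>Wb. related_at M N p b1 b' y"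
      using lift[OF x sectionsD(2)[OF s(2) x]] by blast
    obtain c1 c' Wc where c: "c1 \<in> sections M ?D" "c' \<in> sections N R" "openin (mtop M) Wc" "x \<in> Wc" "c1 x = c x" "\<forall>y\<in>Wc. related_at M N p c1 c' y"
      using lift[OF x sectionsD(2)[OF s(3) x]] by blast
    have W: "openin (mtop M) (Wa \<inter> Wb \<inter> Wc)" "x \<in> Wa \<inter> Wb \<inter> Wc" using a b c by auto
    have "courant_tensor a b c x = courant_tensor a1 b1 c1 x"
      by (rule courant_tensor_cong[OF m lD x s a(1) b(1) c(1)]) (simp_all add: a b c)
    also have "\<dots> = courant_tensor a' b' c' (p x)"
      by (rule courant_tensor_related[OF m n p sectionsD(1)[OF a(1)] sectionsD(1)[OF b(1)] sectionsD(1)[OF c(1)]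
          sectionsD(1)[OF a(2)] sectionsD(1)[OF b(2)] sectionsD(1)[OF c(2)] W]) (use a(6) b(6) c(6) in auto)
    also have "\<dots> = 0" by (rule cR[OF a(2) b(2) c(2) pM[OF x]])
    finally show ?thesis .
  qed
  then show ?thesis unfolding dirac_structure_iff[OF m] using lD sD by blast
qed

section \<open>Descending a Dirac structure along a submersion with connected fibres\<close>

text \<open>
  The Gronwall argument: for \<open>Y = (\<Sum>i\<in>I. (y i)\<^sup>2)\<close> and suitable \<open>c\<close> the function \<open>Y t * exp (- c * t)\<close> is
  nonnegative, nonincreasing, and zero at the start.
\<close>

lemma linear_differential_inequality_zero:
  fixes y :: "'i \<Rightarrow> real \<Rightarrow> real"
  assumes I: "finite I" and K: "K \<ge> 0"
    and d: "\<And>i t. i \<in> I \<Longrightarrow> t \<in> {0..1} \<Longrightarrow> DERIV (y i) t :> y' i t"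
    and b: "\<And>i t. i \<in> I \<Longrightarrow> t \<in> {0..1} \<Longrightarrow> \<bar>y' i t\<bar> \<le> K * (\<Sum>j\<in>I. \<bar>y j t\<bar>)"
    and z: "\<And>i. i \<in> I \<Longrightarrow> y i 0 = 0" and i: "i \<in> I" and t: "t \<in> {0..1}"
  shows "y i t = 0"
proof -
  \<comment> \<open>By Cauchy-Schwarz \<open>Y' \<le> 2 K (\<Sum>j\<in>I. \<bar>y j\<bar>)\<^sup>2 \<le> 2 K card I Y\<close>.\<close>
  define c where "c = 2 * K * card I"
  define Y where "Y s = (\<Sum>i\<in>I. (y i s)\<^sup>2)" for s
  define Z where "Z s = Y s * exp (- c * s)" for s
  have N: "\<exists>u. DERIV Z s :> u \<and> u \<le> 0" if s: "s \<in> {0..1}" for s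
  proof -
    define S where "S = (\<Sum>j\<in>I. \<bar>y j s\<bar>)"
    have dY: "DERIV Y s :> (\<Sum>i\<in>I. 2 * y i s * y' i s)"
      unfolding Y_def using d[OF _ s] by (auto intro!: DERIV_sum derivative_eq_intros)
    have dE: "DERIV (\<lambda>s. exp (- c * s)) s :> exp (- c * s) * (- c)"
      by (auto intro!: derivative_eq_intros)
    have "(\<Sum>i\<in>I. 2 * y i s * y' i s) \<le> (\<Sum>i\<in>I. 2 * \<bar>y i s\<bar> * (K * S))"
    proof (rule sum_mono)
      fix j assume j: "j \<in> I"
      have "y j s * y' j s \<le> \<bar>y j s\<bar> * \<bar>y' j s\<bar>" by (metis abs_ge_self abs_mult)
      also have "\<dots> \<le> \<bar>y j s\<bar> * (K * S)" using b[OF j s] by (intro mult_left_mono) (auto simp: S_def)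
      finally show "2 * y j s * y' j s \<le> 2 * \<bar>y j s\<bar> * (K * S)" by simp
    qed
    also have "\<dots> = 2 * K * S\<^sup>2" by (simp add: S_def sum_distrib_left sum_distrib_right power2_eq_square mult_ac)
    also have "\<dots> \<le> 2 * K * (Y s * card I)"
    proof (intro mult_left_mono)
      have "(\<Sum>i\<in>I. \<bar>y i s\<bar> * 1)\<^sup>2 \<le> (\<Sum>i\<in>I. \<bar>y i s\<bar>\<^sup>2) * (\<Sum>i\<in>I. 1\<^sup>2)" by (rule Cauchy_Schwarz_ineq_sum)
      then show "S\<^sup>2 \<le> Y s * card I" by (simp add: S_def Y_def)
    qed (use K in simp)
    finally have le: "(\<Sum>i\<in>I. 2 * y i s * y' i s) \<le> c * Y s" by (simp add: c_def mult_ac)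
    have "DERIV Z s :> (\<Sum>i\<in>I. 2 * y i s * y' i s) * exp (- c * s) + exp (- c * s) * (- c) * Y s"
      unfolding Z_def by (rule DERIV_mult[OF dY dE])
    moreover have "(\<Sum>i\<in>I. 2 * y i s * y' i s) * exp (- c * s) + exp (- c * s) * (- c) * Y s = ((\<Sum>i\<in>I. 2 * y i s * y' i s) - c * Y s) * exp (- c * s)"
      by (simp add: algebra_simps)
    moreover have "\<dots> \<le> 0" using le by (intro mult_nonpos_nonneg) auto
    ultimately show ?thesis by metis
  qed
  have "Z t \<le> Z 0"
  proof (rule DERIV_nonpos_imp_nonincreasing[of 0 t Z])
    show "0 \<le> t" using t by simp
    fix s assume "0 \<le> s" "s \<le> t"
    then have "s \<in> {0..1}" using t by simp
    then show "\<exists>u. DERIV Z s :> u \<and> u \<le> 0" by (rule N)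
  qed
  also have "Z 0 = 0" using z by (simp add: Z_def Y_def)
  finally have "Y t \<le> 0" by (simp add: Z_def mult_le_0_iff)
  moreover have "(y i t)\<^sup>2 \<le> Y t" unfolding Y_def using I i by (intro member_le_sum) auto
  ultimately show ?thesis by (metis order_trans power2_less_eq_zero_iff)
qed

lemma pairing_commute: "pairing a b = pairing b a" by (simp add: pairing_def)

lemma pairing_sum:
  assumes "\<And>i. i \<in> I \<Longrightarrow> e i \<in> gtangent_space M x" "d \<in> gtangent_space M x"
  shows "pairing (\<Sum>i\<in>I. c i *\<^sub>R e i) d = (\<Sum>i\<in>I. c i * pairing (e i) d)"
proof -
  have d: "snd d \<in> cotangent_space M x" using assms(2) by (auto simp: gtangent_space_def)
  have "snd d (\<Sum>i\<in>I. c i *\<^sub>R fst (e i)) = (\<Sum>i\<in>I. c i * snd d (fst (e i)))"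
    by (rule cotangent_sum[OF d]) (use assms(1) in \<open>auto simp: gtangent_space_def mem_Times_iff\<close>)
  then show ?thesis
    unfolding pairing_def fst_sum snd_sum fst_scaleR snd_scaleR fun_sum_apply fun_scaleR_apply
    by (simp add: sum.distrib distrib_left)
qed

text \<open>
  Test elements that do not vary in coordinates: a family of fibres is constant in coordinates as soon as
  it keeps those of these sections that it contains at one point.
\<close>

definition const_section :: "('a, 'e::euclidean_space) manifold \<Rightarrow> ('e \<Rightarrow> 'a \<Rightarrow> 'a tangent) \<Rightarrow> ('e \<Rightarrow> 'a \<Rightarrow> real) \<Rightarrow>
    'e \<times> 'e \<Rightarrow> 'a \<Rightarrow> 'a gtangent" where
  "const_section M E q z y = (E (fst z) y, \<Sum>b\<in>onb (model M). (snd z \<bullet> b) *\<^sub>R dform M (q b) y)"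

lemma const_section:
  assumes m: "smooth_manifold M" and F: "cframe M W \<kappa> W1 E q" and z: "z \<in> model M \<times> model M"
  shows "smooth_section_on M (mpoints M) (const_section M E q z)"
    "\<And>y. y \<in> W1 \<Longrightarrow> gcoord M E q y (const_section M E q z y) = z"
proof -
  note d = cframeD[OF F] and B = cframe_basis[OF m] and S = smooth_manifoldD(2)[OF m]
  have z1: "fst z \<in> model M" "snd z \<in> model M" using z by auto
  have f: "fst \<circ> const_section M E q z = E (fst z)"
    "snd \<circ> const_section M E q z = (\<lambda>y. \<Sum>b\<in>onb (model M). (snd z \<bullet> b) *\<^sub>R dform M (q b) y)"
    by (auto simp: const_section_def)
  show "smooth_section_on M (mpoints M) (const_section M E q z)"
    unfolding smooth_section_on_def f
    by (intro conjI d(5) z1 one_form_on_sum one_form_on_scale smooth_fun_on_const one_form_dform[OF m] d(6) B order_refl)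
  fix y assume y: "y \<in> W1"
  have 1: "E (fst z) y (q c) = fst z \<bullet> c" if "c \<in> onb (model M)" for c
    by (rule cframe_dual[OF m F y z1(1) B[OF that]])
  have 2: "(\<Sum>b\<in>onb (model M). (snd z \<bullet> b) *\<^sub>R dform M (q b) y) (E c y) = snd z \<bullet> c" if c: "c \<in> onb (model M)" for c
  proof -
    have "(\<Sum>b\<in>onb (model M). (snd z \<bullet> b) *\<^sub>R dform M (q b) y) (E c y) = (\<Sum>b\<in>onb (model M). if b = c then snd z \<bullet> b else 0)"
      unfolding fun_sum_apply fun_scaleR_apply
      by (rule sum.cong) (use cframe_dual[OF m F y B[OF c] B] onb_inner[OF S c] d(9)[OF B[OF c] y] in \<open>auto simp: dform_def\<close>)
    then show ?thesis using c onb(4)[OF S] by simp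
  qed
  show "gcoord M E q y (const_section M E q z y) = z"
    using onb_expand[OF S z1(1)] onb_expand[OF S z1(2)] 1 2
    by (simp add: gcoord_def const_section_def prod_eq_iff cong: sum.cong)
qed

text \<open>
  Coordinate fields commute and the differentials of coordinates are invariant under them. The bracket with
  a coordinate field therefore differentiates the coordinates of a section.
\<close>

lemma dorfman_coordinate_field:
  assumes m: "smooth_manifold M" and F: "cframe M W \<kappa> W1 E q" and \<tau>: "\<tau> \<in> model M"
    and k: "smooth_section_on M (mpoints M) k" and k0: "\<And>y. snd (k y) = 0"
    and W2: "openin (mtop M) W2" "W2 \<subseteq> W1" "\<And>y. y \<in> W2 \<Longrightarrow> fst (k y) = E \<tau> y"
    and e: "smooth_section_on M (mpoints M) e" and z: "z \<in> model M \<times> model M" and x: "x \<in> W2"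
  shows "pairing (dorfman_bracket M k e x) (const_section M E q z x) = E \<tau> x (\<lambda>y. pairing (e y) (const_section M E q z y))"
proof -
  note d = cframeD[OF F] and B = cframe_basis[OF m]
  let ?B = "onb (model M)" and ?d = "const_section M E q z"
  have w: "fst z \<in> model M" using z by auto
  have x1: "x \<in> W1" and xM: "x \<in> mpoints M" using x W2 d(4) by auto
  note K = smooth_sectionD[OF k] and Es = smooth_sectionD[OF e] and Ds = smooth_sectionD[OF const_section(1)[OF m F z]]
  note kx = vector_field_onD(1)[OF K(1) xM] and ex = vector_field_onD(1)[OF Es(1) xM]
  have kE: "(fst \<circ> k) x = E \<tau> x" using W2(3)[OF x] by simp
  have tE: "E \<tau> x \<in> tangent_space M x" by (rule d(9)[OF \<tau> x1])
  have const: "v (\<lambda>y. X y (q b)) = 0"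
    if v: "v \<in> tangent_space M x" and X: "vector_field_on M (mpoints M) X" and s: "s \<in> model M"
      and XE: "\<And>y. y \<in> W2 \<Longrightarrow> X y = E s y" and b: "b \<in> ?B" for v X s b
  proof -
    have "v (\<lambda>y. X y (q b)) = v (\<lambda>y. s \<bullet> b)"
      by (rule tangent_local[OF m v W2(1) x vector_field_smooth_funs[OF X d(6)[OF B[OF b]]] smooth_funs_const])
        (use XE W2(2) cframe_dual[OF m F _ s B[OF b]] in auto)
    then show ?thesis using tangent_const[OF v] by simp
  qed
  have fd: "fst \<circ> ?d = E (fst z)" by (auto simp: const_section_def)
  have br: "lie_bracket (fst \<circ> k) (E (fst z)) x = 0"
  proof -
    note t = lie_bracket_tangent[OF m K(1) d(5)[OF w] xM]
    have "lie_bracket (fst \<circ> k) (E (fst z)) x (q b) = 0" if b: "b \<in> ?B" for b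
      using const[OF kx d(5)[OF w] w _ b] const[OF d(9)[OF w x1] K(1) \<tau> _ b] W2(3) by (simp add: lie_bracket_def)
    then show ?thesis by (subst cframe_tangent_expand[OF m F x1 t]) simp
  qed
  have k0': "snd \<circ> k = (\<lambda>y. 0)" using k0 by auto
  have z0: "d_form (snd \<circ> k) (fst \<circ> e) (E (fst z)) x = 0"
    unfolding k0' d_form_def lie_form_def zero_fun_def
    using tangent_const[OF ex, of 0] tangent_const[OF d(9)[OF w x1], of 0] by simp
  have "snd (dorfman_bracket M k e x) (E (fst z) x) = lie_form (fst \<circ> k) (snd \<circ> e) (E (fst z)) x"
    using dorfman_bracket_form[OF m k e d(5)[OF w] xM] z0 by (simp add: dorfman_form_def)
  also have "\<dots> = E \<tau> x (\<lambda>y. snd (e y) (E (fst z) y))"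
    unfolding lie_form_def br kE using cotangent_0[OF one_form_onD(1)[OF Es(2) xM]] by simp
  finally have P1: "snd (dorfman_bracket M k e x) (E (fst z) x) = E \<tau> x (\<lambda>y. snd (e y) (E (fst z) y))" .
  have sq: "(\<lambda>y. fst (e y) (q b)) \<in> smooth_funs M" if "b \<in> ?B" for b
    using vector_field_smooth_funs[OF Es(1) d(6)[OF B[OF that]]] by simp
  have dv: "snd (?d y) v = (\<Sum>b\<in>?B. (snd z \<bullet> b) * v (q b))" if "v \<in> tangent_space M y" for v y
    unfolding const_section_def snd_conv fun_sum_apply fun_scaleR_apply using that by (simp add: dform_def)
  have "snd (?d x) (fst (dorfman_bracket M k e x)) = (\<Sum>b\<in>?B. (snd z \<bullet> b) * lie_bracket (fst \<circ> k) (fst \<circ> e) x (q b))"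
    using dv[OF lie_bracket_tangent[OF m K(1) Es(1) xM]] by (simp add: dorfman_bracket_def Let_def)
  also have "\<dots> = (\<Sum>b\<in>?B. (snd z \<bullet> b) * E \<tau> x (\<lambda>y. fst (e y) (q b)))"
  proof (rule sum.cong)
    fix b assume b: "b \<in> ?B"
    show "(snd z \<bullet> b) * lie_bracket (fst \<circ> k) (fst \<circ> e) x (q b) = (snd z \<bullet> b) * E \<tau> x (\<lambda>y. fst (e y) (q b))"
      using const[OF ex K(1) \<tau> _ b] W2(3) kE by (simp add: lie_bracket_def)
  qed simp
  also have "\<dots> = E \<tau> x (\<lambda>y. \<Sum>b\<in>?B. (snd z \<bullet> b) * fst (e y) (q b))"
    using sq by (simp add: tangent_sum[OF tE] tangent_cmult[OF tE] smooth_funs_mult smooth_funs_const)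
  also have "\<dots> = E \<tau> x (\<lambda>y. snd (?d y) (fst (e y)))"
  proof (rule tangent_local[OF m tE openin_topspace xM])
    show "(\<lambda>y. \<Sum>b\<in>?B. (snd z \<bullet> b) * fst (e y) (q b)) \<in> smooth_funs M"
      by (intro smooth_funs_sum smooth_funs_mult smooth_funs_const sq)
    show "(\<lambda>y. snd (?d y) (fst (e y))) \<in> smooth_funs M"
      using one_form_smooth_funs[OF Ds(2) Es(1)] by (simp add: o_def)
    fix y assume "y \<in> mpoints M"
    then have "fst (e y) \<in> tangent_space M y" using vector_field_onD(1)[OF Es(1)] by simp
    then show "(\<Sum>b\<in>?B. (snd z \<bullet> b) * fst (e y) (q b)) = snd (?d y) (fst (e y))" by (rule dv[symmetric])
  qed
  finally have P2: "snd (?d x) (fst (dorfman_bracket M k e x)) = E \<tau> x (\<lambda>y. snd (?d y) (fst (e y)))" .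
  have s1: "(\<lambda>y. snd (e y) (E (fst z) y)) \<in> smooth_funs M" using one_form_smooth_funs[OF Es(2) d(5)[OF w]] by (simp add: o_def)
  have s2: "(\<lambda>y. snd (?d y) (fst (e y))) \<in> smooth_funs M" using one_form_smooth_funs[OF Ds(2) Es(1)] by (simp add: o_def)
  have "fst (?d y) = E (fst z) y" for y by (simp add: const_section_def)
  then show ?thesis
    unfolding pairing_def using P1 P2 tangent_add[OF tE s1 s2] by simp
qed

text \<open>
  The vertical directions and the differential of \<open>p\<close> are the same at all points in adapted
  coordinates. The pushforward of a fibre thus depends only on its coordinates and on the image
  point.
\<close>

lemma dirac_push_mono:
  assumes m: "smooth_manifold M" and n: "smooth_manifold N" and p: "smooth_map M N p"
    and A: "adapted M N p W \<kappa> W1 E q V \<psi> V1 E' q' L l c"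
    and y: "y1 \<in> W1" "y2 \<in> W1" "p y1 = p y2" and D: "D y1 \<subseteq> gtangent_space M y1" "D y2 \<subseteq> gtangent_space M y2"
    and sub: "gcoord M E q y1 ` D y1 \<subseteq> gcoord M E q y2 ` D y2"
  shows "dirac_push M N p y1 (D y1) \<subseteq> dirac_push M N p y2 (D y2)"
proof
  note a = adaptedD[OF A]
  note d = cframeD[OF a(1)] and B = cframe_basis[OF m]
  fix r assume "r \<in> dirac_push M N p y1 (D y1)"
  then obtain u \<eta> where u: "r = (pushforward N p u, \<eta>)" "u \<in> tangent_space M y1" "\<eta> \<in> cotangent_space N (p y1)" "(u, pullback M N p y1 \<eta>) \<in> D y1"
    unfolding dirac_push_def by blast
  obtain s where s: "s \<in> model M" "u = E s y1" using cframe_surj[OF m a(1) y(1) u(2)] by metis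
  define d2 where "d2 = (E s y2, pullback M N p y2 \<eta>)"
  have \<eta>2: "\<eta> \<in> cotangent_space N (p y2)" using u(3) y(3) by simp
  have t2: "E s y2 \<in> tangent_space M y2" by (rule d(9)[OF s(1) y(2)])
  have d2g: "d2 \<in> gtangent_space M y2"
    unfolding d2_def gtangent_space_def using t2 pullback_cotangent[OF m n p \<eta>2] by simp
  have 1: "E s y2 (q b) = u (q b)" if "b \<in> onb (model M)" for b
    unfolding s(2) cframe_dual[OF m a(1) y(1) s(1) B[OF that]] cframe_dual[OF m a(1) y(2) s(1) B[OF that]] by (rule refl)
  have 2: "pullback M N p y2 \<eta> (E b y2) = pullback M N p y1 \<eta> (E b y1)" if "b \<in> onb (model M)" for b
    unfolding pullback_apply[OF d(9)[OF B[OF that] y(1)]] pullback_apply[OF d(9)[OF B[OF that] y(2)]]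
      a(13)[OF y(1) B[OF that]] a(13)[OF y(2) B[OF that]] y(3) by (rule refl)
  have "gcoord M E q y2 d2 = gcoord M E q y1 (u, pullback M N p y1 \<eta>)"
    unfolding gcoord_def d2_def using 1 2 by (simp cong: sum.cong)
  then have "gcoord M E q y2 d2 \<in> gcoord M E q y2 ` D y2" using sub u(4) by auto
  then obtain d3 where d3: "d3 \<in> D y2" "gcoord M E q y2 d2 = gcoord M E q y2 d3" by blast
  have "d2 = d3" by (rule gcoord_inj[OF m a(1) y(2) d2g _ d3(2)]) (use D(2) d3(1) in blast)
  then have "d2 \<in> D y2" using d3(1) by simp
  moreover have "pushforward N p u = pushforward N p (E s y2)"
    unfolding s(2) a(13)[OF y(1) s(1)] a(13)[OF y(2) s(1)] y(3) by (rule refl)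
  ultimately show "r \<in> dirac_push M N p y2 (D y2)"
    unfolding dirac_push_def u(1) d2_def using t2 \<eta>2 by auto
qed

lemma cframe_line:
  assumes m: "smooth_manifold M" and F: "cframe M W \<kappa> W1 E q" and y: "y \<in> W1" and s: "s \<in> model M" and f: "f \<in> smooth_funs M"
    and t: "\<kappa> y = z + t *\<^sub>R s"
  shows "DERIV (\<lambda>t. f (inv_into W \<kappa> (z + t *\<^sub>R s))) t :> E s y f"
proof -
  note d = cframeD[OF F]
  have yW: "y \<in> W" using y d(3) by blast
  have "((\<lambda>r. f (inv_into W \<kappa> (\<kappa> y + r *\<^sub>R s))) has_vector_derivative E s y f) (at 0)"
    using cvec_has_derivative[OF m d(1) yW s f] d(7)[OF s y] by simp
  then have "DERIV (\<lambda>r. f (inv_into W \<kappa> (z + (r + t) *\<^sub>R s))) 0 :> E s y f"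
    unfolding has_real_derivative_iff_has_vector_derivative t by (simp add: algebra_simps)
  then show ?thesis using DERIV_shift[of "\<lambda>t. f (inv_into W \<kappa> (z + t *\<^sub>R s))" "E s y f" 0 t] by simp
qed

text \<open>
  Within \<open>O'\<close> two points with the same image are joined by a segment in a vertical direction \<open>\<tau>\<close>. For an
  element of \<open>D x0\<close> with coordinates \<open>z\<close>, the pairings of the frame \<open>e\<close> with the section of constant
  coordinates \<open>z\<close> satisfy a linear differential equation along the segment, because bracketing with
  \<open>E \<tau>\<close> differentiates them and maps \<open>D\<close> to itself. They vanish identically, so the fibres of \<open>D\<close> have
  the same coordinates along the segment.
\<close>

lemma push_locally_constant:
  assumes m: "smooth_manifold M" and n: "smooth_manifold N" and sub: "submersion M N p" and D: "dirac_structure M D"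
    and vert: "\<And>x k. x \<in> mpoints M \<Longrightarrow> k \<in> tangent_space M x \<Longrightarrow> pushforward N p k = 0 \<Longrightarrow> (k, 0) \<in> D x"
    and x0: "x0 \<in> mpoints M"
  obtains O' where "openin (mtop M) O'" "x0 \<in> O'"
    "\<And>y. y \<in> O' \<Longrightarrow> p y = p x0 \<Longrightarrow> dirac_push M N p y (D y) = dirac_push M N p x0 (D x0)"
proof -
  have p: "smooth_map M N p" using sub by (simp add: submersion_def)
  have lD: "lagrangian_family M D" and sD: "has_sections M D" using D unfolding dirac_structure_iff[OF m] by blast+
  have br: "dorfman_bracket M a b \<in> sections M D" if "a \<in> sections M D" "b \<in> sections M D" for a b
    using D that unfolding dirac_structure_def by blast
  note DD = lagrangian_familyD[OF lD]
  obtain W \<kappa> W1 E q V \<psi> V1 E' q' L l c where A: "adapted M N p W \<kappa> W1 E q V \<psi> V1 E' q' L l c" "x0 \<in> W1"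
    using adapted_exists[OF m n sub x0] by (elim exE conjE)
  note ad = adaptedD[OF A(1)]
  note F = ad(1)
  note d = cframeD[OF F]
  note S = smooth_manifoldD(2)[OF m] and cs = coord_simps[OF d(1)]
  have M1: "y \<in> mpoints M" if "y \<in> W1" for y using d(4) that by blast
  obtain \<beta> C W2 where b: "\<beta> \<in> smooth_funs M" "closedin (mtop M) C" "C \<subseteq> W1" "\<And>y. y \<notin> C \<Longrightarrow> \<beta> y = 0"
    "openin (mtop M) W2" "x0 \<in> W2" "W2 \<subseteq> C" "\<And>y. y \<in> W2 \<Longrightarrow> \<beta> y = 1"
    using bump[OF m d(2) A(2)] by metis
  have W21: "W2 \<subseteq> W1" using b by blast
  \<comment> \<open>The vertical coordinate field in direction \<open>\<tau>\<close>, a section of \<open>D\<close> by assumption.\<close>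
  define k where "k \<tau> = cut_off W1 \<beta> (\<lambda>y. (E \<tau> y, 0::'a cotangent))" for \<tau>
  have k: "k \<tau> \<in> sections M D" if \<tau>: "\<tau> \<in> model M" "L \<tau> = 0" for \<tau>
  proof -
    have e: "fst \<circ> (\<lambda>y. (E \<tau> y, 0::'a cotangent)) = E \<tau>" "snd \<circ> (\<lambda>y. (E \<tau> y, 0::'a cotangent)) = (\<lambda>y. 0)" by auto
    have sm: "smooth_section_on M W1 (\<lambda>y. (E \<tau> y, 0::'a cotangent))"
      unfolding smooth_section_on_def e using vector_field_on_mono[OF d(5)[OF \<tau>(1)] d(4)] one_form_on_0 by blast
    have 1: "smooth_section_on M (mpoints M) (k \<tau>)"
      unfolding k_def by (rule smooth_section_cut[OF m d(2) b(2,3,1) _ sm]) (rule b(4))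
    have "(E \<tau> y, 0) \<in> D y" if "y \<in> W1" for y
      by (rule vert[OF M1[OF that] d(9)[OF \<tau>(1) that]]) (use vertical[OF n A(1) that \<tau>(1)] \<tau>(2) in blast)
    then have "k \<tau> y \<in> D y" if "y \<in> mpoints M" for y
      unfolding k_def cut_off_def using DD(2)[OF that] by (auto intro: subspace_scale simp: subspace_0 simp del: scaleR_Pair)
    then show ?thesis using 1 by (simp add: sections_def)
  qed
  have k0: "snd (k \<tau> y) = 0" for \<tau> y by (simp add: k_def cut_off_def)
  have kE: "fst (k \<tau> y) = E \<tau> y" if "y \<in> W2" for \<tau> y using b(8)[OF that] W21 that by (auto simp: k_def cut_off_def)
  let ?r = "dim (model M)" and ?g = "gcoord M E q"
  show thesis
  proof (rule lagrangian_frame[OF m lD sD F A(2)])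
    fix e \<delta> N'
    assume e: "\<And>i. i < ?r \<Longrightarrow> e i \<in> sections M D" and \<delta>: "\<delta> > 0" and N': "N' > 0"
      and est: "\<And>y c. y \<in> W1 \<Longrightarrow> dist (\<kappa> y) (\<kappa> x0) < \<delta> \<Longrightarrow>
        (\<Sum>i<?r. \<bar>c i\<bar>) \<le> N' * norm (?g y (\<Sum>i<?r. c i *\<^sub>R e i y))"
      and spans: "\<And>y d. y \<in> W1 \<Longrightarrow> dist (\<kappa> y) (\<kappa> x0) < \<delta> \<Longrightarrow> d \<in> D y \<Longrightarrow> \<exists>c. d = (\<Sum>i<?r. c i *\<^sub>R e i y)"
    have W2W: "W2 \<subseteq> W" using W21 d(3) by blast
    note oW2 = coord_open_sub[OF m d(1) b(5) W2W]
    obtain \<rho> where \<rho>: "\<rho> > 0" "ball (\<kappa> x0) \<rho> \<inter> model M \<subseteq> \<kappa> ` W2"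
      using oW2 b(6) unfolding open_sub_def openin_contains_ball by blast
    define r where "r = min \<rho> \<delta>"
    have r: "r > 0" using \<rho>(1) \<delta> by (simp add: r_def)
    define B where "B = ball (\<kappa> x0) r \<inter> model M"
    have BW2: "B \<subseteq> \<kappa> ` W2" using \<rho>(2) unfolding B_def r_def by auto
    have Bd: "dist z (\<kappa> x0) < \<delta>" if "z \<in> B" for z using that unfolding B_def r_def by (simp add: dist_commute)
    have cB: "convex B" unfolding B_def by (intro convex_Int convex_ball subspace_imp_convex S)
    have inv: "inv_into W \<kappa> z \<in> W2" "\<kappa> (inv_into W \<kappa> z) = z" if z: "z \<in> B" for z
    proof -
      obtain w where w: "w \<in> W2" "z = \<kappa> w" using z BW2 by blast
      then have "inv_into W \<kappa> z = w" using cs(3) W2W by blast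
      then show "inv_into W \<kappa> z \<in> W2" "\<kappa> (inv_into W \<kappa> z) = z" using w by simp_all
    qed
    define O' where "O' = {y \<in> W. \<kappa> y \<in> B}"
    have oO': "openin (mtop M) O'" unfolding O'_def
      by (rule top_chart_vimage_open[OF coordD(1)[OF d(1)]]) (auto simp: B_def openin_open Int_commute)
    have kx0: "\<kappa> x0 \<in> B" using open_subD(2)[OF oW2] b(6) r by (auto simp: B_def)
    have x0O: "x0 \<in> O'" using kx0 A(2) d(3) by (auto simp: O'_def)
    have O2: "y \<in> W2" if "y \<in> O'" for y using that inv(1)[of "\<kappa> y"] cs(3)[of y] by (auto simp: O'_def)
    show thesis
    proof (rule that[OF oO' x0O])
      fix y assume y: "y \<in> O'" and py: "p y = p x0"
      have y1: "y \<in> W1" using O2[OF y] W21 by blast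
      have ky: "\<kappa> y \<in> B" and yW: "y \<in> W" using y by (auto simp: O'_def)
      define \<tau> where "\<tau> = \<kappa> y - \<kappa> x0"
      have \<tau>: "\<tau> \<in> model M" using ky kx0 S unfolding \<tau>_def B_def by (auto intro: subspace_diff)
      have L\<tau>: "L \<tau> = 0" using ad(12)[OF y1] ad(12)[OF A(2)] py linear_diff[OF ad(6)] by (simp add: \<tau>_def)
      define \<gamma> where "\<gamma> t = inv_into W \<kappa> (\<kappa> x0 + t *\<^sub>R \<tau>)" for t
      have seg: "\<kappa> x0 + t *\<^sub>R \<tau> \<in> B" if "t \<in> {0..1}" for t
        unfolding \<tau>_def by (rule convex_combination_line[OF cB kx0 ky that])
      have segW: "(\<lambda>t. \<kappa> x0 + t *\<^sub>R \<tau>) ` {0..1} \<subseteq> \<kappa> ` W1" using seg BW2 W21 by blast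
      have \<gamma>: "\<gamma> t \<in> W2" "\<gamma> t \<in> W1" "\<kappa> (\<gamma> t) = \<kappa> x0 + t *\<^sub>R \<tau>" "dist (\<kappa> (\<gamma> t)) (\<kappa> x0) < \<delta>" "\<gamma> t \<in> mpoints M" if "t \<in> {0..1}" for t
        using inv[OF seg[OF that]] Bd[OF seg[OF that]] W21 d(4) unfolding \<gamma>_def by auto
      have \<gamma>0: "\<gamma> 0 = x0" and \<gamma>1: "\<gamma> 1 = y" using cs(3) A(2) d(3) yW by (auto simp: \<gamma>_def \<tau>_def)
      define h where "h i = dorfman_bracket M (k \<tau>) (e i)" for i
      have h: "h i \<in> sections M D" if "i < ?r" for i unfolding h_def by (rule br[OF k[OF \<tau> L\<tau>] e[OF that]])
      \<comment> \<open>The brackets are bounded along the segment, and so are their coefficients with respect to the frame.\<close>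
      have "\<exists>K\<ge>0. \<forall>t\<in>{0..1}. norm (?g (\<gamma> t) (h i (\<gamma> t))) \<le> K" if i: "i < ?r" for i
      proof -
        have "continuous_on {0..1} (\<lambda>t. ?g (\<gamma> t) (h i (\<gamma> t)))"
          unfolding \<gamma>_def
          by (rule continuous_on_compose2[OF continuous_gcoord_section[OF m F sectionsD(1)[OF h[OF i]]], of _ "\<lambda>t. \<kappa> x0 + t *\<^sub>R \<tau>"])
            (intro continuous_intros, rule segW)
        from compact_imp_bounded[OF compact_continuous_image[OF this compact_Icc]]
        obtain K where K: "\<forall>z\<in>(\<lambda>t. ?g (\<gamma> t) (h i (\<gamma> t))) ` {0..1}. norm z \<le> K"
          unfolding bounded_iff by (elim exE)
        have "norm (?g (\<gamma> t) (h i (\<gamma> t))) \<le> max K 0" if t: "t \<in> {0..1}" for t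
          using bspec[OF K imageI[OF t]] by simp
        then show ?thesis by (intro exI[of _ "max K 0"] conjI ballI) simp_all
      qed
      then obtain K where K: "\<And>i. i < ?r \<Longrightarrow> K i \<ge> 0" "\<And>i t. i < ?r \<Longrightarrow> t \<in> {0..1} \<Longrightarrow> norm (?g (\<gamma> t) (h i (\<gamma> t))) \<le> K i"
        by metis
      define Kmax where "Kmax = (\<Sum>i<?r. K i)"
      have Kmax: "Kmax \<ge> 0" "\<And>i. i < ?r \<Longrightarrow> K i \<le> Kmax"
        unfolding Kmax_def using K(1) by (auto intro: sum_nonneg member_le_sum)
      have incl: "?g x0 ` D x0 \<subseteq> ?g y ` D y"
      proof
        fix z assume "z \<in> ?g x0 ` D x0"
        then obtain d0 where d0: "d0 \<in> D x0" "z = ?g x0 d0" by blast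
        have z: "z \<in> model M \<times> model M" unfolding d0(2) by (rule gcoord_in[OF m])
        define cz where "cz = const_section M E q z"
        note Z = const_section[OF m F z, folded cz_def]
        note Zs = smooth_sectionD[OF Z(1)]
        define f where "f i y = pairing (e i y) (cz y)" for i y
        have fs: "f i \<in> smooth_funs M" if "i < ?r" for i
        proof -
          note I = smooth_sectionD[OF sectionsD(1)[OF e[OF that]]]
          show ?thesis unfolding f_def pairing_def
            using smooth_funs_add[OF one_form_smooth_funs[OF I(2) Zs(1)] one_form_smooth_funs[OF Zs(2) I(1)]] by (simp add: o_def)
        qed
        have cz0: "cz x0 = d0"
          by (rule gcoord_inj[OF m F A(2) Zs(3)[OF x0]]) (use DD(1)[OF x0] d0 Z(2)[OF A(2)] in auto)
        have zero: "f i (\<gamma> 1) = 0" if i: "i < ?r" for i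
        proof (rule linear_differential_inequality_zero[of "{..<?r}" "N' * Kmax" "\<lambda>i t. f i (\<gamma> t)" "\<lambda>i t. pairing (h i (\<gamma> t)) (cz (\<gamma> t))" i 1])
          show "N' * Kmax \<ge> 0" using N' Kmax(1) by simp
          show "f i (\<gamma> 0) = 0" if "i \<in> {..<?r}" for i
            unfolding \<gamma>0 f_def cz0 using DD(3)[OF x0 sectionsD(2)[OF e x0] d0(1)] that by blast
          fix i t assume i: "i \<in> {..<?r}" and t: "t \<in> {0..1::real}"
          have i': "i < ?r" using i by simp
          have "DERIV (\<lambda>t. f i (inv_into W \<kappa> (\<kappa> x0 + t *\<^sub>R \<tau>))) t :> E \<tau> (\<gamma> t) (f i)"
            by (rule cframe_line[OF m F \<gamma>(2)[OF t] \<tau> fs[OF i'] \<gamma>(3)[OF t]])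
          moreover have "E \<tau> (\<gamma> t) (f i) = pairing (h i (\<gamma> t)) (cz (\<gamma> t))"
            unfolding h_def cz_def f_def[abs_def]
            by (rule dorfman_coordinate_field[OF m F \<tau> sectionsD(1)[OF k[OF \<tau> L\<tau>]] k0 b(5) W21 kE sectionsD(1)[OF e[OF i']] z \<gamma>(1)[OF t], symmetric])
          ultimately show "DERIV (\<lambda>t. f i (\<gamma> t)) t :> pairing (h i (\<gamma> t)) (cz (\<gamma> t))" by (simp add: \<gamma>_def)
          obtain c where c: "h i (\<gamma> t) = (\<Sum>j<?r. c j *\<^sub>R e j (\<gamma> t))"
            using spans[OF \<gamma>(2,4)[OF t] sectionsD(2)[OF h[OF i'] \<gamma>(5)[OF t]]] by (elim exE)
          have "pairing (h i (\<gamma> t)) (cz (\<gamma> t)) = (\<Sum>j<?r. c j * f j (\<gamma> t))"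
            unfolding c f_def
            by (rule pairing_sum[where M = M and x = "\<gamma> t"]) (use DD(1)[OF \<gamma>(5)[OF t]] sectionsD(2)[OF e \<gamma>(5)[OF t]] Zs(3)[OF \<gamma>(5)[OF t]] in auto)
          also have "\<bar>\<dots>\<bar> \<le> (\<Sum>j<?r. \<bar>c j\<bar> * \<bar>f j (\<gamma> t)\<bar>)" by (rule order_trans[OF sum_abs]) (simp add: abs_mult)
          also have "\<dots> \<le> (\<Sum>j<?r. (\<Sum>j<?r. \<bar>c j\<bar>) * \<bar>f j (\<gamma> t)\<bar>)"
            by (intro sum_mono mult_right_mono member_le_sum) auto
          also have "\<dots> = (\<Sum>j<?r. \<bar>c j\<bar>) * (\<Sum>j<?r. \<bar>f j (\<gamma> t)\<bar>)" by (rule sum_distrib_left[symmetric])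
          also have "\<dots> \<le> N' * Kmax * (\<Sum>j<?r. \<bar>f j (\<gamma> t)\<bar>)"
          proof (rule mult_right_mono)
            have "(\<Sum>j<?r. \<bar>c j\<bar>) \<le> N' * norm (?g (\<gamma> t) (h i (\<gamma> t)))" unfolding c by (rule est[OF \<gamma>(2,4)[OF t]])
            also have "\<dots> \<le> N' * Kmax" using K(2)[OF i' t] Kmax(2)[OF i'] N' by (intro mult_left_mono) auto
            finally show "(\<Sum>j<?r. \<bar>c j\<bar>) \<le> N' * Kmax" .
          qed (simp add: sum_nonneg)
          finally show "\<bar>pairing (h i (\<gamma> t)) (cz (\<gamma> t))\<bar> \<le> N' * Kmax * (\<Sum>j\<in>{..<?r}. \<bar>f j (\<gamma> t)\<bar>)" .
        qed (use i in auto)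
        have yM: "y \<in> mpoints M" using M1[OF y1] .
        have "cz y \<in> D y"
        proof (rule DD(4)[OF yM Zs(3)[OF yM]])
          fix d' assume d': "d' \<in> D y"
          obtain c where c: "d' = (\<Sum>j<?r. c j *\<^sub>R e j y)" using spans[OF y1 Bd[OF ky] d'] by (elim exE)
          have "pairing d' (cz y) = (\<Sum>j<?r. c j * pairing (e j y) (cz y))"
            unfolding c by (rule pairing_sum[where M = M and x = y]) (use DD(1)[OF yM] sectionsD(2)[OF e yM] Zs(3)[OF yM] in auto)
          also have "\<dots> = 0" using zero unfolding \<gamma>1 f_def by (intro sum.neutral) auto
          finally show "pairing (cz y) d' = 0" by (simp add: pairing_commute)
        qed
        then show "z \<in> ?g y ` D y" using Z(2)[OF y1] by (metis imageI)
      qed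
      \<comment> \<open>Lagrangian subspaces have equal dimensions, so the inclusion is an equality.\<close>
      have "?g x0 ` D x0 = ?g y ` D y"
        by (rule subspace_dim_equal[OF lagrangian_dim(2)[OF m lD F A(2)] lagrangian_dim(2)[OF m lD F y1] incl])
          (simp add: lagrangian_dim(1)[OF m lD F A(2)] lagrangian_dim(1)[OF m lD F y1])
      then show "dirac_push M N p y (D y) = dirac_push M N p x0 (D x0)"
        using dirac_push_mono[OF m n p A(1) y1 A(2) py DD(1)[OF M1[OF y1]] DD(1)[OF x0]]
          dirac_push_mono[OF m n p A(1) A(2) y1 py[symmetric] DD(1)[OF x0] DD(1)[OF M1[OF y1]]] by blast
    qed
  qed
qed

lemma locally_constant_connected:
  assumes c: "connectedin X S" and loc: "\<And>x. x \<in> S \<Longrightarrow> \<exists>O'. openin X O' \<and> x \<in> O' \<and> (\<forall>y\<in>O' \<inter> S. f y = f x)"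
    and x: "x \<in> S" and y: "y \<in> S"
  shows "f x = f y"
proof (rule ccontr)
  assume ne: "f x \<noteq> f y"
  obtain U where U: "\<And>z. z \<in> S \<Longrightarrow> openin X (U z)" "\<And>z. z \<in> S \<Longrightarrow> z \<in> U z" "\<And>z w. z \<in> S \<Longrightarrow> w \<in> U z \<Longrightarrow> w \<in> S \<Longrightarrow> f w = f z"
    using loc by (metis IntI)
  define A where "A = \<Union>(U ` {z \<in> S. f z = f x})"
  define B where "B = \<Union>(U ` {z \<in> S. f z \<noteq> f x})"
  have oA: "openin X A" and oB: "openin X B" unfolding A_def B_def using U(1) by blast+
  have cov: "S \<subseteq> A \<union> B" using U(2) unfolding A_def B_def by blast
  have "f w = f x" if "w \<in> A" "w \<in> S" for w
  proof -
    from that(1) obtain z where z: "z \<in> S" "f z = f x" "w \<in> U z" unfolding A_def by blast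
    show ?thesis using U(3)[OF z(1,3) that(2)] z(2) by simp
  qed
  moreover have "f w \<noteq> f x" if "w \<in> B" "w \<in> S" for w
  proof -
    from that(1) obtain z where z: "z \<in> S" "f z \<noteq> f x" "w \<in> U z" unfolding B_def by blast
    show ?thesis using U(3)[OF z(1,3) that(2)] z(2) by simp
  qed
  ultimately have dis: "A \<inter> B \<inter> S = {}" by blast
  have "x \<in> A" using x U(2)[OF x] unfolding A_def by blast
  moreover have "y \<in> B" using y U(2)[OF y] ne unfolding B_def by force
  ultimately show False using c oA oB cov dis x y unfolding connectedin by blast
qed

text \<open>
  In adapted coordinates a local section of \<open>p\<close> through \<open>x\<close> is \<open>w \<mapsto> \<kappa> x + l (w - \<psi> (p x))\<close>.
\<close>

lemma local_section:
  assumes m: "smooth_manifold M" and n: "smooth_manifold N" and p: "smooth_map M N p"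
    and A: "adapted M N p W \<kappa> W1 E q V \<psi> V1 E' q' L l c" and x: "x \<in> W1"
  obtains V2 \<sigma> where "openin (mtop N) V2" "V2 \<subseteq> V1" "p x \<in> V2" "\<sigma> (p x) = x"
    "\<And>y. y \<in> V2 \<Longrightarrow> \<sigma> y \<in> W1" "\<And>y. y \<in> V2 \<Longrightarrow> p (\<sigma> y) = y"
    "\<And>f. f \<in> smooth_funs M \<Longrightarrow> smooth_fun_on N V2 (\<lambda>y. f (\<sigma> y))"
proof -
  note a = adaptedD[OF A]
  note d = cframeD[OF a(1)] and d' = cframeD[OF a(2)]
  note cs = coord_simps[OF d(1)] and cs' = coord_simps[OF d'(1)]
  note SM = smooth_manifoldD(2)[OF m] and SN = smooth_manifoldD(2)[OF n]
  note oW = coord_open_sub[OF m d(1,2,3)] and oV = coord_open_sub[OF n d'(1) cs'(1) order_refl]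
  have kS: "\<kappa> y \<in> model M" if "y \<in> W1" for y using open_subD(2)[OF oW] that by blast
  have pS: "\<psi> y \<in> model N" if "y \<in> V" for y using open_subD(2)[OF oV] that by blast
  have px: "p x \<in> V1" "p x \<in> V" using a(3)[OF x] d'(3) by auto
  define g where "g z = \<kappa> x + l (z - \<psi> (p x))" for z
  define \<sigma> where "\<sigma> y = inv_into W \<kappa> (g (\<psi> y))" for y
  have gC: "Cinf_on (model N) U g" for U
    unfolding g_def by (intro Cinf_on_add Cinf_on_const Cinf_on_linear_comp[OF a(5)] Cinf_on_diff Cinf_on_ident)
  have gS: "g \<in> model N \<rightarrow> model M"
    unfolding g_def using kS[OF x] a(10) pS[OF px(2)] SM SN by (auto intro!: subspace_add subspace_diff)
  define X where "X = model N \<inter> g -` (\<kappa> ` W1)"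
  have oX: "openin (top_of_set (model N)) X"
    unfolding X_def
    by (rule continuous_openin_preimage[OF Cinf_on_continuous[OF gC] gS]) (use oW in \<open>simp add: open_sub_def\<close>)
  define V2 where "V2 = {y \<in> V. \<psi> y \<in> X} \<inter> V1"
  have oV2: "openin (mtop N) V2" unfolding V2_def
    using top_chart_vimage_open[OF coordD(1)[OF d'(1)] oX] d'(2) by (rule openin_Int)
  have V2: "y \<in> V2 \<longleftrightarrow> y \<in> V1 \<and> g (\<psi> y) \<in> \<kappa> ` W1" for y
    using d'(3) pS by (auto simp: V2_def X_def)
  have V2V: "V2 \<subseteq> V" by (auto simp: V2_def)
  have gx: "g (\<psi> (p x)) = \<kappa> x" using linear_0[OF a(7)] by (simp add: g_def)
  have inv: "\<sigma> y \<in> W1 \<and> \<kappa> (\<sigma> y) = g (\<psi> y)" if y: "y \<in> V2" for y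
  proof -
    obtain w where w: "w \<in> W1" "g (\<psi> y) = \<kappa> w" using y V2 by blast
    then have "\<sigma> y = w" using cs(3) d(3) unfolding \<sigma>_def by (simp add: subset_iff)
    then show ?thesis using w by simp
  qed
  show thesis
  proof (rule that[of V2 \<sigma>])
    show "p x \<in> V2" using px gx x by (auto simp: V2)
    show "\<sigma> (p x) = x" using cs(3) x d(3) unfolding \<sigma>_def gx by blast
    show "\<sigma> y \<in> W1" if "y \<in> V2" for y using inv[OF that] by blast
    show "p (\<sigma> y) = y" if y: "y \<in> V2" for y
    proof -
      have y1: "\<sigma> y \<in> W1" "\<kappa> (\<sigma> y) = g (\<psi> y)" using inv[OF y] by auto
      have yV: "y \<in> V" using y V2V by blast
      have "\<psi> (p (\<sigma> y)) = c + L (\<kappa> x + l (\<psi> y - \<psi> (p x)))" using a(12)[OF y1(1)] y1(2) by (simp add: g_def)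
      also have "\<dots> = c + L (\<kappa> x) + (\<psi> y - \<psi> (p x))"
        using a(11)[OF subspace_diff[OF SN pS[OF yV] pS[OF px(2)]]] linear_add[OF a(6)] by simp
      also have "\<dots> = \<psi> y" using a(12)[OF x] by simp
      finally show ?thesis using cs'(4) yV a(3)[OF y1(1)] d'(3) by (auto simp: inj_on_def)
    qed
    fix f assume f: "f \<in> smooth_funs M"
    note oV2' = coord_open_sub[OF n d'(1) oV2 V2V]
    show "smooth_fun_on N V2 (\<lambda>y. f (\<sigma> y))"
      unfolding coordD(2)[OF d'(1) oV2 V2V]
    proof (rule Cinf_on_cong)
      show "Cinf_on (model N) (\<psi> ` V2) (\<lambda>z. f (inv_into W \<kappa> (g z)))"
      proof (rule Cinf_on_compose[OF oV2' oW _ gC, where g = "\<lambda>z. f (inv_into W \<kappa> z)"])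
        show "g ` \<psi> ` V2 \<subseteq> \<kappa> ` W1" using V2 by blast
        show "Cinf_on (model M) (\<kappa> ` W1) (\<lambda>z. f (inv_into W \<kappa> z))"
          by (rule Cinf_on_mono[OF coord_rep[OF d(1) f]]) (use d(3) in auto)
      qed
      show "f (inv_into W \<kappa> (g z)) = f (\<sigma> (inv_into V \<psi> z))" if "z \<in> \<psi> ` V2" for z
        using that cs'(3) V2V by (auto simp: \<sigma>_def subset_iff)
    qed
  qed (use oV2 in \<open>auto simp: V2_def\<close>)
qed

text \<open>
  Along a local section \<open>\<sigma>\<close> of \<open>p\<close> the pushforward has a unique value at each point of the base. The
  coefficients of its vector part are obtained by applying the vector part of \<open>s\<close> to the functions
  \<open>q' b \<circ> p\<close>, those of its form by evaluating the form on the lifted directions \<open>l b\<close>; hence they are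
  smooth.
\<close>

lemma push_section:
  assumes m: "smooth_manifold M" and n: "smooth_manifold N" and p: "smooth_map M N p"
    and A: "adapted M N p W \<kappa> W1 E q V \<psi> V1 E' q' L l c"
    and V2: "openin (mtop N) V2" "V2 \<subseteq> V1" "\<And>y. y \<in> V2 \<Longrightarrow> \<sigma> y \<in> W1" "\<And>y. y \<in> V2 \<Longrightarrow> p (\<sigma> y) = y"
    and sm: "\<And>f. f \<in> smooth_funs M \<Longrightarrow> smooth_fun_on N V2 (\<lambda>y. f (\<sigma> y))"
    and s: "smooth_section_on M (mpoints M) s"
    and rng: "\<And>y. y \<in> W1 \<Longrightarrow> \<exists>\<eta>\<in>cotangent_space N (p y). snd (s y) = pullback M N p y \<eta>"
  obtains r where "smooth_section_on N V2 r"
    "\<And>y. y \<in> V2 \<Longrightarrow> r y \<in> dirac_push M N p (\<sigma> y) {s (\<sigma> y)}"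
proof -
  note a = adaptedD[OF A]
  note d = cframeD[OF a(1)] and d' = cframeD[OF a(2)] and B = cframe_basis[OF n]
  note S = smooth_sectionD[OF s]
  let ?B = "onb (model N)"
  define X where "X y = (\<Sum>b\<in>?B. fst (s (\<sigma> y)) (\<lambda>z. q' b (p z)) *\<^sub>R E' b y)" for y
  define \<eta> where "\<eta> y = (\<Sum>b\<in>?B. snd (s (\<sigma> y)) (E (l b) (\<sigma> y)) *\<^sub>R dform N (q' b) y)" for y
  have V2N: "V2 \<subseteq> mpoints N" using V2(2) d'(4) by blast
  have sX: "smooth_fun_on N V2 (\<lambda>y. fst (s (\<sigma> y)) (\<lambda>z. q' b (p z)))" if "b \<in> ?B" for b
    using sm[OF vector_field_smooth_funs[OF S(1) smooth_map_compose[OF m n p d'(6)[OF B[OF that]]]]] by simp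
  have s\<eta>: "smooth_fun_on N V2 (\<lambda>y. snd (s (\<sigma> y)) (E (l b) (\<sigma> y)))" if "b \<in> ?B" for b
    using sm[OF one_form_smooth_funs[OF S(2) d(5)[OF a(10)[OF B[OF that]]]]] by simp
  have vX: "vector_field_on N V2 X"
    unfolding X_def
    by (intro vector_field_on_sum vector_field_on_scale sX vector_field_on_mono[OF d'(5)[OF B] V2N])
  have v\<eta>: "one_form_on N V2 \<eta>"
    unfolding \<eta>_def
    by (intro one_form_on_sum one_form_on_scale s\<eta> one_form_dform[OF n d'(6)[OF B] V2N])
  have mem: "(X y, \<eta> y) \<in> dirac_push M N p (\<sigma> y) {s (\<sigma> y)}" if y: "y \<in> V2" for y
  proof -
    have y1: "\<sigma> y \<in> W1" and yV: "y \<in> V1" and py: "p (\<sigma> y) = y" using V2 y by blast+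
    have yM: "\<sigma> y \<in> mpoints M" using y1 d(4) by blast
    have t: "fst (s (\<sigma> y)) \<in> tangent_space M (\<sigma> y)" using vector_field_onD(1)[OF S(1) yM] by simp
    have pt: "pushforward N p (fst (s (\<sigma> y))) \<in> tangent_space N y" using pushforward_tangent[OF m n p t] py by simp
    have "pushforward N p (fst (s (\<sigma> y))) = X y"
      unfolding X_def
      by (subst cframe_tangent_expand[OF n a(2) yV pt], rule sum.cong)
        (use pushforward_apply[OF d'(6)[OF B], of _ p "fst (s (\<sigma> y))"] in auto)
    moreover obtain \<theta> where \<theta>: "\<theta> \<in> cotangent_space N y" "snd (s (\<sigma> y)) = pullback M N p (\<sigma> y) \<theta>"
      using rng[OF y1] unfolding py by blast
    have "\<theta> = \<eta> y"
    proof (rule cotangent_eqI[OF \<theta>(1) one_form_onD(1)[OF v\<eta> y]])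
      fix v assume v: "v \<in> tangent_space N y"
      have "\<theta> v = (\<Sum>b\<in>?B. v (q' b) * \<theta> (E' b y))" by (rule cframe_cotangent_expand[OF n a(2) yV v \<theta>(1)])
      also have "\<dots> = \<eta> y v"
        unfolding \<eta>_def fun_sum_apply fun_scaleR_apply
      proof (rule sum.cong)
        fix b assume b: "b \<in> ?B"
        have "snd (s (\<sigma> y)) (E (l b) (\<sigma> y)) = \<theta> (E' b y)"
          unfolding \<theta>(2) pullback_apply[OF d(9)[OF a(10)[OF B[OF b]] y1]] a(13)[OF y1 a(10)[OF B[OF b]]] a(11)[OF B[OF b]] py
          by (rule refl)
        then show "v (q' b) * \<theta> (E' b y) = snd (s (\<sigma> y)) (E (l b) (\<sigma> y)) *\<^sub>R dform N (q' b) y v"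
          using v by (simp add: dform_def)
      qed simp
      finally show "\<theta> v = \<eta> y v" .
    qed
    ultimately show ?thesis
      unfolding dirac_push_def using t \<theta> py by (auto simp: prod_eq_iff intro!: exI[of _ "fst (s (\<sigma> y))"])
  qed
  show thesis
  proof (rule that[of "\<lambda>y. (X y, \<eta> y)"])
    show "smooth_section_on N V2 (\<lambda>y. (X y, \<eta> y))"
      using vX v\<eta> by (simp add: smooth_section_on_def o_def)
  qed (rule mem)
qed

text \<open>
  The pushforward is constant on the connected fibres of \<open>p\<close> and defines \<open>R\<close>. Since \<open>D\<close> contains the
  kernel, it is the pullback of \<open>R\<close>. This makes \<open>R\<close> Lagrangian, and sections of \<open>R\<close> have local related lifts
  that are sections of \<open>D\<close>, where the Courant tensor vanishes.
\<close>

theorem dirac_structure_descends: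
  assumes m: "smooth_manifold M" and n: "smooth_manifold N" and sub: "submersion M N p" and D: "dirac_structure M D"
    and surj: "p ` mpoints M = mpoints N"
    and conn: "\<And>x. x \<in> mpoints M \<Longrightarrow> connectedin (mtop M) {y \<in> mpoints M. p y = p x}"
    and vert: "\<And>x k. x \<in> mpoints M \<Longrightarrow> k \<in> tangent_space M x \<Longrightarrow> pushforward N p k = 0 \<Longrightarrow> (k, 0) \<in> D x"
  obtains R where "dirac_structure N R" "\<And>x. x \<in> mpoints M \<Longrightarrow> dirac_push M N p x (D x) = R (p x)"
proof -
  have p: "smooth_map M N p" using sub by (simp add: submersion_def)
  note pM = smooth_map_in[OF p]
  have lD: "lagrangian_family M D" and sD: "has_sections M D"
    and cD: "\<And>a b c x. a \<in> sections M D \<Longrightarrow> b \<in> sections M D \<Longrightarrow> c \<in> sections M D \<Longrightarrow> x \<in> mpoints M \<Longrightarrow> courant_tensor a b c x = 0"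
    using D unfolding dirac_structure_iff[OF m] by blast+
  note DD = lagrangian_familyD[OF lD]
  have const: "dirac_push M N p x (D x) = dirac_push M N p y (D y)"
    if x: "x \<in> mpoints M" and y: "y \<in> mpoints M" and eq: "p x = p y" for x y
  proof (rule locally_constant_connected[OF conn[OF x], of "\<lambda>x. dirac_push M N p x (D x)"])
    fix z assume z: "z \<in> {y \<in> mpoints M. p y = p x}"
    then have zM: "z \<in> mpoints M" by simp
    show "\<exists>O'. openin (mtop M) O' \<and> z \<in> O' \<and> (\<forall>w\<in>O' \<inter> {y \<in> mpoints M. p y = p x}. dirac_push M N p w (D w) = dirac_push M N p z (D z))"
    proof (rule push_locally_constant[OF m n sub D _ zM])
      show "(k, 0) \<in> D x" if "x \<in> mpoints M" "k \<in> tangent_space M x" "pushforward N p k = 0" for x k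
        by (rule vert[OF that])
      fix O' assume O': "openin (mtop M) O'" "z \<in> O'"
        "\<And>w. w \<in> O' \<Longrightarrow> p w = p z \<Longrightarrow> dirac_push M N p w (D w) = dirac_push M N p z (D z)"
      show ?thesis
      proof (intro exI[of _ O'] conjI ballI O'(1,2))
        fix w assume "w \<in> O' \<inter> {y \<in> mpoints M. p y = p x}"
        then have "w \<in> O'" "p w = p z" using z by auto
        then show "dirac_push M N p w (D w) = dirac_push M N p z (D z)" by (rule O'(3))
      qed
    qed
  qed (use x y eq in auto)
  define R where "R y = (let x = (SOME x. x \<in> mpoints M \<and> p x = y) in dirac_push M N p x (D x))" for y
  have R: "dirac_push M N p x (D x) = R (p x)" if x: "x \<in> mpoints M" for x
  proof -
    define x' where "x' = (SOME x'. x' \<in> mpoints M \<and> p x' = p x)"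
    have "x' \<in> mpoints M \<and> p x' = p x" unfolding x'_def by (rule someI_ex) (use x in blast)
    then show ?thesis unfolding R_def Let_def x'_def[symmetric] using const[OF x] by simp
  qed
  \<comment> \<open>\<open>D\<close> contains the kernel and is isotropic, so its covectors annihilate the kernel and come from the base.\<close>
  have ker: "\<xi> k = 0" if x: "x \<in> mpoints M" and d: "(u, \<xi>) \<in> D x" and k: "k \<in> tangent_space M x" "pushforward N p k = 0" for x u \<xi> k
    using DD(3)[OF x d vert[OF x k]] unfolding pairing_def fst_conv snd_conv by (simp add: zero_fun_def)
  have form: "\<exists>\<eta>\<in>cotangent_space N (p x). \<xi> = pullback M N p x \<eta>" if x: "x \<in> mpoints M" and d: "(u, \<xi>) \<in> D x" for x u \<xi>
  proof -
    have "\<xi> \<in> cotangent_space M x" using DD(1)[OF x] d by (auto simp: gtangent_space_def)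
    from annihilator_pullback[OF sub x this ker[OF x d]] obtain \<eta> where "\<eta> \<in> cotangent_space N (p x)" "\<xi> = pullback M N p x \<eta>" .
    then show ?thesis by blast
  qed
  have R_mem: "(pushforward N p u, \<eta>) \<in> R (p x)" if x: "x \<in> mpoints M" and d: "(u, pullback M N p x \<eta>) \<in> D x" and \<eta>: "\<eta> \<in> cotangent_space N (p x)" for x u \<eta>
  proof -
    have "u \<in> tangent_space M x" using DD(1)[OF x] d by (auto simp: gtangent_space_def)
    then show ?thesis unfolding R[OF x, symmetric] dirac_push_def using d \<eta> by blast
  qed
  have R_obt: "\<exists>u \<eta>. r = (pushforward N p u, \<eta>) \<and> u \<in> tangent_space M x \<and> \<eta> \<in> cotangent_space N (p x) \<and> (u, pullback M N p x \<eta>) \<in> D x"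
    if x: "x \<in> mpoints M" and r: "r \<in> R (p x)" for x r
    using r unfolding R[OF x, symmetric] dirac_push_def by blast
  have pull: "dirac_pull M N p R x = D x" if x: "x \<in> mpoints M" for x
  proof (intro equalityI subsetI)
    fix e assume "e \<in> dirac_pull M N p R x"
    then obtain u \<eta> where u: "e = (u, pullback M N p x \<eta>)" "u \<in> tangent_space M x" "\<eta> \<in> cotangent_space N (p x)" "(pushforward N p u, \<eta>) \<in> R (p x)"
      unfolding dirac_pull_def by blast
    obtain v where v: "v \<in> tangent_space M x" "pushforward N p u = pushforward N p v" "(v, pullback M N p x \<eta>) \<in> D x"
      using R_obt[OF x u(4)] by auto
    have "(u - v, 0) \<in> D x"
      by (rule vert[OF x subspace_diff[OF subspace_tangent_space u(2) v(1)]]) (simp only: pushforward_linear(4) v(2) diff_self)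
    from subspace_add[OF DD(2)[OF x] this v(3)] show "e \<in> D x" unfolding u(1) by simp
  next
    fix e assume e: "e \<in> D x"
    obtain u \<xi> where u: "e = (u, \<xi>)" by (cases e)
    have t: "u \<in> tangent_space M x" using DD(1)[OF x] e u by (auto simp: gtangent_space_def)
    obtain \<eta> where \<eta>: "\<eta> \<in> cotangent_space N (p x)" "\<xi> = pullback M N p x \<eta>" using form[OF x] e u by metis
    then show "e \<in> dirac_pull M N p R x" unfolding dirac_pull_def u using t R_mem[OF x _ \<eta>(1)] e u by blast
  qed
  have sec_pull: "sections M (dirac_pull M N p R) = sections M D" using pull by (auto simp: sections_def)
  have lR: "lagrangian_family N R"
    unfolding lagrangian_family_def
  proof (intro ballI equalityI subsetI)
    fix y r assume y: "y \<in> mpoints N" and r: "r \<in> R y"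
    obtain x where x: "x \<in> mpoints M" "y = p x" using surj y by blast
    obtain u \<eta> where u: "r = (pushforward N p u, \<eta>)" "u \<in> tangent_space M x" "\<eta> \<in> cotangent_space N (p x)" "(u, pullback M N p x \<eta>) \<in> D x"
      using R_obt[OF x(1)] r x(2) by blast
    have "pairing r r' = 0" if r': "r' \<in> R y" for r'
    proof -
      obtain v \<theta> where v: "r' = (pushforward N p v, \<theta>)" "v \<in> tangent_space M x" "\<theta> \<in> cotangent_space N (p x)" "(v, pullback M N p x \<theta>) \<in> D x"
        using R_obt[OF x(1)] r' x(2) by blast
      show ?thesis
        using DD(3)[OF x(1) u(4) v(4)] pullback_apply[OF u(2), of N p \<theta>] pullback_apply[OF v(2), of N p \<eta>]
        by (simp add: pairing_def u(1) v(1))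
    qed
    then show "r \<in> orthogonal_space N y (R y)"
      unfolding orthogonal_space_def using u(1,3) pushforward_tangent[OF m n p u(2)] x(2) by (simp add: gtangent_space_def)
  next
    fix y r assume y: "y \<in> mpoints N" and r: "r \<in> orthogonal_space N y (R y)"
    obtain x where x: "x \<in> mpoints M" "y = p x" using surj y by blast
    have rg: "fst r \<in> tangent_space N (p x)" "snd r \<in> cotangent_space N (p x)" and orth: "\<And>r'. r' \<in> R y \<Longrightarrow> pairing r r' = 0"
      using r x(2) by (auto simp: orthogonal_space_def gtangent_space_def)
    obtain u where u: "u \<in> tangent_space M x" "fst r = pushforward N p u" using rg(1) sub x(1) by (auto simp: submersion_def)
    have "(u, pullback M N p x (snd r)) \<in> D x"
    proof (rule DD(4)[OF x(1)])
      show "(u, pullback M N p x (snd r)) \<in> gtangent_space M x"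
        using u(1) pullback_cotangent[OF m n p rg(2)] by (simp add: gtangent_space_def)
      fix e assume e: "e \<in> D x"
      obtain v \<xi> where v: "e = (v, \<xi>)" by (cases e)
      have t: "v \<in> tangent_space M x" using DD(1)[OF x(1)] e v by (auto simp: gtangent_space_def)
      obtain \<eta> where \<eta>: "\<eta> \<in> cotangent_space N (p x)" "\<xi> = pullback M N p x \<eta>" using form[OF x(1)] e v by metis
      have "(pushforward N p v, \<eta>) \<in> R (p x)" by (rule R_mem[OF x(1) _ \<eta>(1)]) (use e v \<eta>(2) in simp)
      from orth[unfolded x(2), OF this] show "pairing (u, pullback M N p x (snd r)) e = 0"
        using pullback_apply[OF u(1), of N p \<eta>] pullback_apply[OF t, of N p "snd r"] u(2)
        by (simp add: pairing_def v \<eta>(2))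
    qed
    from R_mem[OF x(1) this rg(2)] show "r \<in> R y" using u(2)[symmetric] x(2) by simp
  qed
  note RR = lagrangian_familyD[OF lR]
  have sR: "has_sections N R"
    unfolding has_sections_def
  proof (intro ballI)
    fix y r assume y: "y \<in> mpoints N" and r: "r \<in> R y"
    obtain x where x: "x \<in> mpoints M" "y = p x" using surj y by blast
    obtain u \<eta> where u: "r = (pushforward N p u, \<eta>)" "u \<in> tangent_space M x" "\<eta> \<in> cotangent_space N (p x)" "(u, pullback M N p x \<eta>) \<in> D x"
      using R_obt[OF x(1)] r x(2) by blast
    obtain s where s: "s \<in> sections M D" "s x = (u, pullback M N p x \<eta>)" using sD x(1) u(4) unfolding has_sections_def by blast
    obtain W \<kappa> W1 E q V \<psi> V1 E' q' L l c where A: "adapted M N p W \<kappa> W1 E q V \<psi> V1 E' q' L l c" "x \<in> W1"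
      using adapted_exists[OF m n sub x(1)] by (elim exE conjE)
    note d = cframeD[OF adaptedD(1)[OF A(1)]]
    obtain V2 \<sigma> where V2: "openin (mtop N) V2" "V2 \<subseteq> V1" "p x \<in> V2" "\<sigma> (p x) = x"
      "\<And>y. y \<in> V2 \<Longrightarrow> \<sigma> y \<in> W1" "\<And>y. y \<in> V2 \<Longrightarrow> p (\<sigma> y) = y"
      "\<And>f. f \<in> smooth_funs M \<Longrightarrow> smooth_fun_on N V2 (\<lambda>y. f (\<sigma> y))"
      using local_section[OF m n p A] by metis
    have rng: "\<exists>\<eta>\<in>cotangent_space N (p y). snd (s y) = pullback M N p y \<eta>" if "y \<in> W1" for y
    proof -
      have yM: "y \<in> mpoints M" using that d(4) by blast
      show ?thesis using form[OF yM, of "fst (s y)" "snd (s y)"] sectionsD(2)[OF s(1) yM] by simp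
    qed
    obtain t where t: "smooth_section_on N V2 t" "\<And>y. y \<in> V2 \<Longrightarrow> t y \<in> dirac_push M N p (\<sigma> y) {s (\<sigma> y)}"
      using push_section[OF m n p A(1) V2(1,2,5,6,7) sectionsD(1)[OF s(1)] rng] by metis
    have tR: "t y \<in> R y" if y: "y \<in> V2" for y
    proof -
      have yM: "\<sigma> y \<in> mpoints M" using V2(5)[OF y] d(4) by blast
      have "{s (\<sigma> y)} \<subseteq> D (\<sigma> y)" using sectionsD(2)[OF s(1) yM] by simp
      then have "dirac_push M N p (\<sigma> y) {s (\<sigma> y)} \<subseteq> dirac_push M N p (\<sigma> y) (D (\<sigma> y))"
        unfolding dirac_push_def by blast
      then show ?thesis using t(2)[OF y] R[OF yM] V2(6)[OF y] by auto
    qed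
    obtain t' W' where t': "t' \<in> sections N R" "y \<in> W'" "\<And>y. y \<in> W' \<Longrightarrow> t' y = t y"
      using extend_section[OF n V2(1) _ t(1), of y R] V2(3) x(2) tR RR(2) by metis
    have "t (p x) \<in> dirac_push M N p x {s x}" using t(2)[OF V2(3)] V2(4) by simp
    then obtain v \<theta> where v: "t (p x) = (pushforward N p v, \<theta>)" "\<theta> \<in> cotangent_space N (p x)" "(v, pullback M N p x \<theta>) = s x"
      unfolding dirac_push_def by blast
    have "\<theta> = \<eta>" by (rule pullback_inj[OF sub x(1) v(2) u(3)]) (use v(3) s(2) in simp)
    then have "t (p x) = r" using v s(2) u(1) by simp
    then show "\<exists>a\<in>sections N R. a y = r" using t' x(2) by metis
  qed
  have cR: "courant_tensor a b c y = 0" if s: "a \<in> sections N R" "b \<in> sections N R" "c \<in> sections N R" and y: "y \<in> mpoints N" for a b c y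
  proof -
    obtain x where x: "x \<in> mpoints M" "y = p x" using surj y by blast
    have lift: "\<exists>a' W. a' \<in> sections M D \<and> openin (mtop M) W \<and> x \<in> W \<and> (\<forall>z\<in>W. related_at M N p a' a z)" if a: "a \<in> sections N R" for a
    proof -
      have "fst (a (p x)) \<in> tangent_space N (p x)"
        using sectionsD(2)[OF a pM[OF x(1)]] RR(1)[OF pM[OF x(1)]] by (auto simp: gtangent_space_def)
      then obtain u where u: "u \<in> tangent_space M x" "fst (a (p x)) = pushforward N p u" using sub x(1) by (auto simp: submersion_def)
      show ?thesis using lift_section[OF m n sub RR(2,1) a x(1) u(1) u(2)[symmetric]] unfolding sec_pull by metis
    qed
    obtain a' Wa where a: "a' \<in> sections M D" "openin (mtop M) Wa" "x \<in> Wa" "\<forall>z\<in>Wa. related_at M N p a' a z"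
      using lift[OF s(1)] by blast
    obtain b' Wb where b: "b' \<in> sections M D" "openin (mtop M) Wb" "x \<in> Wb" "\<forall>z\<in>Wb. related_at M N p b' b z"
      using lift[OF s(2)] by blast
    obtain c' Wc where c: "c' \<in> sections M D" "openin (mtop M) Wc" "x \<in> Wc" "\<forall>z\<in>Wc. related_at M N p c' c z"
      using lift[OF s(3)] by blast
    have W: "openin (mtop M) (Wa \<inter> Wb \<inter> Wc)" "x \<in> Wa \<inter> Wb \<inter> Wc" using a b c by auto
    have "courant_tensor a' b' c' x = courant_tensor a b c (p x)"
      by (rule courant_tensor_related[OF m n p sectionsD(1)[OF a(1)] sectionsD(1)[OF b(1)] sectionsD(1)[OF c(1)]
          sectionsD(1)[OF s(1)] sectionsD(1)[OF s(2)] sectionsD(1)[OF s(3)] W]) (use a(4) b(4) c(4) in auto)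
    then show ?thesis using cD[OF a(1) b(1) c(1) x(1)] x(2) by simp
  qed
  have "dirac_structure N R" unfolding dirac_structure_iff[OF n] using lR sR cR by blast
  then show thesis using that R by blast
qed

section \<open>The tangent distribution of a simple foliation\<close>

lemma leaf_map_eq:
  assumes "foliation M \<F>" "S \<in> \<F>" "x \<in> S"
  shows "leaf_map \<F> x = S"
proof -
  have "disjoint \<F>" using assms(1) by (auto simp: foliation_def foliation_of_dim_def)
  then show ?thesis unfolding leaf_map_def using assms(2,3) by (intro the_equality) (auto simp: disjoint_def)
qed

lemma leaf_map_in:
  assumes "foliation M \<F>" "x \<in> mpoints M"
  shows "leaf_map \<F> x \<in> \<F>" "x \<in> leaf_map \<F> x"
proof -
  have "\<Union>\<F> = mpoints M" using assms(1) by (auto simp: foliation_def foliation_of_dim_def)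
  then obtain S where S: "S \<in> \<F>" "x \<in> S" using assms(2) by blast
  then show "leaf_map \<F> x \<in> \<F>" "x \<in> leaf_map \<F> x" using leaf_map_eq[OF assms(1) S] by auto
qed

lemma leaf_map_fibre:
  assumes "foliation M \<F>" "x \<in> mpoints M"
  shows "{y \<in> mpoints M. leaf_map \<F> y = leaf_map \<F> x} = leaf_map \<F> x"
proof -
  note l = leaf_map_in[OF assms]
  have "\<Union>\<F> = mpoints M" using assms(1) by (auto simp: foliation_def foliation_of_dim_def)
  then have "leaf_map \<F> x \<subseteq> mpoints M" using l(1) by blast
  then show ?thesis using leaf_map_eq[OF assms(1) l(1)] leaf_map_in(2)[OF assms(1)] by auto
qed

lemma leaf_connected:
  assumes "foliation M \<F>" "S \<in> \<F>"
  shows "connectedin (mtop M) S"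
proof -
  obtain Q where Q: "immersed_submanifold M S Q" "connected_space (mtop Q)"
    using assms by (auto simp: foliation_def foliation_of_dim_def)
  then have "continuous_map (mtop Q) (mtop M) (\<lambda>x. x)" "mpoints Q = S"
    by (auto simp: immersed_submanifold_def immersion_def smooth_map_def)
  then show ?thesis
    using connectedin_continuous_map_image[of "mtop Q" "mtop M" "\<lambda>x. x" "mpoints Q"] Q(2) connectedin_topspace by auto
qed

lemma cframe_coordinates:
  assumes m: "smooth_manifold M" and F: "cframe M W \<kappa> W1 E q" and x: "x \<in> W1" and v: "v \<in> tangent_space M x"
  shows "(\<Sum>b\<in>onb (model M). v (q b) *\<^sub>R b) \<in> model M" "E (\<Sum>b\<in>onb (model M). v (q b) *\<^sub>R b) x = v"
proof -
  note S = smooth_manifoldD(2)[OF m] and B = cframe_basis[OF m]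
  obtain s where s: "s \<in> model M" "v = E s x" using cframe_surj[OF m F x v] by metis
  have "(\<Sum>b\<in>onb (model M). v (q b) *\<^sub>R b) = (\<Sum>b\<in>onb (model M). (s \<bullet> b) *\<^sub>R b)"
    by (rule sum.cong) (use cframe_dual[OF m F x s(1) B] s(2) in auto)
  then have "(\<Sum>b\<in>onb (model M). v (q b) *\<^sub>R b) = s" using onb_expand[OF S s(1)] by simp
  then show "(\<Sum>b\<in>onb (model M). v (q b) *\<^sub>R b) \<in> model M" "E (\<Sum>b\<in>onb (model M). v (q b) *\<^sub>R b) x = v"
    using s by simp_all
qed

text \<open>
  Tangent spaces lie in an infinite dimensional space of functionals. Dimensions are compared in a model
  space instead, by reading linear maps in a coordinate frame.
\<close>

lemma linear_into_tangent_space: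
  fixes h :: "'g::euclidean_space \<Rightarrow> 'a tangent"
  assumes m: "smooth_manifold M" and F: "cframe M W \<kappa> W1 E q" and x: "x \<in> W1"
    and h: "\<And>s. s \<in> S \<Longrightarrow> h s \<in> tangent_space M x" "\<And>s. s \<in> S \<Longrightarrow> h s = (\<Sum>c\<in>onb S. (s \<bullet> c) *\<^sub>R h c)"
  shows "\<exists>G. linear G \<and> (\<forall>s\<in>S. G s \<in> model M \<and> h s = E (G s) x)"
proof -
  define G where "G s = (\<Sum>b\<in>onb (model M). (\<Sum>c\<in>onb S. (s \<bullet> c) *\<^sub>R h c (q b)) *\<^sub>R b)" for s
  have "bounded_linear G" unfolding G_def by (intro bounded_linear_intros)
  then have lin: "linear G" by (rule bounded_linear.linear)
  have G: "G s = (\<Sum>b\<in>onb (model M). h s (q b) *\<^sub>R b)" if "s \<in> S" for s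
    unfolding G_def by (subst h(2)[OF that]) (simp add: fun_sum_apply fun_scaleR_apply)
  have "G s \<in> model M \<and> h s = E (G s) x" if "s \<in> S" for s
    unfolding G[OF that] using cframe_coordinates[OF m F x h(1)[OF that]] by simp
  then show ?thesis using lin by blast
qed

text \<open>The leaf map is constant on each leaf.\<close>

lemma foliation_tangent_subset_kernel:
  assumes m: "smooth_manifold M" and n: "smooth_manifold N" and p: "smooth_map M N (leaf_map \<F>)"
    and F: "foliation M \<F>" and x: "x \<in> mpoints M" and v: "v \<in> foliation_tangent M \<F> x"
  shows "v \<in> tangent_space M x" "pushforward N (leaf_map \<F>) v = 0"
proof -
  note l = leaf_map_in[OF F x]
  obtain Q w where Q: "immersed_submanifold M (leaf_map \<F> x) Q" and w: "w \<in> tangent_space Q x" "v = pushforward M (\<lambda>y. y) w"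
    using v unfolding foliation_tangent_def by blast
  have q: "smooth_manifold Q" "mpoints Q = leaf_map \<F> x" "smooth_map Q M (\<lambda>x. x)"
    using Q by (auto simp: immersed_submanifold_def immersion_def)
  show "v \<in> tangent_space M x" using pushforward_tangent[OF q(1) m q(3) w(1)] w(2) by simp
  have xQ: "x \<in> mpoints Q" using q(2) l(2) by simp
  show "pushforward N (leaf_map \<F>) v = 0"
  proof
    fix g
    show "pushforward N (leaf_map \<F>) v g = 0 g"
    proof (cases "g \<in> smooth_funs N")
      case True
      note gp = smooth_map_compose[OF m n p True]
      have "pushforward N (leaf_map \<F>) v g = w (\<lambda>y. g (leaf_map \<F> y))"
        using pushforward_apply[OF True, of "leaf_map \<F>" v] pushforward_apply[OF gp, of "\<lambda>y. y" w] w(2) by simp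
      also have "\<dots> = w (\<lambda>y. g (leaf_map \<F> x))"
        by (rule tangent_local[OF q(1) w(1) openin_topspace xQ smooth_map_compose[OF q(1) m q(3) gp] smooth_funs_const])
          (use leaf_map_eq[OF F l(1)] q(2) in auto)
      also have "\<dots> = 0" by (rule tangent_const[OF w(1)])
      finally show ?thesis by (simp add: zero_fun_def)
    qed (simp add: pushforward_def zero_fun_def)
  qed
qed

lemma continuous_countable_range_constant:
  fixes f :: "real \<Rightarrow> real"
  assumes "continuous_on {-e<..<e} f" "countable C" "\<And>t. t \<in> {-e<..<e} \<Longrightarrow> f t \<in> C" "s \<in> {-e<..<e}" "t \<in> {-e<..<e}"
  shows "f s = f t"
proof (rule ccontr)
  assume ne: "f s \<noteq> f t"
  have "connected (f ` {-e<..<e})" using assms(1) by (intro connected_continuous_image) auto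
  then have "uncountable (f ` {-e<..<e})" using connected_uncountable ne assms(4,5) by blast
  moreover have "f ` {-e<..<e} \<subseteq> C" using assms(3) by blast
  ultimately show False using assms(2) countable_subset by blast
qed

text \<open>
  A vector tangent to the fibre integrates to a coordinate line inside the leaf. In a flat chart the
  leaf meets only countably many plaques, so by connectedness the line stays in one of them.
\<close>

lemma kernel_tangent_to_plaque:
  assumes m: "smooth_manifold M" and n: "smooth_manifold N"
    and A: "adapted M N (leaf_map \<F>) W \<kappa> W1 E q V \<psi> V1 E' q' L l c" and F: "foliation M \<F>"
    and x: "x \<in> W1" and s: "s \<in> model M" "L s = 0"
    and F2: "cframe M U \<phi> U1 E2 q2" and xU: "x \<in> U1" and b: "b \<in> model M" and C: "countable C"
    and plaque: "\<And>y. y \<in> leaf_map \<F> x \<inter> U \<Longrightarrow> \<exists>c\<in>C. \<phi> y \<bullet> b = c \<bullet> b"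
  shows "E s x (q2 b) = 0"
proof -
  let ?p = "leaf_map \<F>"
  note a = adaptedD[OF A]
  note d = cframeD[OF a(1)] and d' = cframeD[OF a(2)] and d2 = cframeD[OF F2]
  note cs = coord_simps[OF d(1)]
  have xM: "x \<in> mpoints M" using x d(4) by blast
  define O' where "O' = W1 \<inter> U1"
  have oO: "openin (mtop M) O'" unfolding O'_def using d(2) d2(2) by (rule openin_Int)
  have OW: "O' \<subseteq> W" using d(3) by (auto simp: O'_def)
  note oS = coord_open_sub[OF m d(1) oO OW]
  have kx: "\<kappa> x \<in> \<kappa> ` O'" using x xU by (auto simp: O'_def)
  obtain e where e: "e > 0" "\<And>t. \<bar>t\<bar> < e \<Longrightarrow> \<kappa> x + t *\<^sub>R s \<in> \<kappa> ` O'" using open_sub_line[OF oS kx s(1)] by blast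
  \<comment> \<open>The coordinate line in the vertical direction \<open>s\<close>, on which the leaf map is constant.\<close>
  define \<gamma> where "\<gamma> t = inv_into W \<kappa> (\<kappa> x + t *\<^sub>R s)" for t
  have \<gamma>: "\<gamma> t \<in> O' \<and> \<kappa> (\<gamma> t) = \<kappa> x + t *\<^sub>R s" if t: "t \<in> {-e<..<e}" for t
  proof -
    have "\<kappa> x + t *\<^sub>R s \<in> \<kappa> ` O'" using e(2)[of t] t by auto
    then obtain w where w: "w \<in> O'" "\<kappa> x + t *\<^sub>R s = \<kappa> w" by blast
    have "inv_into W \<kappa> (\<kappa> w) = w" using cs(3) OW w(1) by blast
    then show ?thesis using w unfolding \<gamma>_def by simp
  qed
  have leaf: "\<gamma> t \<in> ?p x" if t: "t \<in> {-e<..<e}" for t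
  proof -
    have g1: "\<gamma> t \<in> W1" and gM: "\<gamma> t \<in> mpoints M" using \<gamma>[OF t] d(4) by (auto simp: O'_def)
    have "\<psi> (?p (\<gamma> t)) = \<psi> (?p x)"
      using a(12)[OF g1] a(12)[OF x] \<gamma>[OF t] linear_add[OF a(6)] linear_scale[OF a(6)] s(2) by simp
    then have "?p (\<gamma> t) = ?p x"
      using coord_simps(4)[OF d'(1)] a(3)[OF g1] a(3)[OF x] d'(3) by (auto simp: inj_on_def)
    then show ?thesis using leaf_map_in(2)[OF F gM] by simp
  qed
  \<comment> \<open>A transverse coordinate along the line: it takes only countably many values.\<close>
  define f where "f t = q2 b (\<gamma> t)" for t
  have df: "DERIV f t :> E s (\<gamma> t) (q2 b)" if t: "t \<in> {-e<..<e}" for t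
    unfolding f_def[abs_def] \<gamma>_def
    by (rule cframe_line[OF m a(1) _ s(1) d2(6)[OF b]]) (use \<gamma>[OF t] in \<open>auto simp: O'_def \<gamma>_def\<close>)
  have val: "f t \<in> (\<lambda>c. c \<bullet> b) ` C" if t: "t \<in> {-e<..<e}" for t
  proof -
    have g: "\<gamma> t \<in> U1" "\<gamma> t \<in> U" using \<gamma>[OF t] d2(3) by (auto simp: O'_def)
    have "\<gamma> t \<in> ?p x \<inter> U" using g(2) leaf[OF t] by blast
    then show ?thesis using plaque d2(8)[OF b g(1)] unfolding f_def by auto
  qed
  have cont: "continuous_on {-e<..<e} f"
    by (auto intro!: DERIV_continuous_on[OF DERIV_subset[OF df]])
  have const: "f t = f 0" if t: "t \<in> {-e<..<e}" for t
    by (rule continuous_countable_range_constant[OF cont countable_image[OF C] val t]) (use e(1) in auto)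
  have "DERIV f 0 :> 0"
  proof -
    have "eventually (\<lambda>t. t \<in> {-e<..<e}) (nhds 0)" using e(1) by (intro eventually_nhds_in_open) auto
    then have "eventually (\<lambda>t. f t = f 0) (nhds 0)" by eventually_elim (rule const)
    then show ?thesis using DERIV_cong_ev[of 0 0 f "\<lambda>t. f 0" 0 0] by simp
  qed
  moreover have "DERIV f 0 :> E s (\<gamma> 0) (q2 b)" by (rule df) (use e(1) in simp)
  moreover have "\<gamma> 0 = x" using cs(3) x d(3) by (auto simp: \<gamma>_def)
  ultimately show ?thesis using DERIV_unique by metis
qed

text \<open>
  One inclusion is immediate; for the other, dimensions are compared. A vector in the kernel is tangent
  to a plaque of a flat chart, so the dimension of the kernel is at most \<open>k\<close>, while the leaf is an
  immersed submanifold of dimension \<open>k\<close> whose tangent space lies in the kernel.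
\<close>

lemma foliation_tangent_eq_kernel:
  assumes m: "smooth_manifold M" and n: "smooth_manifold N" and sub: "submersion M N (leaf_map \<F>)"
    and F: "foliation M \<F>" and x: "x \<in> mpoints M"
  shows "foliation_tangent M \<F> x = {v \<in> tangent_space M x. pushforward N (leaf_map \<F>) v = 0}"
proof (intro equalityI subsetI)
  have p: "smooth_map M N (leaf_map \<F>)" using sub by (simp add: submersion_def)
  note S = smooth_manifoldD(2)[OF m] and l = leaf_map_in[OF F x]
  note ker = foliation_tangent_subset_kernel[OF m n p F x]
  show "v \<in> {v \<in> tangent_space M x. pushforward N (leaf_map \<F>) v = 0}" if "v \<in> foliation_tangent M \<F> x" for v
    using ker[OF that] by blast
  fix v assume v: "v \<in> {v \<in> tangent_space M x. pushforward N (leaf_map \<F>) v = 0}"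
  obtain k where k: "foliation_of_dim M k \<F>" using F by (auto simp: foliation_def)
  obtain W \<kappa> W1 E q V \<psi> V1 E' q' L l' c where A: "adapted M N (leaf_map \<F>) W \<kappa> W1 E q V \<psi> V1 E' q' L l' c" "x \<in> W1"
    using adapted_exists[OF m n sub x] by (elim exE conjE)
  note a = adaptedD[OF A(1)]
  note d = cframeD[OF a(1)]
  have xW: "x \<in> W" using A(2) d(3) by blast
  define K where "K = {s \<in> model M. L s = 0}"
  have sK: "subspace K" unfolding K_def
    using S linear_0[OF a(6)] linear_add[OF a(6)] linear_scale[OF a(6)] by (auto simp: subspace_def)
  have Einj: "s = t" if "s \<in> model M" "t \<in> model M" "E s x = E t x" for s t
    using cvec_inj[OF m d(1) xW that(1,2)] that(3) d(7)[OF that(1) A(2)] d(7)[OF that(2) A(2)] by simp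
  have "\<exists>U \<phi>. x \<in> U \<and> flat_chart M k \<F> U \<phi>" using k x unfolding foliation_of_dim_def by blast
  then obtain U \<phi> where U: "x \<in> U" "flat_chart M k \<F> U \<phi>" by blast
  from conjunct2[OF U(2)[unfolded flat_chart_def]] obtain B B' lo hi where
    fl0: "pairwise orthogonal B \<and> (\<forall>b\<in>B. norm b = 1) \<and> span B = model M \<and> B' \<subseteq> B \<and> card B' = k \<and>
        \<phi> ` U = {y \<in> model M. \<forall>b\<in>B. lo b < y \<bullet> b \<and> y \<bullet> b < hi b} \<and>
        (\<forall>S\<in>\<F>. \<exists>C. countable C \<and> \<phi> ` (S \<inter> U) = {y \<in> \<phi> ` U. \<exists>c\<in>C. \<forall>b\<in>B - B'. y \<bullet> b = c \<bullet> b})"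
    by (elim exE)
  note fl = fl0[THEN conjunct1] fl0[THEN conjunct2, THEN conjunct1] fl0[THEN conjunct2, THEN conjunct2, THEN conjunct1] fl0[THEN conjunct2, THEN conjunct2, THEN conjunct2, THEN conjunct1] fl0[THEN conjunct2, THEN conjunct2, THEN conjunct2, THEN conjunct2, THEN conjunct1]
    fl0[THEN conjunct2, THEN conjunct2, THEN conjunct2, THEN conjunct2, THEN conjunct2, THEN conjunct2]
  from bspec[OF fl(6) l(1)] obtain C where
    C0: "countable C \<and> \<phi> ` (leaf_map \<F> x \<inter> U) = {y \<in> \<phi> ` U. \<exists>c\<in>C. \<forall>b\<in>B - B'. y \<bullet> b = c \<bullet> b}"
    by (elim exE)
  note C = conjunct1[OF C0] conjunct2[OF C0]
  have plaque: "\<exists>c\<in>C. \<phi> y \<bullet> b = c \<bullet> b" if "y \<in> leaf_map \<F> x \<inter> U" "b \<in> B - B'" for y b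
  proof -
    have "\<phi> y \<in> \<phi> ` (leaf_map \<F> x \<inter> U)" using that(1) by (rule imageI)
    then show ?thesis unfolding C(2) using that(2) by auto
  qed
  have indB: "independent B" using fl(1,2) by (intro pairwise_orthogonal_independent) auto
  then have finB: "finite B" by (rule independent_imp_finite)
  have cU: "coord M U \<phi>" by (rule smooth_chart_coord[OF m conjunct1[OF U(2)[unfolded flat_chart_def]]])
  obtain U1 E2 q2 where F2: "cframe M U \<phi> U1 E2 q2" "x \<in> U1"
    using cframe_exists[OF m cU coord_simps(1)[OF cU] U(1) order_refl] by metis
  note d2 = cframeD[OF F2(1)]
  have Eexp: "E s x = (\<Sum>c\<in>onb (model M). (s \<bullet> c) *\<^sub>R E c x)" if "s \<in> model M" for s
    unfolding d(7)[OF that A(2)] cvec_expand[OF m d(1) xW that]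
    by (rule sum.cong) (use d(7)[OF cframe_basis[OF m] A(2)] in auto)
  have "\<exists>G. linear G \<and> (\<forall>s\<in>model M. G s \<in> model M \<and> E s x = E2 (G s) x)"
    by (rule linear_into_tangent_space[OF m F2, where h = "\<lambda>s. E s x"]) (erule d(9)[OF _ A(2)], erule Eexp)
  then obtain G1 where G1': "linear G1 \<and> (\<forall>s\<in>model M. G1 s \<in> model M \<and> E s x = E2 (G1 s) x)" by (elim exE)
  then have G1: "linear G1" "\<And>s. s \<in> model M \<Longrightarrow> G1 s \<in> model M" "\<And>s. s \<in> model M \<Longrightarrow> E s x = E2 (G1 s) x"
    by simp_all
  \<comment> \<open>The kernel, read in the flat chart, lies in the span of the \<open>k\<close> directions of the plaques.\<close>
  have G1K: "G1 s \<in> span B'" if s: "s \<in> K" for s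
  proof -
    have sM: "s \<in> model M" and Ls: "L s = 0" using s by (auto simp: K_def)
    have z: "G1 s \<bullet> b = 0" if b: "b \<in> B - B'" for b
    proof -
      have bM: "b \<in> model M" using b fl(3) span_base by blast
      have "E s x (q2 b) = 0"
        by (rule kernel_tangent_to_plaque[OF m n A(1) F A(2) sM Ls F2 bM C(1)]) (rule plaque[OF _ b])
      then show ?thesis using cframe_dual[OF m F2 G1(2)[OF sM] bM] G1(3)[OF sM] by simp
    qed
    have "G1 s = (\<Sum>b\<in>B. (G1 s \<bullet> b) *\<^sub>R b)"
      using orthonormal_expansion[OF fl(1) _ finB, of "G1 s"] fl(2,3) G1(2)[OF sM] by simp
    also have "\<dots> = (\<Sum>b\<in>B'. (G1 s \<bullet> b) *\<^sub>R b)"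
      by (rule sum.mono_neutral_right) (use finB fl(4) z in auto)
    also have "\<dots> \<in> span B'" by (rule span_sum, rule span_scale, rule span_base)
    finally show ?thesis .
  qed
  have G1inj: "inj_on G1 (span K)"
  proof (rule inj_onI)
    fix s t assume st: "s \<in> span K" "t \<in> span K" "G1 s = G1 t"
    then have "s \<in> model M" "t \<in> model M" using sK by (auto simp: K_def span_eq_iff[THEN iffD2])
    then show "s = t" using Einj G1(3) st(3) by metis
  qed
  have "dim K = dim (G1 ` K)" by (rule dim_image_eq[OF G1(1) G1inj, symmetric])
  also have "\<dots> \<le> dim (span B')" by (rule dim_subset) (use G1K in blast)
  also have "\<dots> \<le> k" using dim_le_card'[of B'] finB fl(4,5) finite_subset by (metis dim_span)
  finally have dK: "dim K \<le> k" .
  obtain Q where Q: "immersed_submanifold M (leaf_map \<F> x) Q" "mdim Q = k"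
    using k l(1) unfolding foliation_of_dim_def by blast
  have qm: "smooth_manifold Q" "mpoints Q = leaf_map \<F> x" "smooth_map Q M (\<lambda>x. x)"
    and qi: "inj_on (pushforward M (\<lambda>x. x)) (tangent_space Q x)"
    using Q(1) l(2) by (auto simp: immersed_submanifold_def immersion_def)
  note SQ = smooth_manifoldD(2)[OF qm(1)]
  have xQ: "x \<in> mpoints Q" using qm(2) l(2) by simp
  obtain WQ \<kappa>Q where cQ: "coord Q WQ \<kappa>Q" "x \<in> WQ" using coord_exists[OF qm(1) xQ] by metis
  \<comment> \<open>The tangent space of the leaf, read in the adapted coordinates, is a \<open>k\<close>-dimensional part of the kernel.\<close>
  define h where "h s = pushforward M (\<lambda>x. x) (cvec Q WQ \<kappa>Q x s)" for s
  have hT: "h s \<in> tangent_space M x" if "s \<in> model Q" for s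
    unfolding h_def using pushforward_tangent[OF qm(1) m qm(3) cvec_tangent[OF qm(1) cQ that]] .
  have hexp: "h s = (\<Sum>c\<in>onb (model Q). (s \<bullet> c) *\<^sub>R h c)" if "s \<in> model Q" for s
    unfolding h_def cvec_expand[OF qm(1) cQ that] by (rule pushforward_sum)
  have "\<exists>G. linear G \<and> (\<forall>s\<in>model Q. G s \<in> model M \<and> h s = E (G s) x)"
    by (rule linear_into_tangent_space[OF m a(1) A(2), where h = h]) (erule hT, erule hexp)
  then obtain G2 where G2': "linear G2 \<and> (\<forall>s\<in>model Q. G2 s \<in> model M \<and> h s = E (G2 s) x)" by (elim exE)
  then have G2: "linear G2" "\<And>s. s \<in> model Q \<Longrightarrow> G2 s \<in> model M" "\<And>s. s \<in> model Q \<Longrightarrow> h s = E (G2 s) x"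
    by simp_all
  have hF: "h s \<in> foliation_tangent M \<F> x" if "s \<in> model Q" for s
    unfolding foliation_tangent_def h_def using Q(1) cvec_tangent[OF qm(1) cQ that] by blast
  have G2K: "G2 ` model Q \<subseteq> K"
  proof
    fix t assume "t \<in> G2 ` model Q"
    then obtain s where s: "s \<in> model Q" "t = G2 s" by blast
    have "pushforward N (leaf_map \<F>) (E (G2 s) x) = 0" using ker(2)[OF hF[OF s(1)]] G2(3)[OF s(1)] by simp
    then show "t \<in> K" using vertical[OF n A G2(2)[OF s(1)]] G2(2)[OF s(1)] s(2) by (simp add: K_def)
  qed
  have G2inj: "inj_on G2 (span (model Q))"
  proof (rule inj_onI)
    fix s t assume st: "s \<in> span (model Q)" "t \<in> span (model Q)" "G2 s = G2 t"
    then have s: "s \<in> model Q" "t \<in> model Q" using SQ by (auto simp: span_eq_iff[THEN iffD2])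
    then have "h s = h t" using G2(3) st(3) by metis
    then have "cvec Q WQ \<kappa>Q x s = cvec Q WQ \<kappa>Q x t"
      unfolding h_def using qi cvec_tangent[OF qm(1) cQ s(1)] cvec_tangent[OF qm(1) cQ s(2)] by (auto dest: inj_onD)
    then show "s = t" by (rule cvec_inj[OF qm(1) cQ s])
  qed
  have dG: "dim (G2 ` model Q) = k" using dim_image_eq[OF G2(1) G2inj] Q(2) by (simp add: mdim_def)
  have GK: "G2 ` model Q = K"
    by (rule subspace_dim_equal[OF linear_subspace_image[OF G2(1) SQ] sK G2K]) (use dG dK in simp)
  obtain s where s: "s \<in> model M" "v = E s x" using cframe_surj[OF m a(1) A(2), of v] v by blast
  have "s \<in> K" using vertical[OF n A s(1)] s v by (simp add: K_def)
  then obtain t where t: "t \<in> model Q" "s = G2 t" using GK by blast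
  have "v = h t" using G2(3)[OF t(1)] s(2) t(2) by simp
  then show "v \<in> foliation_tangent M \<F> x" using hF[OF t(1)] by simp
qed

lemma dirac_structure_cong:
  assumes m: "smooth_manifold M" and eq: "\<And>x. x \<in> mpoints M \<Longrightarrow> D x = D' x"
  shows "dirac_structure M D \<longleftrightarrow> dirac_structure M D'"
proof -
  have "sections M D = sections M D'" using eq by (auto simp: sections_def)
  then show ?thesis
    unfolding dirac_structure_iff[OF m] lagrangian_family_def has_sections_def using eq by simp
qed

section \<open>Concurrence with a simple foliation\<close>

theorem proposition5:
  fixes M :: "('a, 'e::euclidean_space) manifold"
    and N :: "('a set, 'f::euclidean_space) manifold"
    and \<F> :: "'a set set"
    and L :: "'a \<Rightarrow> 'a gtangent set"
  assumes "smooth_manifold M"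
    and "simple_foliation M \<F> N"
    and "dirac_structure M L"
  shows "(concur M L (Gr M \<F>) \<longleftrightarrow>
            (\<exists>R. dirac_structure N R \<and> forward_dirac M L N R (leaf_map \<F>))) \<and>
         (\<forall>R. dirac_structure N R \<and> forward_dirac M L N R (leaf_map \<F>) \<longrightarrow>
            (\<forall>x\<in>mpoints M. cotangent_product L (Gr M \<F>) x = dirac_pull M N (leaf_map \<F>) R x))"
proof -
  note m = assms(1)
  let ?p = "leaf_map \<F>" and ?D = "cotangent_product L (Gr M \<F>)"
  have F: "foliation M \<F>" and n: "smooth_manifold N" and NF: "mpoints N = \<F>" and sub: "submersion M N ?p"
    using assms(2) by (auto simp: simple_foliation_def)
  have p: "smooth_map M N ?p" using sub by (simp add: submersion_def)
  have lL: "lagrangian_family M L" using assms(3) unfolding dirac_structure_iff[OF m] by blast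
  note LL = lagrangian_familyD[OF lL]
  have surj: "?p ` mpoints M = mpoints N"
  proof -
    have "S \<in> ?p ` mpoints M" if S: "S \<in> \<F>" for S
    proof -
      have "S \<noteq> {}" "\<Union>\<F> = mpoints M" using F S by (auto simp: foliation_def foliation_of_dim_def)
      then obtain x where x: "x \<in> S" "x \<in> mpoints M" using S by blast
      show ?thesis by (rule image_eqI[where f = "leaf_map \<F>", OF leaf_map_eq[OF F S x(1), symmetric] x(2)])
    qed
    then show ?thesis using leaf_map_in(1)[OF F] NF by auto
  qed
  have conn: "connectedin (mtop M) {y \<in> mpoints M. ?p y = ?p x}" if x: "x \<in> mpoints M" for x
    unfolding leaf_map_fibre[OF F x] by (rule leaf_connected[OF F leaf_map_in(1)[OF F x]])
  note T0 = subspace_0[OF subspace_tangent_space]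
  \<comment> \<open>The cotangent product is obtained from \<open>L\<close> by restricting to covectors that annihilate the kernel and adding the kernel.\<close>
  have D_mem: "e \<in> ?D x \<longleftrightarrow> (\<exists>u \<xi> k. e = (u + k, \<xi>) \<and> (u, \<xi>) \<in> L x \<and> k \<in> tangent_space M x \<and> pushforward N ?p k = 0 \<and>
      (\<forall>w\<in>tangent_space M x. pushforward N ?p w = 0 \<longrightarrow> \<xi> w = 0))" if x: "x \<in> mpoints M" for e x
  proof -
    have G: "(k, \<xi>) \<in> Gr M \<F> x \<longleftrightarrow> k \<in> tangent_space M x \<and> pushforward N ?p k = 0 \<and> \<xi> \<in> cotangent_space M x \<and>
      (\<forall>w\<in>tangent_space M x. pushforward N ?p w = 0 \<longrightarrow> \<xi> w = 0)" for k \<xi>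
      unfolding Gr_def foliation_tangent_eq_kernel[OF m n sub F x] by blast
    have c: "\<xi> \<in> cotangent_space M x" if "(u, \<xi>) \<in> L x" for u \<xi> using LL(1)[OF x] that by (auto simp: gtangent_space_def)
    have iff: "e \<in> ?D x \<longleftrightarrow> (\<exists>u \<xi> k. e = (u + k, \<xi>) \<and> (u, \<xi>) \<in> L x \<and> (k, \<xi>) \<in> Gr M \<F> x)"
    proof
      assume "e \<in> ?D x"
      then obtain a b where ab: "e = a + (fst b, 0)" "a \<in> L x" "b \<in> Gr M \<F> x" "snd a = snd b"
        unfolding cotangent_product_def by blast
      have "e = (fst a + fst b, snd a)" unfolding ab(1) by (cases a) (simp only: add_Pair add_0_right fst_conv snd_conv)
      moreover have "(fst a, snd a) \<in> L x" using ab(2) by simp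
      moreover have "(fst b, snd a) \<in> Gr M \<F> x" using ab(3,4) by simp
      ultimately show "\<exists>u \<xi> k. e = (u + k, \<xi>) \<and> (u, \<xi>) \<in> L x \<and> (k, \<xi>) \<in> Gr M \<F> x" by blast
    next
      assume "\<exists>u \<xi> k. e = (u + k, \<xi>) \<and> (u, \<xi>) \<in> L x \<and> (k, \<xi>) \<in> Gr M \<F> x"
      then obtain u \<xi> k where e: "e = (u + k, \<xi>)" "(u, \<xi>) \<in> L x" "(k, \<xi>) \<in> Gr M \<F> x" by blast
      show "e \<in> ?D x"
        unfolding cotangent_product_def mem_Collect_eq
        by (rule exI[of _ "(u, \<xi>)"], rule exI[of _ "(k, \<xi>)"])
          (simp only: e add_Pair add_0_right fst_conv snd_conv simp_thms)
    qed
    have "(u, \<xi>) \<in> L x \<and> (k, \<xi>) \<in> Gr M \<F> x \<longleftrightarrow> (u, \<xi>) \<in> L x \<and> k \<in> tangent_space M x \<and> pushforward N ?p k = 0 \<and>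
      (\<forall>w\<in>tangent_space M x. pushforward N ?p w = 0 \<longrightarrow> \<xi> w = 0)" for u \<xi> k
      unfolding G using c[of u \<xi>] by metis
    then show ?thesis unfolding iff by (simp only:)
  qed
  \<comment> \<open>The vectors that the product adds are killed by the leaf map, and pulled back covectors survive the restriction.\<close>
  have push_D: "dirac_push M N ?p x (?D x) = dirac_push M N ?p x (L x)" if x: "x \<in> mpoints M" for x
  proof (intro equalityI subsetI)
    fix r assume "r \<in> dirac_push M N ?p x (?D x)"
    then obtain w \<eta> where w: "r = (pushforward N ?p w, \<eta>)" "w \<in> tangent_space M x" "\<eta> \<in> cotangent_space N (?p x)" "(w, pullback M N ?p x \<eta>) \<in> ?D x"
      unfolding dirac_push_def by blast
    obtain u k where u: "w = u + k" "(u, pullback M N ?p x \<eta>) \<in> L x" "pushforward N ?p k = 0"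
      using w(4) unfolding D_mem[OF x] by blast
    have "u \<in> tangent_space M x" using LL(1)[OF x] u(2) by (auto simp: gtangent_space_def)
    moreover have "pushforward N ?p w = pushforward N ?p u" unfolding u(1) pushforward_linear(1) u(3) by (rule add_0_right)
    ultimately show "r \<in> dirac_push M N ?p x (L x)" unfolding dirac_push_def w(1) using u(2) w(3) by auto
  next
    fix r assume "r \<in> dirac_push M N ?p x (L x)"
    then obtain u \<eta> where u: "r = (pushforward N ?p u, \<eta>)" "u \<in> tangent_space M x" "\<eta> \<in> cotangent_space N (?p x)" "(u, pullback M N ?p x \<eta>) \<in> L x"
      unfolding dirac_push_def by blast
    have "pullback M N ?p x \<eta> w = 0" if "w \<in> tangent_space M x" "pushforward N ?p w = 0" for w
      unfolding pullback_apply[OF that(1)] that(2) by (rule cotangent_0[OF u(3)])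
    then have "(u, pullback M N ?p x \<eta>) \<in> ?D x"
      unfolding D_mem[OF x] using u(4) T0[of M x] pushforward_linear(3)[of N ?p]
      by (intro exI[of _ u] exI[of _ "pullback M N ?p x \<eta>"] exI[of _ 0]) (simp del: plus_fun_apply)
    then show "r \<in> dirac_push M N ?p x (?D x)" unfolding dirac_push_def u(1) using u(2,3) by blast
  qed
  \<comment> \<open>The covectors that annihilate the kernel are exactly those pulled back from the leaf space.\<close>
  have pull: "?D x = dirac_pull M N ?p R x" if R: "forward_dirac M L N R ?p" and x: "x \<in> mpoints M" for R x
  proof (intro equalityI subsetI)
    have Rx: "R (?p x) = dirac_push M N ?p x (L x)" using R x by (simp add: forward_dirac_def)
    fix e
    {
      assume "e \<in> ?D x"
      then obtain u \<xi> k where u: "e = (u + k, \<xi>)" "(u, \<xi>) \<in> L x" "k \<in> tangent_space M x" "pushforward N ?p k = 0"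
        "\<And>w. w \<in> tangent_space M x \<Longrightarrow> pushforward N ?p w = 0 \<Longrightarrow> \<xi> w = 0"
        unfolding D_mem[OF x] by blast
      have t: "u \<in> tangent_space M x" "\<xi> \<in> cotangent_space M x" using LL(1)[OF x] u(2) by (auto simp: gtangent_space_def)
      obtain \<eta> where \<eta>: "\<eta> \<in> cotangent_space N (?p x)" "\<xi> = pullback M N ?p x \<eta>"
        using annihilator_pullback[OF sub x t(2) u(5)] by blast
      have "pushforward N ?p (u + k) = pushforward N ?p u" unfolding pushforward_linear(1) u(4) by (rule add_0_right)
      then have "(pushforward N ?p (u + k), \<eta>) \<in> R (?p x)"
        unfolding Rx dirac_push_def using t(1) u(2) \<eta> by auto
      then show "e \<in> dirac_pull M N ?p R x"
        unfolding dirac_pull_def u(1) \<eta>(2) using subspace_add[OF subspace_tangent_space t(1) u(3)] \<eta>(1) by blast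
    next
      assume "e \<in> dirac_pull M N ?p R x"
      then obtain v \<eta> where v: "e = (v, pullback M N ?p x \<eta>)" "v \<in> tangent_space M x" "\<eta> \<in> cotangent_space N (?p x)" "(pushforward N ?p v, \<eta>) \<in> R (?p x)"
        unfolding dirac_pull_def by blast
      obtain u where u: "u \<in> tangent_space M x" "pushforward N ?p v = pushforward N ?p u" "(u, pullback M N ?p x \<eta>) \<in> L x"
        using v(4) unfolding Rx dirac_push_def by blast
      have ann: "pullback M N ?p x \<eta> w = 0" if "w \<in> tangent_space M x" "pushforward N ?p w = 0" for w
        unfolding pullback_apply[OF that(1)] that(2) by (rule cotangent_0[OF v(3)])
      have k: "v - u \<in> tangent_space M x" "pushforward N ?p (v - u) = 0"
        using subspace_diff[OF subspace_tangent_space v(2) u(1)] by (simp_all only: pushforward_linear(4) u(2) diff_self)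
      have "e = (u + (v - u), pullback M N ?p x \<eta>)" unfolding v(1) by simp
      then show "e \<in> ?D x" unfolding D_mem[OF x] using u(3) k ann by blast
    }
  qed
  have "\<exists>R. dirac_structure N R \<and> forward_dirac M L N R ?p" if D: "concur M L (Gr M \<F>)"
  proof (rule dirac_structure_descends[OF m n sub D[unfolded concur_def] surj conn])
    fix x k assume x: "x \<in> mpoints M" and k: "k \<in> tangent_space M x" "pushforward N ?p k = 0"
    have "(0, 0) \<in> L x" using subspace_0[OF LL(2)[OF x]] by (simp add: zero_prod_def)
    then show "(k, 0) \<in> ?D x"
      unfolding D_mem[OF x] using k by (intro exI[of _ 0] exI[of _ k]) (simp add: zero_fun_def)
  next
    fix R assume R: "dirac_structure N R" "\<And>x. x \<in> mpoints M \<Longrightarrow> dirac_push M N ?p x (?D x) = R (?p x)"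
    then have "forward_dirac M L N R ?p" using push_D by (simp add: forward_dirac_def)
    then show ?thesis using R(1) by blast
  qed
  moreover have "concur M L (Gr M \<F>)" if "dirac_structure N R" "forward_dirac M L N R ?p" for R
  proof -
    have "dirac_structure M ?D \<longleftrightarrow> dirac_structure M (dirac_pull M N ?p R)"
      by (rule dirac_structure_cong[OF m]) (rule pull[OF that(2)])
    then show ?thesis using dirac_structure_pull[OF m n sub that(1)] by (simp add: concur_def)
  qed
  ultimately show ?thesis using pull by blast
qed

end
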